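(* Let $a:(0,\infty)\to(0,\infty)$ be nonincreasing, let $\kappa$ be a nonnegative symmetric coagulation rate, let $\nu\in\mathcal{M}_f(\mathbb{T}\times\mathbb{R}_+)$, and let $\omega,\varpi$ be a pair of functions that are bounded on each compact subset of $(0,\infty)$, such that $\varpi\omega^{-1}$ is bounded and $\omega$, $a^{-1/2}\omega$ and $a^{-1/2}\omega\varpi$ are subadditive. Assume that for all $m,m'$ $$\kappa(m,m')\le\omega(m)\,\omega(m'),\qquad \kappa(m,m')\le\omega(m)\varpi(m')+\varpi(m)\omega(m'),$$ and that there is a measure $\nu^*$ on $\mathbb{R}_+$ such that $$\nu(dx,dm)\le\nu^*(dm)\,dx,\qquad\Big\langle\frac{\omega^2}{m},\nu^*\Big\rangle<\infty.$$ Then for any $T>0$ the equation $$\dot\mu_t=\frac12a(m)\frac{\partial^2}{\partial x^2}\mu_t+K(\mu_t),\qquad\mu_0=\nu,$$ has at most one solution $\{\mu_t\}_{0\le t\le T}$ in $\mathcal{B}(\omega)$.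
   Context: $\mathbb{T}$ is the one-dimensional torus, $\mathbb{R}_+=[0,\infty)$; $\mathcal{M}_f(\cdot)$ denotes the positive finite measures (weak topology); $\langle f,\mu\rangle$ is the integral of $f$ against $\mu$. Coagulation operator: for $\mu\in\mathcal{M}_f(\mathbb{R}_+)$ with $\kappa(m,m')/m'\in L^1(d\mu\times d\mu)$ and bounded $f$, $$\langle f,K(\mu)\rangle=\int_{\mathbb{R}_+\times\mathbb{R}_+}[f(m+m')-f(m)]\frac{\kappa(m,m')}{m'}\mu(dm)\mu(dm').$$ For $\mu(dx,dm)=\upsilon(x,dm)\,dx$ on $\mathbb{T}\times\mathbb{R}_+$, $K(\mu)$ is the signed measure $K(\upsilon(x,\cdot))(dm)\,dx$ (coagulation at each fixed $x$). The equation is understood in the weak sense: for every $f\in C_b^2(\mathbb{T}\times\mathbb{R}_+)$ (bounded continuous functions $f(x,m)$ with continuous bounded derivatives in $x$ up to order two) and $t\in[0,T]$, $$\langle f,\mu_t\rangle-\langle f,\nu\rangle=\int_0^t\Big\langle\frac12 a(m)\frac{\partial^2 f}{\partial x^2},\mu_s\Big\rangle ds+\int_0^t\int_{\mathbb{T}}\int_{\mathbb{R}_+\times\mathbb{R}_+}\frac{f(x,m+m')-f(x,m)}{m'}\kappa(m,m')\upsilon_s(x,dm)\upsilon_s(x,dm')\,dx\,ds,$$ where $\mu_s(dx,dm)=\upsilon_s(x,dm)\,dx$. The class $\mathcal{B}(\omega)$ is the set of $\eta\in C(\mathbb{R}_+,\mathcal{M}_f(\mathbb{T}\times\mathbb{R}_+))$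 such that $\eta_t(dx,dm)=\upsilon_t(x,dm)\,dx$ for all $t$, $$\sup_{t\ge0}\Big\|\int_{\mathbb{R}_+}\frac{\omega(m)}{m}\upsilon_t(\cdot,dm)\Big\|_{L^\infty(\mathbb{T})}<\infty,\quad\text{and}\quad\sup_{t\le T}\langle m,\eta_t\rangle<\infty\ \text{ for all }T>0.$$ A path $\{\mu_t\}_{0\le t\le T}$ is said to be in $\mathcal{B}(\omega)$ if it is continuous on $[0,T]$ and has these properties with $t$ restricted to $[0,T]$. Functions $\omega,\varpi$ are positive on $(0,\infty)$; $\omega(m)/m$ is taken to be $+\infty$ at $m=0$, so measures in these classes do not charge $m=0$. *)

theory Defs
  imports "HOL-Analysis.Analysis" "HOL-Probability.Essential_Supremum"
begin

text \<open>
  The torus is the reals modulo 1. Measures on it are carried by the fundamental domain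
  \<open>{0..<1}\<close>, whose Borel sets are those of the torus; functions on it are 1-periodic functions
  on the line, so that continuity and derivatives are taken there.
\<close>

definition torus :: "real measure"
  where "torus = restrict_space lborel {0..<1}"

definition masses :: "real measure"
  where "masses = restrict_space borel {0..}"

definition finite_measures :: "'a measure \<Rightarrow> 'a measure set"
  where "finite_measures S = {M. sets M = sets S \<and> finite_measure M}"

abbreviation phase_measures :: "(real \<times> real) measure set"
  where "phase_measures \<equiv> finite_measures (torus \<Otimes>\<^sub>M masses)"

definition Cb :: "(real \<times> real \<Rightarrow> real) set"
  where "Cb = {f. (\<forall>x. \<forall>m\<ge>0. f (x + 1, m) = f (x, m))
    \<and> continuous_on (UNIV \<times> {0..}) f \<and> bounded (f ` (UNIV \<times> {0..}))}"

definition dx :: "(real \<times> real \<Rightarrow> real) \<Rightarrow> real \<times> real \<Rightarrow> real"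
  where "dx f = (\<lambda>(x, m). deriv (\<lambda>y. f (y, m)) x)"

definition Cb2 :: "(real \<times> real \<Rightarrow> real) set"
  where "Cb2 = {f. f \<in> Cb \<and> dx f \<in> Cb \<and> dx (dx f) \<in> Cb
    \<and> (\<forall>x. \<forall>m\<ge>0. (\<lambda>y. f (y, m)) differentiable at x \<and> (\<lambda>y. dx f (y, m)) differentiable at x)}"

text \<open>Continuity of a path of finite measures for the weak topology.\<close>

definition weakly_continuous_on :: "real set \<Rightarrow> (real \<Rightarrow> (real \<times> real) measure) \<Rightarrow> bool"
  where "weakly_continuous_on I \<mu> \<longleftrightarrow> (\<forall>f\<in>Cb. continuous_on I (\<lambda>t. integral\<^sup>L (\<mu> t) f))"

text \<open>\<open>spatial_density \<mu> \<upsilon>\<close> says that \<open>\<mu>(dx, dm) = \<upsilon>(x, dm) dx\<close>. Taking \<open>\<upsilon>(x, \<cdot>)\<close> finite for all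
  rather than almost all \<open>x\<close> only selects a version.\<close>

definition spatial_density :: "(real \<times> real) measure \<Rightarrow> (real \<Rightarrow> real measure) \<Rightarrow> bool"
  where "spatial_density \<mu> \<upsilon> \<longleftrightarrow>
    (\<forall>x\<in>space torus. \<upsilon> x \<in> finite_measures masses)
    \<and> (\<forall>A\<in>sets masses. (\<lambda>x. emeasure (\<upsilon> x) A) \<in> borel_measurable torus)
    \<and> (\<forall>A\<in>sets (torus \<Otimes>\<^sub>M masses). emeasure \<mu> A = (\<integral>\<^sup>+x. emeasure (\<upsilon> x) (Pair x -` A) \<partial>torus))"

text \<open>The function \<open>g(m)/m\<close>, with value infinity at \<open>m = 0\<close>.\<close>

definition per_mass :: "(real \<Rightarrow> real) \<Rightarrow> real \<Rightarrow> ennreal"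
  where "per_mass g m = (if m = 0 then \<infinity> else ennreal (g m / m))"

text \<open>The part on \<open>[0, T]\<close> of the class \<open>\<B>(\<omega>)\<close>.\<close>

definition class_B :: "(real \<Rightarrow> real) \<Rightarrow> real \<Rightarrow> (real \<Rightarrow> (real \<times> real) measure) set"
  where "class_B \<omega> T = {\<mu>.
    (\<forall>t\<in>{0..T}. \<mu> t \<in> phase_measures)
    \<and> weakly_continuous_on {0..T} \<mu>
    \<and> (\<exists>\<upsilon>. (\<forall>t\<in>{0..T}. spatial_density (\<mu> t) (\<upsilon> t))
        \<and> (SUP t\<in>{0..T}. esssup torus (\<lambda>x. \<integral>\<^sup>+m. per_mass \<omega> m \<partial>\<upsilon> t x)) < \<infinity>)
    \<and> (SUP t\<in>{0..T}. \<integral>\<^sup>+(x, m). ennreal m \<partial>\<mu> t) < \<infinity>}"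

text \<open>The quotient \<open>\<kappa>(m, m')/m'\<close> takes the junk value 0 at \<open>m' = 0\<close>; this is harmless, since
  measures in the class above do not charge \<open>m = 0\<close>.\<close>

definition coag_admissible :: "(real \<Rightarrow> real \<Rightarrow> real) \<Rightarrow> real measure \<Rightarrow> bool"
  where "coag_admissible \<kappa> \<rho> \<longleftrightarrow> integrable (\<rho> \<Otimes>\<^sub>M \<rho>) (\<lambda>(m, m'). \<kappa> m m' / m')"

definition coag :: "(real \<Rightarrow> real \<Rightarrow> real) \<Rightarrow> real measure \<Rightarrow> (real \<Rightarrow> real) \<Rightarrow> real"
  where "coag \<kappa> \<rho> f = (\<integral>(m, m'). (f (m + m') - f m) * (\<kappa> m m' / m') \<partial>(\<rho> \<Otimes>\<^sub>M \<rho>))"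

text \<open>Since the Bochner integral of a non-integrable function is 0, the existence of every integral
  in the weak equation is required explicitly, for almost all values of the outer variables.\<close>

definition weak_solution ::
  "(real \<Rightarrow> real) \<Rightarrow> (real \<Rightarrow> real \<Rightarrow> real) \<Rightarrow> (real \<times> real) measure \<Rightarrow> real
    \<Rightarrow> (real \<Rightarrow> (real \<times> real) measure) \<Rightarrow> bool"
  where "weak_solution a \<kappa> \<nu> T \<mu> \<longleftrightarrow>
    (\<exists>\<upsilon>. (\<forall>t\<in>{0..T}. spatial_density (\<mu> t) (\<upsilon> t))
      \<and> (AE s in lborel. s \<in> {0..T} \<longrightarrow> (AE x in torus. coag_admissible \<kappa> (\<upsilon> s x)))
      \<and> (\<forall>f\<in>Cb2.
          let D = (\<lambda>(x, m). 1/2 * a m * dx (dx f) (x, m));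
              C = (\<lambda>s x. coag \<kappa> (\<upsilon> s x) (\<lambda>m. f (x, m)))
          in (AE s in lborel. s \<in> {0..T} \<longrightarrow> integrable (\<mu> s) D \<and> integrable torus (C s))
             \<and> set_integrable lborel {0..T} (\<lambda>s. integral\<^sup>L (\<mu> s) D)
             \<and> set_integrable lborel {0..T} (\<lambda>s. integral\<^sup>L torus (C s))
             \<and> (\<forall>t\<in>{0..T}. integral\<^sup>L (\<mu> t) f - integral\<^sup>L \<nu> f =
                  (LINT s:{0..t}|lborel. integral\<^sup>L (\<mu> s) D)
                  + (LINT s:{0..t}|lborel. integral\<^sup>L torus (C s)))))"

definition subadditive_mass :: "(real \<Rightarrow> real) \<Rightarrow> bool"
  where "subadditive_mass g \<longleftrightarrow> (\<forall>m>0. \<forall>m'>0. g (m + m') \<le> g m + g m')"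

end

theory Submission
  imports Defs "HOL-Probability.Probability"
begin

text \<open>
  Let \<open>C\<close> bound the moment of \<open>\<omega>(m)/m\<close> for two solutions with densities \<open>\<upsilon>\<close>. The kernel
  \<open>\<rho>(x, dm) = \<omega>(m)/(C m) \<upsilon>(x, dm)\<close> is then a sub-probability at almost every \<open>x\<close>. After
  symmetrisation (\<open>coag_weigh\<close>) the collision term for the test function \<open>f = \<omega> p/(C m)\<close> is the
  integral of
  \<open>[\<omega>(m + m') p(m + m') - \<omega>(m) p(m) - \<omega>(m') p(m')] k(m, m')\<close> against \<open>\<rho> \<times> \<rho>\<close>, where
  \<open>k = (C/2) \<kappa>(m, m')/(\<omega>(m) \<omega>(m'))\<close> is bounded and satisfies \<open>k \<le> (C/2) (q(m) + q(m'))\<close> for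
  \<open>q = \<pi>/\<omega>\<close>. What is unbounded is the weight \<open>\<omega>\<close> in the loss terms. Uniqueness follows by Gronwall's
  argument once \<open>\<integral> \<omega>(m) \<rho>(x, dm)\<close>, the moment of \<open>\<omega>\<^sup>2/m\<close> of the solution, is known to be bounded
  uniformly in \<open>x\<close> and \<open>t\<close>.

  The equation is used in mild form, where diffusion is solved by the heat semigroup at variance
  \<open>a(m) t\<close> (\<open>mild\<close>). It comes from Duhamel's formula on each Fourier mode, on which diffusion is
  multiplication by a function of \<open>m\<close>, and extends to all bounded measurable test functions on compact
  mass ranges by the theorem of Stone and Weierstrass and a monotone class argument
  (\<open>balanced_strip\<close>).

  The moment bound would follow from a maximum principle if the diffusivity did not depend on the
  mass. The substitute is that \<open>sqrt u\<close> times the heat kernel at variance \<open>u v\<close> increases with \<open>u\<close>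
  (\<open>sqrt_heat_mono\<close>). As \<open>a\<close> is nonincreasing, a function \<open>g\<close> for which \<open>g/sqrt a\<close> is subadditive
  stays subadditive in \<open>m\<close> when it is multiplied by the heat flow of a nonnegative function at
  variance \<open>a(m) \<tau>\<close> (\<open>heat_subadditive\<close>), and coagulation does not increase its integral. This
  applies to \<open>\<omega> \<pi> = \<omega>\<^sup>2 q\<close> and bounds the moment of \<open>\<omega> q\<close> under \<open>\<rho>\<close> at almost every position by that of the
  product measure that dominates the initial value (\<open>weighted_estimate\<close>, \<open>weighted_AE\<close>). The weight
  \<open>\<omega>\<close> itself is handled by Gronwall's argument: the gain of \<open>\<omega>\<^sup>2\<close> in a collision consists of mixed
  terms, which the bound \<open>k \<le> (C/2) (q + q')\<close> turns into products of the moment already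
  controlled and the one to be estimated (\<open>capped_gain\<close>, \<open>capped_moment_bound\<close>, \<open>moment_bound\<close>).
  Truncations in mass and height keep all quantities finite; the error they make is a multiple of the
  mass outside a compact range and disappears in the limit (\<open>truncated_bound\<close>).

  For two solutions with the same initial value, the difference of the collision terms is linear in
  \<open>\<rho> - \<rho>'\<close>, with an operator that is bounded on compact mass ranges after the loss rate has been
  moved to the damping rate of the mild equation (\<open>linearised_bound\<close>). The remaining bound does not
  depend on the range, up to an error of the size of the tails of the moment of \<open>\<omega>\<close>
  (\<open>paths_agree\<close>). So the kernels agree on all test functions, and the measures are recovered from
  them because a solution does not charge \<open>m = 0\<close> (\<open>emeasure_\<mu>\<close>).
\<close>

section \<open>Monotone classes and the heat semigroup on the torus\<close>

abbreviation (input) bmeas :: "'a measure => ('a => 'b::topological_space) set"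
 where "bmeas M == borel_measurable M"

text \<open>The functional form of the monotone class theorem, with closure under bounded pointwise limits;
  indicators of the generator suffice because the sets whose indicator lies in \<open>H\<close>
  form a Dynkin system.\<close>

lemma monotone_class_real:
 fixes H :: "('a => real) set"
 assumes gen: "sets M = sigma_sets UNIV G" "Int_stable G"
  and ind: "!!A. A \<in> G ==> indicator A \<in> H"
  and one: "(%_. 1) \<in> H"
  and add: "!!f g. f \<in> H ==> g \<in> H ==> (%x. f x + g x) \<in> H"
  and scale: "!!c f. f \<in> H ==> (%x. c * f x) \<in> H"
  and lim: "!!F f B. (!!n. F n \<in> H) ==> (!!n x. \<bar>F n x\<bar> \<le> B) ==>
   (!!x. (%n. F n x) \<longlonglongrightarrow> f x) ==> f \<in> H"
  and f: "f \<in> bmeas M" "!!x. \<bar>f x\<bar> \<le> B"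
 shows "f \<in> H"
proof -
 have [simp]: "space M = UNIV"
  using gen(1) by (metis sets.top sets_eq_imp_space_eq sigma_sets_into_sp sigma_sets_top subset_UNIV
    sets.sets_into_space top.extremum_uniqueI)
 have zero: "(%_. 0) \<in> H" using scale[OF one, of 0] by simp
 have ind_M: "indicator A \<in> H" if "A \<in> sets M" for A
 proof -
  have "A \<in> sigma_sets UNIV G" using that gen(1) by simp
  with gen(2) subset_UNIV[of G, unfolded Pow_UNIV[symmetric]] show ?thesis
  proof (induction rule: sigma_sets_induct_disjoint)
   case (basic A) thus ?case by (rule ind)
  next
   case empty thus ?case using zero by (simp add: indicator_def[abs_def])
  next
   case (compl A)
   have "indicator (UNIV - A) = (%x. 1 + (-1) * indicator A x :: real)"
    by (auto simp: fun_eq_iff indicator_def)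
   thus ?case using add[OF one scale[OF compl(2), of "-1"]] by simp
  next
   case (union A)
   have fin: "(%x. \<Sum>i<n. indicator (A i) x) \<in> H" for n
    by (induction n) (use zero union in \<open>auto intro: add\<close>)
   have eq: "(\<Sum>i<n. indicator (A i) x) = (indicator (\<Union>i<n. A i) x :: real)" for n x
    using disjoint_family_on_mono[OF subset_UNIV union(1), of "{..<n}"]
    by (subst indicator_UN_disjoint) auto
   show ?case
   proof (rule lim[where F="%n x. \<Sum>i<n. indicator (A i) x" and B=1])
    show "(%n. \<Sum>i<n. indicator (A i) x) \<longlonglongrightarrow> (indicator (\<Union>i. A i) x :: real)" for x
     unfolding eq by (rule LIMSEQ_indicator_UN)
    show "(%x. \<Sum>i<n. indicator (A i) x) \<in> H" for n
     by (rule fin)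
    show "\<bar>\<Sum>i<n. indicator (A i) x :: real\<bar> \<le> 1" for n x
     unfolding eq by (simp add: indicator_def)
   qed
  qed
 qed
 obtain F where F: "!!i. simple_function M (F i)"
   "!!x. x \<in> space M ==> (%i. F i x) \<longlonglongrightarrow> f x"
   "!!i x. x \<in> space M ==> dist (F i x) 0 \<le> 2 * dist (f x) 0"
  using borel_measurable_implies_sequence_metric[OF f(1), of 0] by metis
 have "F i \<in> H" for i
 proof -
  have fin: "finite (range (F i))" using F(1)[of i] by (auto simp: simple_function_def)
  have m: "F i -` {y} \<in> sets M" for y
   using simple_functionD(2)[OF F(1)[of i], of "{y}"] by simp
  have "(%x. \<Sum>y\<in>Y. y * indicator (F i -` {y}) x) \<in> H" if "finite Y" for Y
   using that
  proof induction
   case empty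
   thus ?case using zero by simp
  next
   case (insert y Y)
   thus ?case using add[OF scale[OF ind_M[OF m[of y]], of y] insert(3)]
    by (simp only: sum.insert[OF insert(1,2)])
  qed
  from this[OF fin] have "(%x. \<Sum>y\<in>range (F i). y * indicator (F i -` {y}) x) \<in> H" .
  also have "(%x. \<Sum>y\<in>range (F i). y * indicator (F i -` {y}) x) = F i"
  proof
   fix x
   have "(\<Sum>y\<in>range (F i). y * indicator (F i -` {y}) x)
    = (\<Sum>y\<in>range (F i). if y = F i x then y else 0)"
    by (intro sum.cong) (auto simp: indicator_def)
   thus "(\<Sum>y\<in>range (F i). y * indicator (F i -` {y}) x) = F i x"
    using fin by simp
  qed
  finally show ?thesis .
 qed
 moreover have "\<bar>F i x\<bar> \<le> 2 * B" for i x
  using F(3)[of x i] f(2)[of x] by (simp add: dist_norm)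
 ultimately show ?thesis
  using F(2) by (intro lim[of F "2*B" f]) auto
qed

abbreviation N01 :: "real measure" where "N01 \<equiv> std_normal_distribution"

interpretation N01: prob_space N01
 by (rule prob_space_normal_density) simp

text \<open>The heat semigroup on the torus at variance \<open>v\<close>, as an expectation over a Gaussian
  displacement. This form makes positivity, contraction and bounded convergence immediate and is
  defined for all measurable initial data, without a kernel.\<close>

definition heat :: "real => (real => real) => real => real"
 where "heat v \<phi> x = (\<integral>z. \<phi> (frac (x + sqrt v * z)) \<partial>N01)"

lemma measurable_frac [measurable]: "(frac :: real => real) \<in> bmeas borel"
 unfolding frac_def[abs_def] by measurable

lemma measurable_heat:
 assumes [measurable]: "V \<in> bmeas M" "X \<in> bmeas M"
  "(%(y, u). P y u) \<in> bmeas (M \<Otimes>\<^sub>M borel)"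
 shows "(%y. heat (V y) (P y) (X y)) \<in> bmeas M"
proof -
 have "(%(y, z). P y (frac (X y + sqrt (V y) * z))) \<in> bmeas (M \<Otimes>\<^sub>M borel)"
  by measurable
 hence "(%(y, z). P y (frac (X y + sqrt (V y) * z))) \<in> bmeas (M \<Otimes>\<^sub>M N01)"
  by (simp cong: measurable_cong_sets)
 thus ?thesis
  unfolding heat_def by (rule N01.borel_measurable_lebesgue_integral)
qed

lemma integrable_heat:
 fixes \<phi> :: "real => real"
 assumes [measurable]: "\<phi> \<in> bmeas borel" and "!!x. \<bar>\<phi> x\<bar> \<le> B"
 shows "integrable N01 (%z. \<phi> (frac (x + sqrt v * z)))"
 using assms(2) by (intro N01.integrable_const_bound[where B=B]) auto

lemma heat_mono:
 assumes "\<phi> \<in> bmeas borel" "!!x. \<bar>\<phi> x\<bar> \<le> B"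
  and "\<psi> \<in> bmeas borel" "!!x. \<bar>\<psi> x\<bar> \<le> C"
  and "!!x. 0 \<le> x ==> x < 1 ==> \<phi> x \<le> \<psi> x"
 shows "heat v \<phi> x \<le> heat v \<psi> x"
 unfolding heat_def using assms
 by (intro integral_mono integrable_heat) (auto simp: frac_lt_1)

lemma heat_cong:
 assumes "!!x. 0 \<le> x ==> x < 1 ==> \<phi> x = (\<psi> x :: real)"
 shows "heat v \<phi> x = heat v \<psi> x"
 unfolding heat_def using assms by (simp add: frac_lt_1)

lemma heat_const [simp]: "heat v (%_. c) x = c"
 unfolding heat_def using N01.prob_space by simp

lemma heat_nonneg: "(!!x. 0 \<le> \<phi> x) ==> 0 \<le> heat v \<phi> x"
 unfolding heat_def by (rule integral_nonneg_AE) auto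

lemma abs_heat_le:
 assumes "\<phi> \<in> bmeas borel" "!!x. \<bar>\<phi> x\<bar> \<le> B"
 shows "\<bar>heat v \<phi> x\<bar> \<le> B"
proof -
 have b: "- B \<le> \<phi> x" "\<phi> x \<le> B" for x using assms(2)[of x] by auto
 have "heat v \<phi> x \<le> heat v (%_. B) x"
  by (rule heat_mono[where B=B and C="\<bar>B\<bar>"]) (use assms b in auto)
 moreover have "heat v (%_. - B) x \<le> heat v \<phi> x"
  by (rule heat_mono[where B="\<bar>B\<bar>" and C=B]) (use assms b in auto)
 ultimately show ?thesis by simp
qed

lemma heat_linear:
 assumes "\<phi> \<in> bmeas borel" "!!x. \<bar>\<phi> x\<bar> \<le> B"
  and "\<psi> \<in> bmeas borel" "!!x. \<bar>\<psi> x\<bar> \<le> C"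
 shows "heat v (%x. \<phi> x + \<psi> x) x = heat v \<phi> x + heat v \<psi> x"
 unfolding heat_def using assms by (intro Bochner_Integration.integral_add integrable_heat) auto

lemma heat_scale: "heat v (%x. c * \<phi> x) x = c * heat v \<phi> x"
 unfolding heat_def by simp

lemma heat_zero: "0 \<le> x ==> x < 1 ==> heat 0 \<phi> x = \<phi> x"
 unfolding heat_def using N01.prob_space by (simp add: frac_eq)

lemma heat_tendsto:
 assumes [measurable]: "!!n. \<phi> n \<in> bmeas borel" and "!!n x. \<bar>\<phi> n x\<bar> \<le> B"
  and lim: "!!x. (%n. \<phi> n x) \<longlonglongrightarrow> \<psi> x"
 shows "(%n. heat v (\<phi> n) x) \<longlonglongrightarrow> heat v \<psi> x"
proof -
 have [measurable]: "\<psi> \<in> bmeas borel"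
  by (rule borel_measurable_LIMSEQ_real[of _ \<phi>]) (use lim in auto)
 show ?thesis
  unfolding heat_def
  by (rule integral_dominated_convergence[where w="%_. B"]) (use assms in auto)
qed

lemma distr_N01_add:
 assumes "0 \<le> u" "0 \<le> v"
 shows "distr (N01 \<Otimes>\<^sub>M N01) borel (%(y, z). sqrt u * y + sqrt v * z) = distr N01 borel (%z. sqrt (u + v) * z)"
  (is "?L = ?R")
proof (rule Levy_uniqueness)
 interpret P: pair_prob_space N01 N01 ..
 show "real_distribution ?L"
  by (intro P.real_distribution_distr) measurable
 show "real_distribution ?R"
  by (intro N01.real_distribution_distr) measurable
 have scaled: "(CLINT z|N01. iexp (t * (sqrt u * z))) = exp (- of_real (t\<^sup>2 * u) / 2)" if "0 \<le> u" for t u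
  using char_std_normal_distribution that unfolding char_def fun_eq_iff
  by (drule_tac x="t * sqrt u" in spec) (simp add: mult.assoc power_mult_distrib flip: exp_of_real)
 show "char ?L = char ?R"
 proof
  fix t
  have int: "integrable (N01 \<Otimes>\<^sub>M N01) (%(y, z). iexp (t * (sqrt u * y)) * iexp (t * (sqrt v * z)))"
   by (rule P.integrable_const_bound[where B=1]; (measurable)?) (auto simp: norm_mult split_beta)
  have "char ?L t = (CLINT p|N01 \<Otimes>\<^sub>M N01. iexp (t * (sqrt u * fst p)) * iexp (t * (sqrt v * snd p)))"
   unfolding char_def
   by (subst integral_distr) (auto simp: split_beta distrib_left mult_exp_exp intro!: Bochner_Integration.integral_cong)
  also have "... = (CLINT y|N01. (CLINT z|N01. iexp (t * (sqrt u * y)) * iexp (t * (sqrt v * z))))"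
   using P.integral_fst'[OF int] by (simp add: case_prod_beta')
  also have "... = exp (- of_real (t\<^sup>2 * u) / 2) * exp (- of_real (t\<^sup>2 * v) / 2)"
   using assms scaled by simp
  also have "... = exp (- of_real (t\<^sup>2 * (u + v)) / 2)"
   by (simp add: mult_exp_exp field_simps)
  also have "... = (CLINT z|N01. iexp (t * (sqrt (u + v) * z)))"
   using assms by (intro scaled[symmetric]) simp
  also have "... = char ?R t"
   unfolding char_def by (subst integral_distr) simp_all
  finally show "char ?L t = char ?R t" .
 qed
qed

lemma frac_add_frac: "frac (frac x + y) = frac (x + y :: real)"
proof -
 have "\<lfloor>x - of_int \<lfloor>x\<rfloor> + y\<rfloor> = \<lfloor>x + y\<rfloor> - \<lfloor>x\<rfloor>"
  using floor_diff_of_int[of "x + y" "\<lfloor>x\<rfloor>"] by (simp add: algebra_simps)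
 thus ?thesis by (simp add: frac_def)
qed

text \<open>The semigroup property: a sum of independent centred Gaussians is Gaussian, and the variances
  add.\<close>

lemma heat_heat:
 assumes [measurable]: "\<phi> \<in> bmeas borel" and B: "!!x. \<bar>\<phi> x\<bar> \<le> B" and "0 \<le> u" "0 \<le> v"
 shows "heat u (heat v \<phi>) x = heat (u + v) \<phi> x"
proof -
 interpret P: pair_prob_space N01 N01 ..
 have [measurable]: "(%y. \<phi> (frac (x + y))) \<in> bmeas borel" by measurable
 have int: "integrable (N01 \<Otimes>\<^sub>M N01) (%(y, z). \<phi> (frac (x + (sqrt u * y + sqrt v * z))))"
  using B by (intro P.integrable_const_bound[where B=B]) auto
 have "heat u (heat v \<phi>) x = (\<integral>y. (\<integral>z. \<phi> (frac (x + (sqrt u * y + sqrt v * z))) \<partial>N01) \<partial>N01)"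
  unfolding heat_def by (simp add: frac_add_frac add.assoc)
 also have "... = (\<integral>p. \<phi> (frac (x + (case p of (y, z) => sqrt u * y + sqrt v * z))) \<partial>(N01 \<Otimes>\<^sub>M N01))"
  using P.integral_fst'[OF int] by (simp add: case_prod_beta')
 also have "... = (\<integral>y. \<phi> (frac (x + y)) \<partial>distr (N01 \<Otimes>\<^sub>M N01) borel (%(y, z). sqrt u * y + sqrt v * z))"
  by (subst integral_distr) auto
 also have "... = heat (u + v) \<phi> x"
  unfolding distr_N01_add[OF assms(3,4)] heat_def by (subst integral_distr) auto
 finally show ?thesis .
qed

text \<open>The real form of the statement that characters are eigenfunctions of the heat operator; the
  eigenvalue is the characteristic function of the Gaussian.\<close>

lemma heat_cos:
 fixes n :: nat
 assumes "0 \<le> v"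
 shows "heat v (%x. cos (2 * pi * n * x + \<theta>)) x = exp (- (2 * pi\<^sup>2 * n\<^sup>2 * v)) * cos (2 * pi * n * x + \<theta>)"
proof -
 have periodic: "cos (2 * pi * n * frac y + \<theta>) = cos (2 * pi * n * y + \<theta>)" for y
 proof -
  have "2 * pi * n * frac y + \<theta> = 2 * pi * n * y + \<theta> - 2 * pi * of_int (int n * \<lfloor>y\<rfloor>)"
   by (simp add: frac_def algebra_simps)
  thus ?thesis
   by (metis (no_types, opaque_lifting) cos_diff cos_int_2pin sin_int_2pin mult.right_neutral mult_zero_right add.right_neutral mult.commute)
 qed
 let ?t = "2 * pi * n * sqrt v"
 let ?c = "2 * pi * n * x + \<theta>"
 have "cos (2 * pi * n * (x + sqrt v * z) + \<theta>) = Re (iexp ?c * iexp (?t * z))" for z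
 proof -
  have "2 * pi * n * (x + sqrt v * z) + \<theta> = ?c + ?t * z"
   by (simp add: algebra_simps)
  thus ?thesis
   unfolding cis_conv_exp[symmetric] cis_mult cis.sel by (simp only:)
 qed
 hence "heat v (%x. cos (2 * pi * n * x + \<theta>)) x = (\<integral>z. Re (iexp ?c * iexp (?t * z)) \<partial>N01)"
  unfolding heat_def periodic by simp
 also have "... = Re (CLINT z|N01. iexp ?c * iexp (?t * z))"
  by (intro integral_Re N01.integrable_const_bound[where B=1]) (auto simp: norm_mult)
 also have "... = Re (iexp ?c * char N01 ?t)"
  by (simp add: char_def)
 also have "char N01 ?t = of_real (exp (- (2 * pi\<^sup>2 * n\<^sup>2 * v)))"
  using assms by (simp add: char_std_normal_distribution power_mult_distrib)
 also have "Re (iexp ?c * of_real (exp (- (2 * pi\<^sup>2 * n\<^sup>2 * v)))) = exp (- (2 * pi\<^sup>2 * n\<^sup>2 * v)) * cos ?c"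
  unfolding cis_conv_exp[symmetric] by simp
 finally show ?thesis .
qed

lemma heat_eq_lborel:
 assumes [measurable]: "\<phi> \<in> bmeas borel" and "0 < v"
 shows "heat v \<phi> x = (\<integral>y. normal_density 0 (sqrt v) y * \<phi> (frac (x + y)) \<partial>lborel)"
proof -
 have "(\<integral>y. normal_density 0 (sqrt v) y * \<phi> (frac (x + y)) \<partial>lborel)
  = (\<integral>z. sqrt v * (normal_density 0 (sqrt v) (sqrt v * z) * \<phi> (frac (x + sqrt v * z))) \<partial>lborel)"
  using assms by (subst lborel_integral_real_affine[where c="sqrt v" and t=0]) auto
 also have "... = (\<integral>z. std_normal_density z * \<phi> (frac (x + sqrt v * z)) \<partial>lborel)"
  using assms by (intro Bochner_Integration.integral_cong) (auto simp: normal_density_def real_sqrt_mult power_mult_distrib)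
 also have "... = heat v \<phi> x"
  unfolding heat_def by (subst integral_density) auto
 finally show ?thesis by simp
qed

text \<open>The Gaussian density at variance \<open>u v\<close> multiplied by \<open>sqrt u\<close> is
  \<open>exp (- y\<^sup>2 / (2 u v))\<close> up to a factor independent of \<open>u\<close>, hence
  increasing in \<open>u\<close>. This is the only place where the shape of the heat kernel
  enters; it is what lets heavier particles, which diffuse less, be compared with lighter ones.\<close>

lemma sqrt_heat_mono:
 assumes [measurable]: "\<phi> \<in> bmeas borel" and \<phi>: "!!x. 0 \<le> \<phi> x" "!!x. \<phi> x \<le> B"
  and v: "0 \<le> v" "0 < u" "u \<le> a"
 shows "sqrt u * heat (u * v) \<phi> x \<le> sqrt a * heat (a * v) \<phi> x"
proof (cases "v = 0")
 case True
 thus ?thesis using v heat_nonneg[of \<phi>] \<phi> by (simp add: mult_right_mono)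
next
 case False
 hence pos: "0 < u * v" "0 < a * v" "0 < v" using v by auto
 have B: "\<bar>\<phi> x\<bar> \<le> B" for x using \<phi>[of x] by simp
 have int: "integrable lborel (%y. sqrt w * (normal_density 0 (sqrt (w * v)) y * \<phi> (frac (x + y))))"
  if "0 < w" for w
 proof -
  have "integrable lborel (%y. normal_density 0 (sqrt (w * v)) y * \<phi> (frac (x + y)))"
  proof (rule Bochner_Integration.integrable_bound)
   show "integrable lborel (%y. normal_density 0 (sqrt (w * v)) y * B)"
    using integrable_normal_density[of "sqrt (w * v)" 0] that pos by simp
   show "AE y in lborel. norm (normal_density 0 (sqrt (w * v)) y * \<phi> (frac (x + y)))
     \<le> norm (normal_density 0 (sqrt (w * v)) y * B)"
    using \<phi>(2) order_trans[OF \<phi>] \<phi>(1) by (auto simp: abs_mult intro!: mult_left_mono)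
  qed measurable
  thus ?thesis by (rule integrable_mult_right)
 qed
 have "sqrt u * heat (u * v) \<phi> x = (\<integral>y. sqrt u * (normal_density 0 (sqrt (u * v)) y * \<phi> (frac (x + y))) \<partial>lborel)"
  using pos by (subst heat_eq_lborel) auto
 also have "... \<le> (\<integral>y. sqrt a * (normal_density 0 (sqrt (a * v)) y * \<phi> (frac (x + y))) \<partial>lborel)"
 proof (rule integral_mono)
  fix y
  have scaled: "sqrt w * normal_density 0 (sqrt (w * v)) y = exp (- (y\<^sup>2 / (2 * (w * v)))) / sqrt (2 * pi * v)"
   if "0 < w" for w
   using that pos by (simp add: normal_density_def real_sqrt_mult power_mult_distrib)
  have "sqrt u * normal_density 0 (sqrt (u * v)) y \<le> sqrt a * normal_density 0 (sqrt (a * v)) y"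
   using v pos by (subst (1 2) scaled) (auto intro!: divide_right_mono divide_left_mono mult_right_mono)
  thus "sqrt u * (normal_density 0 (sqrt (u * v)) y * \<phi> (frac (x + y)))
   \<le> sqrt a * (normal_density 0 (sqrt (a * v)) y * \<phi> (frac (x + y)))"
   unfolding mult.assoc[symmetric] using \<phi> by (intro mult_right_mono) auto
 qed (use int v in auto)
 also have "... = sqrt a * heat (a * v) \<phi> x"
  using pos by (subst heat_eq_lborel) auto
 finally show ?thesis .
qed

lemma space_torus [simp]: "space torus = {0..<1}"
 by (simp add: torus_def)

lemma sets_torus: "sets torus = sets (restrict_space borel {0..<1})"
 by (simp add: torus_def sets_restrict_space)

lemma measurable_torus: "f \<in> bmeas borel ==> f \<in> bmeas torus"
 by (simp add: torus_def measurable_restrict_space1)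

lemma prob_space_torus: "prob_space torus"
 by (rule prob_spaceI) (simp add: torus_def emeasure_restrict_space)

interpretation torus: prob_space torus
 by (rule prob_space_torus)

lemma nn_integral_torus: "(\<integral>\<^sup>+x. f x \<partial>torus) = (\<integral>\<^sup>+x. f x * indicator {0..<1} x \<partial>lborel)"
 by (simp add: torus_def nn_integral_restrict_space)

lemma nn_integral_torus_translate:
 fixes f :: "real => ennreal"
 assumes [measurable]: "f \<in> bmeas borel"
 shows "(\<integral>\<^sup>+x. f (frac (x + b)) \<partial>torus) = (\<integral>\<^sup>+x. f x \<partial>torus)"
proof -
 define c where "c = frac b"
 have c: "0 \<le> c" "c < 1" by (auto simp: c_def frac_lt_1)
 have shift: "frac (x + b) = (if x < 1 - c then x + c else x + c - 1)" if "0 \<le> x" "x < 1" for x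
 proof -
  have "frac (x + b) = frac (x + c)" using frac_add_frac[of b x] by (simp add: c_def add.commute)
  also have "... = (if x < 1 - c then x + c else x + c - 1)"
   using that c by (auto simp: frac_unique_iff)
  finally show ?thesis .
 qed
 have "(\<integral>\<^sup>+x. f (frac (x + b)) \<partial>torus)
  = (\<integral>\<^sup>+x. f (x + c) * indicator {0..<1-c} x + f (x + c - 1) * indicator {1-c..<1} x \<partial>lborel)"
  unfolding nn_integral_torus using c by (intro nn_integral_cong) (auto simp: shift indicator_def)
 also have "... = (\<integral>\<^sup>+x. f (x + c) * indicator {0..<1-c} x \<partial>lborel) + (\<integral>\<^sup>+x. f (x + c - 1) * indicator {1-c..<1} x \<partial>lborel)"
  by (rule nn_integral_add) measurable
 also have "(\<integral>\<^sup>+x. f (x + c) * indicator {0..<1-c} x \<partial>lborel) = (\<integral>\<^sup>+x. f x * indicator {c..<1} x \<partial>lborel)"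
  using nn_integral_real_affine[of "%x. f x * indicator {c..<1} x" 1 c]
  by (auto simp: add.commute indicator_def intro!: nn_integral_cong)
 also have "(\<integral>\<^sup>+x. f (x + c - 1) * indicator {1-c..<1} x \<partial>lborel) = (\<integral>\<^sup>+x. f x * indicator {0..<c} x \<partial>lborel)"
  using nn_integral_real_affine[of "%x. f x * indicator {0..<c} x" 1 "c - 1"]
  by (auto simp: algebra_simps indicator_def intro!: nn_integral_cong)
 also have "(\<integral>\<^sup>+x. f x * indicator {c..<1} x \<partial>lborel) + (\<integral>\<^sup>+x. f x * indicator {0..<c} x \<partial>lborel)
  = (\<integral>\<^sup>+x. f x * indicator {c..<1} x + f x * indicator {0..<c} x \<partial>lborel)"
  by (rule nn_integral_add[symmetric]) measurable
 also have "... = (\<integral>\<^sup>+x. f x \<partial>torus)"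
  unfolding nn_integral_torus using c by (intro nn_integral_cong) (auto simp: indicator_def)
 finally show ?thesis .
qed

lemma nn_integral_heat:
 assumes [measurable]: "\<phi> \<in> bmeas borel" and \<phi>: "!!x. 0 \<le> \<phi> x" "!!x. \<phi> x \<le> B"
 shows "(\<integral>\<^sup>+x. ennreal (heat v \<phi> x) \<partial>torus) = (\<integral>\<^sup>+x. ennreal (\<phi> x) \<partial>torus)"
proof -
 interpret P: pair_prob_space torus N01 ..
 have B: "\<bar>\<phi> x\<bar> \<le> B" for x using \<phi>[of x] by simp
 have [measurable]: "(%x. x) \<in> bmeas torus" by (rule measurable_torus) simp
 have "(\<integral>\<^sup>+x. ennreal (heat v \<phi> x) \<partial>torus) = (\<integral>\<^sup>+x. (\<integral>\<^sup>+z. ennreal (\<phi> (frac (x + sqrt v * z))) \<partial>N01) \<partial>torus)"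
 proof (rule nn_integral_cong)
  fix x
  show "ennreal (heat v \<phi> x) = (\<integral>\<^sup>+z. ennreal (\<phi> (frac (x + sqrt v * z))) \<partial>N01)"
   unfolding heat_def
   by (rule nn_integral_eq_integral[symmetric]) (use \<phi> B in \<open>auto intro: integrable_heat[where B=B]\<close>)
 qed
 also have "... = (\<integral>\<^sup>+z. (\<integral>\<^sup>+x. ennreal (\<phi> (frac (x + sqrt v * z))) \<partial>torus) \<partial>N01)"
  by (rule P.Fubini'[symmetric]) measurable
 also have "... = (\<integral>\<^sup>+x. ennreal (\<phi> x) \<partial>torus)"
  using N01.emeasure_space_1 by (simp add: nn_integral_torus_translate[of "%x. ennreal (\<phi> x)"])
 finally show ?thesis .
qed

section \<open>Functionals continuous under bounded pointwise convergence\<close>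

text \<open>The test functions: measurable, bounded by \<open>B\<close>, and zero outside \<open>Z\<close>.\<close>

definition adm :: "'a measure => 'a set => real => ('a => real) => bool"
 where "adm M Z B f \<longleftrightarrow> f \<in> bmeas M \<and> (\<forall>z. \<bar>f z\<bar> \<le> B) \<and> (\<forall>z. z \<notin> Z --> f z = 0)"

lemma admI: "f \<in> bmeas M ==> (!!z. z \<in> Z ==> \<bar>f z\<bar> \<le> B) ==> (!!z. z \<notin> Z ==> f z = 0) ==> 0 \<le> B ==> adm M Z B f"
 unfolding adm_def by (metis abs_zero)

lemma admD:
 assumes "adm M Z B f"
 shows "f \<in> bmeas M" "\<bar>f z\<bar> \<le> B" "z \<notin> Z ==> f z = 0" "0 \<le> B"
 using assms abs_ge_zero[of "f z"] unfolding adm_def by (auto intro: order_trans[OF abs_ge_zero])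

lemma adm_zero: "0 \<le> B ==> adm M Z B (%_. 0)"
 by (rule admI) auto

lemma adm_add: "adm M Z B f ==> adm M Z C g ==> adm M Z (B + C) (%z. f z + g z)"
 unfolding adm_def by (auto intro: order_trans[OF abs_triangle_ineq add_mono])

lemma adm_mult:
 assumes "adm M Z B f" "g \<in> bmeas M" "!!z. z \<in> Z ==> \<bar>g z\<bar> \<le> C" "0 \<le> C"
 shows "adm M Z (C * B) (%z. g z * f z)"
 using admD[OF assms(1)] assms(2-) by (intro admI) (auto simp: abs_mult intro!: mult_mono)

lemma adm_scale: "adm M Z B f ==> adm M Z (\<bar>c\<bar> * B) (%z. c * f z)"
 by (rule adm_mult) auto

lemma adm_lim:
 assumes "!!n. adm M Z B (F n)" "!!z. (%n. F n z) \<longlonglongrightarrow> f z"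
 shows "adm M Z B f"
proof (rule admI)
 show "f \<in> bmeas M"
  by (rule borel_measurable_LIMSEQ_real[of _ F]) (use assms(2) admD(1)[OF assms(1)] in auto)
 show "\<bar>f z\<bar> \<le> B" for z
  by (rule LIMSEQ_le_const2[OF tendsto_rabs[OF assms(2)]]) (use admD[OF assms(1)] in auto)
 show "f z = 0" if "z \<notin> Z" for z
  using assms(2)[of z] admD(3)[OF assms(1) that] by (simp add: LIMSEQ_const_iff)
 show "0 \<le> B" using admD(4)[OF assms(1)] .
qed

text \<open>Linear functionals that are bounded by \<open>K\<close> times the supremum norm and continuous
  under bounded pointwise convergence. Integrals against finite measures have this form, and so
  does the collision term, which is quadratic in the measure but linear in the test function.\<close>

definition bpf :: "'a measure => 'a set => real => (('a => real) => real) => bool"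
 where "bpf M Z K J \<longleftrightarrow> 0 \<le> K
  \<and> (\<forall>f B. adm M Z B f --> \<bar>J f\<bar> \<le> K * B)
  \<and> (\<forall>f g B C. adm M Z B f --> adm M Z C g --> J (%z. f z + g z) = J f + J g)
  \<and> (\<forall>f B c. adm M Z B f --> J (%z. c * f z) = c * J f)
  \<and> (\<forall>F f B. (\<forall>n. adm M Z B (F n)) --> (\<forall>z. (%n. F n z) \<longlonglongrightarrow> f z) --> (%n. J (F n)) \<longlonglongrightarrow> J f)"

lemma bp_functionalI:
 assumes "0 \<le> K" "!!f B. adm M Z B f ==> \<bar>J f\<bar> \<le> K * B"
  "!!f g B C. adm M Z B f ==> adm M Z C g ==> J (%z. f z + g z) = J f + J g"
  "!!f B c. adm M Z B f ==> J (%z. c * f z) = c * J f"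
  "!!F f B. (!!n. adm M Z B (F n)) ==> (!!z. (%n. F n z) \<longlonglongrightarrow> f z) ==> (%n. J (F n)) \<longlonglongrightarrow> J f"
 shows "bpf M Z K J"
 unfolding bpf_def using assms by blast

lemma
 assumes "bpf M Z K J"
 shows bp_nonneg: "0 \<le> K"
  and bp_bound: "adm M Z B f ==> \<bar>J f\<bar> \<le> K * B"
  and bp_add: "adm M Z B f ==> adm M Z C g ==> J (%z. f z + g z) = J f + J g"
  and bp_scale: "adm M Z B f ==> J (%z. c * f z) = c * J f"
  and bp_lim: "(!!n. adm M Z B (F n)) ==> (!!z. (%n. F n z) \<longlonglongrightarrow> f z) ==> (%n. J (F n)) \<longlonglongrightarrow> J f"
 using assms unfolding bpf_def by blast+

lemma bp_diff:
 assumes J: "bpf M Z K J" and f: "adm M Z B f" "adm M Z C g"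
 shows "J (%z. f z - g z) = J f - J g"
 using bp_add[OF J f(1) adm_scale[OF f(2), of "-1"]] bp_scale[OF J f(2), of "-1"] by simp

lemma bp_functional_mono: "bpf M Z K J ==> K \<le> L ==> bpf M Z L J"
 unfolding bpf_def by (meson admD(4) mult_right_mono order_trans)

lemma bp_functional_add:
 assumes "bpf M Z K J" "bpf M Z L H"
 shows "bpf M Z (K + L) (%f. J f + H f)"
proof (rule bp_functionalI)
 show "\<bar>J f + H f\<bar> \<le> (K + L) * B" if "adm M Z B f" for f B
  using bp_bound[OF assms(1) that] bp_bound[OF assms(2) that] by (simp add: distrib_right)
 show "0 \<le> K + L" using bp_nonneg[OF assms(1)] bp_nonneg[OF assms(2)] by simp
 show "J (%z. f z + g z) + H (%z. f z + g z) = J f + H f + (J g + H g)"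
  if "adm M Z B f" "adm M Z C g" for f g B C
  using bp_add[OF assms(1) that] bp_add[OF assms(2) that] by simp
 show "J (%z. c * f z) + H (%z. c * f z) = c * (J f + H f)" if "adm M Z B f" for f B c
  using bp_scale[OF assms(1) that] bp_scale[OF assms(2) that] by (simp add: distrib_left)
 show "(%n. J (F n) + H (F n)) \<longlonglongrightarrow> J f + H f"
  if "!!n. adm M Z B (F n)" "!!z. (%n. F n z) \<longlonglongrightarrow> f z" for F f B
  by (intro tendsto_add bp_lim[OF assms(1) that] bp_lim[OF assms(2) that])
qed

lemma bp_functional_cmult:
 assumes "bpf M Z K J"
 shows "bpf M Z (\<bar>c\<bar> * K) (%f. c * J f)"
proof (rule bp_functionalI)
 show "\<bar>c * J f\<bar> \<le> \<bar>c\<bar> * K * B" if "adm M Z B f" for f B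
  using bp_bound[OF assms(1) that] by (simp add: abs_mult mult.assoc mult_left_mono)
 show "0 \<le> \<bar>c\<bar> * K" using bp_nonneg[OF assms(1)] by simp
 show "c * J (%z. f z + g z) = c * J f + c * J g"
  if "adm M Z B f" "adm M Z C g" for f g B C
  using bp_add[OF assms(1) that] by (simp add: distrib_left)
 show "c * J (%z. d * f z) = d * (c * J f)" if "adm M Z B f" for f B d
  using bp_scale[OF assms(1) that] by simp
 show "(%n. c * J (F n)) \<longlonglongrightarrow> c * J f"
  if "!!n. adm M Z B (F n)" "!!z. (%n. F n z) \<longlonglongrightarrow> f z" for F f B
  by (intro tendsto_mult tendsto_const bp_lim[OF assms(1) that])
qed

lemma bp_functional_compose:
 assumes J: "bpf M' Z' K J" and C: "0 \<le> C"
  and A: "!!f B. adm M Z B f ==> adm M' Z' (C * B) (A f)"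
  and A_add: "!!f g B D. adm M Z B f ==> adm M Z D g ==> A (%z. f z + g z) = (%z. A f z + A g z)"
  and A_scale: "!!f B c. adm M Z B f ==> A (%z. c * f z) = (%z. c * A f z)"
  and A_lim: "!!F f B z. (!!n. adm M Z B (F n)) ==> (!!z. (%n. F n z) \<longlonglongrightarrow> f z) ==> (%n. A (F n) z) \<longlonglongrightarrow> A f z"
 shows "bpf M Z (K * C) (%f. J (A f))"
proof (rule bp_functionalI)
 show "\<bar>J (A f)\<bar> \<le> K * C * B" if "adm M Z B f" for f B
  using bp_bound[OF J A[OF that]] by (simp add: mult.assoc)
 show "(%n. J (A (F n))) \<longlonglongrightarrow> J (A f)"
  if "!!n. adm M Z B (F n)" "!!z. (%n. F n z) \<longlonglongrightarrow> f z" for F f B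
  by (rule bp_lim[OF J]) (use A[OF that(1)] A_lim[OF that] in auto)
 show "J (A (%z. f z + g z)) = J (A f) + J (A g)" if "adm M Z B f" "adm M Z D g" for f g B D
  unfolding A_add[OF that] by (rule bp_add[OF J A[OF that(1)] A[OF that(2)]])
 show "J (A (%z. c * f z)) = c * J (A f)" if "adm M Z B f" for f B c
  unfolding A_scale[OF that] by (rule bp_scale[OF J A[OF that]])
 show "0 \<le> K * C" using C bp_nonneg[OF J] by simp
qed

lemma bp_functional_mult:
 assumes J: "bpf M Z K J" and g: "g \<in> bmeas M" "!!z. z \<in> Z ==> \<bar>g z\<bar> \<le> C" "0 \<le> C"
 shows "bpf M Z (K * C) (%f. J (%z. g z * f z))"
 by (rule bp_functional_compose[OF J g(3)])
  (auto intro: adm_mult g tendsto_mult simp: distrib_left mult.left_commute)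

lemma abs_exp_diff_le: "\<bar>exp a - exp b\<bar> \<le> \<bar>a - b\<bar> * exp (max a b :: real)"
proof -
 have *: "exp a - exp b \<le> (a - b) * exp a" for a b :: real
  using mult_left_mono[OF exp_ge_add_one_self[of "b - a"], of "exp a"]
  by (simp add: exp_diff algebra_simps)
 show ?thesis
  using *[of a b] *[of b a] by (cases "a \<le> b") (auto simp: max_def)
qed

text \<open>Difference quotients of \<open>exp\<close> converge boundedly, because the rate \<open>R\<close>
  is bounded on \<open>Z\<close>; so the derivative passes through \<open>J\<close>.\<close>

lemma bp_exp_deriv:
 assumes J: "bpf M Z K J" and h: "adm M Z B h"
  and R: "R \<in> bmeas M" "!!z. z \<in> Z ==> 0 \<le> R z" "!!z. z \<in> Z ==> R z \<le> b" "0 \<le> b"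
 shows "((%r. J (%z. exp ((r - t) * R z) * h z)) has_real_derivative
  J (%z. R z * (exp ((r - t) * R z) * h z))) (at r)"
proof -
 have adm_exp: "adm M Z (exp (\<bar>y - t\<bar> * b) * B) (%z. exp ((y - t) * R z) * h z)" for y
 proof (rule adm_mult[OF h])
  show "\<bar>exp ((y - t) * R z)\<bar> \<le> exp (\<bar>y - t\<bar> * b)" if "z \<in> Z" for z
  proof -
   have "(y - t) * R z \<le> \<bar>y - t\<bar> * b" using R(2-4) that by (intro mult_mono) auto
   thus ?thesis by simp
  qed
 qed (use R in auto)
 show ?thesis
  unfolding has_field_derivative_iff tendsto_at_iff_sequentially
 proof (intro allI impI)
  fix X :: "nat => real" assume X: "\<forall>i. X i \<in> UNIV - {r}" "X \<longlonglongrightarrow> r"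
  define F where "F n z = 1 / (X n - r) * (exp ((X n - t) * R z) * h z - exp ((r - t) * R z) * h z)" for n z
  obtain c where c: "!!n. \<bar>X n\<bar> \<le> c"
   using convergent_imp_Bseq[of X] X(2) by (auto simp: convergent_def Bseq_def)
  let ?e = "exp ((c + \<bar>r\<bar> + \<bar>t\<bar>) * b)"
  have "adm M Z ((b * ?e) * B) (F n)" for n
  proof -
   have "adm M Z ((b * ?e) * B) (%z. (exp ((X n - t) * R z) - exp ((r - t) * R z)) / (X n - r) * h z)"
   proof (rule adm_mult[OF h])
    fix z assume z: "z \<in> Z"
    have le: "(y - t) * R z \<le> (c + \<bar>r\<bar> + \<bar>t\<bar>) * b" if "\<bar>y\<bar> \<le> c + \<bar>r\<bar>" for y
     using R z that by (intro mult_mono) auto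
    have c0: "0 \<le> c" using c[of 0] by (auto intro: order_trans[OF abs_ge_zero])
    have "\<bar>exp ((X n - t) * R z) - exp ((r - t) * R z)\<bar>
     \<le> \<bar>(X n - t) * R z - (r - t) * R z\<bar> * exp (max ((X n - t) * R z) ((r - t) * R z))"
     by (rule abs_exp_diff_le)
    also have "... \<le> \<bar>X n - r\<bar> * R z * ?e"
    proof (rule mult_mono)
     have "(X n - t) * R z - (r - t) * R z = (X n - r) * R z" by (simp add: algebra_simps)
     thus "\<bar>(X n - t) * R z - (r - t) * R z\<bar> \<le> \<bar>X n - r\<bar> * R z"
      using R z by (simp add: abs_mult)
     show "exp (max ((X n - t) * R z) ((r - t) * R z)) \<le> ?e"
      using le[of "X n"] le[of r] c[of n] c0 by simp
    qed (use R z in auto)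
    also have "... \<le> \<bar>X n - r\<bar> * (b * ?e)"
     using R z by (simp add: mult.assoc mult_left_mono mult_right_mono)
    finally show "\<bar>(exp ((X n - t) * R z) - exp ((r - t) * R z)) / (X n - r)\<bar> \<le> b * ?e"
     using X(1) by (simp add: abs_divide field_simps)
   qed (use R in auto)
   thus ?thesis by (simp add: F_def[abs_def] field_simps)
  qed
  moreover have "(%n. F n z) \<longlonglongrightarrow> R z * (exp ((r - t) * R z) * h z)" for z
  proof -
   have "((%y. exp ((y - t) * R z) * h z) has_real_derivative R z * (exp ((r - t) * R z) * h z)) (at r)"
    by (auto intro!: derivative_eq_intros)
   thus ?thesis
    unfolding has_field_derivative_iff tendsto_at_iff_sequentially
    using X by (simp add: F_def[abs_def] comp_def)
  qed
  ultimately have "(%n. J (F n)) \<longlonglongrightarrow> J (%z. R z * (exp ((r - t) * R z) * h z))"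
   by (rule bp_lim[OF J])
  moreover have "J (F n) = 1 / (X n - r) * (J (%z. exp ((X n - t) * R z) * h z) - J (%z. exp ((r - t) * R z) * h z))" for n
   unfolding F_def
   using bp_scale[OF J adm_add[OF adm_exp adm_scale[OF adm_exp, of "-1"]], of "1 / (X n - r)" "X n" r]
    bp_diff[OF J adm_exp adm_exp, of "X n" r] by simp
  ultimately show "((%y. (J (%z. exp ((y - t) * R z) * h z) - J (%z. exp ((r - t) * R z) * h z)) / (y - r)) \<circ> X)
    \<longlonglongrightarrow> J (%z. R z * (exp ((r - t) * R z) * h z))"
   by (simp add: comp_def)
 qed
qed

text \<open>Approximation by the step functions \<open>f (\<lfloor>r n\<rfloor> / n) s\<close> gives joint
  measurability from continuity in one variable.\<close>

lemma caratheodory_measurable: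
 fixes f :: "real => 'a => real"
 assumes meas: "!!r. f r \<in> bmeas M" and cont: "!!s r. isCont (%r. f r s) r"
 shows "(%(r, s). f r s) \<in> bmeas (borel \<Otimes>\<^sub>M M)"
proof (rule borel_measurable_LIMSEQ_real)
 fix n :: nat
 have "(%z. f (real_of_int \<lfloor>fst z * real (Suc n)\<rfloor> / Suc n) (snd z)) \<in> bmeas (borel \<Otimes>\<^sub>M M)"
 proof (rule measurable_compose_countable[where f="%i z. f (real_of_int i / Suc n) (snd z)" and g="%z. \<lfloor>fst z * real (Suc n)\<rfloor>"])
  show "(%z. f (real_of_int i / Suc n) (snd z)) \<in> bmeas (borel \<Otimes>\<^sub>M M)" for i
   by (rule measurable_compose[OF measurable_snd meas])
  have "(%z. fst z * real (Suc n)) \<in> bmeas (borel \<Otimes>\<^sub>M M)"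
   by (intro borel_measurable_times measurable_fst borel_measurable_const)
  from measurable_compose[OF this measurable_real_floor]
  show "(%z. \<lfloor>fst z * real (Suc n)\<rfloor>) \<in> borel \<Otimes>\<^sub>M M \<rightarrow>\<^sub>M count_space UNIV" .
 qed
 thus "(%(r, s). f (real_of_int \<lfloor>r * real (Suc n)\<rfloor> / Suc n) s) \<in> bmeas (borel \<Otimes>\<^sub>M M)"
  by (simp add: case_prod_beta')
next
 fix z :: "real \<times> 'a"
 obtain r s where z: "z = (r, s)" by force
 have "(%n. real_of_int \<lfloor>r * real (Suc n)\<rfloor> / Suc n) \<longlonglongrightarrow> r"
 proof (rule tendsto_sandwich)
  show "\<forall>\<^sub>F n in sequentially. r - 1 / Suc n \<le> real_of_int \<lfloor>r * real (Suc n)\<rfloor> / Suc n"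
  proof (rule always_eventually, rule allI)
   fix n
   have "r * Suc n - 1 \<le> real_of_int \<lfloor>r * real (Suc n)\<rfloor>" by linarith
   hence "(r * Suc n - 1) / Suc n \<le> real_of_int \<lfloor>r * real (Suc n)\<rfloor> / Suc n"
    by (rule divide_right_mono) simp
   thus "r - 1 / Suc n \<le> real_of_int \<lfloor>r * real (Suc n)\<rfloor> / Suc n"
    by (simp add: diff_divide_distrib)
  qed
  show "\<forall>\<^sub>F n in sequentially. real_of_int \<lfloor>r * real (Suc n)\<rfloor> / Suc n \<le> r"
  proof (rule always_eventually, rule allI)
   fix n
   have "real_of_int \<lfloor>r * real (Suc n)\<rfloor> / Suc n \<le> r * Suc n / Suc n"
    by (rule divide_right_mono) auto
   thus "real_of_int \<lfloor>r * real (Suc n)\<rfloor> / Suc n \<le> r" by simp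
  qed
  show "(%n. r - 1 / Suc n) \<longlonglongrightarrow> r"
   using tendsto_diff[OF tendsto_const[of r] LIMSEQ_inverse_real_of_nat] by (simp add: inverse_eq_divide)
 qed simp
 from isCont_tendsto_compose[OF cont this]
 show "(%n. case z of (r, s) => f (real_of_int \<lfloor>r * real (Suc n)\<rfloor> / Suc n) s) \<longlonglongrightarrow> (case z of (r, s) => f r s)"
  by (simp add: z)
qed

lemma set_integrable_bounded:
 fixes f :: "real => real"
 assumes "set_borel_measurable lborel {a..b} f" "!!s. a \<le> s ==> s \<le> b ==> \<bar>f s\<bar> \<le> C"
 shows "set_integrable lborel {a..b} f"
 unfolding set_integrable_def
proof (rule Bochner_Integration.integrable_bound)
 show "integrable lborel (%s. indicator {a..b} s *\<^sub>R C)"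
  by (intro integrable_scaleR_left integrable_real_indicator) (auto simp: emeasure_lborel_Icc_eq)
 show "AE s in lborel. norm (indicator {a..b} s *\<^sub>R f s) \<le> norm (indicator {a..b} s *\<^sub>R C)"
  using assms(2) order_trans[OF _ abs_ge_self] by (auto simp: indicator_def)
qed (use assms(1) in \<open>simp add: set_borel_measurable_def\<close>)

text \<open>The integrated evolution equation for the single test function \<open>f\<close>: value at time
  \<open>t\<close>, initial value, and rate.\<close>

definition balanced :: "real => (('a => real) => real) => (('a => real) => real) => (real => ('a => real) => real) => ('a => real) => bool"
 where "balanced t A A0 J f \<longleftrightarrow> set_borel_measurable lborel {0..t} (%s. J s f)
  \<and> A f = A0 f + (LINT s:{0..t}|lborel. J s f)"

lemma balanced_integrable:
 assumes "balanced t A A0 J f" "adm M Z B f" "!!s. s \<in> {0..t} ==> bpf M Z K (J s)"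
 shows "set_integrable lborel {0..t} (%s. J s f)"
 using assms(1) bp_bound[OF assms(3) assms(2)] unfolding balanced_def
 by (intro set_integrable_bounded[where C="K * B"]) auto

lemma set_borel_measurable_cong:
 fixes f g :: "'a => real"
 shows "set_borel_measurable M S f ==> (!!s. s \<in> S ==> f s = g s) ==> set_borel_measurable M S g"
 unfolding set_borel_measurable_def
 by (erule measurable_cong[THEN iffD1, rotated]) (simp add: indicator_def)

lemma balanced_add:
 assumes A: "bpf M Z K A" "bpf M Z K A0" "!!s. s \<in> {0..t} ==> bpf M Z K (J s)"
  and f: "adm M Z B f" "balanced t A A0 J f" and g: "adm M Z C g" "balanced t A A0 J g"
 shows "balanced t A A0 J (%z. f z + g z)"
proof -
 have J: "J s (%z. f z + g z) = J s f + J s g" if "s \<in> {0..t}" for s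
  by (rule bp_add[OF A(3)[OF that] f(1) g(1)])
 note int = balanced_integrable[OF f(2,1) A(3)] balanced_integrable[OF g(2,1) A(3)]
 have "set_borel_measurable lborel {0..t} (%s. J s f + J s g)"
  using set_integral_add(1)[OF int] unfolding set_borel_measurable_def set_integrable_def by auto
 hence "set_borel_measurable lborel {0..t} (%s. J s (%z. f z + g z))"
  by (rule set_borel_measurable_cong) (simp add: J)
 moreover have "(LINT s:{0..t}|lborel. J s (%z. f z + g z)) = (LINT s:{0..t}|lborel. J s f + J s g)"
  by (rule set_lebesgue_integral_cong) (auto simp: J)
 ultimately show ?thesis
  using f(2) g(2) set_integral_add(2)[OF int] bp_add[OF A(1) f(1) g(1)] bp_add[OF A(2) f(1) g(1)]
  unfolding balanced_def by simp
qed

lemma balanced_scale: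
 assumes A: "bpf M Z K A" "bpf M Z K A0" "!!s. s \<in> {0..t} ==> bpf M Z K (J s)"
  and f: "adm M Z B f" "balanced t A A0 J f"
 shows "balanced t A A0 J (%z. c * f z)"
proof -
 have J: "J s (%z. c * f z) = c * J s f" if "s \<in> {0..t}" for s
  by (rule bp_scale[OF A(3)[OF that] f(1)])
 have "(%s. indicator {0..t} s *\<^sub>R J s f) \<in> bmeas lborel"
  using f(2) unfolding balanced_def set_borel_measurable_def by auto
 from borel_measurable_times[OF borel_measurable_const this]
 have "set_borel_measurable lborel {0..t} (%s. c * J s f)"
  unfolding set_borel_measurable_def by (simp add: mult.left_commute)
 hence "set_borel_measurable lborel {0..t} (%s. J s (%z. c * f z))"
  by (rule set_borel_measurable_cong) (simp add: J)
 moreover have "(LINT s:{0..t}|lborel. J s (%z. c * f z)) = (LINT s:{0..t}|lborel. c * J s f)"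
  by (rule set_lebesgue_integral_cong) (auto simp: J)
 ultimately show ?thesis
  using f(2) bp_scale[OF A(1) f(1), of c] bp_scale[OF A(2) f(1), of c]
  unfolding balanced_def by (simp add: distrib_left)
qed

lemma balanced_lim:
 assumes A: "bpf M Z K A" "bpf M Z K A0" "!!s. s \<in> {0..t} ==> bpf M Z K (J s)"
  and F: "!!n. adm M Z B (F n)" "!!n. balanced t A A0 J (F n)" "!!z. (%n. F n z) \<longlonglongrightarrow> f z"
 shows "balanced t A A0 J f"
proof -
 have lim: "(%n. indicator {0..t} s *\<^sub>R J s (F n)) \<longlonglongrightarrow> indicator {0..t} s *\<^sub>R J s f" for s
  using bp_lim[OF A(3) F(1,3), of s] by (cases "s \<in> {0..t}") auto
 have meas: "(%s. indicator {0..t} s *\<^sub>R J s (F n)) \<in> bmeas lborel" for n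
  using F(2) unfolding balanced_def set_borel_measurable_def by auto
 have meas': "(%s. indicator {0..t} s *\<^sub>R J s f) \<in> bmeas lborel"
  by (rule borel_measurable_LIMSEQ_real[OF lim meas])
 have bound: "\<bar>J s (F n)\<bar> \<le> K * B" if "s \<in> {0..t}" for s n
  by (rule bp_bound[OF A(3)[OF that] F(1)])
 have "(%n. LINT s:{0..t}|lborel. J s (F n)) \<longlonglongrightarrow> (LINT s:{0..t}|lborel. J s f)"
  unfolding set_lebesgue_integral_def
 proof (rule integral_dominated_convergence)
  show "integrable lborel (%s. indicator {0..t} s *\<^sub>R (K * B))"
   by (intro integrable_scaleR_left integrable_real_indicator) (auto simp: emeasure_lborel_Icc_eq)
 qed (use lim meas meas' bound in \<open>auto simp: indicator_def\<close>)
 hence "(%n. A0 (F n) + (LINT s:{0..t}|lborel. J s (F n))) \<longlonglongrightarrow> A0 f + (LINT s:{0..t}|lborel. J s f)"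
  by (intro tendsto_add bp_lim[OF A(2) F(1,3)])
 moreover have "(%n. A (F n)) \<longlonglongrightarrow> A f"
  by (rule bp_lim[OF A(1) F(1,3)])
 ultimately have "A f = A0 f + (LINT s:{0..t}|lborel. J s f)"
  using F(2) unfolding balanced_def by (auto intro: LIMSEQ_unique)
 with meas' show ?thesis
  unfolding balanced_def set_borel_measurable_def by simp
qed

text \<open>A multiplier \<open>\<psi>\<close> with support in \<open>Z\<close> is carried along, so that
  the functions \<open>h\<close> range over all bounded measurable functions while the functionals
  are only controlled on \<open>Z\<close>.\<close>

lemma balanced_monotone_class:
 assumes A: "bpf M Z K A" "bpf M Z K A0" "!!s. s \<in> {0..t} ==> bpf M Z K (J s)"
  and gen: "sets M = sigma_sets UNIV G" "Int_stable G"
  and \<psi>: "adm M Z 1 \<psi>" "balanced t A A0 J \<psi>"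
  and base: "!!U. U \<in> G ==> balanced t A A0 J (%z. \<psi> z * indicator U z)"
  and h: "h \<in> bmeas M" "!!z. \<bar>h z\<bar> \<le> B"
 shows "balanced t A A0 J (%z. \<psi> z * h z)"
proof -
 let ?H = "{h \<in> bmeas M. (\<exists>B. \<forall>z. \<bar>h z\<bar> \<le> B) \<and> balanced t A A0 J (%z. \<psi> z * h z)}"
 have adm: "adm M Z B (%z. \<psi> z * h z)" if "h \<in> bmeas M" "!!z. \<bar>h z\<bar> \<le> B" for h B
  using adm_mult[OF \<psi>(1) that(1), of B] that(2) order_trans[OF abs_ge_zero that(2)]
  by (simp add: mult.commute)
 have [measurable]: "U \<in> sets M" if "U \<in> G" for U
  using that gen(1) by auto
 have "h \<in> ?H"
 proof (rule monotone_class_real[OF gen _ _ _ _ _ h])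
  show "indicator U \<in> ?H" if "U \<in> G" for U
   using base[OF that] that by (auto intro!: exI[of _ 1] simp: indicator_def)
  show "(%_. 1) \<in> ?H" using \<psi>(2) by auto
 next
  fix f g assume "f \<in> ?H" "g \<in> ?H"
  then obtain B C where B: "f \<in> bmeas M" "!!z. \<bar>f z\<bar> \<le> B" "balanced t A A0 J (%z. \<psi> z * f z)"
   and C: "g \<in> bmeas M" "!!z. \<bar>g z\<bar> \<le> C" "balanced t A A0 J (%z. \<psi> z * g z)"
   by auto
  from balanced_add[OF A adm[OF B(1,2)] B(3) adm[OF C(1,2)] C(3)]
  show "(%z. f z + g z) \<in> ?H"
   using B C by (auto intro!: exI[of _ "B + C"] order_trans[OF abs_triangle_ineq add_mono] simp: distrib_left)
 next
  fix c f assume "f \<in> ?H"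
  then obtain B where B: "f \<in> bmeas M" "!!z. \<bar>f z\<bar> \<le> B" "balanced t A A0 J (%z. \<psi> z * f z)"
   by auto
  from balanced_scale[OF A adm[OF B(1,2)] B(3), of c]
  show "(%z. c * f z) \<in> ?H"
   using B by (auto intro!: exI[of _ "\<bar>c\<bar> * B"] simp: mult.left_commute abs_mult mult_left_mono)
 next
  fix F f B assume F: "!!n. F n \<in> ?H" "!!n z. \<bar>F n z\<bar> \<le> B" "!!z. (%n. F n z) \<longlonglongrightarrow> f z"
  have "balanced t A A0 J (%z. \<psi> z * f z)"
   by (rule balanced_lim[OF A adm[where B=B]]) (use F in \<open>auto intro!: tendsto_mult\<close>)
  moreover have "f \<in> bmeas M"
   by (rule borel_measurable_LIMSEQ_real[of _ F]) (use F in auto)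
  moreover have "\<bar>f z\<bar> \<le> B" for z
   by (rule LIMSEQ_le_const2[OF tendsto_rabs[OF F(3)]]) (use F(2) in auto)
  ultimately show "f \<in> ?H" by auto
 qed
 thus ?thesis by simp
qed

text \<open>Variation of constants for a damping rate \<open>R\<close> that depends on the point. The
  functional is differentiated along the test functions \<open>exp ((r - t) R) h\<close>; Fubini's
  theorem exchanges the integral over time with the one produced by this derivative.\<close>

lemma duhamel:
 fixes V L :: "real => ('a => real) => real"
 assumes V: "!!s. s \<in> {0..T} ==> bpf M Z K (V s)" and V0: "bpf M Z K V0"
  and L: "!!s. s \<in> {0..T} ==> bpf M Z K (L s)"
  and R: "R \<in> bmeas M" "!!z. z \<in> Z ==> 0 \<le> R z" "!!z. z \<in> Z ==> R z \<le> b" "0 \<le> b"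
  and Vm: "!!h B. adm M Z B h ==> set_borel_measurable lborel {0..T} (%s. V s h)"
  and Lm: "!!h B. adm M Z B h ==> set_borel_measurable lborel {0..T} (%s. L s h)"
  and eq: "!!h B t. adm M Z B h ==> t \<in> {0..T} ==>
   V t h = V0 h + (LINT s:{0..t}|lborel. L s h - V s (%z. R z * h z))"
  and h: "adm M Z B h" and t: "t \<in> {0..T}"
 shows "balanced t (V t) (%f. V0 (%z. exp (- t * R z) * f z)) (%s f. L s (%z. exp ((s - t) * R z) * f z)) h"
proof -
 define G where "G r = (%z. exp ((r - t) * R z) * h z)" for r
 define RG where "RG r = (%z. R z * G r z)" for r
 define l where "l s f = L s f - V s (%z. R z * f z)" for s f
 have B: "0 \<le> B" by (rule admD(4)[OF h])
 have K: "0 \<le> K" by (rule bp_nonneg[OF V0])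
 have Gt: "G t = h" and G0: "G 0 = (%z. exp (- t * R z) * h z)" by (auto simp: G_def)
 have adm_G_gen: "\<exists>C. adm M Z C (G r)" for r
 proof -
  have "adm M Z (exp (\<bar>r - t\<bar> * b) * B) (G r)"
   unfolding G_def
  proof (rule adm_mult[OF h])
   show "\<bar>exp ((r - t) * R z)\<bar> \<le> exp (\<bar>r - t\<bar> * b)" if "z \<in> Z" for z
   proof -
    have "(r - t) * R z \<le> \<bar>r - t\<bar> * b" using R(2-4) that by (intro mult_mono) auto
    thus ?thesis by simp
   qed
  qed (use R in auto)
  thus ?thesis ..
 qed
 have adm_R: "adm M Z (b * C) (%z. R z * f z)" if "adm M Z C f" for C f
  by (rule adm_mult[OF that]) (use R in auto)
 have adm_G: "adm M Z B (G r)" if "r \<le> t" for r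
 proof -
  have "adm M Z (1 * B) (G r)"
   unfolding G_def using R that by (intro adm_mult[OF h]) (auto simp: mult_nonpos_nonneg)
  thus ?thesis by simp
 qed
 have adm_RG: "adm M Z (b * B) (RG r)" if "r \<le> t" for r
  unfolding RG_def by (rule adm_R[OF adm_G[OF that]])
 have l: "bpf M Z (K + K * b) (l s)" if "s \<in> {0..T}" for s
 proof -
  have "bpf M Z (K * b) (%f. V s (%z. R z * f z))"
   by (rule bp_functional_mult[OF V[OF that] R(1) _ R(4)]) (use R in auto)
  from bp_functional_add[OF L[OF that] bp_functional_cmult[OF this, of "-1"]]
  show ?thesis by (simp add: l_def[abs_def])
 qed
 have lm: "set_borel_measurable lborel {0..T} (%s. l s f)" if "adm M Z C f" for f C
  using Lm[OF that] Vm[OF adm_R[OF that]] unfolding set_borel_measurable_def l_def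
  by (simp add: right_diff_distrib)
 have deriv_G: "((%r. J (G r)) has_real_derivative J (RG r)) (at r)"
  if "bpf M Z K' J" for J K' r
  unfolding G_def RG_def by (rule bp_exp_deriv[OF that h R])
 have cont_G: "isCont (%r. J (G r)) r" if "bpf M Z K' J" for J K' r
  using deriv_G[OF that] by (rule DERIV_isCont)
 have cont_RG: "isCont (%r. J (RG r)) r" if "bpf M Z K' J" for J K' r
 proof -
  have "bpf M Z (K' * b) (%f. J (%z. R z * f z))"
   by (rule bp_functional_mult[OF that R(1) _ R(4)]) (use R in auto)
  from cont_G[OF this] show "isCont (%r. J (RG r)) r"
   unfolding RG_def .
 qed
 have t0: "0 \<le> t" "t \<le> T" using t by auto
 have joint: "(%(r, s). indicator {0..T} s * J s (X r)) \<in> bmeas (borel \<Otimes>\<^sub>M borel)"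
  if "!!r. \<exists>C. adm M Z C (X r)" "!!f C. adm M Z C f ==> set_borel_measurable lborel {0..T} (%s. J s f)"
   and "!!s r. s \<in> {0..T} ==> isCont (%r. J s (X r)) r"
  for J :: "real => ('a => real) => real" and X :: "real => 'a => real"
 proof (rule caratheodory_measurable[where f="%r s. indicator {0..T} s * J s (X r)"])
  show "(%s. indicator {0..T} s * J s (X r)) \<in> bmeas borel" for r
   using that(1)[of r] that(2) by (auto simp: set_borel_measurable_def)
  show "isCont (%r. indicator {0..T} s * J s (X r)) r" for s r
   using that(3)[of s r] by (cases "s \<in> {0..T}") auto
 qed
 have diag: "set_borel_measurable lborel {0..t} (%s. J s (X s))"
  if "(%(r, s). indicator {0..T} s * J s (X r)) \<in> bmeas (borel \<Otimes>\<^sub>M borel)"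
  for J :: "real => ('a => real) => real" and X
 proof -
  have "(%s. indicator {0..t} s * (case (s, s) of (r, s) => indicator {0..T} s * J s (X r))) \<in> bmeas borel"
   using measurable_compose[OF _ that, of "%s. (s, s)" borel] by measurable
  also have "(%s. indicator {0..t} s * (case (s, s) of (r, s) => indicator {0..T} s * J s (X r)))
   = (%s. indicator {0..t} s *\<^sub>R J s (X s))"
   using t0 by (auto simp: fun_eq_iff indicator_def)
  finally show ?thesis by (simp add: set_borel_measurable_def)
 qed
 have adm_RG_gen: "\<exists>C. adm M Z C (RG r)" for r
  using adm_G_gen[of r] adm_R unfolding RG_def by blast
 define C where "C = (K + K * b) * (b * B)"
 have C0: "0 \<le> C" using K R(4) B by (auto simp: C_def)
 have bounds: "\<bar>l s (RG r)\<bar> \<le> C" if "s \<in> {0..T}" "r \<le> t" for s r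
  unfolding C_def by (rule bp_bound[OF l[OF that(1)] adm_RG[OF that(2)]])
 have int_V: "set_integrable lborel {0..t} (%s. V s (RG s))"
 proof (rule set_integrable_bounded[where C="K * (b * B)"])
  show "set_borel_measurable lborel {0..t} (%s. V s (RG s))"
   by (rule diag, rule joint[where J=V and X=RG]) (use adm_RG_gen Vm in \<open>auto intro: cont_RG[OF V]\<close>)
 qed (use t0 bp_bound[OF V adm_RG] in auto)
 have meas_L: "set_borel_measurable lborel {0..t} (%s. L s (G s))"
  by (rule diag, rule joint[where J=L and X=G]) (use adm_G_gen Lm in \<open>auto intro: cont_G[OF L]\<close>)
 have int_L: "set_integrable lborel {0..t} (%s. L s (G s))"
  by (rule set_integrable_bounded[where C="K * B", OF meas_L]) (use t0 bp_bound[OF L adm_G] in auto)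
 have int_V0: "set_integrable lborel {0..t} (%s. V0 (RG s))"
 proof (rule set_integrable_bounded[where C="K * (b * B)"])
  have "(%s. V0 (RG s)) \<in> bmeas borel"
   using cont_RG[OF V0] by (intro borel_measurable_continuous_onI continuous_at_imp_continuous_on) auto
  thus "set_borel_measurable lborel {0..t} (%s. V0 (RG s))"
   by (simp add: set_borel_measurable_def)
 qed (use bp_bound[OF V0 adm_RG] in auto)
 have lG: "l s (G s) = L s (G s) - V s (RG s)" for s
  by (simp add: l_def RG_def)
 have FTC: "J h - J (G s) = (\<integral>r. J (RG r) * indicator {s..t} r \<partial>lborel)"
  if "bpf M Z K' J" "s \<le> t" for J K' s
  using integral_FTC_Icc_real[OF that(2) deriv_G[OF that(1)] cont_RG[OF that(1)]] by (simp add: Gt)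
 define \<Phi> where "\<Phi> s r = indicator {0..t} s * indicator {s..t} r * (indicator {0..T} s * l s (RG r))" for s r
 have \<Phi>_int: "integrable (lborel \<Otimes>\<^sub>M lborel) (%(s, r). \<Phi> s r)"
 proof (rule Bochner_Integration.integrable_bound)
  show "integrable (lborel \<Otimes>\<^sub>M lborel) (%z. indicator ({0..t} \<times> {0..t}) z * C)"
   by (intro integrable_mult_left integrable_real_indicator)
    (auto simp: lborel.emeasure_pair_measure_Times emeasure_lborel_Icc_eq ennreal_mult_less_top)
  have q: "(%(r, s). indicator {0..T} s * l s (RG r)) \<in> bmeas (borel \<Otimes>\<^sub>M borel)"
   by (rule joint[where J=l and X=RG]) (use adm_RG_gen lm in \<open>auto intro: cont_RG[OF l]\<close>)
  have "(%z. indicator {0..T} (fst z) * l (fst z) (RG (snd z))) \<in> bmeas (borel \<Otimes>\<^sub>M borel)"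
   using measurable_compose[OF _ q, of "%z. (snd z, fst z)" "borel \<Otimes>\<^sub>M borel"] by simp
  moreover have "(%z. indicator {0..t} (fst z) * indicator {fst z..t} (snd z) :: real) \<in> bmeas (borel \<Otimes>\<^sub>M borel)"
   unfolding indicator_def atLeastAtMost_iff by measurable
  ultimately have "(%z. indicator {0..t} (fst z) * indicator {fst z..t} (snd z) * (indicator {0..T} (fst z) * l (fst z) (RG (snd z)))) \<in> bmeas (borel \<Otimes>\<^sub>M borel)"
   by (rule borel_measurable_times[rotated])
  thus "(%(s, r). \<Phi> s r) \<in> bmeas (lborel \<Otimes>\<^sub>M lborel)"
   unfolding \<Phi>_def case_prod_beta' by (simp cong: measurable_cong_sets sets_pair_measure_cong)
  show "AE z in lborel \<Otimes>\<^sub>M lborel. norm (case z of (s, r) => \<Phi> s r) \<le> norm (indicator ({0..t} \<times> {0..t}) z * C)"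
   using bounds C0 t0 by (auto simp: \<Phi>_def indicator_def)
 qed
 have inner_r: "(\<integral>r. \<Phi> s r \<partial>lborel) = indicator {0..t} s *\<^sub>R (l s h - l s (G s))" for s
 proof (cases "s \<in> {0..t}")
  case True
  hence "s \<in> {0..T}" "s \<le> t" using t0 by auto
  from FTC[OF l[OF this(1)] this(2)] show ?thesis
   using True t0 by (simp add: \<Phi>_def mult.commute)
 qed (simp add: \<Phi>_def)
 have inner_s: "(\<integral>s. \<Phi> s r \<partial>lborel) = indicator {0..t} r *\<^sub>R (V r (RG r) - V0 (RG r))" for r
 proof (cases "r \<in> {0..t}")
  case True
  hence r: "r \<in> {0..T}" "r \<le> t" "0 \<le> r" using t0 by auto
  have "(\<integral>s. \<Phi> s r \<partial>lborel) = (LINT s:{0..r}|lborel. l s (RG r))"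
   unfolding set_lebesgue_integral_def \<Phi>_def using r t0
   by (intro Bochner_Integration.integral_cong) (auto simp: indicator_def)
  also have "... = V r (RG r) - V0 (RG r)"
   using eq[OF adm_RG[OF r(2)] r(1)] by (simp add: l_def)
  finally show ?thesis using True by simp
 next
  case False
  hence "\<Phi> s r = 0" for s by (auto simp: \<Phi>_def indicator_def)
  thus ?thesis using False by simp
 qed
 have set_h: "set_integrable lborel {0..t} (%s. l s h)"
 proof (rule set_integrable_bounded[where C="(K + K * b) * B"])
  have "(%s. indicator {0..t} s * (indicator {0..T} s *\<^sub>R l s h)) \<in> bmeas lborel"
   using lm[OF h] unfolding set_borel_measurable_def by measurable
  also have "(%s. indicator {0..t} s * (indicator {0..T} s *\<^sub>R l s h)) = (%s. indicator {0..t} s *\<^sub>R l s h)"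
   using t0 by (auto simp: fun_eq_iff indicator_def)
  finally show "set_borel_measurable lborel {0..t} (%s. l s h)"
   unfolding set_borel_measurable_def .
 qed (use t0 bp_bound[OF l h] in auto)
 have set_lG: "set_integrable lborel {0..t} (%s. l s (G s))"
  unfolding lG by (rule set_integral_diff(1)[OF int_L int_V])
 have "(LINT s:{0..t}|lborel. l s h - l s (G s)) = (LINT r:{0..t}|lborel. V r (RG r) - V0 (RG r))"
  using lborel_pair.Fubini_integral[OF \<Phi>_int] unfolding inner_r inner_s set_lebesgue_integral_def by simp
 hence "(LINT s:{0..t}|lborel. l s h) - (LINT s:{0..t}|lborel. l s (G s))
   = (LINT r:{0..t}|lborel. V r (RG r)) - (LINT r:{0..t}|lborel. V0 (RG r))"
  by (simp add: set_integral_diff(2)[OF set_h set_lG] set_integral_diff(2)[OF int_V int_V0])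
 moreover have "(LINT s:{0..t}|lborel. l s (G s)) = (LINT s:{0..t}|lborel. L s (G s)) - (LINT s:{0..t}|lborel. V s (RG s))"
  unfolding lG by (rule set_integral_diff(2)[OF int_L int_V])
 moreover have "V0 h - V0 (G 0) = (LINT r:{0..t}|lborel. V0 (RG r))"
  using FTC[OF V0 t0(1)] by (simp add: set_lebesgue_integral_def mult.commute)
 moreover have "V t h = V0 h + (LINT s:{0..t}|lborel. l s h)"
  unfolding l_def by (rule eq[OF h t])
 ultimately have "V t h = V0 (G 0) + (LINT s:{0..t}|lborel. L s (G s))"
  by simp
 thus ?thesis
  unfolding balanced_def using meas_L G0 by (simp add: G_def)
qed

section \<open>Sub-probability kernels and the collision functional\<close>

definition subkernel :: "(real => real measure) => bool"
 where "subkernel \<rho> \<longleftrightarrow> \<rho> \<in> borel \<rightarrow>\<^sub>M subprob_algebra borel"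

lemma subkernel_subprob: "subkernel \<rho> ==> subprob_space (\<rho> x)"
 unfolding subkernel_def by (erule subprob_space_kernel) simp

lemma subkernel_sets: "subkernel \<rho> ==> sets (\<rho> x) = sets borel"
 unfolding subkernel_def by (erule sets_kernel) simp

lemma subkernel_measurable:
 "subkernel \<rho> ==> f \<in> bmeas borel ==> f \<in> bmeas (\<rho> x)"
 using measurable_cong_sets[OF subkernel_sets refl] by blast

lemma subkernel_nn_integral_measurable:
 assumes "subkernel \<rho>" "(%(y, m). f y m) \<in> bmeas (M \<Otimes>\<^sub>M borel)" "X \<in> bmeas M"
 shows "(%y. \<integral>\<^sup>+m. f y m \<partial>\<rho> (X y)) \<in> bmeas M"
 by (rule nn_integral_measurable_subprob_algebra2[OF assms(2)])
  (use assms(1) measurable_compose[OF assms(3)] in \<open>simp add: subkernel_def\<close>)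

lemma subkernel_integrable:
 fixes g :: "real => real"
 assumes "subkernel \<rho>" "g \<in> bmeas borel" "!!m. \<bar>g m\<bar> \<le> B"
 shows "integrable (\<rho> x) g"
proof -
 interpret subprob_space "\<rho> x" by (rule subkernel_subprob[OF assms(1)])
 show ?thesis
  by (rule integrable_const_bound[where B=B]) (use assms(3) subkernel_measurable[OF assms(1,2)] in auto)
qed

lemma subkernel_integral_bound:
 fixes g :: "real => real"
 assumes "subkernel \<rho>" "g \<in> bmeas borel" "!!m. \<bar>g m\<bar> \<le> B"
 shows "\<bar>\<integral>m. g m \<partial>\<rho> x\<bar> \<le> B"
proof -
 interpret subprob_space "\<rho> x" by (rule subkernel_subprob[OF assms(1)])
 have B: "0 \<le> B" using assms(3)[of 0] by simp
 have int: "integrable (\<rho> x) g" by (rule subkernel_integrable[OF assms])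
 have "\<bar>\<integral>m. g m \<partial>\<rho> x\<bar> \<le> (\<integral>m. \<bar>g m\<bar> \<partial>\<rho> x)" by (rule integral_abs_bound)
 also have "... \<le> (\<integral>m. B \<partial>\<rho> x)" using int assms(3) by (intro integral_mono) auto
 also have "... \<le> B" using B subprob_measure_le_1 by (simp add: mult_left_le_one_le)
 finally show ?thesis .
qed

lemma subkernel_integral_measurable:
 fixes f :: "'a => real => real"
 assumes \<rho>: "subkernel \<rho>" and f: "(%(y, m). f y m) \<in> bmeas (M \<Otimes>\<^sub>M borel)"
  and B: "!!y m. \<bar>f y m\<bar> \<le> B" and X: "X \<in> bmeas M"
 shows "(%y. \<integral>m. f y m \<partial>\<rho> (X y)) \<in> bmeas M"
proof -
 have [measurable]: "(%z. f (fst z) (snd z)) \<in> bmeas (M \<Otimes>\<^sub>M borel)"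
  using f by (simp add: case_prod_beta')
 have "(%y. \<integral>m. f y m \<partial>\<rho> (X y)) \<in> bmeas M
  \<longleftrightarrow> (%y. enn2real (\<integral>\<^sup>+m. ennreal (f y m) \<partial>\<rho> (X y)) - enn2real (\<integral>\<^sup>+m. ennreal (- f y m) \<partial>\<rho> (X y))) \<in> bmeas M"
 proof (rule measurable_cong)
  fix y assume "y \<in> space M"
  hence "f y \<in> bmeas borel"
   using measurable_compose[OF measurable_Pair1' f, of y] by simp
  thus "(\<integral>m. f y m \<partial>\<rho> (X y)) = enn2real (\<integral>\<^sup>+m. ennreal (f y m) \<partial>\<rho> (X y)) - enn2real (\<integral>\<^sup>+m. ennreal (- f y m) \<partial>\<rho> (X y))"
   by (intro real_lebesgue_integral_def subkernel_integrable[OF \<rho> _ B])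
 qed
 also have "..."
  by (intro borel_measurable_diff borel_measurable_enn2real subkernel_nn_integral_measurable[OF \<rho> _ X])
   (simp_all add: case_prod_beta')
 finally show ?thesis .
qed

text \<open>The integral of \<open>p\<close> against the measure \<open>\<rho>(x, dm) dx\<close> on the
  torus times the line.\<close>

definition pairing :: "(real => real measure) => (real \<times> real => real) => real"
 where "pairing \<rho> p = (\<integral>x. (\<integral>m. p (x, m) \<partial>\<rho> x) \<partial>torus)"

abbreviation RR :: "(real \<times> real) measure" where "RR \<equiv> borel \<Otimes>\<^sub>M borel"

lemma measurable_section: "p \<in> bmeas RR ==> (%m. p (x, m)) \<in> bmeas borel"
 by (rule measurable_compose[OF measurable_Pair1']) auto

lemma pairing_inner_measurable:
 fixes p :: "real \<times> real => real"
 assumes "subkernel \<rho>" "p \<in> bmeas RR" "!!z. \<bar>p z\<bar> \<le> B"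
 shows "(%x. \<integral>m. p (x, m) \<partial>\<rho> x) \<in> bmeas borel"
 by (rule subkernel_integral_measurable[where B=B, OF assms(1)]) (use assms(2,3) in auto)

lemma torus_integrable:
 fixes g :: "real => real"
 assumes "g \<in> bmeas borel" "!!x. \<bar>g x\<bar> \<le> B"
 shows "integrable torus g"
 using assms by (intro torus.integrable_const_bound[where B=B]) (auto intro: measurable_torus)

lemma pairing_bound:
 assumes "subkernel \<rho>" "p \<in> bmeas RR" "!!z. \<bar>p z\<bar> \<le> B"
 shows "\<bar>pairing \<rho> p\<bar> \<le> B"
proof -
 have inner: "\<bar>\<integral>m. p (x, m) \<partial>\<rho> x\<bar> \<le> B" for x
  by (rule subkernel_integral_bound[OF assms(1) measurable_section[OF assms(2)] assms(3)])
 have "\<bar>pairing \<rho> p\<bar> \<le> (\<integral>x. \<bar>\<integral>m. p (x, m) \<partial>\<rho> x\<bar> \<partial>torus)"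
  unfolding pairing_def by (rule integral_abs_bound)
 also have "... \<le> (\<integral>x. B \<partial>torus)"
  using inner torus_integrable[OF pairing_inner_measurable[OF assms] inner]
  by (intro integral_mono) auto
 also have "... = B" using torus.prob_space by simp
 finally show ?thesis .
qed

lemma pairing_add:
 assumes \<rho>: "subkernel \<rho>" and p: "p \<in> bmeas RR" "!!z. \<bar>p z\<bar> \<le> B"
  and q: "q \<in> bmeas RR" "!!z. \<bar>q z\<bar> \<le> C"
 shows "pairing \<rho> (%z. p z + q z) = pairing \<rho> p + pairing \<rho> q"
proof -
 have inner: "(\<integral>m. p (x, m) + q (x, m) \<partial>\<rho> x) = (\<integral>m. p (x, m) \<partial>\<rho> x) + (\<integral>m. q (x, m) \<partial>\<rho> x)" for x
  using p q by (intro Bochner_Integration.integral_add subkernel_integrable[OF \<rho>] measurable_section)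
 have int: "integrable torus (%x. \<integral>m. p (x, m) \<partial>\<rho> x)"
  if "p \<in> bmeas RR" "!!z. \<bar>p z\<bar> \<le> B" for p :: "real \<times> real => real" and B
 proof (rule torus_integrable)
  show "(%x. \<integral>m. p (x, m) \<partial>\<rho> x) \<in> bmeas borel"
   by (rule pairing_inner_measurable[OF \<rho> that])
  show "\<bar>\<integral>m. p (x, m) \<partial>\<rho> x\<bar> \<le> B" for x
   by (rule subkernel_integral_bound[OF \<rho> measurable_section[OF that(1)] that(2)])
 qed
 show ?thesis
  unfolding pairing_def inner by (rule Bochner_Integration.integral_add[OF int int]) (use p q in auto)
qed

lemma pairing_scale: "pairing \<rho> (%z. c * p z) = c * pairing \<rho> p"
 unfolding pairing_def by simp

lemma pairing_diff:
 assumes \<rho>: "subkernel \<rho>" and p: "p \<in> bmeas RR" "!!z. \<bar>p z\<bar> \<le> B"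
  and q: "q \<in> bmeas RR" "!!z. \<bar>q z\<bar> \<le> C"
 shows "pairing \<rho> (%z. p z - q z) = pairing \<rho> p - pairing \<rho> q"
 using pairing_add[OF \<rho> p, of "%z. - q z" C] pairing_scale[of \<rho> "-1" q] q by simp

lemma pairing_cong: "(!!x m. 0 \<le> x ==> x < 1 ==> p (x, m) = q (x, m)) ==> pairing \<rho> p = pairing \<rho> q"
 unfolding pairing_def by (intro Bochner_Integration.integral_cong) auto

lemma pairing_tendsto:
 assumes \<rho>: "subkernel \<rho>" and P: "!!n. P n \<in> bmeas RR" "!!n z. \<bar>P n z\<bar> \<le> B"
  and lim: "!!z. (%n. P n z) \<longlonglongrightarrow> p z"
 shows "(%n. pairing \<rho> (P n)) \<longlonglongrightarrow> pairing \<rho> p"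
proof -
 have p: "p \<in> bmeas RR"
  by (rule borel_measurable_LIMSEQ_real[OF lim P(1)])
 have pB: "\<bar>p z\<bar> \<le> B" for z
  by (rule LIMSEQ_le_const2[OF tendsto_rabs[OF lim]]) (use P(2) in auto)
 have inner: "(%n. \<integral>m. P n (x, m) \<partial>\<rho> x) \<longlonglongrightarrow> (\<integral>m. p (x, m) \<partial>\<rho> x)" for x
 proof -
  interpret subprob_space "\<rho> x" by (rule subkernel_subprob[OF \<rho>])
  show ?thesis
   by (rule integral_dominated_convergence[where w="%_. B"])
    (use P lim p in \<open>auto intro!: subkernel_measurable[OF \<rho>] measurable_section\<close>)
 qed
 have meas: "(%x. \<integral>m. p (x, m) \<partial>\<rho> x) \<in> bmeas torus"
  if "p \<in> bmeas RR" "!!z. \<bar>p z\<bar> \<le> B" for p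
  by (rule measurable_torus[OF pairing_inner_measurable[OF \<rho> that]])
 show ?thesis
  unfolding pairing_def
 proof (rule integral_dominated_convergence[where w="%_. B"])
  show "AE x in torus. norm (\<integral>m. P n (x, m) \<partial>\<rho> x) \<le> B" for n
   using subkernel_integral_bound[OF \<rho> measurable_section[OF P(1)] P(2)] by auto
 qed (use meas[OF p pB] meas[OF P] inner in auto)
qed

text \<open>Compact mass ranges that exhaust \<open>{0<..}\<close>.\<close>

definition slab :: "real => real set"
 where "slab r = {inverse r..r}"

lemma slab_pos: "m \<in> slab r ==> 1 \<le> r ==> 0 < m"
 unfolding slab_def using less_le_trans[of 0 "inverse r" m] by simp

lemma slab_sets [measurable]: "slab r \<in> sets borel"
 unfolding slab_def by simp

abbreviation strip :: "real => (real \<times> real) set"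
 where "strip r \<equiv> UNIV \<times> slab r"

lemma bp_pairing:
 assumes \<rho>: "subkernel \<rho>"
 shows "bpf RR Z 1 (pairing \<rho>)"
proof (rule bp_functionalI)
 show "\<bar>pairing \<rho> f\<bar> \<le> 1 * B" if "adm RR Z B f" for f B
  using pairing_bound[OF \<rho> admD(1,2)[OF that]] by simp
 show "pairing \<rho> (%z. f z + g z) = pairing \<rho> f + pairing \<rho> g"
  if "adm RR Z B f" "adm RR Z C g" for f g B C
  by (rule pairing_add[OF \<rho> admD(1,2)[OF that(1)] admD(1,2)[OF that(2)]])
 show "(%n. pairing \<rho> (F n)) \<longlonglongrightarrow> pairing \<rho> f"
  if "!!n. adm RR Z B (F n)" "!!z. (%n. F n z) \<longlonglongrightarrow> f z" for F f B
  by (rule pairing_tendsto[OF \<rho> admD(1,2)[OF that(1)] that(2)])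
qed (simp_all add: pairing_scale)

definition gain_loss :: "(real => real) => (real \<times> real => real) => real => real => real => real"
 where "gain_loss w p x m m' = w (m + m') * p (x, m + m') - w m * p (x, m) - w m' * p (x, m')"

text \<open>The symmetrised weak form of the coagulation operator, for a kernel \<open>\<rho>\<close> that
  already carries the weight \<open>w\<close>.\<close>

definition collision :: "(real => real) => (real => real => real) => (real => real measure) => (real \<times> real => real) => real"
 where "collision w k \<rho> p = pairing \<rho> (%(x, m). \<integral>m'. gain_loss w p x m m' * k m m' \<partial>\<rho> x)"

text \<open>Particles of mass \<open>m\<close> diffuse with their own diffusivity \<open>a m\<close>.\<close>

definition semigroup_at :: "(real => real) => real => (real \<times> real => real) => real \<times> real => real"
 where "semigroup_at a \<tau> p = (%(x, m). heat (a m * \<tau>) (%y. p (y, m)) x)"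

lemma measurable_section': "p \<in> bmeas RR ==> (%x. p (x, m)) \<in> bmeas borel"
 by (rule measurable_compose[OF measurable_Pair2']) auto

lemma adm_semigroup:
 assumes [measurable]: "a \<in> bmeas borel" and p: "adm RR (UNIV \<times> S) B p"
 shows "adm RR (UNIV \<times> S) B (semigroup_at a \<tau> p)"
proof (rule admI)
 have [measurable]: "p \<in> bmeas RR" by (rule admD(1)[OF p])
 have "(%z. heat (a (snd z) * \<tau>) (%y. p (y, snd z)) (fst z)) \<in> bmeas RR"
  by (rule measurable_heat) measurable
 thus "semigroup_at a \<tau> p \<in> bmeas RR"
  by (simp add: semigroup_at_def case_prod_beta')
 show "\<bar>semigroup_at a \<tau> p z\<bar> \<le> B" for z
  unfolding semigroup_at_def case_prod_beta'
  by (rule abs_heat_le[OF measurable_section'[OF admD(1)[OF p]] admD(2)[OF p]])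
 show "semigroup_at a \<tau> p z = 0" if "z \<notin> UNIV \<times> S" for z
 proof -
  have "p (y, snd z) = 0" for y using admD(3)[OF p, of "(y, snd z)"] that by (cases z) auto
  thus ?thesis by (simp add: semigroup_at_def case_prod_beta')
 qed
 show "0 \<le> B" by (rule admD(4)[OF p])
qed

lemma bp_semigroup:
 assumes a: "a \<in> bmeas borel" and J: "bpf RR (UNIV \<times> S) K J"
 shows "bpf RR (UNIV \<times> S) K (%p. J (semigroup_at a \<tau> p))"
proof -
 have "bpf RR (UNIV \<times> S) (K * 1) (%p. J (semigroup_at a \<tau> p))"
 proof (rule bp_functional_compose[OF J])
  show "semigroup_at a \<tau> (%z. f z + g z) = (%z. semigroup_at a \<tau> f z + semigroup_at a \<tau> g z)"
   if "adm RR (UNIV \<times> S) B f" "adm RR (UNIV \<times> S) D g" for f g B D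
   unfolding semigroup_at_def using admD[OF that(1)] admD[OF that(2)]
   by (auto simp: fun_eq_iff intro!: heat_linear measurable_section')
  show "(%n. semigroup_at a \<tau> (F n) z) \<longlonglongrightarrow> semigroup_at a \<tau> f z"
   if "!!n. adm RR (UNIV \<times> S) B (F n)" "!!z. (%n. F n z) \<longlonglongrightarrow> f z" for F f B z
   unfolding semigroup_at_def case_prod_beta'
   by (rule heat_tendsto[where B=B]) (use admD[OF that(1)] that(2) in \<open>auto intro!: measurable_section'\<close>)
 qed (use adm_semigroup[OF a] in \<open>auto simp: semigroup_at_def heat_scale fun_eq_iff\<close>)
 thus ?thesis by simp
qed

lemma semigroup_at_cong:
 "(!!x m. 0 \<le> x ==> x < 1 ==> p (x, m) = q (x, m)) ==> semigroup_at a \<tau> p = semigroup_at a \<tau> q"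
 unfolding semigroup_at_def fun_eq_iff by (auto intro: heat_cong)

lemma weighted_bound:
 assumes "adm RR (strip r) B p" "!!m. m \<in> slab r ==> \<bar>w m\<bar> \<le> W" "0 \<le> W"
 shows "\<bar>w m * p (x, m)\<bar> \<le> W * B"
proof (cases "m \<in> slab r")
 case True
 thus ?thesis using assms(2)[OF True] admD(2,4)[OF assms(1)] assms(3)
  by (auto simp: abs_mult intro!: mult_mono)
next
 case False
 thus ?thesis using admD(3)[OF assms(1), of "(x, m)"] admD(4)[OF assms(1)] assms(3) by simp
qed

lemma gain_loss_bound:
 assumes "adm RR (strip r) B p" "!!m. m \<in> slab r ==> \<bar>w m\<bar> \<le> W" "0 \<le> W"
 shows "\<bar>gain_loss w p x m m'\<bar> \<le> 3 * W * B"
proof -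
 have "\<bar>w m * p (x, m)\<bar> \<le> W * B" for m
  by (rule weighted_bound[OF assms])
 from this[of m] this[of m'] this[of "m + m'"] show ?thesis
  unfolding gain_loss_def by linarith
qed

lemma gain_loss_measurable [measurable]:
 assumes [measurable]: "w \<in> bmeas borel" "p \<in> bmeas RR"
 shows "(%z. gain_loss w p (fst (fst z)) (snd (fst z)) (snd z)) \<in> bmeas (RR \<Otimes>\<^sub>M borel)"
 unfolding gain_loss_def by measurable

text \<open>The map from a test function to the inner integral of its collision term. The test function
  lives on a slab, where \<open>w\<close> is bounded, and \<open>k\<close> is bounded everywhere,
  so the result is bounded; its support is no longer in the slab.\<close>

lemma adm_collision_inner:
 assumes \<rho>: "subkernel \<rho>" and w: "w \<in> bmeas borel" "!!m. m \<in> slab r ==> \<bar>w m\<bar> \<le> W" "0 \<le> W"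
  and k: "(%(m, m'). k m m') \<in> bmeas RR" "!!m m'. \<bar>k m m'\<bar> \<le> c0"
  and p: "adm RR (strip r) B p"
 shows "adm RR UNIV (3 * W * c0 * B) (%(x, m). \<integral>m'. gain_loss w p x m m' * k m m' \<partial>\<rho> x)"
  and "integrable (\<rho> x) (%m'. gain_loss w p x m m' * k m m')"
proof -
 note [measurable] = w(1) admD(1)[OF p]
 have [measurable]: "(%z. k (fst z) (snd z)) \<in> bmeas RR"
  using k(1) by (simp add: case_prod_beta')
 have c0: "0 \<le> c0" using k(2)[of 0 0] by simp
 have bound: "\<bar>gain_loss w p x m m' * k m m'\<bar> \<le> 3 * W * c0 * B" for x m m'
 proof -
  have "\<bar>gain_loss w p x m m'\<bar> * \<bar>k m m'\<bar> \<le> (3 * W * B) * c0"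
   using k(2)[of m m'] w(3) admD(4)[OF p]
   by (intro mult_mono gain_loss_bound[OF p w(2,3)]) auto
  thus ?thesis by (simp add: abs_mult mult_ac)
 qed
 have [measurable]: "(%z. k (snd (fst z)) (snd z)) \<in> bmeas (RR \<Otimes>\<^sub>M borel)"
  using measurable_compose[of "%z. (snd (fst z), snd z)" "RR \<Otimes>\<^sub>M borel" RR "%z. k (fst z) (snd z)" borel] by simp
 have meas: "(%z. gain_loss w p (fst (fst z)) (snd (fst z)) (snd z) * k (snd (fst z)) (snd z)) \<in> bmeas (RR \<Otimes>\<^sub>M borel)"
  by measurable
 have sec: "(%m'. gain_loss w p x m m' * k m m') \<in> bmeas borel" for x m
  using measurable_compose[OF measurable_Pair1' meas, of "(x, m)"] by (simp add: space_pair_measure)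
 show "integrable (\<rho> x) (%m'. gain_loss w p x m m' * k m m')"
  by (rule subkernel_integrable[OF \<rho> sec bound])
 have "(%z. \<integral>m'. gain_loss w p (fst z) (snd z) m' * k (snd z) m' \<partial>\<rho> (fst z)) \<in> bmeas RR"
  by (rule subkernel_integral_measurable[OF \<rho> _ bound]) (use meas in \<open>auto simp: case_prod_beta'\<close>)
 thus "adm RR UNIV (3 * W * c0 * B) (%(x, m). \<integral>m'. gain_loss w p x m m' * k m m' \<partial>\<rho> x)"
  using subkernel_integral_bound[OF \<rho> sec bound] c0 w(3) admD(4)[OF p]
  by (intro admI) (auto simp: case_prod_beta')
qed

lemma bp_collision:
 assumes \<rho>: "subkernel \<rho>" and w: "w \<in> bmeas borel" "!!m. m \<in> slab r ==> \<bar>w m\<bar> \<le> W" "0 \<le> W"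
  and k: "(%(m, m'). k m m') \<in> bmeas RR" "!!m m'. \<bar>k m m'\<bar> \<le> c0"
 shows "bpf RR (strip r) (3 * W * c0) (collision w k \<rho>)"
proof -
 have adm: "adm RR UNIV (3 * W * c0 * B) (%(x, m). \<integral>m'. gain_loss w p x m m' * k m m' \<partial>\<rho> x)"
  "integrable (\<rho> x) (%m'. gain_loss w p x m m' * k m m')" if "adm RR (strip r) B p" for B p x m
  by (rule adm_collision_inner[where r=r]; use assms that in blast)+
 have c0: "0 \<le> c0" using k(2)[of 0 0] by simp
 have "bpf RR (strip r) (1 * (3 * W * c0)) (%p. pairing \<rho> (%(x, m). \<integral>m'. gain_loss w p x m m' * k m m' \<partial>\<rho> x))"
 proof (rule bp_functional_compose[OF bp_pairing[OF \<rho>]])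
  show "adm RR UNIV (3 * W * c0 * B) (%(x, m). \<integral>m'. gain_loss w f x m m' * k m m' \<partial>\<rho> x)"
   if "adm RR (strip r) B f" for f B by (rule adm(1)[OF that])
  show "(%(x, m). \<integral>m'. gain_loss w (%z. f z + g z) x m m' * k m m' \<partial>\<rho> x)
   = (%z. (case z of (x, m) => \<integral>m'. gain_loss w f x m m' * k m m' \<partial>\<rho> x)
     + (case z of (x, m) => \<integral>m'. gain_loss w g x m m' * k m m' \<partial>\<rho> x))"
   if "adm RR (strip r) B f" "adm RR (strip r) D g" for f g B D
  proof (rule ext, clarsimp)
   fix x m
   have "gain_loss w (%z. f z + g z) x m m' * k m m' = gain_loss w f x m m' * k m m' + gain_loss w g x m m' * k m m'" for m'
    by (simp add: gain_loss_def algebra_simps)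
   thus "(\<integral>m'. gain_loss w (%z. f z + g z) x m m' * k m m' \<partial>\<rho> x)
    = (\<integral>m'. gain_loss w f x m m' * k m m' \<partial>\<rho> x) + (\<integral>m'. gain_loss w g x m m' * k m m' \<partial>\<rho> x)"
    using Bochner_Integration.integral_add[OF adm(2)[OF that(1)] adm(2)[OF that(2)]] by simp
  qed
  show "(%(x, m). \<integral>m'. gain_loss w (%z. c * f z) x m m' * k m m' \<partial>\<rho> x)
   = (%z. c * (case z of (x, m) => \<integral>m'. gain_loss w f x m m' * k m m' \<partial>\<rho> x))" for f c
  proof (rule ext, clarsimp)
   fix x m
   have "gain_loss w (%z. c * f z) x m m' * k m m' = c * (gain_loss w f x m m' * k m m')" for m'
    by (simp add: gain_loss_def algebra_simps)
   thus "(\<integral>m'. gain_loss w (%z. c * f z) x m m' * k m m' \<partial>\<rho> x)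
    = c * (\<integral>m'. gain_loss w f x m m' * k m m' \<partial>\<rho> x)"
    by (simp only: integral_mult_right_zero)
  qed
  show "(%n. case z of (x, m) => \<integral>m'. gain_loss w (F n) x m m' * k m m' \<partial>\<rho> x)
    \<longlonglongrightarrow> (case z of (x, m) => \<integral>m'. gain_loss w f x m m' * k m m' \<partial>\<rho> x)"
   if F: "!!n. adm RR (strip r) B (F n)" "!!z. (%n. F n z) \<longlonglongrightarrow> f z" for F f B z
  proof (cases z)
   case (Pair x m)
   interpret subprob_space "\<rho> x" by (rule subkernel_subprob[OF \<rho>])
   have f: "adm RR (strip r) B f" by (rule adm_lim[OF F])
   have "(%n. \<integral>m'. gain_loss w (F n) x m m' * k m m' \<partial>\<rho> x) \<longlonglongrightarrow> (\<integral>m'. gain_loss w f x m m' * k m m' \<partial>\<rho> x)"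
   proof (rule integral_dominated_convergence[where w="%_. (3 * W * B) * c0"])
    show "AE m' in \<rho> x. norm (gain_loss w (F n) x m m' * k m m') \<le> (3 * W * B) * c0" for n
     using k(2) w(3) admD(4)[OF f]
     by (auto simp: abs_mult intro!: mult_mono gain_loss_bound[OF F(1) w(2,3)])
    show "AE m' in \<rho> x. (%n. gain_loss w (F n) x m m' * k m m') \<longlonglongrightarrow> gain_loss w f x m m' * k m m'"
     unfolding gain_loss_def by (auto intro!: tendsto_intros F(2))
   qed (use borel_measurable_integrable[OF adm(2)[OF F(1)]] borel_measurable_integrable[OF adm(2)[OF f]] in auto)
   thus ?thesis using Pair by simp
  qed
  show "0 \<le> 3 * W * c0" using w(3) c0 by simp
 qed
 thus ?thesis by (simp add: collision_def[abs_def])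
qed

section \<open>Extension from trigonometric test functions\<close>

lemma balanced_cong:
 assumes "balanced t A A0 J f" "A f = A' f'" "A0 f = A0' f'" "!!s. s \<in> {0..t} ==> J s f = J' s f'"
 shows "balanced t A' A0' J' f'"
proof -
 have "set_borel_measurable lborel {0..t} (%s. J' s f')"
  by (rule set_borel_measurable_cong[of _ _ "%s. J s f"]) (use assms in \<open>auto simp: balanced_def\<close>)
 moreover have "(LINT s:{0..t}|lborel. J s f) = (LINT s:{0..t}|lborel. J' s f')"
  by (rule set_lebesgue_integral_cong) (use assms(4) in auto)
 ultimately show ?thesis
  using assms(1-3) by (simp add: balanced_def)
qed

inductive trig_sum :: "(real => real) => bool" where
 base: "trig_sum (%x. c * cos (2 * pi * real n * x + \<theta>))"
| add: "trig_sum e ==> trig_sum e' ==> trig_sum (%x. e x + e' x)"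

lemma trig_sum_const: "trig_sum (%x. c)"
 using trig_sum.base[of c 0 0] by simp

lemma trig_sum_cos_mult:
 "trig_sum (%x. (c * cos (2 * pi * real n * x + \<theta>)) * (d * cos (2 * pi * real m * x + \<phi>)))"
proof -
 have diff: "trig_sum (%x. (c * d / 2) * cos ((2 * pi * real n * x + \<theta>) - (2 * pi * real m * x + \<phi>)))"
 proof (cases "m \<le> n")
  case True
  hence "(2 * pi * real n * x + \<theta>) - (2 * pi * real m * x + \<phi>) = 2 * pi * real (n - m) * x + (\<theta> - \<phi>)" for x
   by (simp add: of_nat_diff algebra_simps)
  thus ?thesis using trig_sum.base[of "c * d / 2" "n - m" "\<theta> - \<phi>"] by (simp only:)
 next
  case False
  have "cos ((2 * pi * real n * x + \<theta>) - (2 * pi * real m * x + \<phi>)) = cos (2 * pi * real (m - n) * x + (\<phi> - \<theta>))" for x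
  proof -
   have "(2 * pi * real n * x + \<theta>) - (2 * pi * real m * x + \<phi>) = - (2 * pi * real (m - n) * x + (\<phi> - \<theta>))"
    using False by (simp add: of_nat_diff algebra_simps)
   thus ?thesis by (simp only: cos_minus)
  qed
  thus ?thesis using trig_sum.base[of "c * d / 2" "m - n" "\<phi> - \<theta>"] by (simp only:)
 qed
 have "(2 * pi * real n * x + \<theta>) + (2 * pi * real m * x + \<phi>) = 2 * pi * real (n + m) * x + (\<theta> + \<phi>)" for x
  by (simp add: algebra_simps)
 with trig_sum.base[of "c * d / 2" "n + m" "\<theta> + \<phi>"] have sum: "trig_sum (%x. (c * d / 2) * cos ((2 * pi * real n * x + \<theta>) + (2 * pi * real m * x + \<phi>)))"
  by (simp only:)
 have "(c * cos \<alpha>) * (d * cos \<beta>) = (c * d / 2) * cos (\<alpha> - \<beta>) + (c * d / 2) * cos (\<alpha> + \<beta>)" for \<alpha> \<beta>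
  by (simp add: cos_diff cos_add algebra_simps)
 thus ?thesis using trig_sum.add[OF diff sum] by simp
qed

lemma trig_sum_mult:
 assumes "trig_sum e" "trig_sum e'"
 shows "trig_sum (%x. e x * e' x)"
 using assms(1)
proof induction
 case (base c n \<theta>)
 show ?case using assms(2)
 proof induction
  case (base d m \<phi>)
  show ?case by (rule trig_sum_cos_mult)
 next
  case (add f g)
  thus ?case using trig_sum.add by (simp add: distrib_left)
 qed
next
 case (add f g)
 thus ?case using trig_sum.add by (simp add: distrib_right)
qed

text \<open>A polynomial in two real variables becomes a trigonometric sum on the unit circle, so the
  approximation theorem of Stone and Weierstrass yields trigonometric approximations of continuous
  functions.\<close>

lemma trig_sum_polynomial:
 fixes P :: "complex => real"
 assumes "real_polynomial_function P"
 shows "trig_sum (%x. P (cis (2 * pi * x)))"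
 using assms
proof induction
 case (linear f)
 then interpret bounded_linear f .
 have "f (cis y) = f 1 * cos (y + 0) + f \<i> * cos (y + - pi / 2)" for y
 proof -
  have "cis y = cos y *\<^sub>R 1 + sin y *\<^sub>R \<i>" by (simp add: complex_eq_iff)
  hence "f (cis y) = cos y * f 1 + sin y * f \<i>" by (simp only: add scaleR real_scaleR_def)
  moreover have "sin y = cos (y + - pi / 2)" by (simp add: cos_sin_eq[of "y + - pi / 2"]) (simp add: cos_diff)
  ultimately show ?thesis by simp
 qed
 thus ?case
  using trig_sum.add[OF trig_sum.base[of "f 1" 1 0] trig_sum.base[of "f \<i>" 1 "- pi / 2"]] by simp
next
 case (const c) show ?case by (rule trig_sum_const)
next
 case (add f g) thus ?case by (intro trig_sum.add)
next
 case (mult f g) thus ?case by (intro trig_sum_mult)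
qed

lemma trig_sum_bounded:
 assumes "trig_sum e" shows "\<exists>B. \<forall>x. \<bar>e x\<bar> \<le> B" "e \<in> bmeas borel"
proof -
 show "\<exists>B. \<forall>x. \<bar>e x\<bar> \<le> B"
  using assms
 proof induction
  case (base c n \<theta>)
  have "\<bar>c * cos (2 * pi * real n * x + \<theta>)\<bar> \<le> \<bar>c\<bar>" for x
   by (simp add: abs_mult mult_left_le)
  thus ?case by blast
 next
  case (add f g)
  then obtain B C where "!!x. \<bar>f x\<bar> \<le> B" "!!x. \<bar>g x\<bar> \<le> C" by blast
  thus ?case by (intro exI[of _ "B + C"]) (auto intro: order_trans[OF abs_triangle_ineq add_mono])
 qed
 show "e \<in> bmeas borel"
  using assms by induction measurable
qed

text \<open>The functions \<open>min 1 (j * infdist z (- U))\<close> increase to the indicator of an open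
  set.\<close>

lemma open_indicator_limit:
 fixes U :: "'a::metric_space set"
 assumes "open U"
 obtains F :: "nat => 'a => real" where "!!j. continuous_on UNIV (F j)" "!!j z. 0 \<le> F j z" "!!j z. F j z \<le> 1"
  "!!z. (%j. F j z) \<longlonglongrightarrow> indicator U z"
proof (cases "U = UNIV")
 case True
 show ?thesis by (rule that[of "%_ _. 1"]) (use True in auto)
next
 case False
 define F where "F j z = min 1 (real j * infdist z (- U))" for j z
 show ?thesis
 proof (rule that[of F])
  show "continuous_on UNIV (F j)" for j
   unfolding F_def by (intro continuous_intros)
  show "0 \<le> F j z" "F j z \<le> 1" for j z
   by (auto simp: F_def infdist_nonneg)
  show "(%j. F j z) \<longlonglongrightarrow> indicator U z" for z
  proof (cases "z \<in> U")
   case True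
   hence pos: "0 < infdist z (- U)"
    using assms False by (intro infdist_pos_not_in_closed) auto
   obtain N where N: "1 / infdist z (- U) < real N" using reals_Archimedean2 by blast
   have "F j z = 1" if "N \<le> j" for j
   proof -
    have "1 / infdist z (- U) \<le> real j" using N that by linarith
    hence "1 \<le> real j * infdist z (- U)" using pos by (simp add: divide_le_eq)
    thus ?thesis by (simp add: F_def)
   qed
   hence "\<forall>\<^sub>F j in sequentially. F j z = 1"
    using eventually_sequentially by blast
   thus ?thesis using True by (simp add: tendsto_eventually)
  qed (simp add: F_def)
 qed
qed

lemma borel_measurable_Arg2pi: "Arg2pi \<in> bmeas borel"
 unfolding borel_measurable_iff_le by (auto intro: borel_closed closed_Arg2pi2pi_le)

lemma Arg2pi_cis: "0 \<le> x ==> x < 1 ==> Arg2pi (cis (2 * pi * x)) = 2 * pi * x"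
 by (rule Arg2pi_unique[of 1]) (auto simp: cis_conv_exp)

text \<open>An identity that holds for products of trigonometric functions and functions of the mass extends
  to all bounded measurable functions on the strip: first to continuous functions of the position
  by Stone and Weierstrass, then to indicators of rectangles, and then by the monotone class
  theorem.\<close>

lemma balanced_strip:
 assumes A: "bpf RR (strip r) K A" "bpf RR (strip r) K A0"
   "!!s. s \<in> {0..t} ==> bpf RR (strip r) K (J s)"
  and cong: "!!p q. (!!x m. 0 \<le> x ==> x < 1 ==> p (x, m) = q (x, m)) ==> A p = A q"
   "!!p q. (!!x m. 0 \<le> x ==> x < 1 ==> p (x, m) = q (x, m)) ==> A0 p = A0 q"
   "!!p q s. (!!x m. 0 \<le> x ==> x < 1 ==> p (x, m) = q (x, m)) ==> J s p = J s q"
  and trig: "!!n \<theta> g B. adm borel (slab r) B g ==>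
   balanced t A A0 J (%(x, m). cos (2 * pi * real n * x + \<theta>) * g m)"
  and p: "adm RR (strip r) B p"
 shows "balanced t A A0 J p"
proof -
 let ?I = "%B. indicator (B \<inter> slab r) :: real => real"
 have adm_e: "adm RR (strip r) B (%(x, m). e x * ?I S m)"
  if "e \<in> bmeas borel" "!!x. \<bar>e x\<bar> \<le> B" "S \<in> sets borel" for e B S
 proof (rule admI)
  note [measurable] = that(1,3)
  show "(%(x, m). e x * ?I S m) \<in> bmeas RR" by measurable
  show "0 \<le> B" using that(2)[of 0] by simp
 qed (use that(2) order_trans[OF abs_ge_zero that(2)] in \<open>auto simp: indicator_def abs_mult\<close>)
 have trig_sum: "balanced t A A0 J (%(x, m). e x * ?I S m)" if "trig_sum e" "S \<in> sets borel" for e S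
  using that(1)
 proof induction
  case (base c n \<theta>)
  have "adm borel (slab r) 1 (?I S)" using that(2) by (intro admI) (auto simp: indicator_def)
  from trig[OF this] have b: "balanced t A A0 J (%(x, m). cos (2 * pi * real n * x + \<theta>) * ?I S m)" .
  have "balanced t A A0 J (%z. c * (case z of (x, m) => cos (2 * pi * real n * x + \<theta>) * ?I S m))"
   by (rule balanced_scale[OF A _ b], assumption, rule adm_e[where B=1]) (use that(2) in auto)
  thus ?case by (simp add: case_prod_beta' mult.assoc)
 next
  case (add f g)
  obtain B C where B: "!!x. \<bar>f x\<bar> \<le> B" "!!x. \<bar>g x\<bar> \<le> C"
   using trig_sum_bounded(1)[OF add.hyps(1)] trig_sum_bounded(1)[OF add.hyps(2)] by blast
  from balanced_add[OF A adm_e[OF trig_sum_bounded(2)[OF add.hyps(1)] B(1) that(2)] add.IH(1)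
    adm_e[OF trig_sum_bounded(2)[OF add.hyps(2)] B(2) that(2)] add.IH(2)]
  show ?case by (simp add: case_prod_beta' distrib_right)
 qed
 have cis_meas [measurable]: "(%x. cis (2 * pi * x)) \<in> bmeas borel"
  by (intro borel_measurable_continuous_onI continuous_intros)
 have cont: "balanced t A A0 J (%(x, m). F (cis (2 * pi * x)) * ?I S m)"
  if F: "continuous_on UNIV F" "!!z. 0 \<le> F z" "!!z. F z \<le> 1" and S: "S \<in> sets borel" for F :: "complex => real" and S
 proof -
  have F': "continuous_on (sphere 0 1) F" by (rule continuous_on_subset[OF F(1)]) simp
  have "\<exists>P. real_polynomial_function P \<and> (\<forall>z\<in>sphere 0 1. \<bar>F z - P z\<bar> < 1 / real (Suc j))" for j
   using Stone_Weierstrass_real_polynomial_function[OF compact_sphere F', of "1 / real (Suc j)"]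
   by (metis of_nat_0_less_iff zero_less_Suc zero_less_divide_1_iff)
  then obtain P where P: "!!j. real_polynomial_function (P j)"
    "!!j z. z \<in> sphere 0 1 ==> \<bar>F z - P j z\<bar> < 1 / real (Suc j)"
   by metis
  define e where "e j x = P j (cis (2 * pi * x))" for j x
  have e: "trig_sum (e j)" for j
   unfolding e_def by (rule trig_sum_polynomial[OF P(1)])
  have close: "\<bar>F (cis (2 * pi * x)) - e j x\<bar> < 1 / real (Suc j)" for j x
   unfolding e_def by (rule P(2)) simp
  have e2: "\<bar>e j x\<bar> \<le> 2" for j x
  proof -
   have "1 / real (Suc j) \<le> 1" by simp
   thus ?thesis using close[of x j] F(2,3)[of "cis (2 * pi * x)"] by linarith
  qed
  have lim: "(%j. e j x) \<longlonglongrightarrow> F (cis (2 * pi * x))" for x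
  proof -
   have "(%j. F (cis (2 * pi * x)) - e j x) \<longlonglongrightarrow> 0"
    by (rule Lim_null_comparison[OF _ LIMSEQ_inverse_real_of_nat])
     (use close[of x] in \<open>auto simp: inverse_eq_divide intro!: always_eventually less_imp_le\<close>)
   from tendsto_diff[OF tendsto_const[where k="F (cis (2 * pi * x))"] this] show ?thesis by simp
  qed
  show ?thesis
   by (rule balanced_lim[OF A, where B=2 and F="%j (x, m). e j x * ?I S m"])
    (use adm_e[OF trig_sum_bounded(2)[OF e] e2 S] trig_sum[OF e S] lim in \<open>auto intro!: tendsto_mult\<close>)
 qed
 have rect_open: "balanced t A A0 J (%(x, m). indicator U (cis (2 * pi * x)) * ?I S m)"
  if U: "open U" and S: "S \<in> sets borel" for U S
 proof -
  obtain F :: "nat => complex => real" where F: "!!j. continuous_on UNIV (F j)" "!!j z. 0 \<le> F j z" "!!j z. F j z \<le> 1"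
   "!!z. (%j. F j z) \<longlonglongrightarrow> indicator U z"
   by (rule open_indicator_limit[OF U]) blast
  have [measurable]: "F j \<in> bmeas borel" for j
   using F(1) by (intro borel_measurable_continuous_onI)
  have adm: "adm RR (strip r) 1 (%(x, m). F j (cis (2 * pi * x)) * ?I S m)" for j
   by (rule adm_e[OF _ _ S]) (use F(2,3) in auto)
  show ?thesis
   by (rule balanced_lim[OF A, where B=1 and F="%j (x, m). F j (cis (2 * pi * x)) * ?I S m"])
    (use adm cont[OF F(1-3) S] F(4) in \<open>auto intro!: tendsto_mult\<close>)
 qed
 have lift: "bpf M Z' (K * 1) (%h. J (%(x, m). \<Psi> h x m))"
  if J: "bpf RR (strip r) K J"
   and adm: "!!h B. adm M Z' B h ==> adm RR (strip r) (1 * B) (%(x, m). \<Psi> h x m)"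
   and lin: "!!f g x m. \<Psi> (%z. f z + g z) x m = \<Psi> f x m + \<Psi> g x m" "!!f c x m. \<Psi> (%z. c * f z) x m = c * \<Psi> f x m"
   and lim: "!!F f x m. (!!z. (%n. F n z) \<longlonglongrightarrow> f z) ==> (%n. \<Psi> (F n) x m) \<longlonglongrightarrow> \<Psi> f x m"
  for J and M :: "'b measure" and Z' \<Psi>
  by (rule bp_functional_compose[OF J _ adm]) (auto simp: lin fun_eq_iff intro!: lim)
 have rect: "balanced t A A0 J (%(x, m). indicator U (cis (2 * pi * x)) * ?I S m)"
  if U: "U \<in> sets borel" and S: "S \<in> sets borel" for U S
 proof -
  let ?\<Psi> = "%(h :: complex => real) x m. h (cis (2 * pi * x)) * ?I S m"
  have bp: "bpf borel UNIV (K * 1) (%h. J (%(x, m). ?\<Psi> h x m))"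
   if "bpf RR (strip r) K J" for J
  proof (rule lift[OF that])
   show "adm RR (strip r) (1 * B) (%(x, m). ?\<Psi> h x m)" if "adm borel UNIV B h" for h B
   proof -
    note [measurable] = admD(1)[OF that]
    show ?thesis using adm_e[OF _ _ S, of "%x. h (cis (2 * pi * x))" B] admD(2)[OF that] by simp
   qed
  qed (auto simp: algebra_simps intro!: tendsto_mult)
  have "balanced t (%h. A (%(x, m). ?\<Psi> h x m)) (%h. A0 (%(x, m). ?\<Psi> h x m)) (%s h. J s (%(x, m). ?\<Psi> h x m)) (%z. 1 * indicator U z)"
  proof (rule balanced_monotone_class[OF bp[OF A(1)] bp[OF A(2)] bp[OF A(3)], where G="{U. open U}" and B=1])
   show "sets (borel :: complex measure) = sigma_sets UNIV {U. open U}"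
    by (simp add: borel_def)
   show "Int_stable {U :: complex set. open U}" by (auto simp: Int_stable_def)
   show "adm borel UNIV 1 (%_ :: complex. 1)" by (rule admI) auto
   show "balanced t (%h. A (%(x, m). ?\<Psi> h x m)) (%h. A0 (%(x, m). ?\<Psi> h x m)) (%s h. J s (%(x, m). ?\<Psi> h x m)) (%_. 1)"
    by (rule balanced_cong[OF rect_open[OF open_UNIV S]]) auto
   show "balanced t (%h. A (%(x, m). ?\<Psi> h x m)) (%h. A0 (%(x, m). ?\<Psi> h x m)) (%s h. J s (%(x, m). ?\<Psi> h x m)) (%z. 1 * indicator U z)"
    if "U \<in> {U. open U}" for U
    by (rule balanced_cong[OF rect_open[OF _ S, of U]]) (use that in auto)
  qed (use U in \<open>auto simp: indicator_def\<close>)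
  thus ?thesis by (rule balanced_cong) auto
 qed
 let ?M = "borel \<Otimes>\<^sub>M borel :: (complex \<times> real) measure"
 let ?\<Psi> = "%(h :: complex \<times> real => real) x m. h (cis (2 * pi * x), m)"
 have bp: "bpf ?M (UNIV \<times> slab r) (K * 1) (%h. J (%(x, m). ?\<Psi> h x m))"
  if "bpf RR (strip r) K J" for J
 proof (rule lift[OF that])
  show "adm RR (strip r) (1 * B) (%(x, m). ?\<Psi> h x m)" if "adm ?M (UNIV \<times> slab r) B h" for h B
  proof (rule admI)
   note [measurable] = admD(1)[OF that]
   show "(%(x, m). ?\<Psi> h x m) \<in> bmeas RR" by measurable
  qed (use admD(2-4)[OF that] in auto)
 qed auto
 let ?B = "%h. balanced t (%h. A (%(x, m). ?\<Psi> h x m)) (%h. A0 (%(x, m). ?\<Psi> h x m)) (%s h. J s (%(x, m). ?\<Psi> h x m)) h"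
 let ?\<psi> = "%z :: complex \<times> real. ?I UNIV (snd z)"
 define h where "h = (%z. p (Arg2pi (fst z) / (2 * pi), snd z))"
 have [measurable]: "p \<in> bmeas RR" by (rule admD(1)[OF p])
 note [measurable] = borel_measurable_Arg2pi
 have "?B (%z. ?\<psi> z * h z)"
 proof (rule balanced_monotone_class[OF bp[OF A(1)] bp[OF A(2)] bp[OF A(3)], where G="{a \<times> b | a b. a \<in> sets borel \<and> b \<in> sets borel}" and B=B])
  show "sets ?M = sigma_sets UNIV {a \<times> b | a b. a \<in> sets borel \<and> b \<in> sets borel}"
   using sets_pair_measure[of "borel :: complex measure" "borel :: real measure"] by simp
  show "Int_stable {a \<times> b | (a :: complex set) (b :: real set). a \<in> sets borel \<and> b \<in> sets borel}"
   by (rule Int_stable_pair_measure_generator)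
  show "adm ?M (UNIV \<times> slab r) 1 ?\<psi>" by (rule admI) (auto simp: indicator_def)
  show "?B ?\<psi>" by (rule balanced_cong[OF rect[of UNIV UNIV]]) auto
  show "?B (%z. ?\<psi> z * indicator U z)" if "U \<in> {a \<times> b | a b. a \<in> sets borel \<and> b \<in> sets borel}" for U
  proof -
   from that obtain a b where U: "U = a \<times> b" "a \<in> sets borel" "b \<in> sets borel" by auto
   have eq: "(%(x, m). indicator a (cis (2 * pi * x)) * ?I b m) = (%(x, m). ?I UNIV m * indicator (a \<times> b) (cis (2 * pi * x), m))"
    by (auto simp: fun_eq_iff indicator_def)
   show ?thesis using rect[OF U(2,3)] unfolding eq by (rule balanced_cong) (auto simp: U(1))
  qed
  show "h \<in> borel_measurable ?M" unfolding h_def by measurable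
 qed (use admD(2)[OF p] in \<open>auto simp: h_def\<close>)
 note bal = this
 have eq: "?I UNIV m * h (cis (2 * pi * x), m) = p (x, m)" if "0 \<le> x" "x < 1" for x m
  using that admD(3)[OF p, of "(x, m)"] by (auto simp: h_def Arg2pi_cis indicator_def)
 show ?thesis
 proof (rule balanced_cong[OF bal])
  show "A (%(x, m). ?\<Psi> (%z. ?\<psi> z * h z) x m) = A p"
   by (rule cong(1)) (use eq in simp)
  show "A0 (%(x, m). ?\<Psi> (%z. ?\<psi> z * h z) x m) = A0 p"
   by (rule cong(2)) (use eq in simp)
  show "J s (%(x, m). ?\<Psi> (%z. ?\<psi> z * h z) x m) = J s p" for s
   by (rule cong(3)) (use eq in simp)
 qed
qed

section \<open>Coagulation paths and their mild formulation\<close>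

text \<open>The integrated form \<open>M' = h\<close> rewritten as \<open>M' = - c M + (c M + h)\<close>. A
  damping rate of this kind is added to an equation in order to make its generator monotone.\<close>

lemma scalar_duhamel:
 fixes h :: "real => real" and u0 :: real
 assumes h: "set_borel_measurable lborel {0..T} h" "!!s. s \<in> {0..T} ==> \<bar>h s\<bar> \<le> H"
  and c: "0 \<le> c" and t: "t \<in> {0..T}"
 defines "M \<equiv> %s. u0 + (LINT r:{0..s}|lborel. h r)"
 shows "set_borel_measurable lborel {0..t} (%s. exp (- c * (t - s)) * (c * M s + h s))"
  and "M t = exp (- c * t) * u0 + (LINT s:{0..t}|lborel. exp (- c * (t - s)) * (c * M s + h s))"
  and "s \<in> {0..T} ==> \<bar>M s\<bar> \<le> \<bar>u0\<bar> + T * H"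
proof -
 have H: "0 \<le> H" using h(2)[OF t] by simp
 have hs: "set_integrable lborel {0..s} h" if "s \<in> {0..T}" for s
  by (rule set_integrable_subset[OF set_integrable_bounded[OF h(1), of H]]) (use that h(2) in auto)
 have const: "(LINT r:{a..b}|lborel. (y::real)) = (b - a) * y" if "a \<le> b" for a b y :: real
  using that by (simp add: set_lebesgue_integral_def)
 have const_int: "set_integrable lborel {a..b} (%_. y :: real)" for a b y :: real
  by (rule set_integrable_bounded[where C="\<bar>y\<bar>"]) (auto simp: set_borel_measurable_def)
 have M_bound: "\<bar>M s\<bar> \<le> \<bar>u0\<bar> + T * H" if "s \<in> {0..T}" for s
 proof -
  have "\<bar>LINT r:{0..s}|lborel. h r\<bar> \<le> (LINT r:{0..s}|lborel. \<bar>h r\<bar>)"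
   using set_integral_norm_bound[OF hs[OF that]] by simp
  also have "... \<le> (LINT r:{0..s}|lborel. H)"
   using hs[OF that] h(2) that by (intro set_integral_mono const_int set_integrable_abs) auto
  also have "... \<le> T * H" using that H by (simp add: const mult_right_mono)
  finally show ?thesis unfolding M_def by linarith
 qed
 thus "s \<in> {0..T} ==> \<bar>M s\<bar> \<le> \<bar>u0\<bar> + T * H" .
 have M_lip: "\<bar>M s - M s'\<bar> \<le> H * \<bar>s - s'\<bar>" if "s \<in> {0..T}" "s' \<in> {0..T}" for s s'
 proof -
  have *: "\<bar>M s - M s'\<bar> \<le> H * \<bar>s - s'\<bar>" if "s' \<le> s" "s \<in> {0..T}" "s' \<in> {0..T}" for s s'
  proof -
   have d: "{0..s} = {0..s'} \<union> {s'<..s}" "{0..s'} \<inter> {s'<..s} = {}" using that by auto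
   have i: "set_integrable lborel {s'<..s} h"
    by (rule set_integrable_subset[OF hs[OF that(2)]]) (use that in auto)
   have ci: "set_integrable lborel {s'<..s} (%_. H)"
    by (rule set_integrable_subset[OF const_int[of s' s]]) auto
   have "M s - M s' = (LINT r:{s'<..s}|lborel. h r)"
    unfolding M_def d(1) using set_integral_Un[OF d(2) hs[OF that(3)] i] by simp
   also have "\<bar>...\<bar> \<le> (LINT r:{s'<..s}|lborel. \<bar>h r\<bar>)"
    using set_integral_norm_bound[OF i] by simp
   also have "... \<le> (LINT r:{s'<..s}|lborel. H)"
    using i ci h(2) that by (intro set_integral_mono set_integrable_abs) auto
   also have "... = H * \<bar>s - s'\<bar>"
    using that by (simp add: set_lebesgue_integral_def)
   finally show ?thesis .
  qed
  show ?thesis using *[of s' s] *[of s s'] that by (cases "s' \<le> s") (auto simp: abs_minus_commute)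
 qed
 have M_cont: "continuous_on {0..T} M"
 proof (rule continuous_onI)
  fix s e :: real assume s: "s \<in> {0..T}" "0 < e"
  show "\<exists>d>0. \<forall>s'\<in>{0..T}. dist s' s < d --> dist (M s') (M s) \<le> e"
  proof (intro exI[of _ "e / (H + 1)"] conjI ballI impI)
   show "0 < e / (H + 1)" using s(2) H by simp
   fix s' assume s': "s' \<in> {0..T}" "dist s' s < e / (H + 1)"
   have "\<bar>M s' - M s\<bar> \<le> (H + 1) * \<bar>s' - s\<bar>"
    using M_lip[OF s'(1) s(1)] by (simp add: distrib_right)
   also have "... \<le> e" using s'(2) H by (simp add: dist_real_def field_simps)
   finally show "dist (M s') (M s) \<le> e" by (simp add: dist_real_def)
  qed
 qed
 have M_meas: "set_borel_measurable lborel {0..T} M"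
  using borel_measurable_continuous_on_indicator[OF _ M_cont] by (simp add: set_borel_measurable_def)
 have bp_const: "bpf (count_space UNIV) UNIV K (%f. y * f ())" if "\<bar>y\<bar> \<le> K" for y K
 proof (rule bp_functionalI)
  show "\<bar>y * f ()\<bar> \<le> K * B" if "adm (count_space UNIV) UNIV B f" for f B
   using \<open>\<bar>y\<bar> \<le> K\<close> admD(2,4)[OF that] by (auto simp: abs_mult intro!: mult_mono)
 qed (use that in \<open>auto simp: algebra_simps intro!: tendsto_mult\<close>)
 have "balanced t (%f. M t * f ()) (%f. u0 * (exp (- t * c) * f ())) (%s f. (c * M s + h s) * (exp ((s - t) * c) * f ())) (%_. 1)"
 proof (rule duhamel[where T=T and M="count_space UNIV" and Z=UNIV and K="(c + 1) * (\<bar>u0\<bar> + T * H) + H" and b=c and R="%_. c" and V="%s f. M s * f ()"])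
  have T: "0 \<le> T" using t by auto
  let ?K = "(c + 1) * (\<bar>u0\<bar> + T * H) + H"
  have K: "\<bar>u0\<bar> + T * H \<le> ?K" using c H T by (simp add: distrib_right)
  show "bpf (count_space UNIV) UNIV ?K (%f. M s * f ())" if "s \<in> {0..T}" for s
   by (rule bp_const) (use M_bound[OF that] K in linarith)
  show "bpf (count_space UNIV) UNIV ?K (%f. u0 * f ())"
   by (rule bp_const) (use K H T mult_nonneg_nonneg[OF T H] in linarith)
  show "bpf (count_space UNIV) UNIV ?K (%f. (c * M s + h s) * f ())" if "s \<in> {0..T}" for s
  proof (rule bp_const)
   have "\<bar>c * M s\<bar> \<le> c * (\<bar>u0\<bar> + T * H)"
    using M_bound[OF that] c by (simp add: abs_mult mult_left_mono)
   hence "\<bar>c * M s + h s\<bar> \<le> c * (\<bar>u0\<bar> + T * H) + H"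
    using h(2)[OF that] by (intro order_trans[OF abs_triangle_ineq add_mono])
   also have "... \<le> ?K" using T H by (simp add: distrib_right[of c 1])
   finally show "\<bar>c * M s + h s\<bar> \<le> ?K" .
  qed
  show "set_borel_measurable lborel {0..T} (%s. M s * f ())" for f :: "unit => real"
   using M_meas unfolding set_borel_measurable_def by (simp flip: mult.assoc)
  show "set_borel_measurable lborel {0..T} (%s. (c * M s + h s) * f ())" for f :: "unit => real"
  proof -
   have "(%s. (c * (indicator {0..T} s *\<^sub>R M s) + indicator {0..T} s *\<^sub>R h s) * f ()) \<in> bmeas lborel"
    using M_meas h(1) unfolding set_borel_measurable_def by measurable
   thus ?thesis unfolding set_borel_measurable_def by (simp add: algebra_simps)
  qed
  show "M t * f () = u0 * f () + (LINT s:{0..t}|lborel. (c * M s + h s) * f () - M s * (c * f ()))"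
   for f :: "unit => real" and t
  proof -
   have "(%s. (c * M s + h s) * f () - M s * (c * f ())) = (%s. h s * f ())"
    by (simp add: algebra_simps)
   thus ?thesis by (simp add: M_def distrib_right)
  qed
 qed (use c t in \<open>auto intro: adm_zero admI\<close>)
 thus "set_borel_measurable lborel {0..t} (%s. exp (- c * (t - s)) * (c * M s + h s))"
  and "M t = exp (- c * t) * u0 + (LINT s:{0..t}|lborel. exp (- c * (t - s)) * (c * M s + h s))"
  unfolding balanced_def by (simp_all add: algebra_simps)
qed

text \<open>A Gronwall argument for a family of functions at once. The largest excess of \<open>v i
  s\<close> over the majorant is a finite supremum by \<open>bdd\<close>; inserting it into
  \<open>step\<close> reproduces it with the factor \<open>1 - exp (- c T)\<close>, so it is not
  positive.\<close>

lemma comparison: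
 fixes v :: "'i => real => real"
 assumes h: "set_borel_measurable lborel {0..T} h" "!!s. s \<in> {0..T} ==> \<bar>h s\<bar> \<le> H"
  and c: "0 \<le> c"
  and bdd: "!!i s. i \<in> I ==> s \<in> {0..T} ==> v i s \<le> V"
  and step: "!!i t. i \<in> I ==> t \<in> {0..T} ==> \<exists>g. set_integrable lborel {0..t} (%s. exp (- c * (t - s)) * g s)
   \<and> v i t \<le> exp (- c * t) * u0 + (LINT s:{0..t}|lborel. exp (- c * (t - s)) * g s)
   \<and> (\<forall>s\<in>{0..t}. \<forall>b. (\<forall>j\<in>I. v j s \<le> b) --> g s \<le> c * b + h s)"
  and i: "i \<in> I" and t: "t \<in> {0..T}"
 shows "v i t \<le> u0 + (LINT s:{0..t}|lborel. h s)"
proof (rule ccontr)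
 define M where "M s = u0 + (LINT r:{0..s}|lborel. h r)" for s
 have M_bound: "\<bar>M s\<bar> \<le> \<bar>u0\<bar> + T * H" if "s \<in> {0..T}" for s
  unfolding M_def by (rule scalar_duhamel(3)[OF h c t that])
 define D where "D = (%(i, s). v i s - M s) ` (I \<times> {0..T})"
 have bddD: "bdd_above D"
  unfolding D_def by (rule bdd_aboveI[of _ "V + (\<bar>u0\<bar> + T * H)"]) (use bdd M_bound in fastforce)
 define \<alpha> where "\<alpha> = Sup D"
 have le: "v j s \<le> M s + \<alpha>" if "j \<in> I" "s \<in> {0..T}" for j s
  using cSup_upper[OF _ bddD, of "v j s - M s"] that by (force simp: \<alpha>_def D_def)
 assume "\<not> v i t \<le> u0 + (LINT s:{0..t}|lborel. h s)"
 hence "M t < v i t" by (simp add: M_def)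
 with le[OF i t] have \<alpha>: "0 < \<alpha>" by linarith
 have T: "0 \<le> T" using t by auto
 have "v j s - M s \<le> \<alpha> * (1 - exp (- c * T))" if j: "j \<in> I" "s \<in> {0..T}" for j s
 proof -
  obtain g where g: "set_integrable lborel {0..s} (%r. exp (- c * (s - r)) * g r)"
   "v j s \<le> exp (- c * s) * u0 + (LINT r:{0..s}|lborel. exp (- c * (s - r)) * g r)"
   "!!r b. r \<in> {0..s} ==> (!!j. j \<in> I ==> v j r \<le> b) ==> g r \<le> c * b + h r"
   using step[OF j] by blast
  define M' where "M' r = (u0 + \<alpha>) + (LINT r:{0..r}|lborel. h r)" for r
  have M': "M' r = M r + \<alpha>" for r by (simp add: M'_def M_def)
  note sd = scalar_duhamel[OF h c j(2), where ?u0.0="u0 + \<alpha>", folded M'_def]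
  have int: "set_integrable lborel {0..s} (%r. exp (- c * (s - r)) * (c * M' r + h r))"
  proof (rule set_integrable_bounded[OF sd(1)])
   fix r assume r: "0 \<le> r" "r \<le> s"
   hence "\<bar>M' r\<bar> \<le> \<bar>u0 + \<alpha>\<bar> + T * H" using sd(3)[of r] j(2) by auto
   hence "\<bar>c * M' r + h r\<bar> \<le> c * (\<bar>u0 + \<alpha>\<bar> + T * H) + H"
    using h(2)[of r] r j(2) c
    by (intro order_trans[OF abs_triangle_ineq] add_mono) (auto simp: abs_mult mult_left_mono)
   moreover have "exp (- c * (s - r)) \<le> 1" using c r by simp
   ultimately have "exp (- c * (s - r)) * \<bar>c * M' r + h r\<bar> \<le> 1 * (c * (\<bar>u0 + \<alpha>\<bar> + T * H) + H)"
    by (intro mult_mono) auto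
   thus "\<bar>exp (- c * (s - r)) * (c * M' r + h r)\<bar> \<le> c * (\<bar>u0 + \<alpha>\<bar> + T * H) + H"
    by (simp add: abs_mult)
  qed
  have "(LINT r:{0..s}|lborel. exp (- c * (s - r)) * g r) \<le> (LINT r:{0..s}|lborel. exp (- c * (s - r)) * (c * M' r + h r))"
  proof (rule set_integral_mono[OF g(1) int])
   fix r assume r: "r \<in> {0..s}"
   have "g r \<le> c * M' r + h r"
    by (rule g(3)[OF r]) (use le r j(2) in \<open>auto simp: M'\<close>)
   thus "exp (- c * (s - r)) * g r \<le> exp (- c * (s - r)) * (c * M' r + h r)"
    by simp
  qed
  also have "... = M' s - exp (- c * s) * (u0 + \<alpha>)"
   using sd(2) by simp
  finally have "v j s \<le> M s + \<alpha> * (1 - exp (- c * s))"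
   using g(2) by (simp add: M' algebra_simps)
  moreover have "\<alpha> * (1 - exp (- c * s)) \<le> \<alpha> * (1 - exp (- c * T))"
   using \<alpha> c j(2) by (intro mult_left_mono) (auto intro: mult_left_mono)
  ultimately show ?thesis by linarith
 qed
 hence "\<alpha> \<le> \<alpha> * (1 - exp (- c * T))"
  unfolding \<alpha>_def using i t by (intro cSup_least) (auto simp: D_def)
 hence "\<alpha> * exp (- c * T) \<le> 0" by (simp add: algebra_simps)
 thus False using \<alpha> by (simp add: mult_le_0_iff)
qed

text \<open>The test functions on which diffusion acts by multiplication with a function of the mass.\<close>

definition trig_test :: "nat => real => (real => real) => real \<times> real => real"
 where "trig_test n \<theta> g = (%(x, m). cos (2 * pi * real n * x + \<theta>) * g m)"

lemma adm_trig_test: "adm borel Z B g ==> adm RR (UNIV \<times> Z) B (trig_test n \<theta> g)"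
proof (rule admI)
 assume g: "adm borel Z B g"
 note [measurable] = admD(1)[OF g]
 show "trig_test n \<theta> g \<in> bmeas RR"
  unfolding trig_test_def case_prod_beta' by measurable
 show "\<bar>trig_test n \<theta> g z\<bar> \<le> B" for z
 proof -
  have "\<bar>cos (2 * pi * real n * fst z + \<theta>)\<bar> * \<bar>g (snd z)\<bar> \<le> 1 * B"
   using admD(2)[OF g] by (intro mult_mono) auto
  thus ?thesis by (simp add: trig_test_def case_prod_beta' abs_mult)
 qed
 show "trig_test n \<theta> g z = 0" if "z \<notin> UNIV \<times> Z" for z
 proof -
  have "snd z \<notin> Z" using that by (cases z) simp
  thus ?thesis using admD(3)[OF g] by (simp add: trig_test_def case_prod_beta')
 qed
 show "0 \<le> B" by (rule admD(4)[OF g])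
qed

lemma trig_test_mult': "trig_test n \<theta> (%m. c m * g m) = (%z. c (snd z) * trig_test n \<theta> g z)"
 by (simp add: fun_eq_iff trig_test_def)

lemma bp_trig_test:
 assumes J: "bpf RR (UNIV \<times> Z) K J"
 shows "bpf borel Z K (%h. J (trig_test n \<theta> h))"
proof -
 have "bpf borel Z (K * 1) (%h. J (trig_test n \<theta> h))"
 proof (rule bp_functional_compose[OF J])
  show "adm RR (UNIV \<times> Z) (1 * B) (trig_test n \<theta> f)" if "adm borel Z B f" for f B
   using adm_trig_test[OF that] by simp
  show "(%j. trig_test n \<theta> (F j) z) \<longlonglongrightarrow> trig_test n \<theta> f z"
   if "!!z. (%n. F n z) \<longlonglongrightarrow> f z" for F f z
   unfolding trig_test_def case_prod_beta' by (intro tendsto_mult tendsto_const that)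
 qed (auto simp: trig_test_def fun_eq_iff algebra_simps)
 thus ?thesis by simp
qed

text \<open>The rates after division by the weight: \<open>w\<close> stands for the weight
  \<open>\<omega>\<close>, \<open>q\<close> for the quotient of the two weights, and
  \<open>k\<close> for the coagulation rate divided by the product of the weights. In this
  normalisation \<open>k\<close> is bounded and all the growth is in \<open>w\<close>.\<close>

locale coagulation =
 fixes a w q :: "real => real" and k :: "real => real => real" and c0 Q0 :: real
 assumes a_meas: "a \<in> bmeas borel" and w_meas: "w \<in> bmeas borel"
  and q_meas: "q \<in> bmeas borel" and k_meas: "(%(m, m'). k m m') \<in> bmeas RR"
  and a_pos: "0 < m ==> 0 < a m" and a_anti: "0 < m ==> m \<le> m' ==> a m' \<le> a m"
  and w_pos: "0 < m ==> 0 < w m" and w_bdd: "1 \<le> r ==> \<exists>W. \<forall>m\<in>slab r. w m \<le> W"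
  and q_nonneg: "0 < m ==> 0 \<le> q m" and q_le: "0 < m ==> q m \<le> Q0"
  and k_nonneg: "0 \<le> k m m'" and k_le: "k m m' \<le> c0" and k_sym: "k m m' = k m' m"
  and k_pos: "k m m' \<noteq> 0 ==> 0 < m \<and> 0 < m'"
  and k_q: "0 < m ==> 0 < m' ==> k m m' \<le> c0 * (q m + q m')"
  and w_sub: "0 < m ==> 0 < m' ==> w (m + m') \<le> w m + w m'"
  and aw_sub: "0 < m ==> 0 < m' ==>
   w (m + m') / sqrt (a (m + m')) \<le> w m / sqrt (a m) + w m' / sqrt (a m')"
  and awq_sub: "0 < m ==> 0 < m' ==> (w (m + m'))\<^sup>2 * q (m + m') / sqrt (a (m + m'))
   \<le> (w m)\<^sup>2 * q m / sqrt (a m) + (w m')\<^sup>2 * q m' / sqrt (a m')"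

text \<open>A weak solution, tested only against trigonometric functions of the position times functions of
  a compact mass range. The initial value enters through the functional \<open>E0\<close>, which
  two paths can share.\<close>

locale coagulation_path = coagulation +
 fixes T :: real and E0 :: "(real \<times> real => real) => real" and \<rho> :: "real => real => real measure"
 assumes kernel: "s \<in> {0..T} ==> subkernel (\<rho> s)"
  and E0_bp: "1 \<le> r ==> \<exists>K. bpf RR (strip r) K E0"
  and E0_cong: "(!!x m. 0 \<le> x ==> x < 1 ==> p (x, m) = p' (x, m)) ==> E0 p = E0 p'"
  and trig_meas: "1 \<le> r ==> adm borel (slab r) B g ==>
    set_borel_measurable lborel {0..T} (%s. pairing (\<rho> s) (trig_test n \<theta> g))"
  and trig_coll_meas: "1 \<le> r ==> adm borel (slab r) B g ==>
    set_borel_measurable lborel {0..T} (%s. collision w k (\<rho> s) (trig_test n \<theta> g))"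
  and trig_weak: "1 \<le> r ==> adm borel (slab r) B g ==> t \<in> {0..T} ==>
    pairing (\<rho> t) (trig_test n \<theta> g) = E0 (trig_test n \<theta> g)
    + (LINT s:{0..t}|lborel. collision w k (\<rho> s) (trig_test n \<theta> g)
      - 2 * pi\<^sup>2 * (real n)\<^sup>2 * pairing (\<rho> s) (trig_test n \<theta> (%m. a m * g m)))"
begin

lemma k_abs: "\<bar>k m m'\<bar> \<le> c0"
 using k_nonneg[of m m'] k_le[of m m'] by simp

lemma c0_nonneg: "0 \<le> c0"
 using k_abs[of 0 0] by simp

lemma slab_bounds:
 assumes "1 \<le> r"
 obtains W where "0 \<le> W" "!!m. m \<in> slab r ==> \<bar>w m\<bar> \<le> W"
proof -
 obtain W where "\<forall>m\<in>slab r. w m \<le> W" using w_bdd[OF assms] by blast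
 thus ?thesis
  using w_pos slab_pos[OF _ assms] by (intro that[of "\<bar>W\<bar>"]) (force intro: order_trans[OF _ abs_ge_self])+
qed

lemma a_slab: "1 \<le> r ==> m \<in> slab r ==> \<bar>a m\<bar> \<le> a (inverse r)"
 using a_pos[OF slab_pos, of m r] a_anti[of "inverse r" m] by (simp add: slab_def)

lemma path_bp:
 assumes "1 \<le> r" "0 \<le> c"
 obtains K where "!!s. s \<in> {0..T} ==> bpf RR (strip r) K (pairing (\<rho> s))"
  "bpf RR (strip r) K E0"
  "!!s. s \<in> {0..T} ==> bpf RR (strip r) K (%p. c * pairing (\<rho> s) p + collision w k (\<rho> s) p)"
proof -
 obtain W where W: "0 \<le> W" "!!m. m \<in> slab r ==> \<bar>w m\<bar> \<le> W"
  using slab_bounds[OF assms(1)] by blast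
 obtain K0 where K0: "bpf RR (strip r) K0 E0" using E0_bp[OF assms(1)] by blast
 have K0': "0 \<le> K0" by (rule bp_nonneg[OF K0])
 let ?L = "\<bar>c\<bar> * 1 + 3 * W * c0"
 have L: "0 \<le> ?L" using W c0_nonneg by simp
 have coll: "bpf RR (strip r) ?L (%p. c * pairing (\<rho> s) p + collision w k (\<rho> s) p)" if "s \<in> {0..T}" for s
  by (rule bp_functional_add[OF bp_functional_cmult[OF bp_pairing[OF kernel[OF that]]]
    bp_collision[OF kernel[OF that] w_meas W(2) W(1) k_meas k_abs]])
 show ?thesis
 proof (rule that[of "1 + K0 + ?L"])
  show "bpf RR (strip r) (1 + K0 + ?L) (pairing (\<rho> s))" if "s \<in> {0..T}" for s
   by (rule bp_functional_mono[OF bp_pairing[OF kernel[OF that]]]) (use K0' L in linarith)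
  show "bpf RR (strip r) (1 + K0 + ?L) E0"
   by (rule bp_functional_mono[OF K0]) (use L in linarith)
  show "bpf RR (strip r) (1 + K0 + ?L) (%p. c * pairing (\<rho> s) p + collision w k (\<rho> s) p)" if "s \<in> {0..T}" for s
   by (rule bp_functional_mono[OF coll[OF that]]) (use K0' in linarith)
 qed
qed

lemma semigroup_trig_test:
 assumes "1 \<le> r" "adm borel (slab r) B g" "0 \<le> \<tau>"
 shows "semigroup_at a \<tau> (trig_test n \<theta> g) = trig_test n \<theta> (%m. exp (- (2 * pi\<^sup>2 * (real n)\<^sup>2 * (a m * \<tau>))) * g m)"
proof (rule ext, clarify)
 fix x m
 show "semigroup_at a \<tau> (trig_test n \<theta> g) (x, m) = trig_test n \<theta> (%m. exp (- (2 * pi\<^sup>2 * (real n)\<^sup>2 * (a m * \<tau>))) * g m) (x, m)"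
 proof (cases "m \<in> slab r")
  case True
  hence "0 \<le> a m * \<tau>" using a_pos[OF slab_pos[OF True assms(1)]] assms(3) by simp
  have "semigroup_at a \<tau> (trig_test n \<theta> g) (x, m) = heat (a m * \<tau>) (%y. g m * cos (2 * pi * real n * y + \<theta>)) x"
   by (simp add: semigroup_at_def trig_test_def mult.commute)
  also have "... = g m * (exp (- (2 * pi\<^sup>2 * (real n)\<^sup>2 * (a m * \<tau>))) * cos (2 * pi * real n * x + \<theta>))"
   by (simp only: heat_scale heat_cos[OF \<open>0 \<le> a m * \<tau>\<close>] of_nat_power)
  finally show ?thesis by (simp add: trig_test_def)
 next
  case False
  thus ?thesis using admD(3)[OF assms(2) False] by (simp add: semigroup_at_def trig_test_def)
 qed
qed

text \<open>On one Fourier mode diffusion is damping at the rate \<open>2 pi\<^sup>2 n\<^sup>2 a m\<close>,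
  so Duhamel's formula applies to the functions of the mass, and the resulting exponential is the
  eigenvalue of the heat operator.\<close>

lemma mild_trig:
 assumes r: "1 \<le> r" and c: "0 \<le> c" and t: "t \<in> {0..T}" and g: "adm borel (slab r) B g"
 shows "balanced t (pairing (\<rho> t)) (%p. exp (- c * t) * E0 (semigroup_at a t p))
  (%s p. exp (- c * (t - s)) * (c * pairing (\<rho> s) (semigroup_at a (t - s) p) + collision w k (\<rho> s) (semigroup_at a (t - s) p)))
  (trig_test n \<theta> g)"
proof -
 define l where "l = 2 * pi\<^sup>2 * (real n)\<^sup>2"
 have l0: "0 \<le> l" by (simp add: l_def)
 obtain K where K: "!!s. s \<in> {0..T} ==> bpf RR (strip r) K (pairing (\<rho> s))"
  "bpf RR (strip r) K E0"
  "!!s. s \<in> {0..T} ==> bpf RR (strip r) K (%p. c * pairing (\<rho> s) p + collision w k (\<rho> s) p)"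
  using path_bp[OF r c] by blast
 define V where "V s g = pairing (\<rho> s) (trig_test n \<theta> g)" for s g
 define L where "L s g = c * pairing (\<rho> s) (trig_test n \<theta> g) + collision w k (\<rho> s) (trig_test n \<theta> g)" for s g
 have bpV: "bpf borel (slab r) K (V s)" if "s \<in> {0..T}" for s
  unfolding V_def by (rule bp_trig_test[OF K(1)[OF that]])
 have bpL: "bpf borel (slab r) K (L s)" if "s \<in> {0..T}" for s
  unfolding L_def by (rule bp_trig_test[OF K(3)[OF that]])
 have bp0: "bpf borel (slab r) K (%g. E0 (trig_test n \<theta> g))"
  by (rule bp_trig_test[OF K(2)])
 have adm_a: "adm borel (slab r) (a (inverse r) * B) (%m. a m * h m)" if "adm borel (slab r) B h" for h B
  by (rule adm_mult[OF that a_meas]) (use a_slab[OF r] a_pos[of "inverse r"] r in \<open>auto intro: less_imp_le\<close>)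
 have "balanced t (V t) (%f. E0 (trig_test n \<theta> (%m. exp (- t * (l * a m + c)) * f m)))
  (%s f. L s (%m. exp ((s - t) * (l * a m + c)) * f m)) g"
 proof (rule duhamel[where T=T and K=K and b="l * a (inverse r) + c"])
  show "(%m. l * a m + c) \<in> bmeas borel" using a_meas by measurable
  show "0 \<le> l * a m + c" if "m \<in> slab r" for m
   using a_pos[OF slab_pos[OF that r]] l0 c by simp
  show "l * a m + c \<le> l * a (inverse r) + c" if "m \<in> slab r" for m
   using a_slab[OF r that] l0 by (simp add: mult_left_mono)
  show "0 \<le> l * a (inverse r) + c" using a_pos[of "inverse r"] r l0 c by simp
  show "set_borel_measurable lborel {0..T} (%s. V s h)" if "adm borel (slab r) B h" for h B
   unfolding V_def by (rule trig_meas[OF r that])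
  show "set_borel_measurable lborel {0..T} (%s. L s h)" if "adm borel (slab r) B h" for h B
  proof -
   have "(%s. c * (indicator {0..T} s *\<^sub>R V s h) + indicator {0..T} s *\<^sub>R collision w k (\<rho> s) (trig_test n \<theta> h)) \<in> bmeas lborel"
    using trig_meas[OF r that] trig_coll_meas[OF r that] unfolding set_borel_measurable_def V_def by measurable
   thus ?thesis unfolding set_borel_measurable_def L_def V_def by (simp add: algebra_simps)
  qed
  show "V t h = E0 (trig_test n \<theta> h) + (LINT s:{0..t}|lborel. L s h - V s (%m. (l * a m + c) * h m))"
   if h: "adm borel (slab r) B h" and t: "t \<in> {0..T}" for h B t
  proof -
   have eq: "L s h - V s (%m. (l * a m + c) * h m)
    = collision w k (\<rho> s) (trig_test n \<theta> h) - l * pairing (\<rho> s) (trig_test n \<theta> (%m. a m * h m))" if "s \<in> {0..T}" for s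
   proof -
    have "V s (%m. l * (a m * h m) + c * h m) = l * V s (%m. a m * h m) + c * V s h"
     using bp_add[OF bpV[OF that] adm_scale[OF adm_a[OF h], of l] adm_scale[OF h, of c]]
      bp_scale[OF bpV[OF that] adm_a[OF h], of l] bp_scale[OF bpV[OF that] h, of c] by simp
    hence "V s (%m. (l * a m + c) * h m) = l * V s (%m. a m * h m) + c * V s h"
     by (simp add: distrib_right mult.assoc)
    thus ?thesis by (simp add: L_def V_def)
   qed
   have "(LINT s:{0..t}|lborel. L s h - V s (%m. (l * a m + c) * h m))
    = (LINT s:{0..t}|lborel. collision w k (\<rho> s) (trig_test n \<theta> h) - l * pairing (\<rho> s) (trig_test n \<theta> (%m. a m * h m)))"
    by (rule set_lebesgue_integral_cong) (use t eq in auto)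
   thus ?thesis using trig_weak[OF r h t, of n \<theta>] by (simp add: V_def l_def)
  qed
 qed (use bpV bpL bp0 g t in auto)
 thus ?thesis
 proof (rule balanced_cong)
  show "V t g = pairing (\<rho> t) (trig_test n \<theta> g)" by (simp add: V_def)
  have adm_exp: "adm borel (slab r) (1 * B) (%m. exp (- (l * (a m * \<tau>))) * g m)" if "0 \<le> \<tau>" for \<tau>
  proof (rule adm_mult[OF g])
   show "\<bar>exp (- (l * (a m * \<tau>)))\<bar> \<le> 1" if "m \<in> slab r" for m
    using a_pos[OF slab_pos[OF that r]] l0 \<open>0 \<le> \<tau>\<close> by simp
  qed (use a_meas in auto)
  have split: "(%m. exp (- \<tau> * (l * a m + c)) * g m) = (%m. exp (- c * \<tau>) * (exp (- (l * (a m * \<tau>))) * g m))" for \<tau>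
   by (simp add: fun_eq_iff exp_add[symmetric] mult.assoc[symmetric]) (simp add: algebra_simps)
  have sg: "semigroup_at a \<tau> (trig_test n \<theta> g) = trig_test n \<theta> (%m. exp (- (l * (a m * \<tau>))) * g m)" if "0 \<le> \<tau>" for \<tau>
   unfolding l_def by (rule semigroup_trig_test[OF r g that])
  have t0: "0 \<le> t" using t by auto
  show "E0 (trig_test n \<theta> (%m. exp (- t * (l * a m + c)) * g m)) = exp (- c * t) * E0 (semigroup_at a t (trig_test n \<theta> g))"
   unfolding split sg[OF t0] by (rule bp_scale[OF bp0 adm_exp[OF t0]])
  fix s assume s: "s \<in> {0..t}"
  hence ts: "0 \<le> t - s" "s \<in> {0..T}" using t by auto
  have "(s - t) * (l * a m + c) = - (t - s) * (l * a m + c)" for m by (simp add: algebra_simps)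
  hence "L s (%m. exp ((s - t) * (l * a m + c)) * g m) = L s (%m. exp (- (t - s) * (l * a m + c)) * g m)"
   by simp
  also have "... = exp (- c * (t - s)) * L s (%m. exp (- (l * (a m * (t - s)))) * g m)"
   unfolding split by (rule bp_scale[OF bpL[OF ts(2)] adm_exp[OF ts(1)]])
  also have "... = exp (- c * (t - s)) * (c * pairing (\<rho> s) (semigroup_at a (t - s) (trig_test n \<theta> g)) + collision w k (\<rho> s) (semigroup_at a (t - s) (trig_test n \<theta> g)))"
   unfolding L_def sg[OF ts(1)] ..
  finally show "L s (%m. exp ((s - t) * (l * a m + c)) * g m) = ..." .
 qed
qed

text \<open>The mild form of the equation with an additional damping rate \<open>c\<close>. Unlike the weak
  form it needs no regularity of the test function in the position.\<close>

theorem mild: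
 assumes r: "1 \<le> r" and c: "0 \<le> c" and t: "t \<in> {0..T}" and p: "adm RR (strip r) B p"
 shows "balanced t (pairing (\<rho> t)) (%p. exp (- c * t) * E0 (semigroup_at a t p))
  (%s p. exp (- c * (t - s)) * (c * pairing (\<rho> s) (semigroup_at a (t - s) p) + collision w k (\<rho> s) (semigroup_at a (t - s) p))) p"
proof -
 obtain K where K: "!!s. s \<in> {0..T} ==> bpf RR (strip r) K (pairing (\<rho> s))"
  "bpf RR (strip r) K E0"
  "!!s. s \<in> {0..T} ==> bpf RR (strip r) K (%p. c * pairing (\<rho> s) p + collision w k (\<rho> s) p)"
  using path_bp[OF r c] by blast
 have exp_bp: "bpf RR (strip r) K (%p. exp (- c * \<tau>) * J (semigroup_at a \<tau> p))"
  if "bpf RR (strip r) K J" "0 \<le> \<tau>" for J \<tau>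
 proof (rule bp_functional_mono[OF bp_functional_cmult[OF bp_semigroup[OF a_meas that(1)]]])
  show "\<bar>exp (- c * \<tau>)\<bar> * K \<le> K"
   using c that(2) bp_nonneg[OF that(1)] by (simp add: mult_left_le_one_le)
 qed
 have t0: "0 \<le> t" using t by auto
 show ?thesis
 proof (rule balanced_strip[OF K(1)[OF t] exp_bp[OF K(2) t0]])
  show "bpf RR (strip r) K (%p. exp (- c * (t - s)) * (c * pairing (\<rho> s) (semigroup_at a (t - s) p) + collision w k (\<rho> s) (semigroup_at a (t - s) p)))"
   if "s \<in> {0..t}" for s
   by (rule exp_bp[OF K(3)]) (use that t in auto)
  show "balanced t (pairing (\<rho> t)) (%p. exp (- c * t) * E0 (semigroup_at a t p))
   (%s p. exp (- c * (t - s)) * (c * pairing (\<rho> s) (semigroup_at a (t - s) p) + collision w k (\<rho> s) (semigroup_at a (t - s) p)))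
   (%(x, m). cos (2 * pi * real n * x + \<theta>) * g m)" if "adm borel (slab r) B g" for n \<theta> g B
   using mild_trig[OF r c t that] unfolding trig_test_def .
  show "pairing (\<rho> t) p = pairing (\<rho> t) q" if "!!x m. 0 \<le> x ==> x < 1 ==> p (x, m) = q (x, m)" for p q
   by (rule pairing_cong) (use that in simp)
 next
  fix p q :: "real \<times> real => real"
  assume eq: "!!x m. 0 \<le> x ==> x < 1 ==> p (x, m) = q (x, m)"
  show "exp (- c * t) * E0 (semigroup_at a t p) = exp (- c * t) * E0 (semigroup_at a t q)"
   using semigroup_at_cong[of p q, OF eq] by simp
  show "exp (- c * (t - s)) * (c * pairing (\<rho> s) (semigroup_at a (t - s) p) + collision w k (\<rho> s) (semigroup_at a (t - s) p))
   = exp (- c * (t - s)) * (c * pairing (\<rho> s) (semigroup_at a (t - s) q) + collision w k (\<rho> s) (semigroup_at a (t - s) q))" for s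
   using semigroup_at_cong[of p q, OF eq] by simp
 qed (rule p)
qed

end

section \<open>Subadditivity of the weighted heat flow\<close>

definition nnpair :: "(real => real measure) => (real \<times> real => ennreal) => ennreal"
 where "nnpair \<rho> P = (\<integral>\<^sup>+x. (\<integral>\<^sup>+m. P (x, m) \<partial>\<rho> x) \<partial>torus)"

lemma measurable_section_nn: "P \<in> bmeas RR ==> (%m. P (x, m) :: ennreal) \<in> bmeas borel"
 by (rule measurable_compose[OF measurable_Pair1']) auto

lemma nnpair_inner_measurable:
 fixes P :: "real \<times> real => ennreal"
 assumes "subkernel \<rho>" "P \<in> bmeas RR"
 shows "(%x. \<integral>\<^sup>+m. P (x, m) \<partial>\<rho> x) \<in> bmeas borel"
 by (rule subkernel_nn_integral_measurable[OF assms(1)]) (use assms(2) in auto)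

lemma nnpair_mono:
 "(!!x m. 0 \<le> x ==> x < 1 ==> P (x, m) \<le> R (x, m)) ==> nnpair \<rho> P \<le> nnpair \<rho> R"
 unfolding nnpair_def by (intro nn_integral_mono) auto

lemma nnpair_eq_pairing:
 assumes \<rho>: "subkernel \<rho>" and p: "p \<in> bmeas RR" "!!z. 0 \<le> p z" "!!z. p z \<le> B"
 shows "nnpair \<rho> (%z. ennreal (p z)) = ennreal (pairing \<rho> p)"
proof -
 have B: "\<bar>p z\<bar> \<le> B" for z using p(2,3)[of z] by simp
 have inner: "(\<integral>\<^sup>+m. ennreal (p (x, m)) \<partial>\<rho> x) = ennreal (\<integral>m. p (x, m) \<partial>\<rho> x)" for x
  using subkernel_integrable[OF \<rho> measurable_section[OF p(1)] B] p(2) by (intro nn_integral_eq_integral) auto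
 have "nnpair \<rho> (%z. ennreal (p z)) = (\<integral>\<^sup>+x. ennreal (\<integral>m. p (x, m) \<partial>\<rho> x) \<partial>torus)"
  unfolding nnpair_def inner ..
 also have "... = ennreal (pairing \<rho> p)"
  unfolding pairing_def
 proof (rule nn_integral_eq_integral)
  show "integrable torus (%x. \<integral>m. p (x, m) \<partial>\<rho> x)"
   by (rule torus_integrable[OF pairing_inner_measurable[OF \<rho> p(1) B]
     subkernel_integral_bound[OF \<rho> measurable_section[OF p(1)] B]])
 qed (use p(2) in \<open>auto intro!: AE_I2 integral_nonneg_AE\<close>)
 finally show ?thesis .
qed

lemma pairing_nonneg: "(!!z. 0 \<le> p z) ==> 0 \<le> pairing \<rho> p"
 unfolding pairing_def by (intro integral_nonneg_AE AE_I2) auto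

lemma pairing_mono:
 assumes \<rho>: "subkernel \<rho>" and p: "p \<in> bmeas RR" "!!z. \<bar>p z\<bar> \<le> B"
  and q: "q \<in> bmeas RR" "!!z. \<bar>q z\<bar> \<le> C" and le: "!!z. p z \<le> q z"
 shows "pairing \<rho> p \<le> pairing \<rho> q"
 using pairing_nonneg[of "%z. q z - p z" \<rho>] pairing_diff[OF \<rho> q p] le by simp

lemma pairing_le_nnpair:
 assumes \<rho>: "subkernel \<rho>" and p: "p \<in> bmeas RR" "!!z. \<bar>p z\<bar> \<le> B"
  and le: "nnpair \<rho> (%z. ennreal (p z)) \<le> ennreal b" "0 \<le> b"
 shows "pairing \<rho> p \<le> b"
proof -
 have [measurable]: "p \<in> bmeas RR" by fact
 let ?p = "%z. max 0 (p z)"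
 have B: "0 \<le> B" using p(2)[of "(0, 0)"] by simp
 have pB: "?p z \<le> B" for z using p(2)[of z] B by auto
 have "ennreal (pairing \<rho> ?p) = nnpair \<rho> (%z. ennreal (?p z))"
  by (rule nnpair_eq_pairing[OF \<rho> _ _ pB, symmetric]) auto
 also have "(%z. ennreal (?p z)) = (%z. ennreal (p z))"
  by (auto simp: fun_eq_iff max_def ennreal_neg)
 also note le(1)
 finally have "pairing \<rho> ?p \<le> b" using ennreal_le_iff[OF le(2)] by blast
 moreover have "pairing \<rho> p \<le> pairing \<rho> ?p"
  using pB B by (intro pairing_mono[OF \<rho> p, where C=B]) auto
 ultimately show ?thesis by simp
qed

lemma ennreal_integral_le_nn:
 fixes f :: "'a => real"
 assumes "integrable M f"
 shows "ennreal (\<integral>x. f x \<partial>M) \<le> (\<integral>\<^sup>+x. ennreal (f x) \<partial>M)"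
proof -
 have "ennreal (\<integral>x. f x \<partial>M) \<le> ennreal (\<integral>x. max 0 (f x) \<partial>M)"
  using assms by (intro ennreal_leI integral_mono) auto
 also have "... = (\<integral>\<^sup>+x. ennreal (max 0 (f x)) \<partial>M)"
  using assms by (intro nn_integral_eq_integral[symmetric]) auto
 also have "... = (\<integral>\<^sup>+x. ennreal (f x) \<partial>M)"
  by (intro nn_integral_cong) (auto simp: max_def ennreal_neg)
 finally show ?thesis .
qed

lemma nn_integral_double_sum:
 assumes \<rho>: "subkernel \<rho>" and d: "d \<in> bmeas borel"
 shows "(\<integral>\<^sup>+m. (\<integral>\<^sup>+m'. d m + d m' \<partial>\<rho> x) \<partial>\<rho> x) \<le> 2 * (\<integral>\<^sup>+m. d m \<partial>\<rho> x)"
proof -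
 interpret subprob_space "\<rho> x" by (rule subkernel_subprob[OF \<rho>])
 have [measurable]: "d \<in> bmeas (\<rho> x)" by (rule subkernel_measurable[OF \<rho> d])
 let ?D = "\<integral>\<^sup>+m. d m \<partial>\<rho> x" and ?o = "emeasure (\<rho> x) (space (\<rho> x))"
 have "(\<integral>\<^sup>+m. (\<integral>\<^sup>+m'. d m + d m' \<partial>\<rho> x) \<partial>\<rho> x) = (\<integral>\<^sup>+m. d m * ?o + ?D \<partial>\<rho> x)"
  by (intro nn_integral_cong) (simp add: nn_integral_add)
 also have "... = ?D * ?o + ?D * ?o"
  by (subst nn_integral_add) (auto simp: nn_integral_multc)
 also have "... \<le> ?D * 1 + ?D * 1"
  using emeasure_space_le_1 by (intro add_mono mult_left_mono) auto
 finally show ?thesis by (simp add: mult_2)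
qed

context coagulation
begin

text \<open>Upper bounds for the collision term may be proved with extended nonnegative integrals of a
  majorant, where no integrability is at stake.\<close>

lemma collision_le_nn:
 assumes \<rho>: "subkernel \<rho>" and r: "1 \<le> r" and p: "adm RR (strip r) B p"
  and le: "!!x m m'. 0 \<le> x ==> x < 1 ==> ennreal (gain_loss w p x m m' * k m m') \<le> R x m m'"
  and R: "(\<integral>\<^sup>+x. (\<integral>\<^sup>+m. (\<integral>\<^sup>+m'. R x m m' \<partial>\<rho> x) \<partial>\<rho> x) \<partial>torus) \<le> ennreal b" and b: "0 \<le> b"
 shows "collision w k \<rho> p \<le> b"
proof -
 obtain W where W: "\<forall>m\<in>slab r. w m \<le> W" using w_bdd[OF r] by blast
 have W': "\<bar>w m\<bar> \<le> \<bar>W\<bar>" if "m \<in> slab r" for m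
  using W w_pos[OF slab_pos[OF that r]] that by (auto intro: order_trans[OF _ abs_ge_self])
 have k_abs: "\<bar>k m m'\<bar> \<le> c0" for m m' using k_nonneg[of m m'] k_le[of m m'] by simp
 have adm: "adm RR UNIV (3 * \<bar>W\<bar> * c0 * B) (%(x, m). \<integral>m'. gain_loss w p x m m' * k m m' \<partial>\<rho> x)"
  by (rule adm_collision_inner(1)[OF \<rho> w_meas W' _ k_meas k_abs p]) auto
 have int: "integrable (\<rho> x) (%m'. gain_loss w p x m m' * k m m')" for x m
  by (rule adm_collision_inner(2)[OF \<rho> w_meas W' _ k_meas k_abs p]) auto
 show ?thesis
  unfolding collision_def
 proof (rule pairing_le_nnpair[OF \<rho> admD(1,2)[OF adm] _ b])
  have "nnpair \<rho> (%z. ennreal (case z of (x, m) => \<integral>m'. gain_loss w p x m m' * k m m' \<partial>\<rho> x))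
   \<le> (\<integral>\<^sup>+x. (\<integral>\<^sup>+m. (\<integral>\<^sup>+m'. R x m m' \<partial>\<rho> x) \<partial>\<rho> x) \<partial>torus)"
   unfolding nnpair_def
  proof (intro nn_integral_mono, clarsimp)
   fix x m :: real assume x: "0 \<le> x" "x < 1"
   show "ennreal (\<integral>m'. gain_loss w p x m m' * k m m' \<partial>\<rho> x) \<le> (\<integral>\<^sup>+m'. R x m m' \<partial>\<rho> x)"
    using le[OF x] by (intro order_trans[OF ennreal_integral_le_nn[OF int]] nn_integral_mono)
  qed
  also note R
  finally show "nnpair \<rho> (%z. ennreal (case z of (x, m) => \<integral>m'. gain_loss w p x m m' * k m m' \<partial>\<rho> x)) \<le> ennreal b" .
 qed
qed

lemma collision_le_sum:
 assumes \<rho>: "subkernel \<rho>" and r: "1 \<le> r" and p: "adm RR (strip r) B p"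
  and d: "d \<in> bmeas RR" "!!z. 0 \<le> d z" "!!z. d z \<le> C"
  and le: "!!x m m'. gain_loss w p x m m' * k m m' \<le> d (x, m) + d (x, m')"
 shows "collision w k \<rho> p \<le> 2 * pairing \<rho> d"
proof (rule collision_le_nn[OF \<rho> r p])
 show "ennreal (gain_loss w p x m m' * k m m') \<le> ennreal (d (x, m)) + ennreal (d (x, m'))" for x m m'
  using ennreal_leI[OF le[of x m m']] ennreal_plus[OF d(2) d(2), of "(x, m)" "(x, m')"] by simp
 have "(\<integral>\<^sup>+x. (\<integral>\<^sup>+m. (\<integral>\<^sup>+m'. ennreal (d (x, m)) + ennreal (d (x, m')) \<partial>\<rho> x) \<partial>\<rho> x) \<partial>torus)
  \<le> (\<integral>\<^sup>+x. 2 * (\<integral>\<^sup>+m. ennreal (d (x, m)) \<partial>\<rho> x) \<partial>torus)"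
  using measurable_section[OF d(1)]
  by (intro nn_integral_mono nn_integral_double_sum[OF \<rho>]) auto
 also have "... = 2 * nnpair \<rho> (%z. ennreal (d z))"
  unfolding nnpair_def using d(1)
  by (intro nn_integral_cmult measurable_torus nnpair_inner_measurable[OF \<rho>]) measurable
 also have "... = ennreal (2 * pairing \<rho> d)"
  using nnpair_eq_pairing[OF \<rho> d] pairing_nonneg[of d \<rho>, OF d(2)] by (simp add: ennreal_mult)
 finally show "(\<integral>\<^sup>+x. (\<integral>\<^sup>+m. (\<integral>\<^sup>+m'. ennreal (d (x, m)) + ennreal (d (x, m')) \<partial>\<rho> x) \<partial>\<rho> x) \<partial>torus) \<le> ennreal (2 * pairing \<rho> d)" .
 show "0 \<le> 2 * pairing \<rho> d" using pairing_nonneg[of d \<rho>, OF d(2)] by simp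
qed

lemma w_slab_bound:
 assumes "1 \<le> r"
 obtains W where "0 \<le> W" "!!m. m \<in> slab r ==> 0 < w m" "!!m. m \<in> slab r ==> w m \<le> W"
proof -
 obtain W where "\<forall>m\<in>slab r. w m \<le> W" using w_bdd[OF assms] by blast
 thus ?thesis
  using w_pos slab_pos[OF _ assms] by (intro that[of "\<bar>W\<bar>"]) (force intro: order_trans[OF _ abs_ge_self])+
qed

text \<open>The only negative contributions to the collision term are the two losses; on a slab their rate
  is at most \<open>c0 W\<close> each, and the added term compensates for them.\<close>

lemma shifted_collision_mono:
 assumes \<rho>: "subkernel \<rho>" and r: "1 \<le> r"
  and W: "0 \<le> W" "!!m. m \<in> slab r ==> 0 < w m" "!!m. m \<in> slab r ==> w m \<le> W"
  and p: "adm RR (strip r) B p" and p': "adm RR (strip r) B' p'" and le: "!!z. p z \<le> p' z"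
 shows "2 * c0 * W * pairing \<rho> p + collision w k \<rho> p \<le> 2 * c0 * W * pairing \<rho> p' + collision w k \<rho> p'"
proof -
 define d where "d z = p' z - p z" for z
 have W': "!!m. m \<in> slab r ==> \<bar>w m\<bar> \<le> W" using W(2,3) by force
 have k_abs: "\<bar>k m m'\<bar> \<le> c0" for m m' using k_nonneg[of m m'] k_le[of m m'] by simp
 have c0: "0 \<le> c0" using k_abs[of 0 0] by simp
 have bpC: "bpf RR (strip r) (3 * W * c0) (collision w k \<rho>)"
  by (rule bp_collision[OF \<rho> w_meas W' W(1) k_meas k_abs])
 have d: "adm RR (strip r) (B' + \<bar>-1\<bar> * B) d"
  using adm_add[OF p' adm_scale[OF p, of "-1"]] by (simp add: d_def[abs_def])
 have d0: "0 \<le> d z" for z using le[of z] by (simp add: d_def)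
 have dw: "0 \<le> w m * d (x, m)" "w m * d (x, m) \<le> W * d (x, m)" for x m
 proof -
  show "0 \<le> w m * d (x, m)" "w m * d (x, m) \<le> W * d (x, m)"
   using W(2,3)[of m] d0[of "(x, m)"] admD(3)[OF d, of "(x, m)"]
   by (cases "m \<in> slab r"; force intro: mult_right_mono)+
 qed
 have "collision w k \<rho> (%z. - 1 * d z) \<le> 2 * pairing \<rho> (%z. (c0 * W) * d z)"
 proof (rule collision_le_sum[OF \<rho> r adm_scale[OF d]])
  show "gain_loss w (%z. - 1 * d z) x m m' * k m m' \<le> (c0 * W) * d (x, m) + (c0 * W) * d (x, m')" for x m m'
  proof -
   have "gain_loss w (%z. - 1 * d z) x m m' \<le> W * (d (x, m) + d (x, m'))"
    using dw[of m x] dw[of m' x] dw[of "m + m'" x] unfolding gain_loss_def by (simp add: distrib_left)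
   hence "gain_loss w (%z. - 1 * d z) x m m' * k m m' \<le> (W * (d (x, m) + d (x, m'))) * c0"
    using d0 W(1) by (intro order_trans[OF mult_right_mono[OF _ k_nonneg] mult_left_mono[OF k_le]]) auto
   thus ?thesis by (simp add: algebra_simps)
  qed
  show "(%z. c0 * W * d z) \<in> bmeas RR" using admD(1)[OF d] by measurable
  show "0 \<le> c0 * W * d z" for z using c0 W(1) d0 by simp
  show "c0 * W * d z \<le> c0 * W * (B' + \<bar>-1\<bar> * B)" for z
   using c0 W(1) admD(2)[OF d, of z] by (intro mult_left_mono) auto
 qed
 hence "- collision w k \<rho> d \<le> 2 * c0 * W * pairing \<rho> d"
  using bp_scale[OF bpC d, of "-1"] by (simp add: pairing_scale)
 thus ?thesis
  using bp_diff[OF bpC p' p] bp_diff[OF bp_pairing[OF \<rho>] p' p]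
  unfolding d_def by (simp add: algebra_simps)
qed

text \<open>Subadditivity of \<open>g / sqrt a\<close> combined with the monotonicity of \<open>sqrt u *
  heat (u v)\<close>: since \<open>a\<close> is nonincreasing, \<open>sqrt (a (m + m'))\<close>
  times the heat flow at mass \<open>m + m'\<close> is below the same expression at
  \<open>m\<close> and at \<open>m'\<close>.\<close>

lemma heat_subadditive:
 assumes m: "0 < m" "0 < m'" and \<phi>: "\<phi> \<in> bmeas borel" "!!x. 0 \<le> \<phi> x" "!!x. \<phi> x \<le> B"
  and g: "0 \<le> g (m + m')" "0 \<le> g m" "0 \<le> g m'" "g (m + m') / sqrt (a (m + m')) \<le> g m / sqrt (a m) + g m' / sqrt (a m')"
  and \<tau>: "0 \<le> \<tau>"
 shows "g (m + m') * heat (a (m + m') * \<tau>) \<phi> x \<le> g m * heat (a m * \<tau>) \<phi> x + g m' * heat (a m' * \<tau>) \<phi> x"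
proof -
 have pos: "0 < a m" "0 < a m'" "0 < a (m + m')" using a_pos m by auto
 let ?h = "%m. sqrt (a m) * heat (a m * \<tau>) \<phi> x"
 have h: "0 \<le> heat (a (m + m') * \<tau>) \<phi> x" by (rule heat_nonneg[OF \<phi>(2)])
 have mono: "?h (m + m') \<le> ?h m" "?h (m + m') \<le> ?h m'"
  using sqrt_heat_mono[OF \<phi> \<tau> pos(3)] a_anti m by auto
 have "g (m + m') * heat (a (m + m') * \<tau>) \<phi> x = g (m + m') / sqrt (a (m + m')) * ?h (m + m')"
  using pos by simp
 also have "... \<le> (g m / sqrt (a m) + g m' / sqrt (a m')) * ?h (m + m')"
  using g(4) h pos by (intro mult_right_mono) auto
 also have "... \<le> g m / sqrt (a m) * ?h m + g m' / sqrt (a m') * ?h m'"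
  using mono g pos unfolding distrib_right by (intro add_mono mult_left_mono) auto
 also have "... = g m * heat (a m * \<tau>) \<phi> x + g m' * heat (a m' * \<tau>) \<phi> x"
  using pos by simp
 finally show ?thesis .
qed

end

text \<open>The mild equation evolves \<open>f t0\<close> backwards in time by the heat semigroup, and
  \<open>super\<close> keeps the result below \<open>f u\<close>. With the damping rate that makes
  the generator monotone, the mild equation turns into an inequality for the pairings with
  \<open>f\<close> alone.\<close>

lemma (in coagulation_path) supersolution_bound:
 assumes r: "1 \<le> r" and t0: "t0 \<in> {0..T}"
  and f: "!!s. s \<in> {0..t0} ==> adm RR (strip r) B (f s)"
  and super: "!!u s z. 0 \<le> u ==> u \<le> s ==> s \<le> t0 ==> semigroup_at a (s - u) (f s) z \<le> f u z"
  and h: "set_borel_measurable lborel {0..t0} h" "!!s. s \<in> {0..t0} ==> \<bar>h s\<bar> \<le> H"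
  and coll: "!!s. s \<in> {0..t0} ==> collision w k (\<rho> s) (f s) \<le> h s"
  and init: "!!s. s \<in> {0..t0} ==> E0 (semigroup_at a s (f s)) \<le> u0"
 shows "pairing (\<rho> t0) (f t0) \<le> u0 + (LINT s:{0..t0}|lborel. h s)"
proof -
 obtain W where W: "0 \<le> W" "!!m. m \<in> slab r ==> 0 < w m" "!!m. m \<in> slab r ==> w m \<le> W"
  using w_slab_bound[OF r] by blast
 define c where "c = 2 * c0 * W"
 have c: "0 \<le> c" using W(1) c0_nonneg by (simp add: c_def)
 obtain K where K: "!!s. s \<in> {0..T} ==> bpf RR (strip r) K (pairing (\<rho> s))"
  "bpf RR (strip r) K E0"
  "!!s. s \<in> {0..T} ==> bpf RR (strip r) K (%p. c * pairing (\<rho> s) p + collision w k (\<rho> s) p)"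
  using path_bp[OF r c] by blast
 show ?thesis
 proof (rule comparison[OF h c, where I="{()}" and v="%_ s. pairing (\<rho> s) (f s)" and i="()" and V="K * B"])
  show "pairing (\<rho> s) (f s) \<le> K * B" if "s \<in> {0..t0}" for s
   using bp_bound[OF K(1)[of s] f[OF that]] that t0 by auto
  fix t assume t: "t \<in> {0..t0}"
  hence tT: "t \<in> {0..T}" using t0 by auto
  define g where "g s = c * pairing (\<rho> s) (semigroup_at a (t - s) (f t)) + collision w k (\<rho> s) (semigroup_at a (t - s) (f t))" for s
  have bal: "set_borel_measurable lborel {0..t} (%s. exp (- c * (t - s)) * g s)"
   "pairing (\<rho> t) (f t) = exp (- c * t) * E0 (semigroup_at a t (f t)) + (LINT s:{0..t}|lborel. exp (- c * (t - s)) * g s)"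
   using mild[OF r c tT f[OF t]] unfolding balanced_def g_def by auto
  have "set_integrable lborel {0..t} (%s. exp (- c * (t - s)) * g s)"
  proof (rule set_integrable_bounded[OF bal(1)])
   fix s assume s: "0 \<le> s" "s \<le> t"
   hence "\<bar>g s\<bar> \<le> K * B"
    unfolding g_def using tT by (intro bp_bound[OF K(3)] adm_semigroup[OF a_meas] f[OF t]) auto
   hence "exp (- c * (t - s)) * \<bar>g s\<bar> \<le> 1 * (K * B)"
    using c s by (intro mult_mono) auto
   thus "\<bar>exp (- c * (t - s)) * g s\<bar> \<le> K * B" by (simp add: abs_mult)
  qed
  moreover have "pairing (\<rho> t) (f t) \<le> exp (- c * t) * u0 + (LINT s:{0..t}|lborel. exp (- c * (t - s)) * g s)"
   unfolding bal(2) using init[OF t] by simp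
  moreover have "g s \<le> c * b + h s" if s: "s \<in> {0..t}" and b: "pairing (\<rho> s) (f s) \<le> b" for s b
  proof -
   have s': "s \<in> {0..t0}" "s \<in> {0..T}" using s t t0 by auto
   have "g s \<le> c * pairing (\<rho> s) (f s) + collision w k (\<rho> s) (f s)"
    unfolding g_def c_def
    by (rule shifted_collision_mono[OF kernel[OF s'(2)] r W adm_semigroup[OF a_meas f[OF t]] f[OF s'(1)]])
     (use super s t in auto)
   also have "... \<le> c * b + h s"
    using b c coll[OF s'(1)] by (intro add_mono mult_left_mono) auto
   finally show ?thesis .
  qed
  ultimately show "\<exists>g. set_integrable lborel {0..t} (%s. exp (- c * (t - s)) * g s)
   \<and> pairing (\<rho> t) (f t) \<le> exp (- c * t) * u0 + (LINT s:{0..t}|lborel. exp (- c * (t - s)) * g s)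
   \<and> (\<forall>s\<in>{0..t}. \<forall>b. (\<forall>j\<in>{()}. pairing (\<rho> s) (f s) \<le> b) --> g s \<le> c * b + h s)"
   by blast
 qed (use t0 in auto)
qed

section \<open>Truncation of supersolutions\<close>

lemma nnpair_restrict_pos:
 assumes \<rho>: "subkernel \<rho>" and null: "!!x. emeasure (\<rho> x) {..0} = 0"
 shows "nnpair \<rho> X = nnpair \<rho> (%z. indicator (UNIV \<times> {0<..}) z * X z)"
 unfolding nnpair_def
proof (rule nn_integral_cong)
 fix x
 have "AE m in \<rho> x. 0 < m"
  by (rule AE_I[of _ _ "{..0}"]) (use null subkernel_sets[OF \<rho>] in auto)
 thus "(\<integral>\<^sup>+m. X (x, m) \<partial>\<rho> x) = (\<integral>\<^sup>+m. indicator (UNIV \<times> {0<..}) (x, m) * X (x, m) \<partial>\<rho> x)"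
  by (intro nn_integral_cong_AE) (auto elim: eventually_mono)
qed

text \<open>Monotone convergence under both integrals; nothing is asked of the functions at masses that the
  kernel does not charge.\<close>

lemma nnpair_LIMSEQ:
 assumes \<rho>: "subkernel \<rho>" and null: "!!x. emeasure (\<rho> x) {..0} = 0"
  and P: "!!n. P n \<in> bmeas RR" "!!n x m. 0 < m ==> P n (x, m) \<le> P (Suc n) (x, m)"
  and lim: "!!x m. 0 < m ==> (%n. P n (x, m)) \<longlonglongrightarrow> R (x, m)"
 shows "(%n. nnpair \<rho> (P n)) \<longlonglongrightarrow> nnpair \<rho> R"
proof -
 define P' where "P' n z = indicator (UNIV \<times> {0<..}) z * P n z" for n z
 define R' where "R' z = indicator (UNIV \<times> {0<..}) z * R z" for z
 have eq: "nnpair \<rho> (P n) = nnpair \<rho> (P' n)" "nnpair \<rho> R = nnpair \<rho> R'" for n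
  unfolding P'_def R'_def by (rule nnpair_restrict_pos[OF \<rho> null])+
 note [measurable] = P(1)
 have P'_meas: "P' n \<in> bmeas RR" for n
  unfolding P'_def by measurable
 have inc: "P' n z \<le> P' (Suc n) z" for n z
  using P(2)[of "snd z" n "fst z"] by (cases z) (auto simp: P'_def indicator_def)
 have lim': "(%n. P' n z) \<longlonglongrightarrow> R' z" for z
  using lim[of "snd z" "fst z"] by (cases z) (auto simp: P'_def R'_def indicator_def)
 show ?thesis
  unfolding eq
  unfolding nnpair_def
 proof (rule nn_integral_LIMSEQ)
  show "incseq (%n x. \<integral>\<^sup>+m. P' n (x, m) \<partial>\<rho> x)"
   by (rule incseq_SucI) (auto simp: le_fun_def intro!: nn_integral_mono inc)
  show "(%x. \<integral>\<^sup>+m. P' n (x, m) \<partial>\<rho> x) \<in> bmeas torus" for n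
   by (rule measurable_torus[OF nnpair_inner_measurable[OF \<rho> P'_meas]])
  show "(%n. \<integral>\<^sup>+m. P' n (x, m) \<partial>\<rho> x) \<longlonglongrightarrow> (\<integral>\<^sup>+m. R' (x, m) \<partial>\<rho> x)" for x
  proof (rule nn_integral_LIMSEQ)
   show "incseq (%n m. P' n (x, m))"
    by (rule incseq_SucI) (auto simp: le_fun_def intro!: inc)
   show "(%m. P' n (x, m)) \<in> bmeas (\<rho> x)" for n
    by (rule subkernel_measurable[OF \<rho> measurable_section_nn[OF P'_meas]])
  qed (rule lim')
 qed
qed

lemma slab_mono: "1 \<le> r ==> r \<le> r' ==> slab r \<subseteq> slab r'"
 unfolding slab_def by (auto intro: order_trans[OF le_imp_inverse_le])

lemma slab_exhaust:
 assumes "0 < m"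
 shows "\<forall>\<^sub>F n in sequentially. m \<in> slab (real (Suc n))"
proof -
 obtain N where N: "max m (inverse m) < real N" using reals_Archimedean2 by blast
 have "m \<in> slab (real (Suc n))" if "N \<le> n" for n
 proof -
  have "inverse m \<le> real (Suc n)" "m \<le> real (Suc n)" using N that by auto
  thus ?thesis
   using assms le_imp_inverse_le[of "inverse m" "real (Suc n)"] by (simp add: slab_def)
 qed
 thus ?thesis using eventually_sequentially by blast
qed

text \<open>A bound on averages over all sets is a pointwise bound: test with the set where the bound fails.\<close>

lemma AE_le_of_averages:
 fixes f :: "real => ennreal"
 assumes f[measurable]: "f \<in> bmeas borel" and C: "0 \<le> C"
  and avg: "!!A. A \<in> sets borel ==> (\<integral>\<^sup>+x. f x * indicator A x \<partial>torus) \<le> ennreal C * (\<integral>\<^sup>+x. indicator A x \<partial>torus)"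
 shows "AE x in torus. f x \<le> ennreal C"
proof -
 define A where "A = {x. ennreal C < f x}"
 have A[measurable]: "A \<in> sets borel" unfolding A_def by measurable
 have fm: "(%x. f x * indicator A x) \<in> bmeas torus" "(%x. ennreal C * indicator A x) \<in> bmeas torus"
  by (rule measurable_torus; measurable)+
 have fin: "(\<integral>\<^sup>+x. ennreal C * indicator A x \<partial>torus) \<noteq> \<infinity>"
 proof -
  have "(\<integral>\<^sup>+x. ennreal C * indicator A x \<partial>torus) \<le> (\<integral>\<^sup>+x. ennreal C \<partial>torus)"
   by (intro nn_integral_mono) (auto simp: indicator_def)
  also have "... < \<infinity>" using torus.emeasure_space_1 by simp
  finally show ?thesis by simp
 qed
 have "(\<integral>\<^sup>+x. f x * indicator A x - ennreal C * indicator A x \<partial>torus)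
   = (\<integral>\<^sup>+x. f x * indicator A x \<partial>torus) - (\<integral>\<^sup>+x. ennreal C * indicator A x \<partial>torus)"
  by (rule nn_integral_diff[OF fm fin]) (auto simp: A_def indicator_def)
 also have "... = 0"
 proof (rule diff_eq_0_ennreal)
  have "(\<integral>\<^sup>+x. ennreal C * indicator A x \<partial>torus) = ennreal C * (\<integral>\<^sup>+x. indicator A x \<partial>torus)"
   by (rule nn_integral_cmult) (rule measurable_torus, measurable)
  with avg[OF A] show le: "(\<integral>\<^sup>+x. f x * indicator A x \<partial>torus) \<le> (\<integral>\<^sup>+x. ennreal C * indicator A x \<partial>torus)"
   by simp
  thus "(\<integral>\<^sup>+x. f x * indicator A x \<partial>torus) < top"
   using fin le_less_trans by (auto simp: less_top)
 qed
 finally have "AE x in torus. f x * indicator A x - ennreal C * indicator A x = 0"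
  by (subst (asm) nn_integral_0_iff_AE) (use fm in auto)
 thus ?thesis
 proof (rule eventually_mono)
  fix x assume "f x * indicator A x - ennreal C * indicator A x = 0"
  thus "f x \<le> ennreal C"
   by (cases "x \<in> A") (auto simp: A_def diff_eq_0_iff_ennreal not_less)
 qed
qed

definition off_slab :: "real => real \<times> real => real"
 where "off_slab r z = indicator (- slab r) (snd z)"

lemma off_slab: "off_slab r \<in> bmeas RR" "0 \<le> off_slab r z" "off_slab r z \<le> 1" "\<bar>off_slab r z\<bar> \<le> 1"
 by (auto simp: off_slab_def[abs_def] indicator_def)

lemma torus_integral_nn:
 assumes "\<phi> \<in> bmeas borel" "!!x. 0 \<le> \<phi> x" "!!x. \<phi> x \<le> B"
 shows "(\<integral>\<^sup>+x. ennreal (\<phi> x) \<partial>torus) = ennreal (\<integral>x. \<phi> x \<partial>torus)" "0 \<le> (\<integral>x. \<phi> x \<partial>torus)"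
 using assms by (auto intro!: nn_integral_eq_integral torus_integrable[where B=B])

text \<open>The quantitative information on a path: its initial value is dominated by a product measure,
  whose mass distribution weighted by \<open>w\<close> is the finite measure
  \<open>\<eta>\<close>, and it does not charge the mass zero.\<close>

locale moment_path = coagulation_path +
 fixes \<eta> :: "real measure"
 assumes \<eta>_finite: "finite_measure \<eta>" and \<eta>_sets: "sets \<eta> = sets borel"
  and E0_bound: "1 \<le> r ==> adm RR (strip r) B p ==> (!!z. 0 \<le> p z) ==>
   ennreal (E0 p) \<le> (\<integral>\<^sup>+x. (\<integral>\<^sup>+m. ennreal (p (x, m) / w m) \<partial>\<eta>) \<partial>torus)"
  and no_zero: "s \<in> {0..T} ==> emeasure (\<rho> s x) {..0} = 0"
  and time_meas: "h \<in> bmeas borel ==>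
   (%s. indicator {0..T} s * nnpair (\<rho> s) (%(x, m). h m)) \<in> bmeas borel"
begin

definition \<eta>0 :: real where "\<eta>0 = measure \<eta> UNIV"

lemma \<eta>0: "0 \<le> \<eta>0" "emeasure \<eta> UNIV = ennreal \<eta>0"
 unfolding \<eta>0_def using finite_measure.emeasure_eq_measure[OF \<eta>_finite] by auto

lemma E0_heat_bound:
 assumes r: "1 \<le> r" and p: "adm RR (strip r) B p" "!!z. 0 \<le> p z"
  and \<phi>: "\<phi> \<in> bmeas borel" "!!x. 0 \<le> \<phi> x" "!!x. \<phi> x \<le> B'"
  and C: "0 \<le> C" and le: "!!x m. m \<in> slab r ==> p (x, m) \<le> C * w m * heat (a m * \<tau>) \<phi> x"
 shows "E0 p \<le> C * \<eta>0 * (\<integral>x. \<phi> x \<partial>torus)"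
proof -
 interpret \<eta>: finite_measure \<eta> by (rule \<eta>_finite)
 interpret P: pair_sigma_finite torus \<eta> ..
 note [measurable] = \<phi>(1) a_meas
 have a_\<eta>: "a \<in> bmeas \<eta>"
  using a_meas unfolding measurable_cong_sets[OF \<eta>_sets refl] .
 have id: "(%x. x) \<in> bmeas torus"
  by (rule measurable_torus) simp
 have "(%z. heat (a (snd z) * \<tau>) \<phi> (fst z)) \<in> bmeas (torus \<Otimes>\<^sub>M \<eta>)"
 proof (rule measurable_heat)
  show "(%z. a (snd z) * \<tau>) \<in> bmeas (torus \<Otimes>\<^sub>M \<eta>)"
   by (intro borel_measurable_times measurable_compose[OF measurable_snd a_\<eta>] borel_measurable_const)
  show "fst \<in> bmeas (torus \<Otimes>\<^sub>M \<eta>)"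
   using measurable_compose[OF measurable_fst[of torus \<eta>] id] by simp
  show "(%(y, u). \<phi> u) \<in> bmeas ((torus \<Otimes>\<^sub>M \<eta>) \<Otimes>\<^sub>M borel)"
   using measurable_compose[OF measurable_snd \<phi>(1)] by (simp add: case_prod_beta')
 qed
 hence meas': "(%z. ennreal C * ennreal (heat (a (snd z) * \<tau>) \<phi> (fst z))) \<in> bmeas (torus \<Otimes>\<^sub>M \<eta>)"
  by measurable
 have "ennreal (E0 p) \<le> (\<integral>\<^sup>+x. (\<integral>\<^sup>+m. ennreal (p (x, m) / w m) \<partial>\<eta>) \<partial>torus)"
  by (rule E0_bound[OF r p])
 also have "... \<le> (\<integral>\<^sup>+x. (\<integral>\<^sup>+m. ennreal C * ennreal (heat (a m * \<tau>) \<phi> x) \<partial>\<eta>) \<partial>torus)"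
 proof (intro nn_integral_mono)
  fix x m
  show "ennreal (p (x, m) / w m) \<le> ennreal C * ennreal (heat (a m * \<tau>) \<phi> x)"
  proof (cases "m \<in> slab r")
   case True
   hence "0 < w m" using w_pos slab_pos r by auto
   hence "p (x, m) / w m \<le> C * heat (a m * \<tau>) \<phi> x"
    using le[OF True, of x] by (simp add: divide_le_eq mult_ac)
   thus ?thesis using C heat_nonneg[of \<phi>, OF \<phi>(2)] by (simp add: ennreal_mult[symmetric] ennreal_leI)
  next
   case False
   thus ?thesis using admD(3)[OF p(1), of "(x, m)"] by simp
  qed
 qed
 also have "... = (\<integral>\<^sup>+m. (\<integral>\<^sup>+x. ennreal C * ennreal (heat (a m * \<tau>) \<phi> x) \<partial>torus) \<partial>\<eta>)"
  by (rule P.Fubini'[symmetric]) (use meas' in \<open>simp add: case_prod_beta'\<close>)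
 also have "... = (\<integral>\<^sup>+m. ennreal C * ennreal (\<integral>x. \<phi> x \<partial>torus) \<partial>\<eta>)"
 proof (intro nn_integral_cong)
  fix m
  have "(%x. heat (a m * \<tau>) \<phi> x) \<in> bmeas borel"
   by (rule measurable_heat) measurable
  hence "(\<integral>\<^sup>+x. ennreal C * ennreal (heat (a m * \<tau>) \<phi> x) \<partial>torus) = ennreal C * (\<integral>\<^sup>+x. ennreal (heat (a m * \<tau>) \<phi> x) \<partial>torus)"
   by (intro nn_integral_cmult) (auto intro: measurable_torus)
  thus "(\<integral>\<^sup>+x. ennreal C * ennreal (heat (a m * \<tau>) \<phi> x) \<partial>torus) = ennreal C * ennreal (\<integral>x. \<phi> x \<partial>torus)"
   unfolding nn_integral_heat[OF \<phi>] torus_integral_nn(1)[OF \<phi>] .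
 qed
 also have "... = ennreal (C * \<eta>0 * (\<integral>x. \<phi> x \<partial>torus))"
  using \<eta>0 C torus_integral_nn(2)[OF \<phi>] \<eta>_sets sets_eq_imp_space_eq[OF \<eta>_sets]
  by (simp add: ennreal_mult[symmetric] mult_ac)
 finally show ?thesis
  using C \<eta>0(1) torus_integral_nn(2)[OF \<phi>] by (subst (asm) ennreal_le_iff) auto
qed

lemma pairing_time_meas:
 assumes g: "g \<in> bmeas borel" "!!m. 0 \<le> g m" "!!m. g m \<le> B" and t: "t \<in> {0..T}"
 shows "set_borel_measurable lborel {0..t} (%s. pairing (\<rho> s) (%z. g (snd z)))"
proof -
 have "pairing (\<rho> s) (%z. g (snd z)) = enn2real (nnpair (\<rho> s) (%(x, m). ennreal (g m)))" if "s \<in> {0..T}" for s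
 proof -
  have "nnpair (\<rho> s) (%z. ennreal (g (snd z))) = ennreal (pairing (\<rho> s) (%z. g (snd z)))"
   by (rule nnpair_eq_pairing[OF kernel[OF that]]) (use g in auto)
  thus ?thesis using pairing_nonneg[of "%z. g (snd z)"] g(2) by (simp add: case_prod_beta')
 qed
 hence "indicator {0..t} s *\<^sub>R pairing (\<rho> s) (%z. g (snd z))
  = indicator {0..t} s * enn2real (indicator {0..T} s * nnpair (\<rho> s) (%(x, m). ennreal (g m)))" for s
  using t by (auto simp: indicator_def)
 moreover have "(%s. indicator {0..t} s * enn2real (indicator {0..T} s * nnpair (\<rho> s) (%(x, m). ennreal (g m)))) \<in> bmeas lborel"
  using time_meas[of "%m. ennreal (g m)"] g(1) by measurable
 ultimately show ?thesis unfolding set_borel_measurable_def by (simp only:)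
qed

lemma off_slab_meas: "t \<in> {0..T} ==> set_borel_measurable lborel {0..t} (%s. pairing (\<rho> s) (off_slab r))"
 using pairing_time_meas[of "indicator (- slab r)" 1 t] by (simp add: off_slab_def[abs_def] indicator_def)

lemma off_slab_pairing: "s \<in> {0..T} ==> 0 \<le> pairing (\<rho> s) (off_slab r)" "s \<in> {0..T} ==> pairing (\<rho> s) (off_slab r) \<le> 1"
 using pairing_nonneg[of "off_slab r", OF off_slab(2)] pairing_bound[OF kernel off_slab(1,4)] by (auto intro: abs_le_D1)

lemma pairing_nonpos_zero:
 assumes s: "s \<in> {0..T}"
 shows "pairing (\<rho> s) (%z. indicator {..0} (snd z) * g z) = 0"
proof -
 have "AE m in \<rho> s x. m \<notin> {..0}" for x
  by (rule AE_I[of _ _ "{..0}"]) (use no_zero[OF s] subkernel_sets[OF kernel[OF s]] in auto)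
 hence "(\<integral>m. indicator {..0} m * g (x, m) \<partial>\<rho> s x) = 0" for x
  by (intro integral_eq_zero_AE eventually_mono[OF \<open>AE m in \<rho> s x. m \<notin> {..0}\<close>]) auto
 thus ?thesis by (simp add: pairing_def)
qed

text \<open>Mass escapes from the slabs only in the limit: dominated convergence, first in the space
  variables and then in time.\<close>

lemma off_slab_limit:
 assumes t: "t \<in> {0..T}"
 shows "(%n. LINT s:{0..t}|lborel. pairing (\<rho> s) (off_slab (real (Suc n)))) \<longlonglongrightarrow> 0"
proof -
 have lim: "(%n. pairing (\<rho> s) (off_slab (real (Suc n)))) \<longlonglongrightarrow> 0" if s: "s \<in> {0..T}" for s
 proof -
  have "(%n. pairing (\<rho> s) (off_slab (real (Suc n)))) \<longlonglongrightarrow> pairing (\<rho> s) (%z. indicator {..0} (snd z) * 1)"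
  proof (rule pairing_tendsto[OF kernel[OF s] off_slab(1,4)])
   fix z :: "real \<times> real"
   show "(%n. off_slab (real (Suc n)) z) \<longlonglongrightarrow> indicator {..0} (snd z) * 1"
   proof (cases "0 < snd z")
    case True
    from slab_exhaust[OF this] have "\<forall>\<^sub>F n in sequentially. off_slab (real (Suc n)) z = 0"
     by (rule eventually_mono) (simp add: off_slab_def)
    thus ?thesis using True by (simp add: tendsto_eventually)
   next
    case False
    hence "snd z \<notin> slab (real (Suc n))" for n using slab_pos[of "snd z" "real (Suc n)"] by auto
    thus ?thesis using False by (simp add: off_slab_def)
   qed
  qed
  thus ?thesis by (simp only: pairing_nonpos_zero[OF s])
 qed
 have "(%n. LINT s:{0..t}|lborel. pairing (\<rho> s) (off_slab (real (Suc n)))) \<longlonglongrightarrow> (LINT s:{0..t}|lborel. (0::real))"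
  unfolding set_lebesgue_integral_def
 proof (rule integral_dominated_convergence)
  show "integrable lborel (%s. indicator {0..t} s *\<^sub>R (1::real))"
   by (intro integrable_scaleR_left integrable_real_indicator) (auto simp: emeasure_lborel_Icc_eq)
  show "AE s in lborel. (%n. indicator {0..t} s *\<^sub>R pairing (\<rho> s) (off_slab (real (Suc n)))) \<longlonglongrightarrow> indicator {0..t} s *\<^sub>R 0"
   using lim t by (auto simp: indicator_def)
  show "AE s in lborel. norm (indicator {0..t} s *\<^sub>R pairing (\<rho> s) (off_slab (real (Suc n)))) \<le> indicator {0..t} s *\<^sub>R 1" for n
   using off_slab_pairing t by (auto simp: indicator_def)
 qed (use off_slab_meas[OF t] in \<open>auto simp: set_borel_measurable_def\<close>)
 thus ?thesis by simp
qed

text \<open>Truncated weights: supersolutions that are supported in a slab and become bounded by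
  \<open>M\<close> after multiplication by \<open>w\<close>.\<close>

definition truncated :: "real => real => (real => real) => real => (real => real) => real \<times> real => real"
 where "truncated r M g \<tau> \<phi> = (%(x, m). if m \<in> slab r then min (g m * heat (a m * \<tau>) \<phi> x) (M / w m) else 0)"

lemma adm_truncated:
 assumes r: "1 \<le> r" and g: "g \<in> bmeas borel" "!!m. m \<in> slab r ==> 0 \<le> g m" "!!m. m \<in> slab r ==> g m \<le> G"
  and \<phi>: "\<phi> \<in> bmeas borel" "!!x. 0 \<le> \<phi> x" "!!x. \<phi> x \<le> B" and M: "0 \<le> M"
 shows "adm RR (strip r) (\<bar>G\<bar> * B) (truncated r M g \<tau> \<phi>)" "0 \<le> truncated r M g \<tau> \<phi> z"
proof -
 note [measurable] = g(1) \<phi>(1) a_meas w_meas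
 have B: "\<bar>\<phi> x\<bar> \<le> B" "0 \<le> B" for x using \<phi>(2,3)[of x] by auto
 have h: "0 \<le> heat v \<phi> x" "heat v \<phi> x \<le> B" for v x
  using heat_nonneg[of \<phi>, OF \<phi>(2)] abs_heat_le[OF \<phi>(1) B(1), of v x] by auto
 have w: "0 \<le> M / w m" if "m \<in> slab r" for m using w_pos[OF slab_pos[OF that r]] M by simp
 have [measurable]: "(%z. heat (a (snd z) * \<tau>) \<phi> (fst z)) \<in> bmeas RR"
  by (rule measurable_heat) measurable
 have meas: "(%z. if snd z \<in> slab r then min (g (snd z) * heat (a (snd z) * \<tau>) \<phi> (fst z)) (M / w (snd z)) else 0) \<in> bmeas RR"
  by measurable
 show nn: "0 \<le> truncated r M g \<tau> \<phi> z" for z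
  using w g(2) h(1) by (auto simp: truncated_def split: prod.split)
 show "adm RR (strip r) (\<bar>G\<bar> * B) (truncated r M g \<tau> \<phi>)"
 proof (rule admI)
  show "truncated r M g \<tau> \<phi> \<in> bmeas RR"
   using meas by (simp add: truncated_def case_prod_beta')
  show "\<bar>truncated r M g \<tau> \<phi> z\<bar> \<le> \<bar>G\<bar> * B" if "z \<in> strip r" for z
  proof -
   obtain x m where z: "z = (x, m)" "m \<in> slab r" using \<open>z \<in> strip r\<close> by (cases z) auto
   have "g m * heat (a m * \<tau>) \<phi> x \<le> \<bar>G\<bar> * B"
    using g(2,3)[OF z(2)] h by (intro mult_mono) auto
   thus ?thesis using nn[of z] z by (auto simp: truncated_def)
  qed
 qed (use B in \<open>auto simp: truncated_def split: if_splits\<close>)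
qed

lemma truncated_super:
 assumes r: "1 \<le> r" and g: "g \<in> bmeas borel" "!!m. m \<in> slab r ==> 0 \<le> g m" "!!m. m \<in> slab r ==> g m \<le> G"
  and \<phi>: "\<phi> \<in> bmeas borel" "!!x. 0 \<le> \<phi> x" "!!x. \<phi> x \<le> B" and M: "0 \<le> M" and \<tau>: "0 \<le> \<tau>" "0 \<le> \<sigma>"
 shows "semigroup_at a \<sigma> (truncated r M g \<tau> \<phi>) z \<le> truncated r M g (\<sigma> + \<tau>) \<phi> z"
proof (cases z)
 case (Pair x m)
 show ?thesis
 proof (cases "m \<in> slab r")
  case True
  have am: "0 \<le> a m" using a_pos[OF slab_pos[OF True r]] by simp
  have wm: "0 \<le> M / w m" using w_pos[OF slab_pos[OF True r]] M by simp
  have B: "\<bar>\<phi> x\<bar> \<le> B" "0 \<le> B" for x using \<phi>(2,3)[of x] by auto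
  have hB: "\<bar>heat (a m * \<tau>) \<phi> y\<bar> \<le> B" for y by (rule abs_heat_le[OF \<phi>(1) B(1)])
  let ?t = "%y. truncated r M g \<tau> \<phi> (y, m)"
  have t: "?t \<in> bmeas borel" "!!y. \<bar>?t y\<bar> \<le> \<bar>G\<bar> * B"
   using measurable_section'[OF admD(1)[OF adm_truncated(1)[OF r g \<phi> M]]] admD(2)[OF adm_truncated(1)[OF r g \<phi> M]] by auto
  have [measurable]: "(%y. heat (a m * \<tau>) \<phi> y) \<in> bmeas borel"
   by (rule measurable_heat) (use measurable_compose[OF measurable_snd \<phi>(1)] in \<open>auto simp: case_prod_beta'\<close>)
  have "heat (a m * \<sigma>) ?t x \<le> heat (a m * \<sigma>) (%y. g m * heat (a m * \<tau>) \<phi> y) x"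
  proof (rule heat_mono[OF t])
   show "\<bar>g m * heat (a m * \<tau>) \<phi> y\<bar> \<le> \<bar>g m\<bar> * B" for y
    unfolding abs_mult by (intro mult_left_mono hB) auto
  qed (use True in \<open>auto simp: truncated_def\<close>)
  also have "... = g m * heat (a m * (\<sigma> + \<tau>)) \<phi> x"
   using heat_heat[OF \<phi>(1) B(1), of "a m * \<sigma>" "a m * \<tau>" x] am \<tau> by (simp add: heat_scale distrib_left)
  finally have 1: "heat (a m * \<sigma>) ?t x \<le> g m * heat (a m * (\<sigma> + \<tau>)) \<phi> x" .
  have "heat (a m * \<sigma>) ?t x \<le> heat (a m * \<sigma>) (%_. M / w m) x"
   by (rule heat_mono[OF t, where C="M / w m"]) (use True wm in \<open>auto simp: truncated_def\<close>)
  hence 2: "heat (a m * \<sigma>) ?t x \<le> M / w m" by simp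
  show ?thesis using 1 2 True Pair by (simp add: semigroup_at_def truncated_def)
 next
  case False
  thus ?thesis using Pair by (simp add: semigroup_at_def truncated_def)
 qed
qed

text \<open>The limit in the slab is taken before the one in the height, because the error made outside the
  slab is multiplied by the height.\<close>

lemma truncation_limit:
 assumes s: "s \<in> {0..T}" and g: "g \<in> bmeas borel" "!!m. 0 < m ==> 0 \<le> g m"
  and \<phi>: "\<phi> \<in> bmeas borel" "!!x. 0 \<le> \<phi> x" "!!x. \<phi> x \<le> B"
  and ex_adm: "!!n M. \<exists>C. adm RR (strip (real (Suc n))) C (truncated (real (Suc n)) (real M) g \<tau> \<phi>)"
  and b: "!!n M. pairing (\<rho> s) (truncated (real (Suc n)) (real M) g \<tau> \<phi>) \<le> b M n"
   "!!M. b M \<longlonglongrightarrow> b0"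
 shows "nnpair (\<rho> s) (%(x, m). ennreal (g m * heat (a m * \<tau>) \<phi> x)) \<le> ennreal b0"
proof -
 note [measurable] = g(1) \<phi>(1) a_meas w_meas
 note k = kernel[OF s] no_zero[OF s]
 obtain C where adm: "!!n M. adm RR (strip (real (Suc n))) (C n M) (truncated (real (Suc n)) (real M) g \<tau> \<phi>)"
  using ex_adm by metis
 have h: "0 \<le> heat v \<phi> x" for v x using heat_nonneg[of \<phi>, OF \<phi>(2)] by auto
 have w: "0 < w m" if "m \<in> slab (real (Suc n))" for m n using w_pos[OF slab_pos[OF that]] by simp
 have t0: "0 \<le> truncated (real (Suc n)) (real M) g \<tau> \<phi> z" for n M z
 proof (cases z)
  case (Pair x m)
  thus ?thesis
   using w[of m n] g(2)[OF slab_pos[of m "real (Suc n)"]] h by (auto simp: truncated_def)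
 qed
 have [measurable]: "(%z. heat (a (snd z) * \<tau>) \<phi> (fst z)) \<in> bmeas RR"
  by (rule measurable_heat) measurable
 have M: "nnpair (\<rho> s) (%(x, m). ennreal (min (g m * heat (a m * \<tau>) \<phi> x) (real M / w m))) \<le> ennreal b0" for M
 proof (rule LIMSEQ_le)
  show "(%n. nnpair (\<rho> s) (%z. ennreal (truncated (real (Suc n)) (real M) g \<tau> \<phi> z)))
   \<longlonglongrightarrow> nnpair (\<rho> s) (%(x, m). ennreal (min (g m * heat (a m * \<tau>) \<phi> x) (real M / w m)))"
  proof (rule nnpair_LIMSEQ[OF k])
   show "(%z. ennreal (truncated (real (Suc n)) (real M) g \<tau> \<phi> z)) \<in> bmeas RR" for n
    using admD(1)[OF adm[of n M]] by measurable
   show "ennreal (truncated (real (Suc n)) (real M) g \<tau> \<phi> (x, m)) \<le> ennreal (truncated (real (Suc (Suc n))) (real M) g \<tau> \<phi> (x, m))" for n x m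
   proof (cases "m \<in> slab (real (Suc n))")
    case True
    hence "m \<in> slab (real (Suc (Suc n)))" using slab_mono[of "real (Suc n)" "real (Suc (Suc n))"] by auto
    thus ?thesis using True by (simp add: truncated_def)
   next
    case False
    hence "truncated (real (Suc n)) (real M) g \<tau> \<phi> (x, m) = 0" by (simp add: truncated_def)
    thus ?thesis by simp
   qed
   show "(%n. ennreal (truncated (real (Suc n)) (real M) g \<tau> \<phi> (x, m))) \<longlonglongrightarrow> (case (x, m) of (x, m) => ennreal (min (g m * heat (a m * \<tau>) \<phi> x) (real M / w m)))"
    if "0 < m" for x m
    by (rule tendsto_eventually, rule eventually_mono[OF slab_exhaust[OF that]]) (simp add: truncated_def)
  qed
  show "(%n. ennreal (b M n)) \<longlonglongrightarrow> ennreal b0" by (rule tendsto_ennrealI[OF b(2)])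
  have "nnpair (\<rho> s) (%z. ennreal (truncated (real (Suc n)) (real M) g \<tau> \<phi> z)) \<le> ennreal (b M n)" for n
  proof -
   have "nnpair (\<rho> s) (%z. ennreal (truncated (real (Suc n)) (real M) g \<tau> \<phi> z)) = ennreal (pairing (\<rho> s) (truncated (real (Suc n)) (real M) g \<tau> \<phi>))"
    by (rule nnpair_eq_pairing[OF k(1) admD(1)[OF adm] t0 abs_le_D1[OF admD(2)[OF adm]]])
   thus ?thesis using b(1) by (simp add: ennreal_leI)
  qed
  thus "\<exists>N. \<forall>n\<ge>N. nnpair (\<rho> s) (%z. ennreal (truncated (real (Suc n)) (real M) g \<tau> \<phi> z)) \<le> ennreal (b M n)"
   by blast
 qed
 show ?thesis
 proof (rule LIMSEQ_le_const2)
  show "(%M. nnpair (\<rho> s) (%(x, m). ennreal (min (g m * heat (a m * \<tau>) \<phi> x) (real M / w m))))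
   \<longlonglongrightarrow> nnpair (\<rho> s) (%(x, m). ennreal (g m * heat (a m * \<tau>) \<phi> x))"
  proof (rule nnpair_LIMSEQ[OF k])
   show "(%(x, m). ennreal (min (g m * heat (a m * \<tau>) \<phi> x) (real M / w m))) \<in> bmeas RR" for M
    unfolding case_prod_beta' by measurable
   show "(case (x, m) of (x, m) => ennreal (min (g m * heat (a m * \<tau>) \<phi> x) (real M / w m)))
    \<le> (case (x, m) of (x, m) => ennreal (min (g m * heat (a m * \<tau>) \<phi> x) (real (Suc M) / w m)))" if "0 < m" for M x m
    using w_pos[OF that] by (auto intro!: ennreal_leI min.mono divide_right_mono)
   show "(%M. case (x, m) of (x, m) => ennreal (min (g m * heat (a m * \<tau>) \<phi> x) (real M / w m)))
    \<longlonglongrightarrow> (case (x, m) of (x, m) => ennreal (g m * heat (a m * \<tau>) \<phi> x))" if m: "0 < m" for x m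
   proof -
    obtain N where N: "g m * heat (a m * \<tau>) \<phi> x * w m < real N" using reals_Archimedean2 by blast
    have "min (g m * heat (a m * \<tau>) \<phi> x) (real M / w m) = g m * heat (a m * \<tau>) \<phi> x" if "N \<le> M" for M
    proof -
     have "g m * heat (a m * \<tau>) \<phi> x * w m \<le> real M" using N that by linarith
     hence "g m * heat (a m * \<tau>) \<phi> x \<le> real M / w m" using w_pos[OF m] by (simp add: le_divide_eq)
     thus ?thesis by simp
    qed
    hence "\<forall>\<^sub>F M in sequentially. ennreal (min (g m * heat (a m * \<tau>) \<phi> x) (real M / w m)) = ennreal (g m * heat (a m * \<tau>) \<phi> x)"
     by (intro eventually_sequentiallyI[of N]) simp
    thus ?thesis by (simp add: tendsto_eventually)
   qed
  qed
 qed (use M in auto)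
qed

end

section \<open>The moment preserved by the flow\<close>

lemma set_integral_exp:
 fixes l :: real
 assumes "l \<noteq> 0" "0 \<le> t"
 shows "(LINT s:{0..t}|lborel. exp (l * s)) = (exp (l * t) - 1) / l"
proof -
 have "(\<integral>s. exp (l * s) * indicator {0..t} s \<partial>lborel) = exp (l * t) / l - exp (l * 0) / l"
  by (rule integral_FTC_Icc_real[OF assms(2)]) (use assms(1) in \<open>auto intro!: derivative_eq_intros continuous_intros\<close>)
 thus ?thesis by (simp add: set_lebesgue_integral_def mult.commute diff_divide_distrib)
qed

context moment_path
begin

lemma Q0_nonneg: "0 \<le> Q0"
 using q_nonneg[of 1] q_le[of 1] by simp

lemma weighted_truncated:
 assumes "1 \<le> r"
 shows "w m * truncated r M g \<tau> \<phi> (x, m) = (if m \<in> slab r then min (w m * g m * heat (a m * \<tau>) \<phi> x) M else 0)"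
proof (cases "m \<in> slab r")
 case True
 hence "0 < w m" using w_pos slab_pos assms by auto
 thus ?thesis using True by (auto simp: truncated_def min_def field_simps)
qed (simp add: truncated_def)

lemma weight_slab_bound:
 assumes r: "1 \<le> r" and g: "!!m. 0 < m ==> 0 \<le> g m" "!!m. 0 < m ==> g m \<le> C * w m" "0 \<le> C"
 shows "\<exists>G. \<forall>m\<in>slab r. 0 \<le> g m \<and> g m \<le> G"
proof -
 obtain W where W: "0 \<le> W" "!!m. m \<in> slab r ==> w m \<le> W"
  by (rule w_slab_bound[OF r]) blast
 have "0 \<le> g m" "g m \<le> C * W" if "m \<in> slab r" for m
 proof -
  have "0 < m" by (rule slab_pos[OF that r])
  thus "0 \<le> g m" "g m \<le> C * W"
   using g(1,2)[of m] mult_left_mono[OF W(2)[OF that] g(3)] by auto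
 qed
 thus ?thesis by blast
qed

text \<open>The estimate common to both moments below. Outside the slab the truncated function vanishes
  although subadditivity would allow it to be positive; the resulting gain is at most \<open>c0
  M\<close> per particle outside and tends to zero with the slab.\<close>

lemma truncated_bound:
 assumes t: "t \<in> {0..T}" and g: "g \<in> bmeas borel" "!!m. 0 < m ==> 0 \<le> g m" "!!m. 0 < m ==> g m \<le> C * w m" "0 \<le> C"
  and \<phi>: "\<phi> \<in> bmeas borel" "!!x. 0 \<le> \<phi> x" "!!x. \<phi> x \<le> B" and \<tau>: "0 \<le> \<tau>" and M: "0 \<le> M"
  and h: "set_borel_measurable lborel {0..t} h" "!!s. s \<in> {0..t} ==> 0 \<le> h s" "!!s. s \<in> {0..t} ==> h s \<le> H"
  and r: "1 \<le> r"
  and coll: "!!s. s \<in> {0..t} ==> collision w k (\<rho> s) (truncated r M g (t - s + \<tau>) \<phi>)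
   \<le> 2 * (c0 * M) * pairing (\<rho> s) (off_slab r) + h s"
 shows "pairing (\<rho> t) (truncated r M g \<tau> \<phi>) \<le> C * \<eta>0 * (\<integral>x. \<phi> x \<partial>torus)
   + 2 * (c0 * M) * (LINT s:{0..t}|lborel. pairing (\<rho> s) (off_slab r)) + (LINT s:{0..t}|lborel. h s)"
  and "\<exists>B. adm RR (strip r) B (truncated r M g \<tau> \<phi>)"
proof -
 obtain G where g': "!!m. m \<in> slab r ==> 0 \<le> g m" "!!m. m \<in> slab r ==> g m \<le> G"
  using weight_slab_bound[where g=g and C=C, OF r g(2-4)] by blast
 note adm = adm_truncated[where r=r and G=G, OF r g(1) g' \<phi> M]
 show "\<exists>B. adm RR (strip r) B (truncated r M g \<tau> \<phi>)" using adm(1) by blast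
 define f where "f s = truncated r M g (t - s + \<tau>) \<phi>" for s
 have off: "set_integrable lborel {0..t} (%s. 2 * (c0 * M) * pairing (\<rho> s) (off_slab r))"
 proof (rule set_integrable_mult_right, rule set_integrable_bounded[OF off_slab_meas[OF t]])
  fix s assume "0 \<le> s" "s \<le> t"
  hence "s \<in> {0..T}" using t by auto
  thus "\<bar>pairing (\<rho> s) (off_slab r)\<bar> \<le> 1"
   using off_slab_pairing[of s r] by simp
 qed
 have h_int: "set_integrable lborel {0..t} h"
  by (rule set_integrable_bounded[OF h(1), of H]) (use h in auto)
 have "pairing (\<rho> t) (f t) \<le> C * \<eta>0 * (\<integral>x. \<phi> x \<partial>torus)
  + (LINT s:{0..t}|lborel. 2 * (c0 * M) * pairing (\<rho> s) (off_slab r) + h s)"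
 proof (rule supersolution_bound[OF r t])
  show "adm RR (strip r) (\<bar>G\<bar> * B) (f s)" for s
   unfolding f_def by (rule adm(1))
  show super: "semigroup_at a (s - u) (f s) z \<le> f u z" if "0 \<le> u" "u \<le> s" "s \<le> t" for u s z
  proof -
   have "semigroup_at a (s - u) (truncated r M g (t - s + \<tau>) \<phi>) z \<le> truncated r M g ((s - u) + (t - s + \<tau>)) \<phi> z"
    by (rule truncated_super[where G=G, OF r g(1) g' \<phi> M]) (use that \<tau> in auto)
   moreover have "(s - u) + (t - s + \<tau>) = t - u + \<tau>" by simp
   ultimately show ?thesis unfolding f_def by (simp only:)
  qed
  show "set_borel_measurable lborel {0..t} (%s. 2 * (c0 * M) * pairing (\<rho> s) (off_slab r) + h s)"
   using set_integral_add(1)[OF off h_int] unfolding set_integrable_def set_borel_measurable_def by auto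
  show "\<bar>2 * (c0 * M) * pairing (\<rho> s) (off_slab r) + h s\<bar> \<le> 2 * (c0 * M) + H" if "s \<in> {0..t}" for s
  proof -
   have "s \<in> {0..T}" using that t by auto
   hence "0 \<le> 2 * (c0 * M) * pairing (\<rho> s) (off_slab r)" "2 * (c0 * M) * pairing (\<rho> s) (off_slab r) \<le> 2 * (c0 * M) * 1"
    using off_slab_pairing[of s r] c0_nonneg M by (simp, intro mult_left_mono) auto
   thus ?thesis using h(2,3)[OF that] by simp
  qed
  show "collision w k (\<rho> s) (f s) \<le> 2 * (c0 * M) * pairing (\<rho> s) (off_slab r) + h s" if "s \<in> {0..t}" for s
   unfolding f_def by (rule coll[OF that])
  show "E0 (semigroup_at a s (f s)) \<le> C * \<eta>0 * (\<integral>x. \<phi> x \<partial>torus)" if "s \<in> {0..t}" for s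
  proof (rule E0_heat_bound[OF r _ _ \<phi> g(4)])
   show "adm RR (strip r) (\<bar>G\<bar> * B) (semigroup_at a s (f s))"
    unfolding f_def by (rule adm_semigroup[OF a_meas adm(1)])
   show "0 \<le> semigroup_at a s (f s) z" for z
    unfolding semigroup_at_def f_def case_prod_beta' by (rule heat_nonneg) (rule adm(2))
   show "semigroup_at a s (f s) (x, m) \<le> C * w m * heat (a m * (t + \<tau>)) \<phi> x" if m: "m \<in> slab r" for x m
   proof -
    have "semigroup_at a s (f s) (x, m) \<le> f 0 (x, m)"
     using super[of 0 s] \<open>s \<in> {0..t}\<close> by simp
    also have "... \<le> g m * heat (a m * (t + \<tau>)) \<phi> x"
     using m by (simp add: f_def truncated_def)
    also have "... \<le> C * w m * heat (a m * (t + \<tau>)) \<phi> x"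
     using g(3) slab_pos[OF m r] heat_nonneg[of \<phi>, OF \<phi>(2)] by (intro mult_right_mono) auto
    finally show ?thesis .
   qed
  qed
 qed
 also have "(LINT s:{0..t}|lborel. 2 * (c0 * M) * pairing (\<rho> s) (off_slab r) + h s)
  = 2 * (c0 * M) * (LINT s:{0..t}|lborel. pairing (\<rho> s) (off_slab r)) + (LINT s:{0..t}|lborel. h s)"
  by (simp add: set_integral_add(2)[OF off h_int])
 finally show "pairing (\<rho> t) (truncated r M g \<tau> \<phi>) \<le> C * \<eta>0 * (\<integral>x. \<phi> x \<partial>torus)
   + 2 * (c0 * M) * (LINT s:{0..t}|lborel. pairing (\<rho> s) (off_slab r)) + (LINT s:{0..t}|lborel. h s)"
  by (simp add: f_def)
qed

text \<open>The weight \<open>w\<^sup>2 q\<close> divided by \<open>sqrt a\<close> is subadditive, so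
  \<open>heat_subadditive\<close> makes its gain no larger than its loss and coagulation does not
  increase the moment. Keeping \<open>\<phi>\<close> in the statement localises the bound in
  space.\<close>

theorem weighted_estimate:
 assumes t: "t \<in> {0..T}" and \<phi>: "\<phi> \<in> bmeas borel" "!!x. 0 \<le> \<phi> x" "!!x. \<phi> x \<le> B" and \<tau>: "0 \<le> \<tau>"
 shows "nnpair (\<rho> t) (%(x, m). ennreal (w m * q m * heat (a m * \<tau>) \<phi> x)) \<le> ennreal (Q0 * \<eta>0 * (\<integral>x. \<phi> x \<partial>torus))"
proof -
 let ?g = "%m. w m * q m"
 have g: "?g \<in> bmeas borel" "!!m. 0 < m ==> 0 \<le> ?g m" "!!m. 0 < m ==> ?g m \<le> Q0 * w m"
  using w_meas q_meas by (auto simp: w_pos less_imp_le q_nonneg q_le mult.commute[of Q0] intro: mult_left_mono)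
 have coll: "collision w k (\<rho> s) (truncated r M ?g \<sigma> \<phi>) \<le> 2 * (c0 * M) * pairing (\<rho> s) (off_slab r) + 0"
  if r: "1 \<le> r" and M: "0 \<le> M" and s: "s \<in> {0..T}" and \<sigma>: "0 \<le> \<sigma>" for r M s \<sigma>
 proof -
  obtain G where g': "!!m. m \<in> slab r ==> 0 \<le> ?g m" "!!m. m \<in> slab r ==> ?g m \<le> G"
   using weight_slab_bound[where g="?g", OF r g(2,3) Q0_nonneg] by blast
  have "collision w k (\<rho> s) (truncated r M ?g \<sigma> \<phi>) \<le> 2 * pairing (\<rho> s) (%z. (c0 * M) * off_slab r z)"
  proof (rule collision_le_sum[OF kernel[OF s] r adm_truncated(1)[where r=r and G=G, OF r g(1) g' \<phi> M]])
   show "(%z. c0 * M * off_slab r z) \<in> bmeas RR" using off_slab(1) by measurable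
   show "0 \<le> c0 * M * off_slab r z" for z using c0_nonneg M off_slab(2) by simp
   show "c0 * M * off_slab r z \<le> c0 * M" for z using c0_nonneg M off_slab(3) by (simp add: mult_left_le)
   show "gain_loss w (truncated r M ?g \<sigma> \<phi>) x m m' * k m m' \<le> c0 * M * off_slab r (x, m) + c0 * M * off_slab r (x, m')" for x m m'
   proof (cases "k m m' = 0")
    case True
    thus ?thesis using c0_nonneg M off_slab(2) by simp
   next
    case False
    hence m: "0 < m" "0 < m'" using k_pos by auto
    let ?\<Phi> = "%m. w m * ?g m * heat (a m * \<sigma>) \<phi> x"
    have nn: "0 \<le> w m * ?g m" if "0 < m" for m
     using w_pos[OF that] q_nonneg[OF that] by simp
    have sub: "?\<Phi> (m + m') \<le> ?\<Phi> m + ?\<Phi> m'"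
     using heat_subadditive[OF m \<phi>, of "%m. w m * ?g m" \<sigma> x] awq_sub[OF m] \<sigma>
      nn[OF m(1)] nn[OF m(2)] nn[OF add_pos_pos[OF m]]
     by (simp add: power2_eq_square mult.assoc)
    have \<Phi>: "0 \<le> ?\<Phi> m" "0 \<le> ?\<Phi> m'"
     using mult_nonneg_nonneg[OF nn heat_nonneg[of \<phi>, OF \<phi>(2)]] m by blast+
    have "gain_loss w (truncated r M ?g \<sigma> \<phi>) x m m' \<le> M * (off_slab r (x, m) + off_slab r (x, m'))"
     unfolding gain_loss_def weighted_truncated[OF r]
     using sub \<Phi> M by (auto simp: off_slab_def min_def)
    hence "gain_loss w (truncated r M ?g \<sigma> \<phi>) x m m' * k m m' \<le> (M * (off_slab r (x, m) + off_slab r (x, m'))) * c0"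
     using M off_slab(2) by (intro order_trans[OF mult_right_mono[OF _ k_nonneg] mult_left_mono[OF k_le]]) auto
    thus ?thesis by (simp add: algebra_simps)
   qed
  qed
  thus ?thesis by (simp add: pairing_scale)
 qed
 have bound: "pairing (\<rho> t) (truncated (real (Suc n)) (real M) ?g \<tau> \<phi>) \<le> Q0 * \<eta>0 * (\<integral>x. \<phi> x \<partial>torus)
   + 2 * (c0 * real M) * (LINT s:{0..t}|lborel. pairing (\<rho> s) (off_slab (real (Suc n)))) + (LINT s:{0..t}|lborel. 0)"
  "\<exists>B. adm RR (strip (real (Suc n))) B (truncated (real (Suc n)) (real M) ?g \<tau> \<phi>)" for n M
 proof -
  note * = truncated_bound[OF t g Q0_nonneg \<phi> \<tau>, where H=0 and h="%_. 0" and r="real (Suc n)" and M="real M"]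
  show "pairing (\<rho> t) (truncated (real (Suc n)) (real M) ?g \<tau> \<phi>) \<le> Q0 * \<eta>0 * (\<integral>x. \<phi> x \<partial>torus)
   + 2 * (c0 * real M) * (LINT s:{0..t}|lborel. pairing (\<rho> s) (off_slab (real (Suc n)))) + (LINT s:{0..t}|lborel. 0)"
   by (rule *(1)) (use t \<tau> in \<open>auto simp: set_borel_measurable_def intro!: coll[simplified]\<close>)
  show "\<exists>B. adm RR (strip (real (Suc n))) B (truncated (real (Suc n)) (real M) ?g \<tau> \<phi>)"
   by (rule *(2)) (use t \<tau> in \<open>auto simp: set_borel_measurable_def intro!: coll[simplified]\<close>)
 qed
 have lim: "(%n. Q0 * \<eta>0 * (\<integral>x. \<phi> x \<partial>torus) + 2 * (c0 * real M) * (LINT s:{0..t}|lborel. pairing (\<rho> s) (off_slab (real (Suc n)))) + (LINT s:{0..t}|lborel. 0))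
  \<longlonglongrightarrow> Q0 * \<eta>0 * (\<integral>x. \<phi> x \<partial>torus) + 2 * (c0 * real M) * 0 + (LINT s:{0..t}|lborel. 0)" for M
  by (intro tendsto_intros off_slab_limit[OF t])
 show ?thesis
 proof (rule truncation_limit[OF t g(1,2) \<phi>])
  show "\<exists>B. adm RR (strip (real (Suc n))) B (truncated (real (Suc n)) (real M) ?g \<tau> \<phi>)" for n M
   by (rule bound(2))
  show "pairing (\<rho> t) (truncated (real (Suc n)) (real M) ?g \<tau> \<phi>) \<le> Q0 * \<eta>0 * (\<integral>x. \<phi> x \<partial>torus)
   + 2 * (c0 * real M) * (LINT s:{0..t}|lborel. pairing (\<rho> s) (off_slab (real (Suc n)))) + (LINT s:{0..t}|lborel. 0)" for n M
   by (rule bound(1))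
  show "(%n. Q0 * \<eta>0 * (\<integral>x. \<phi> x \<partial>torus) + 2 * (c0 * real M) * (LINT s:{0..t}|lborel. pairing (\<rho> s) (off_slab (real (Suc n)))) + (LINT s:{0..t}|lborel. 0))
   \<longlonglongrightarrow> Q0 * \<eta>0 * (\<integral>x. \<phi> x \<partial>torus)" for M
   using lim[of M] by simp
 qed
qed

end

section \<open>The collision term of a capped moment\<close>

context moment_path
begin

text \<open>The weight \<open>w\<close> cut off at height \<open>L\<close>. The moment of the capped weight
  is finite a priori, which the Gronwall argument needs, and its bound will not depend on
  \<open>L\<close>.\<close>

definition capped :: "real => real => real"
 where "capped L m = (if 0 < m then min (w m) L else 0)"

definition capped_test :: "real => (real => real) => real => real \<times> real => real"
 where "capped_test L \<phi> \<tau> = (%(x, m). capped L m * heat (a m * \<tau>) \<phi> x)"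

lemma capped:
 assumes "0 \<le> L"
 shows "capped L \<in> bmeas borel" "0 \<le> capped L m" "capped L m \<le> L" "0 < m ==> capped L m \<le> w m"
 using w_meas w_pos[of m] assms by (auto simp: capped_def[abs_def] less_imp_le)

lemma capped_test:
 assumes L: "0 \<le> L" and \<phi>: "\<phi> \<in> bmeas borel" "!!x. 0 \<le> \<phi> x" "!!x. \<phi> x \<le> B"
 shows "capped_test L \<phi> \<tau> \<in> bmeas RR" "0 \<le> capped_test L \<phi> \<tau> z" "capped_test L \<phi> \<tau> z \<le> L * B"
proof -
 note [measurable] = capped(1)[OF L] a_meas \<phi>(1)
 have [measurable]: "(%z. heat (a (snd z) * \<tau>) \<phi> (fst z)) \<in> bmeas RR"
  by (rule measurable_heat) measurable
 have "(%z. capped L (snd z) * heat (a (snd z) * \<tau>) \<phi> (fst z)) \<in> bmeas RR" by measurable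
 thus "capped_test L \<phi> \<tau> \<in> bmeas RR"
  by (simp add: capped_test_def case_prod_beta')
 have B: "\<bar>\<phi> x\<bar> \<le> B" for x using \<phi>(2,3)[of x] by auto
 have h: "0 \<le> heat v \<phi> x" "heat v \<phi> x \<le> B" for v x
  using heat_nonneg[of \<phi>, OF \<phi>(2)] abs_heat_le[OF \<phi>(1) B, of v x] by auto
 show "0 \<le> capped_test L \<phi> \<tau> z" "capped_test L \<phi> \<tau> z \<le> L * B"
  using capped[OF L] h L unfolding capped_test_def case_prod_beta' by (auto intro!: mult_mono)
qed

text \<open>The averages of the preserved moment over sets of positions are bounded by the measure of the
  set, by its estimate for indicators; a pointwise bound follows.\<close>

lemma weighted_AE:
 assumes t: "t \<in> {0..T}"
 shows "AE x in torus. (\<integral>\<^sup>+m. ennreal (w m * q m) \<partial>\<rho> t x) \<le> ennreal (Q0 * \<eta>0)"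
proof (rule AE_le_of_averages)
 note k = kernel[OF t]
 have wq: "(%m. ennreal (w m * q m)) \<in> bmeas borel" using w_meas q_meas by measurable
 show "(%x. \<integral>\<^sup>+m. ennreal (w m * q m) \<partial>\<rho> t x) \<in> bmeas borel"
  by (rule subkernel_nn_integral_measurable[OF k]) (use wq in \<open>auto simp: case_prod_beta' intro: measurable_compose[OF measurable_snd]\<close>)
 show "0 \<le> Q0 * \<eta>0" using Q0_nonneg \<eta>0(1) by simp
 fix A :: "real set" assume A: "A \<in> sets borel"
 have \<phi>: "indicator A \<in> bmeas borel" "!!x. 0 \<le> (indicator A x :: real)" "!!x. (indicator A x :: real) \<le> 1"
  using A by (auto simp: indicator_def)
 have "(\<integral>\<^sup>+x. (\<integral>\<^sup>+m. ennreal (w m * q m) \<partial>\<rho> t x) * indicator A x \<partial>torus)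
  = nnpair (\<rho> t) (%(x, m). ennreal (w m * q m * heat (a m * 0) (indicator A) x))"
  unfolding nnpair_def
 proof (rule nn_integral_cong)
  fix x assume "x \<in> space torus"
  hence "heat (a m * 0) (indicator A) x = indicator A x" for m
   using heat_zero[of x "indicator A"] by simp
  thus "(\<integral>\<^sup>+m. ennreal (w m * q m) \<partial>\<rho> t x) * indicator A x
   = (\<integral>\<^sup>+m. (case (x, m) of (x, m) => ennreal (w m * q m * heat (a m * 0) (indicator A) x)) \<partial>\<rho> t x)"
   by (auto simp: indicator_def)
 qed
 also have "... \<le> ennreal (Q0 * \<eta>0 * (\<integral>x. indicator A x \<partial>torus))"
  by (rule weighted_estimate[OF t \<phi>]) simp
 also have "... = ennreal (Q0 * \<eta>0) * (\<integral>\<^sup>+x. indicator A x \<partial>torus)"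
  using torus_integral_nn[OF \<phi>] Q0_nonneg \<eta>0(1) by (simp add: ennreal_mult ennreal_indicator)
 finally show "(\<integral>\<^sup>+x. (\<integral>\<^sup>+m. ennreal (w m * q m) \<partial>\<rho> t x) * indicator A x \<partial>torus) \<le> ennreal (Q0 * \<eta>0) * (\<integral>\<^sup>+x. indicator A x \<partial>torus)" .
qed

text \<open>The weight \<open>w\<^sup>2\<close> is not subadditive after division by \<open>sqrt a\<close>,
  only \<open>w\<close> is. Expanding \<open>w (m + m') \<le> w m + w m'\<close> leaves mixed
  terms, and the second bound \<open>k \<le> c0 (q + q')\<close> on the rate turns each of them
  into a product of a moment that is already controlled and a capped moment.\<close>

lemma capped_gain:
 fixes x :: real
 assumes m: "0 < m" "0 < m'" and L: "0 \<le> L" and M: "0 \<le> M" and r: "1 \<le> r" and \<tau>: "0 \<le> \<tau>"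
  and \<phi>: "\<phi> \<in> bmeas borel" "!!x. 0 \<le> \<phi> x" "!!x. \<phi> x \<le> B"
 defines "h \<equiv> %m. heat (a m * \<tau>) \<phi> x"
 shows "gain_loss w (truncated r M (capped L) \<tau> \<phi>) x m m' * k m m'
  \<le> c0 * M * off_slab r (x, m) + c0 * M * off_slab r (x, m')
   + c0 * ((w m * q m * h m) * capped L m' + (capped L m * h m) * (w m' * q m')
    + (w m' * q m' * h m') * capped L m + (capped L m' * h m') * (w m * q m))"
proof -
 have mm: "0 < m + m'" using m by simp
 have h: "0 \<le> h m" for m unfolding h_def by (rule heat_nonneg[OF \<phi>(2)])
 have wp: "0 < w m" "0 < w m'" "0 < w (m + m')" using w_pos m by auto
 have qp: "0 \<le> q m" "0 \<le> q m'" using q_nonneg m by auto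
 let ?v = "capped L"
 have v: "0 \<le> ?v m" "?v m \<le> L" for m using capped[OF L] by auto
 have vw: "?v m \<le> w m" "?v m' \<le> w m'" "?v (m + m') \<le> w (m + m')" using capped(4)[OF L] m mm by auto
 have sub: "w (m + m') * h (m + m') \<le> w m * h m + w m' * h m'"
  unfolding h_def by (rule heat_subadditive[OF m \<phi> _ _ _ _ \<tau>]) (use wp aw_sub[OF m] in auto)
 define X where "X = (if w m < L then ?v m' * (w m * h m) else 0)"
 define X' where "X' = (if w m' < L then ?v m * (w m' * h m') else 0)"
 have X0: "0 \<le> X" "0 \<le> X'" using v wp h by (auto simp: X_def X'_def)
 have cap1: "?v (m + m') * (w m * h m) \<le> ?v m * (w m * h m) + X"
 proof -
  have "?v (m + m') \<le> ?v m + (if w m < L then ?v m' else 0)"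
   using w_sub[OF m] m mm L wp by (auto simp: capped_def min_def)
  from mult_right_mono[OF this, of "w m * h m"] wp h show ?thesis by (auto simp: X_def distrib_right)
 qed
 have cap2: "?v (m + m') * (w m' * h m') \<le> ?v m' * (w m' * h m') + X'"
 proof -
  have "?v (m + m') \<le> ?v m' + (if w m' < L then ?v m else 0)"
   using w_sub[OF m] m mm L wp by (auto simp: capped_def min_def)
  from mult_right_mono[OF this, of "w m' * h m'"] wp h show ?thesis by (auto simp: X'_def distrib_right)
 qed
 let ?G = "%m. w m * ?v m * h m"
 have "?G (m + m') = ?v (m + m') * (w (m + m') * h (m + m'))" by simp
 also have "... \<le> ?v (m + m') * (w m * h m + w m' * h m')"
  by (rule mult_left_mono[OF sub v(1)])
 also have "... \<le> ?G m + ?G m' + X + X'"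
  using cap1 cap2 by (simp add: distrib_left mult.commute mult.left_commute)
 finally have G: "?G (m + m') \<le> ?G m + ?G m' + X + X'" .
 have G0: "0 \<le> ?G m" "0 \<le> ?G m'" using wp v h by simp_all
 have "gain_loss w (truncated r M ?v \<tau> \<phi>) x m m' \<le> M * (off_slab r (x, m) + off_slab r (x, m')) + X + X'"
  unfolding gain_loss_def weighted_truncated[OF r] h_def[symmetric]
  using G[unfolded h_def] G0[unfolded h_def] M X0 by (auto simp: off_slab_def min_def)
 hence "gain_loss w (truncated r M ?v \<tau> \<phi>) x m m' * k m m'
  \<le> (M * (off_slab r (x, m) + off_slab r (x, m')) + X + X') * k m m'"
  by (rule mult_right_mono[OF _ k_nonneg])
 also have "... = M * (off_slab r (x, m) + off_slab r (x, m')) * k m m' + X * k m m' + X' * k m m'"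
  by (simp add: distrib_right)
 also have "... \<le> M * (off_slab r (x, m) + off_slab r (x, m')) * c0
  + c0 * ((w m * q m * h m) * ?v m' + (?v m * h m) * (w m' * q m'))
  + c0 * ((w m' * q m' * h m') * ?v m + (?v m' * h m') * (w m * q m))"
 proof (intro add_mono)
  show "M * (off_slab r (x, m) + off_slab r (x, m')) * k m m' \<le> M * (off_slab r (x, m) + off_slab r (x, m')) * c0"
   using M off_slab(2) by (intro mult_left_mono[OF k_le]) auto
  have c0: "0 \<le> c0" by (rule c0_nonneg)
  have "X * k m m' \<le> X * (c0 * (q m + q m'))" by (rule mult_left_mono[OF k_q[OF m] X0(1)])
  also have "... = c0 * (X * q m + X * q m')" by (simp add: algebra_simps)
  also have "... \<le> c0 * ((w m * q m * h m) * ?v m' + (?v m * h m) * (w m' * q m'))"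
  proof (intro mult_left_mono[OF _ c0] add_mono)
   have "X \<le> (w m * h m) * ?v m'" using v wp h by (auto simp: X_def mult.commute)
   from mult_right_mono[OF this qp(1)] show "X * q m \<le> (w m * q m * h m) * ?v m'" by (simp add: mult_ac)
   have "X \<le> (?v m * h m) * w m'"
   proof (cases "w m < L")
    case True
    hence "?v m = w m" using m by (simp add: capped_def)
    hence "X = (?v m * h m) * ?v m'" using True by (simp add: X_def mult_ac)
    thus ?thesis using vw(2) v h by (simp add: mult_left_mono)
   qed (use v h wp in \<open>simp add: X_def\<close>)
   from mult_right_mono[OF this qp(2)] show "X * q m' \<le> (?v m * h m) * (w m' * q m')" by (simp add: mult_ac)
  qed
  finally show "X * k m m' \<le> c0 * ((w m * q m * h m) * ?v m' + (?v m * h m) * (w m' * q m'))" .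
  have "X' * k m m' \<le> X' * (c0 * (q m + q m'))" by (rule mult_left_mono[OF k_q[OF m] X0(2)])
  also have "... = c0 * (X' * q m' + X' * q m)" by (simp add: algebra_simps)
  also have "... \<le> c0 * ((w m' * q m' * h m') * ?v m + (?v m' * h m') * (w m * q m))"
  proof (intro mult_left_mono[OF _ c0] add_mono)
   have "X' \<le> (w m' * h m') * ?v m" using v wp h by (auto simp: X'_def mult.commute)
   from mult_right_mono[OF this qp(2)] show "X' * q m' \<le> (w m' * q m' * h m') * ?v m" by (simp add: mult_ac)
   have "X' \<le> (?v m' * h m') * w m"
   proof (cases "w m' < L")
    case True
    hence "?v m' = w m'" using m by (simp add: capped_def)
    hence "X' = (?v m' * h m') * ?v m" using True by (simp add: X'_def mult_ac)
    thus ?thesis using vw(1) v h by (simp add: mult_left_mono)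
   qed (use v h wp in \<open>simp add: X'_def\<close>)
   from mult_right_mono[OF this qp(1)] show "X' * q m \<le> (?v m' * h m') * (w m * q m)" by (simp add: mult_ac)
  qed
  finally show "X' * k m m' \<le> c0 * ((w m' * q m' * h m') * ?v m + (?v m' * h m') * (w m * q m))" .
 qed
 finally show ?thesis by (simp add: algebra_simps)
qed

text \<open>Given a common bound \<open>A\<close> for the capped moments at time \<open>s\<close>, the
  collision term is of order \<open>A\<close>. The products of moments at one position are
  integrated by using the pointwise bound on one factor, or by regarding the normalised localised
  moment as a new function \<open>\<psi>\<close>.\<close>

lemma capped_collision:
 assumes s: "s \<in> {0..T}" and L: "0 \<le> L" and M: "0 \<le> M" and r: "1 \<le> r" and \<tau>: "0 \<le> \<tau>"
  and \<phi>: "\<phi> \<in> bmeas borel" "!!x. 0 \<le> \<phi> x" "!!x. \<phi> x \<le> B" "(\<integral>x. \<phi> x \<partial>torus) \<le> 1"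
  and A: "0 \<le> A" "!!\<psi> \<sigma>. \<psi> \<in> bmeas borel ==> (!!x. 0 \<le> \<psi> x) ==> (!!x. \<psi> x \<le> B) ==> (\<integral>x. \<psi> x \<partial>torus) \<le> 1
   ==> 0 \<le> \<sigma> ==> pairing (\<rho> s) (capped_test L \<psi> \<sigma>) \<le> A"
  and C1: "C1 = Q0 * \<eta>0 + 1"
 shows "collision w k (\<rho> s) (truncated r M (capped L) \<tau> \<phi>) \<le> 2 * (c0 * M) * pairing (\<rho> s) (off_slab r) + 4 * c0 * C1 * A"
proof -
 note k = kernel[OF s]
 interpret K: subprob_space "\<rho> s x" for x by (rule subkernel_subprob[OF k])
 have C1p: "0 < C1" "Q0 * \<eta>0 \<le> C1" using Q0_nonneg \<eta>0(1) by (auto simp: C1 add_nonneg_pos)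
 have B0: "0 \<le> B" using \<phi>(2,3)[of 0] by linarith
 have B: "\<bar>\<phi> x\<bar> \<le> B" for x using \<phi>(2,3)[of x] by auto
 let ?h = "%x m. heat (a m * \<tau>) \<phi> x"
 have h: "0 \<le> ?h x m" "?h x m \<le> B" for x m
  using heat_nonneg[of \<phi>, OF \<phi>(2)] abs_heat_le[OF \<phi>(1) B, of "a m * \<tau>" x] by auto
 let ?v = "capped L"
 note [measurable] = capped(1)[OF L] a_meas \<phi>(1) w_meas q_meas
 have hm [measurable]: "(%z. ?h (fst z) (snd z)) \<in> bmeas RR"
  by (rule measurable_heat) measurable
 define \<Gamma> where "\<Gamma> m = ennreal (w m * q m)" for m
 define Y where "Y z = ennreal (w (snd z) * q (snd z) * ?h (fst z) (snd z))" for z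
 define Z where "Z z = ennreal (capped_test L \<phi> \<tau> z)" for z
 define V where "V m = ennreal (?v m)" for m
 have Ym: "Y \<in> bmeas RR" and Zm: "Z \<in> bmeas RR"
  unfolding Y_def Z_def using capped_test(1)[OF L \<phi>(1-3)] by measurable
 have \<Gamma>m: "\<Gamma> \<in> bmeas borel" and Vm: "V \<in> bmeas borel" unfolding \<Gamma>_def V_def by measurable
 define \<gamma> where "\<gamma> x = (\<integral>\<^sup>+m. \<Gamma> m \<partial>\<rho> s x)" for x
 define \<beta> where "\<beta> x = (\<integral>\<^sup>+m. V m \<partial>\<rho> s x)" for x
 define y where "y x = (\<integral>\<^sup>+m. Y (x, m) \<partial>\<rho> s x)" for x
 define z where "z x = (\<integral>\<^sup>+m. Z (x, m) \<partial>\<rho> s x)" for x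
 have meas1: "(%x. \<integral>\<^sup>+m. g m \<partial>\<rho> s x) \<in> bmeas borel" if "g \<in> bmeas borel" for g :: "real => ennreal"
  by (rule subkernel_nn_integral_measurable[OF k]) (use that in \<open>auto simp: case_prod_beta' intro: measurable_compose[OF measurable_snd]\<close>)
 have \<gamma>m [measurable]: "\<gamma> \<in> bmeas borel"
  unfolding \<gamma>_def[abs_def] by (rule meas1[OF \<Gamma>m])
 have \<beta>m [measurable]: "\<beta> \<in> bmeas borel"
  unfolding \<beta>_def[abs_def] by (rule meas1[OF Vm])
 have ym [measurable]: "y \<in> bmeas borel" and zm [measurable]: "z \<in> bmeas borel"
  unfolding y_def z_def by (rule nnpair_inner_measurable[OF k Ym] nnpair_inner_measurable[OF k Zm])+
 have \<gamma>_AE: "AE x in torus. \<gamma> x \<le> ennreal C1"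
  using weighted_AE[OF s] unfolding \<gamma>_def \<Gamma>_def
  by (rule eventually_mono) (use C1p(2) in \<open>auto intro: order_trans ennreal_leI\<close>)
 have y_\<gamma>: "y x \<le> ennreal B * \<gamma> x" for x
 proof -
  have "Y (x, m) \<le> ennreal B * \<Gamma> m" for m
  proof -
   have hx: "0 \<le> ?h x m" "?h x m \<le> B" by (rule h)+
   show ?thesis
   proof (cases "0 \<le> w m * q m")
   case True
   hence "w m * q m * ?h x m \<le> B * (w m * q m)"
    using mult_left_mono[OF hx(2), of "w m * q m"] by (simp only: mult.commute[of B])
   thus ?thesis using True B0 unfolding Y_def \<Gamma>_def by (simp add: ennreal_mult[symmetric] ennreal_leI)
  next
   case False
   hence "w m * q m * ?h x m \<le> 0" using hx(1) by (metis mult_nonpos_nonneg nle_le)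
   thus ?thesis unfolding Y_def by (simp add: ennreal_neg)
   qed
  qed
  hence "y x \<le> (\<integral>\<^sup>+m. ennreal B * \<Gamma> m \<partial>\<rho> s x)"
   unfolding y_def by (intro nn_integral_mono)
  also have "... = ennreal B * \<gamma> x"
   unfolding \<gamma>_def by (intro nn_integral_cmult subkernel_measurable[OF k \<Gamma>m])
  finally show ?thesis .
 qed
 define \<psi> where "\<psi> x = min (enn2real (y x)) (B * C1) / C1" for x
 have \<psi>: "\<psi> \<in> bmeas borel" "!!x. 0 \<le> \<psi> x" "!!x. \<psi> x \<le> B"
 proof -
  show "\<psi> \<in> bmeas borel" unfolding \<psi>_def by measurable
  show "0 \<le> \<psi> x" for x using C1p B0 by (simp add: \<psi>_def)
  show "\<psi> x \<le> B" for x using C1p by (simp add: \<psi>_def divide_le_eq)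
 qed
 have y_\<psi>: "AE x in torus. y x = ennreal (C1 * \<psi> x)"
  using \<gamma>_AE
 proof (rule eventually_mono)
  fix x assume "\<gamma> x \<le> ennreal C1"
  hence "y x \<le> ennreal B * ennreal C1"
   by (intro order_trans[OF y_\<gamma> mult_left_mono]) auto
  hence le: "y x \<le> ennreal (B * C1)" using B0 C1p by (simp add: ennreal_mult)
  hence "enn2real (y x) \<le> B * C1" using B0 C1p by (intro enn2real_leI) auto
  moreover have "y x < top" using le by (rule le_less_trans) simp
  ultimately show "y x = ennreal (C1 * \<psi> x)" using C1p by (simp add: \<psi>_def)
 qed
 have \<psi>_int: "(\<integral>x. \<psi> x \<partial>torus) \<le> 1"
 proof -
  have "ennreal (C1 * (\<integral>x. \<psi> x \<partial>torus)) = ennreal C1 * (\<integral>\<^sup>+x. ennreal (\<psi> x) \<partial>torus)"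
   using torus_integral_nn[OF \<psi>] C1p by (simp add: ennreal_mult)
  also have "... = (\<integral>\<^sup>+x. ennreal C1 * ennreal (\<psi> x) \<partial>torus)"
   using \<psi>(1) by (intro nn_integral_cmult[symmetric] measurable_torus) measurable
  also have "... = (\<integral>\<^sup>+x. y x \<partial>torus)"
   using y_\<psi> C1p \<psi>(2) by (intro nn_integral_cong_AE) (auto elim: eventually_mono simp: ennreal_mult)
  also have "... = nnpair (\<rho> s) (%(x, m). ennreal (w m * q m * ?h x m))"
   unfolding nnpair_def y_def Y_def by simp
  also have "... \<le> ennreal (Q0 * \<eta>0 * (\<integral>x. \<phi> x \<partial>torus))"
   by (rule weighted_estimate[OF s \<phi>(1-3) \<tau>])
  also have "... \<le> ennreal (C1 * 1)"
   using C1p(2) less_imp_le[OF C1p(1)] \<phi>(4) Q0_nonneg \<eta>0(1) torus_integral_nn(2)[OF \<phi>(1-3)] by (intro ennreal_leI mult_mono) auto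
  finally show ?thesis using C1p by (subst (asm) ennreal_le_iff) auto
 qed
 have test_nn: "nnpair (\<rho> s) (%z. ennreal (capped_test L \<psi> \<sigma> z)) \<le> ennreal A"
  if "\<psi> \<in> bmeas borel" "!!x. 0 \<le> \<psi> x" "!!x. \<psi> x \<le> B" "(\<integral>x. \<psi> x \<partial>torus) \<le> 1" "0 \<le> \<sigma>" for \<psi> \<sigma>
 proof -
  have "nnpair (\<rho> s) (%z. ennreal (capped_test L \<psi> \<sigma> z)) = ennreal (pairing (\<rho> s) (capped_test L \<psi> \<sigma>))"
   by (rule nnpair_eq_pairing[OF k capped_test[OF L that(1-3)]])
  thus ?thesis using A(2)[OF that] by (simp add: ennreal_leI)
 qed
 have y\<beta>: "(\<integral>\<^sup>+x. y x * \<beta> x \<partial>torus) \<le> ennreal (C1 * A)"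
 proof -
  have "(\<integral>\<^sup>+x. y x * \<beta> x \<partial>torus) = (\<integral>\<^sup>+x. ennreal C1 * (ennreal (\<psi> x) * \<beta> x) \<partial>torus)"
   using y_\<psi> C1p \<psi>(2) by (intro nn_integral_cong_AE) (auto elim!: eventually_mono simp: ennreal_mult mult.assoc)
  also have "... = ennreal C1 * (\<integral>\<^sup>+x. ennreal (\<psi> x) * \<beta> x \<partial>torus)"
   by (intro nn_integral_cmult measurable_torus borel_measurable_times_ennreal \<beta>m measurable_compose[OF \<psi>(1)]) simp
  also have "(\<integral>\<^sup>+x. ennreal (\<psi> x) * \<beta> x \<partial>torus) = nnpair (\<rho> s) (%z. ennreal (capped_test L \<psi> 0 z))"
   unfolding nnpair_def
  proof (rule nn_integral_cong)
   fix x assume "x \<in> space torus"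
   hence "capped_test L \<psi> 0 (x, m) = \<psi> x * ?v m" for m
    using heat_zero[of x \<psi>] by (simp add: capped_test_def)
   hence "ennreal (capped_test L \<psi> 0 (x, m)) = ennreal (\<psi> x) * V m" for m
    using \<psi>(2) capped(2)[OF L] by (simp add: V_def ennreal_mult)
   thus "ennreal (\<psi> x) * \<beta> x = (\<integral>\<^sup>+m. ennreal (capped_test L \<psi> 0 (x, m)) \<partial>\<rho> s x)"
    unfolding \<beta>_def by (simp add: nn_integral_cmult subkernel_measurable[OF k Vm])
  qed
  also have "ennreal C1 * ... \<le> ennreal C1 * ennreal A"
   by (intro mult_left_mono test_nn \<psi> \<psi>_int) auto
  finally show ?thesis using C1p A(1) by (simp add: ennreal_mult)
 qed
 have z\<gamma>: "(\<integral>\<^sup>+x. z x * \<gamma> x \<partial>torus) \<le> ennreal (C1 * A)"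
 proof -
  have "(\<integral>\<^sup>+x. z x * \<gamma> x \<partial>torus) \<le> (\<integral>\<^sup>+x. ennreal C1 * z x \<partial>torus)"
   using \<gamma>_AE by (intro nn_integral_mono_AE) (auto elim!: eventually_mono simp: mult.commute[of "z _"] intro: mult_right_mono)
  also have "... = ennreal C1 * (\<integral>\<^sup>+x. z x \<partial>torus)"
   by (intro nn_integral_cmult measurable_torus) measurable
  also have "(\<integral>\<^sup>+x. z x \<partial>torus) = nnpair (\<rho> s) (%z. ennreal (capped_test L \<phi> \<tau> z))"
   unfolding nnpair_def z_def Z_def ..
  also have "ennreal C1 * ... \<le> ennreal C1 * ennreal A"
   by (intro mult_left_mono test_nn \<phi> \<tau>) auto
  finally show ?thesis using C1p A(1) by (simp add: ennreal_mult)
 qed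
 have "\<exists>G. \<forall>m\<in>slab r. 0 \<le> ?v m \<and> ?v m \<le> G"
  using capped[OF L] by blast
 then obtain G where G: "!!m. m \<in> slab r ==> 0 \<le> ?v m" "!!m. m \<in> slab r ==> ?v m \<le> G" by blast
 let ?O = "%x m. ennreal (c0 * M * off_slab r (x, m))"
 have Om: "(%z. ennreal (c0 * M * off_slab r z)) \<in> bmeas RR" using off_slab(1) by measurable
 define R where "R x m m' = (?O x m + ?O x m') + ennreal c0 * ((Y (x, m) * V m' + Z (x, m) * \<Gamma> m') + (Y (x, m') * V m + Z (x, m') * \<Gamma> m))" for x m m'
 show ?thesis
 proof (rule collision_le_nn[OF k r adm_truncated(1)[where r=r and G=G, OF r capped(1)[OF L] G \<phi>(1-3) M], of \<tau> R])
  fix x m m'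
  show "ennreal (gain_loss w (truncated r M ?v \<tau> \<phi>) x m m' * k m m') \<le> R x m m'"
  proof (cases "k m m' = 0")
   case False
   hence m: "0 < m" "0 < m'" using k_pos by auto
   have wq: "0 \<le> w m * q m" "0 \<le> w m' * q m'" using w_pos q_nonneg m by (auto simp: less_imp_le)
   have v: "0 \<le> ?v m" "0 \<le> ?v m'" using capped(2)[OF L] by auto
   have o: "0 \<le> c0 * M * off_slab r z" for z using c0_nonneg M off_slab(2) by simp
   have "R x m m' = ennreal (c0 * M * off_slab r (x, m) + c0 * M * off_slab r (x, m')
    + c0 * ((w m * q m * ?h x m) * ?v m' + (?v m * ?h x m) * (w m' * q m')
    + (w m' * q m' * ?h x m') * ?v m + (?v m' * ?h x m') * (w m * q m)))"
    unfolding R_def Y_def Z_def V_def \<Gamma>_def capped_test_def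
    using wq v o h(1) c0_nonneg by (simp add: ennreal_plus[symmetric] ennreal_mult[symmetric] add.assoc del: ennreal_plus)
   thus ?thesis
    using capped_gain[OF m L M r \<tau> \<phi>(1-3), of x] by (simp add: ennreal_leI)
  qed simp
 next
  have inner: "(\<integral>\<^sup>+m. (\<integral>\<^sup>+m'. R x m m' \<partial>\<rho> s x) \<partial>\<rho> s x)
   \<le> 2 * (\<integral>\<^sup>+m. ?O x m \<partial>\<rho> s x) + ennreal c0 * (2 * (y x * \<beta> x + z x * \<gamma> x))" for x
  proof -
   have sec [measurable]: "(%m. ?O x m) \<in> bmeas (\<rho> s x)" "(%m. Y (x, m)) \<in> bmeas (\<rho> s x)"
    "(%m. Z (x, m)) \<in> bmeas (\<rho> s x)" "\<Gamma> \<in> bmeas (\<rho> s x)" "V \<in> bmeas (\<rho> s x)"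
    using measurable_section_nn[OF Om, of x] measurable_section_nn[OF Ym, of x] measurable_section_nn[OF Zm, of x] \<Gamma>m Vm
    by (auto intro: subkernel_measurable[OF k])
   have R1: "(\<integral>\<^sup>+m'. R x m m' \<partial>\<rho> s x) = (\<integral>\<^sup>+m'. ?O x m + ?O x m' \<partial>\<rho> s x)
    + ennreal c0 * ((Y (x, m) * \<beta> x + Z (x, m) * \<gamma> x) + (y x * V m + z x * \<Gamma> m))" for m
    unfolding R_def
    by (simp add: nn_integral_add nn_integral_cmult nn_integral_multc flip: \<beta>_def \<gamma>_def y_def z_def)
   have "(\<integral>\<^sup>+m. (\<integral>\<^sup>+m'. R x m m' \<partial>\<rho> s x) \<partial>\<rho> s x)
    = (\<integral>\<^sup>+m. (\<integral>\<^sup>+m'. ?O x m + ?O x m' \<partial>\<rho> s x) \<partial>\<rho> s x)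
     + ennreal c0 * ((y x * \<beta> x + z x * \<gamma> x) + (y x * \<beta> x + z x * \<gamma> x))"
   proof -
    have "(%m. \<integral>\<^sup>+m'. ?O x m + ?O x m' \<partial>\<rho> s x) \<in> bmeas (\<rho> s x)"
     by (simp add: nn_integral_add)
    thus ?thesis
     unfolding R1
     by (simp add: nn_integral_add nn_integral_cmult nn_integral_multc flip: \<beta>_def \<gamma>_def y_def z_def)
   qed
   also have "... \<le> 2 * (\<integral>\<^sup>+m. ?O x m \<partial>\<rho> s x) + ennreal c0 * (2 * (y x * \<beta> x + z x * \<gamma> x))"
    using nn_integral_double_sum[OF k measurable_section_nn[OF Om]]
    by (intro add_mono) (simp_all add: mult_2 add_ac)
   finally show ?thesis .
  qed
  have "(\<integral>\<^sup>+x. (\<integral>\<^sup>+m. (\<integral>\<^sup>+m'. R x m m' \<partial>\<rho> s x) \<partial>\<rho> s x) \<partial>torus)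
   \<le> (\<integral>\<^sup>+x. 2 * (\<integral>\<^sup>+m. ?O x m \<partial>\<rho> s x) + ennreal c0 * (2 * (y x * \<beta> x + z x * \<gamma> x)) \<partial>torus)"
   by (intro nn_integral_mono inner)
  also have "... = 2 * nnpair (\<rho> s) (%z. ennreal (c0 * M * off_slab r z))
    + ennreal c0 * (2 * ((\<integral>\<^sup>+x. y x * \<beta> x \<partial>torus) + (\<integral>\<^sup>+x. z x * \<gamma> x \<partial>torus)))"
  proof -
   have m: "(%x. \<integral>\<^sup>+m. ?O x m \<partial>\<rho> s x) \<in> bmeas torus"
    "(%x. y x * \<beta> x) \<in> bmeas torus" "(%x. z x * \<gamma> x) \<in> bmeas torus"
    by (rule measurable_torus[OF nnpair_inner_measurable[OF k Om]], (rule measurable_torus, measurable)+)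
   thus ?thesis unfolding nnpair_def by (simp add: nn_integral_add nn_integral_cmult)
  qed
  also have "nnpair (\<rho> s) (%z. ennreal (c0 * M * off_slab r z)) = ennreal (c0 * M * pairing (\<rho> s) (off_slab r))"
  proof -
   have "nnpair (\<rho> s) (%z. ennreal (c0 * M * off_slab r z)) = ennreal (pairing (\<rho> s) (%z. c0 * M * off_slab r z))"
    by (rule nnpair_eq_pairing[OF k, where B="c0 * M"])
     (use off_slab c0_nonneg M in \<open>auto simp: mult_left_le\<close>)
   thus ?thesis by (simp add: pairing_scale)
  qed
  also have "2 * ennreal (c0 * M * pairing (\<rho> s) (off_slab r)) + ennreal c0 * (2 * ((\<integral>\<^sup>+x. y x * \<beta> x \<partial>torus) + (\<integral>\<^sup>+x. z x * \<gamma> x \<partial>torus)))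
   \<le> 2 * ennreal (c0 * M * pairing (\<rho> s) (off_slab r)) + ennreal c0 * (2 * (ennreal (C1 * A) + ennreal (C1 * A)))"
   by (intro add_mono mult_left_mono order_refl y\<beta> z\<gamma>) auto
  also have "... = ennreal (2 * (c0 * M) * pairing (\<rho> s) (off_slab r) + 4 * c0 * C1 * A)"
  proof -
   have nn: "0 \<le> c0 * M * pairing (\<rho> s) (off_slab r)" "0 \<le> C1 * A" "0 \<le> c0"
    using off_slab_pairing(1)[OF s] c0_nonneg M C1p A(1) by auto
   have two: "2 * ennreal u = ennreal (2 * u)" if "0 \<le> u" for u
    unfolding mult_2 by (rule ennreal_plus[OF that that, symmetric])
   have "2 * ennreal p + ennreal c0 * (2 * (ennreal u + ennreal u)) = ennreal (2 * p + c0 * (2 * (u + u)))"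
    if "0 \<le> p" "0 \<le> u" for p u
   proof -
    have "2 * (ennreal u + ennreal u) = ennreal (2 * (u + u))"
     unfolding ennreal_plus[OF that(2) that(2), symmetric] by (rule two) (use that in simp)
    hence "ennreal c0 * (2 * (ennreal u + ennreal u)) = ennreal (c0 * (2 * (u + u)))"
     by (simp only:) (rule ennreal_mult[symmetric]; use that(2) nn(3) in simp)
    moreover have "ennreal (2 * p + c0 * (2 * (u + u))) = ennreal (2 * p) + ennreal (c0 * (2 * (u + u)))"
     by (rule ennreal_plus) (use that nn(3) in auto)
    ultimately show ?thesis
     by (simp only: two[OF that(1)])
   qed
   from this[OF nn(1,2)] show ?thesis by (simp add: algebra_simps)
  qed
  finally show "(\<integral>\<^sup>+x. (\<integral>\<^sup>+m. (\<integral>\<^sup>+m'. R x m m' \<partial>\<rho> s x) \<partial>\<rho> s x) \<partial>torus)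
   \<le> ennreal (2 * (c0 * M) * pairing (\<rho> s) (off_slab r) + 4 * c0 * C1 * A)" .
  show "0 \<le> 2 * (c0 * M) * pairing (\<rho> s) (off_slab r) + 4 * c0 * C1 * A"
   using off_slab_pairing(1)[OF s] c0_nonneg M C1p A(1) by simp
 qed
qed

end

section \<open>The a priori moment bound\<close>

context moment_path
begin

text \<open>A Gronwall argument for the supremum of all capped moments after discounting by \<open>exp (-
  \<lambda> s)\<close> with \<open>\<lambda> > 8 c0 C1\<close>: the collision terms, of size
  \<open>4 c0 C1\<close> times the supremum, then contribute at most half of it.\<close>

lemma capped_moment_bound:
 assumes L: "0 \<le> L" and t: "t \<in> {0..T}"
  and \<phi>: "\<phi> \<in> bmeas borel" "!!x. 0 \<le> \<phi> x" "!!x. \<phi> x \<le> B" "(\<integral>x. \<phi> x \<partial>torus) \<le> 1" and \<tau>: "0 \<le> \<tau>"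
 shows "pairing (\<rho> t) (capped_test L \<phi> \<tau>) \<le> 2 * \<eta>0 * exp ((8 * c0 * (Q0 * \<eta>0 + 1) + 1) * T)"
proof -
 define C1 where "C1 = Q0 * \<eta>0 + 1"
 define l where "l = 8 * c0 * C1 + 1"
 have C1: "0 < C1" using Q0_nonneg \<eta>0(1) by (auto simp: C1_def add_nonneg_pos)
 have l: "0 < l" using c0_nonneg C1 by (simp add: l_def add_nonneg_pos)
 have B: "0 \<le> B" using \<phi>(2,3)[of 0] by linarith
 define cls where "cls = {\<psi> :: real => real. \<psi> \<in> bmeas borel \<and> (\<forall>x. 0 \<le> \<psi> x) \<and> (\<forall>x. \<psi> x \<le> B) \<and> (\<integral>x. \<psi> x \<partial>torus) \<le> 1}"
 define val where "val = (%(\<psi>, \<sigma>, s). pairing (\<rho> s) (capped_test L \<psi> \<sigma>) * exp (- l * s))"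
 define S where "S = val ` (cls \<times> {0..} \<times> {0..T})"
 have bdd: "bdd_above S"
 proof (rule bdd_aboveI)
  fix y assume "y \<in> S"
  then obtain \<psi> \<sigma> s where y: "y = pairing (\<rho> s) (capped_test L \<psi> \<sigma>) * exp (- l * s)" "\<psi> \<in> cls" "0 \<le> \<sigma>" "s \<in> {0..T}"
   by (auto simp: S_def val_def)
  have \<psi>: "\<psi> \<in> bmeas borel" "!!x. 0 \<le> \<psi> x" "!!x. \<psi> x \<le> B" using y(2) by (auto simp: cls_def)
  have "\<bar>capped_test L \<psi> \<sigma> z\<bar> \<le> L * B" for z using capped_test(2,3)[OF L \<psi>, of \<sigma> z] by simp
  from pairing_bound[OF kernel[OF y(4)] capped_test(1)[OF L \<psi>] this]
  have "pairing (\<rho> s) (capped_test L \<psi> \<sigma>) \<le> L * B" by simp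
  moreover have "exp (- l * s) \<le> 1" using l y(4) by simp
  ultimately show "y \<le> L * B"
   unfolding y(1) using mult_mono[of "pairing (\<rho> s) (capped_test L \<psi> \<sigma>)" "L * B" "exp (- l * s)" 1] L B by simp
 qed
 define \<alpha> where "\<alpha> = Sup S"
 have T: "0 \<in> {0..T}" using t by auto
 have "val (%_. 0, 0, 0) = 0" by (simp add: val_def capped_test_def pairing_def)
 moreover have "val (%_. 0, 0, 0) \<in> S" unfolding S_def using T B by (intro imageI) (auto simp: cls_def)
 ultimately have \<alpha>0: "0 \<le> \<alpha>" unfolding \<alpha>_def using cSup_upper[OF _ bdd] by metis
 have S_ne: "S \<noteq> {}" using \<open>val (%_. 0, 0, 0) \<in> S\<close> by auto
 have le: "pairing (\<rho> s) (capped_test L \<psi> \<sigma>) \<le> \<alpha> * exp (l * s)" if "\<psi> \<in> cls" "0 \<le> \<sigma>" "s \<in> {0..T}" for \<psi> \<sigma> s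
 proof -
  have "val (\<psi>, \<sigma>, s) \<in> S" unfolding S_def using that by (intro imageI) auto
  hence "pairing (\<rho> s) (capped_test L \<psi> \<sigma>) * exp (- l * s) \<le> \<alpha>"
   unfolding \<alpha>_def using cSup_upper[OF _ bdd] by (force simp: val_def)
  thus ?thesis by (simp add: exp_minus field_simps)
 qed
 have step: "pairing (\<rho> s) (capped_test L \<psi> \<sigma>) \<le> \<eta>0 + \<alpha> / 2 * exp (l * s)" if \<psi>c: "\<psi> \<in> cls" and \<sigma>: "0 \<le> \<sigma>" and s: "s \<in> {0..T}" for \<psi> \<sigma> s
 proof -
  have \<psi>: "\<psi> \<in> bmeas borel" "!!x. 0 \<le> \<psi> x" "!!x. \<psi> x \<le> B" "(\<integral>x. \<psi> x \<partial>torus) \<le> 1" using \<psi>c by (auto simp: cls_def)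
  define h where "h s' = 4 * c0 * C1 * (\<alpha> * exp (l * s'))" for s'
  have h: "set_borel_measurable lborel {0..s} h" "!!s'. s' \<in> {0..s} ==> 0 \<le> h s'" "!!s'. s' \<in> {0..s} ==> h s' \<le> 4 * c0 * C1 * (\<alpha> * exp (l * s))"
   using c0_nonneg C1 \<alpha>0 l by (auto simp: set_borel_measurable_def h_def intro!: mult_left_mono)
  have cap: "capped L \<in> bmeas borel" "!!m. 0 < m ==> 0 \<le> capped L m" "!!m. 0 < m ==> capped L m \<le> 1 * w m"
   using capped[OF L] by auto
  have coll: "collision w k (\<rho> s') (truncated r M (capped L) (s - s' + \<sigma>) \<psi>) \<le> 2 * (c0 * M) * pairing (\<rho> s') (off_slab r) + h s'"
   if "1 \<le> r" "0 \<le> M" "s' \<in> {0..s}" for r M s'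
   unfolding h_def mult.assoc[of 4] mult.assoc[of "4 * c0"]
   using capped_collision[where A="\<alpha> * exp (l * s')" and s=s' and ?C1.0=C1, OF _ L that(2,1) _ \<psi> _ _ C1_def, of "s - s' + \<sigma>"]
    le that(3) s \<sigma> \<alpha>0 unfolding cls_def by (simp add: mult.assoc)
  have bounds: "pairing (\<rho> s) (truncated (real (Suc n)) (real M) (capped L) \<sigma> \<psi>) \<le> 1 * \<eta>0 * (\<integral>x. \<psi> x \<partial>torus)
    + 2 * (c0 * real M) * (LINT s':{0..s}|lborel. pairing (\<rho> s') (off_slab (real (Suc n)))) + (LINT s':{0..s}|lborel. h s')"
   "\<exists>B. adm RR (strip (real (Suc n))) B (truncated (real (Suc n)) (real M) (capped L) \<sigma> \<psi>)" for n M
   by (rule truncated_bound[OF s cap _ \<psi>(1-3) \<sigma> _ h]; (rule coll)?; simp)+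
  have "nnpair (\<rho> s) (%(x, m). ennreal (capped L m * heat (a m * \<sigma>) \<psi> x)) \<le> ennreal (1 * \<eta>0 * (\<integral>x. \<psi> x \<partial>torus)
    + 2 * (c0 * real 0) * 0 + (LINT s':{0..s}|lborel. h s'))"
  proof (rule truncation_limit[OF s cap(1,2) \<psi>(1-3) bounds(2) bounds(1)])
   show "(%n. 1 * \<eta>0 * (\<integral>x. \<psi> x \<partial>torus) + 2 * (c0 * real M) * (LINT s':{0..s}|lborel. pairing (\<rho> s') (off_slab (real (Suc n)))) + (LINT s':{0..s}|lborel. h s'))
    \<longlonglongrightarrow> 1 * \<eta>0 * (\<integral>x. \<psi> x \<partial>torus) + 2 * (c0 * real 0) * 0 + (LINT s':{0..s}|lborel. h s')" for M
   proof -
    have "(%n. 2 * (c0 * real M) * (LINT s':{0..s}|lborel. pairing (\<rho> s') (off_slab (real (Suc n))))) \<longlonglongrightarrow> 2 * (c0 * real M) * 0"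
     by (intro tendsto_mult tendsto_const off_slab_limit[OF s])
    thus ?thesis by (intro tendsto_add tendsto_const) simp
   qed
  qed
  also have "(%(x, m). ennreal (capped L m * heat (a m * \<sigma>) \<psi> x)) = (%z. ennreal (capped_test L \<psi> \<sigma> z))"
   by (auto simp: capped_test_def fun_eq_iff)
  also have "nnpair (\<rho> s) (%z. ennreal (capped_test L \<psi> \<sigma> z)) = ennreal (pairing (\<rho> s) (capped_test L \<psi> \<sigma>))"
   by (rule nnpair_eq_pairing[OF kernel[OF s] capped_test[OF L \<psi>(1-3)]])
  finally have "ennreal (pairing (\<rho> s) (capped_test L \<psi> \<sigma>)) \<le> ennreal (\<eta>0 * (\<integral>x. \<psi> x \<partial>torus) + (LINT s':{0..s}|lborel. h s'))"
   by simp
  moreover have Jh: "(LINT s':{0..s}|lborel. h s') = 4 * c0 * C1 * \<alpha> * ((exp (l * s) - 1) / l)"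
   unfolding h_def using set_integral_exp[of l s] l s by simp
  moreover have "0 \<le> \<eta>0 * (\<integral>x. \<psi> x \<partial>torus) + 4 * c0 * C1 * \<alpha> * ((exp (l * s) - 1) / l)"
   using \<eta>0(1) torus_integral_nn(2)[OF \<psi>(1-3)] c0_nonneg C1 \<alpha>0 l s
   by (intro add_nonneg_nonneg mult_nonneg_nonneg divide_nonneg_nonneg) auto
  ultimately have "pairing (\<rho> s) (capped_test L \<psi> \<sigma>) \<le> \<eta>0 * (\<integral>x. \<psi> x \<partial>torus) + 4 * c0 * C1 * \<alpha> * ((exp (l * s) - 1) / l)"
   using ennreal_le_iff by metis
  also have "... \<le> \<eta>0 * 1 + \<alpha> / 2 * exp (l * s)"
  proof (intro add_mono mult_left_mono \<psi>(4) \<eta>0(1))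
   have "4 * c0 * C1 / l \<le> 1 / 2" using l by (simp add: divide_le_eq l_def)
   hence "4 * c0 * C1 / l * (\<alpha> * (exp (l * s) - 1)) \<le> 1 / 2 * (\<alpha> * (exp (l * s) - 1))"
    using \<alpha>0 l s by (intro mult_right_mono mult_nonneg_nonneg) auto
   also have "... \<le> \<alpha> / 2 * exp (l * s)" using \<alpha>0 by (simp add: algebra_simps)
   finally show "4 * c0 * C1 * \<alpha> * ((exp (l * s) - 1) / l) \<le> \<alpha> / 2 * exp (l * s)" by (simp add: field_simps)
  qed
  finally show ?thesis by simp
 qed
 have "\<alpha> \<le> \<eta>0 + \<alpha> / 2"
  unfolding \<alpha>_def
 proof (rule cSup_least[OF S_ne], fold \<alpha>_def)
  fix y assume "y \<in> S"
  then obtain \<psi> \<sigma> s where y: "y = pairing (\<rho> s) (capped_test L \<psi> \<sigma>) * exp (- l * s)" "\<psi> \<in> cls" "0 \<le> \<sigma>" "s \<in> {0..T}"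
   by (auto simp: S_def val_def)
  have "y \<le> (\<eta>0 + \<alpha> / 2 * exp (l * s)) * exp (- l * s)"
   unfolding y(1) using step[OF y(2-4)] by (intro mult_right_mono) auto
  also have "... = \<eta>0 * exp (- l * s) + \<alpha> / 2" by (simp add: exp_minus distrib_right)
  also have "... \<le> \<eta>0 + \<alpha> / 2" using \<eta>0(1) l y(4) by (simp add: mult_left_le)
  finally show "y \<le> \<eta>0 + \<alpha> / 2" .
 qed
 hence \<alpha>: "\<alpha> \<le> 2 * \<eta>0" by simp
 have "\<phi> \<in> cls" using \<phi> by (auto simp: cls_def)
 from le[OF this \<tau> t] have "pairing (\<rho> t) (capped_test L \<phi> \<tau>) \<le> \<alpha> * exp (l * t)" .
 also have "... \<le> 2 * \<eta>0 * exp (l * T)" using \<alpha> \<alpha>0 l t by (intro mult_mono) auto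
 finally show ?thesis by (simp add: l_def C1_def)
qed

text \<open>The bound on capped moments is uniform in the height of the cap and in the localisation, so it
  gives a bound at almost every position.\<close>

theorem moment_bound:
 "\<exists>C\<ge>0. \<forall>t\<in>{0..T}. AE x in torus. (\<integral>\<^sup>+m. ennreal (w m) \<partial>\<rho> t x) \<le> ennreal C"
proof -
 define C where "C = 2 * \<eta>0 * exp ((8 * c0 * (Q0 * \<eta>0 + 1) + 1) * T)"
 have C: "0 \<le> C" using \<eta>0(1) by (simp add: C_def)
 have "AE x in torus. (\<integral>\<^sup>+m. ennreal (w m) \<partial>\<rho> t x) \<le> ennreal C" if t: "t \<in> {0..T}" for t
 proof -
  note k = kernel[OF t]
  have cm: "(%m. ennreal (capped L m)) \<in> bmeas borel" if "0 \<le> L" for L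
   using capped(1)[OF that] by measurable
  have capped_AE: "AE x in torus. (\<integral>\<^sup>+m. ennreal (capped L m) \<partial>\<rho> t x) \<le> ennreal C" if L: "0 \<le> L" for L
  proof (rule AE_le_of_averages[OF _ C])
   define \<beta> where "\<beta> x = (\<integral>\<^sup>+m. ennreal (capped L m) \<partial>\<rho> t x)" for x
   show "(%x. \<integral>\<^sup>+m. ennreal (capped L m) \<partial>\<rho> t x) \<in> bmeas borel"
    by (rule subkernel_nn_integral_measurable[OF k]) (use cm[OF L] in \<open>auto simp: case_prod_beta' intro: measurable_compose[OF measurable_snd]\<close>)
   hence \<beta>m: "\<beta> \<in> bmeas borel" by (simp add: \<beta>_def[abs_def])
   fix A :: "real set" assume A: "A \<in> sets borel"
   have iA: "(indicator A :: real => real) \<in> bmeas borel" "!!x. 0 \<le> (indicator A x :: real)" "!!x. (indicator A x :: real) \<le> 1"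
    using A by (auto simp: indicator_def)
   define \<mu> where "\<mu> = (\<integral>x. indicator A x \<partial>torus :: real)"
   have \<mu>: "(\<integral>\<^sup>+x. indicator A x \<partial>torus) = ennreal \<mu>" "0 \<le> \<mu>"
    using torus_integral_nn[OF iA] by (auto simp: \<mu>_def ennreal_indicator)
   have "(\<integral>\<^sup>+x. \<beta> x * indicator A x \<partial>torus) \<le> ennreal C * ennreal \<mu>"
   proof (cases "\<mu> = 0")
    case True
    have "(%x. indicator A x :: ennreal) \<in> bmeas torus" using A by (intro measurable_torus) auto
    hence "AE x in torus. (indicator A x :: ennreal) = 0"
     using \<mu>(1) True nn_integral_0_iff_AE[of "indicator A :: real => ennreal" torus] by simp
    hence "(\<integral>\<^sup>+x. \<beta> x * indicator A x \<partial>torus) = (\<integral>\<^sup>+x. 0 \<partial>torus)"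
     by (intro nn_integral_cong_AE) (auto elim: eventually_mono)
    thus ?thesis by simp
   next
    case False
    hence \<mu>p: "0 < \<mu>" using \<mu>(2) by simp
    define \<phi> where "\<phi> x = indicator A x / \<mu>" for x
    have "(\<integral>x. \<phi> x \<partial>torus) = (\<integral>x. indicator A x \<partial>torus) / \<mu>"
     unfolding \<phi>_def by (rule integral_divide_zero)
    hence one: "(\<integral>x. \<phi> x \<partial>torus) \<le> 1"
     using \<mu>p unfolding \<mu>_def[symmetric] by simp
    have \<phi>: "\<phi> \<in> bmeas borel" "!!x. 0 \<le> \<phi> x" "!!x. \<phi> x \<le> 1 / \<mu>"
     using A \<mu>p by (auto simp: \<phi>_def[abs_def] indicator_def)
    note \<phi> = this one
    have "nnpair (\<rho> t) (%z. ennreal (capped_test L \<phi> 0 z)) = ennreal (pairing (\<rho> t) (capped_test L \<phi> 0))"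
     by (rule nnpair_eq_pairing[OF k capped_test[OF L \<phi>(1-3)]])
    also have "... \<le> ennreal C"
     unfolding C_def by (intro ennreal_leI capped_moment_bound[OF L t \<phi>]) simp
    finally have le: "nnpair (\<rho> t) (%z. ennreal (capped_test L \<phi> 0 z)) \<le> ennreal C" .
    have "(\<integral>\<^sup>+x. \<beta> x * indicator A x \<partial>torus) = (\<integral>\<^sup>+x. ennreal \<mu> * (\<integral>\<^sup>+m. ennreal (capped_test L \<phi> 0 (x, m)) \<partial>\<rho> t x) \<partial>torus)"
    proof (rule nn_integral_cong)
     fix x assume "x \<in> space torus"
     hence "capped_test L \<phi> 0 (x, m) = \<phi> x * capped L m" for m
      using heat_zero[of x \<phi>] by (simp add: capped_test_def)
     hence "ennreal (capped_test L \<phi> 0 (x, m)) = ennreal (\<phi> x) * ennreal (capped L m)" for m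
      using \<phi>(2) capped(2)[OF L] by (simp add: ennreal_mult)
     hence "(\<integral>\<^sup>+m. ennreal (capped_test L \<phi> 0 (x, m)) \<partial>\<rho> t x) = ennreal (\<phi> x) * \<beta> x"
      unfolding \<beta>_def by (simp add: nn_integral_cmult subkernel_measurable[OF k cm[OF L]])
     moreover have "ennreal \<mu> * ennreal (\<phi> x) = indicator A x"
      using \<mu>p by (auto simp: \<phi>_def indicator_def ennreal_mult[symmetric])
     ultimately show "\<beta> x * indicator A x = ennreal \<mu> * (\<integral>\<^sup>+m. ennreal (capped_test L \<phi> 0 (x, m)) \<partial>\<rho> t x)"
      by (simp add: mult.assoc[symmetric] mult.commute)
    qed
    also have "... = ennreal \<mu> * nnpair (\<rho> t) (%z. ennreal (capped_test L \<phi> 0 z))"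
     unfolding nnpair_def
     by (intro nn_integral_cmult measurable_torus nnpair_inner_measurable[OF k])
      (use capped_test(1)[OF L \<phi>(1-3)] in measurable)
    also have "... \<le> ennreal \<mu> * ennreal C" by (rule mult_left_mono[OF le]) simp
    finally show ?thesis by (simp add: mult.commute)
   qed
   thus "(\<integral>\<^sup>+x. (\<integral>\<^sup>+m. ennreal (capped L m) \<partial>\<rho> t x) * indicator A x \<partial>torus) \<le> ennreal C * (\<integral>\<^sup>+x. indicator A x \<partial>torus)"
    by (simp add: \<beta>_def \<mu>(1))
  qed
  have "AE x in torus. \<forall>n. (\<integral>\<^sup>+m. ennreal (capped (real n) m) \<partial>\<rho> t x) \<le> ennreal C"
   unfolding AE_all_countable using capped_AE by simp
  thus ?thesis
  proof (rule eventually_mono)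
   fix x assume x: "\<forall>n. (\<integral>\<^sup>+m. ennreal (capped (real n) m) \<partial>\<rho> t x) \<le> ennreal C"
   have pos: "AE m in \<rho> t x. 0 < m"
    by (rule AE_I[of _ _ "{..0}"]) (use no_zero[OF t] subkernel_sets[OF k] in auto)
   have "(%n. \<integral>\<^sup>+m. ennreal (capped (real n) m) \<partial>\<rho> t x) \<longlonglongrightarrow> (\<integral>\<^sup>+m. (if 0 < m then ennreal (w m) else 0) \<partial>\<rho> t x)"
   proof (rule nn_integral_LIMSEQ)
    show "incseq (%n m. ennreal (capped (real n) m))"
     by (rule incseq_SucI) (auto simp: le_fun_def capped_def intro!: ennreal_leI)
    show "(%m. ennreal (capped (real n) m)) \<in> bmeas (\<rho> t x)" for n
     by (rule subkernel_measurable[OF k cm]) simp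
    show "(%n. ennreal (capped (real n) m)) \<longlonglongrightarrow> (if 0 < m then ennreal (w m) else 0)" for m
    proof -
     obtain N where "w m < real N" using reals_Archimedean2 by blast
     hence "\<forall>\<^sub>F n in sequentially. ennreal (capped (real n) m) = (if 0 < m then ennreal (w m) else 0)"
      by (intro eventually_sequentiallyI[of N]) (auto simp: capped_def min_def)
     thus ?thesis by (rule tendsto_eventually)
    qed
   qed
   from LIMSEQ_le_const2[OF this] x
   have "(\<integral>\<^sup>+m. (if 0 < m then ennreal (w m) else 0) \<partial>\<rho> t x) \<le> ennreal C" by blast
   also have "(\<integral>\<^sup>+m. (if 0 < m then ennreal (w m) else 0) \<partial>\<rho> t x) = (\<integral>\<^sup>+m. ennreal (w m) \<partial>\<rho> t x)"
    by (intro nn_integral_cong_AE) (use pos in \<open>auto elim: eventually_mono\<close>)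
   finally show "(\<integral>\<^sup>+m. ennreal (w m) \<partial>\<rho> t x) \<le> ennreal C" .
  qed
 qed
 thus ?thesis using C by blast
qed

end

section \<open>The linearised collision operator\<close>

text \<open>The first of the two integrals of the collision term: a test function again, so that the
  difference of two collision terms becomes linear in the difference of the kernels.\<close>

definition inner_collision :: "(real => real) => (real => real => real) => (real => real measure) => (real \<times> real => real) => real \<times> real => real"
 where "inner_collision w k \<rho> p = (%(x, m). \<integral>m'. gain_loss w p x m m' * k m m' \<partial>\<rho> x)"

lemma collision_inner: "collision w k \<rho> p = pairing \<rho> (inner_collision w k \<rho> p)"
 by (simp add: collision_def inner_collision_def)

context coagulation
begin

lemma abs_k: "\<bar>k m m'\<bar> \<le> c0"
 using k_nonneg[of m m'] k_le[of m m'] by simp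

lemma c0_le: "0 \<le> c0"
 using abs_k[of 0 0] by simp

lemma inner_collision_adm:
 assumes \<rho>: "subkernel \<rho>" and r: "1 \<le> r" and W: "0 \<le> W" "!!m. m \<in> slab r ==> \<bar>w m\<bar> \<le> W" and p: "adm RR (strip r) B p"
 shows "adm RR UNIV (3 * W * c0 * B) (inner_collision w k \<rho> p)"
  "integrable (\<rho> x) (%m'. gain_loss w p x m m' * k m m')"
 using adm_collision_inner[OF \<rho> w_meas W(2,1) k_meas abs_k p] unfolding inner_collision_def by auto

lemma pairing_inner_swap:
 assumes \<rho>: "subkernel \<rho>" and \<rho>': "subkernel \<rho>'" and r: "1 \<le> r" and W: "0 \<le> W" "!!m. m \<in> slab r ==> \<bar>w m\<bar> \<le> W"
  and p: "adm RR (strip r) B p"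
 shows "pairing \<rho> (inner_collision w k \<rho>' p) = pairing \<rho>' (inner_collision w k \<rho> p)"
 unfolding pairing_def
proof (rule Bochner_Integration.integral_cong[OF refl])
 fix x
 interpret A: subprob_space "\<rho> x" by (rule subkernel_subprob[OF \<rho>])
 interpret B: subprob_space "\<rho>' x" by (rule subkernel_subprob[OF \<rho>'])
 interpret P: pair_sigma_finite "\<rho> x" "\<rho>' x" ..
 let ?f = "%m m'. gain_loss w p x m m' * k m m'"
 have sym: "?f m m' = ?f m' m" for m m'
  using k_sym[of m m'] by (simp add: gain_loss_def add.commute)
 note [measurable] = w_meas admD(1)[OF p]
 have [measurable]: "(%z. k (fst z) (snd z)) \<in> bmeas RR"
  using k_meas by (simp add: case_prod_beta')
 have "(%z. ?f (fst z) (snd z)) \<in> bmeas RR"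
  unfolding gain_loss_def by measurable
 hence meas: "(%(m, m'). ?f m m') \<in> bmeas (\<rho> x \<Otimes>\<^sub>M \<rho>' x)"
  unfolding measurable_cong_sets[OF sets_pair_measure_cong[OF subkernel_sets[OF \<rho>, of x] subkernel_sets[OF \<rho>', of x]] refl, of borel]
  by (simp add: case_prod_beta')
 have int: "integrable (\<rho> x \<Otimes>\<^sub>M \<rho>' x) (%(m, m'). ?f m m')"
 proof (rule Bochner_Integration.integrable_bound[OF _ meas])
  have "emeasure (\<rho> x \<Otimes>\<^sub>M \<rho>' x) (space (\<rho> x \<Otimes>\<^sub>M \<rho>' x)) < \<infinity>"
   unfolding space_pair_measure
   using A.emeasure_finite B.emeasure_finite
   by (subst B.emeasure_pair_measure_Times) (auto simp: ennreal_mult_eq_top_iff less_top[symmetric])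
  thus "integrable (\<rho> x \<Otimes>\<^sub>M \<rho>' x) (%_. 3 * W * B * c0)"
   by (intro finite_measure.integrable_const finite_measureI) auto
  show "AE z in \<rho> x \<Otimes>\<^sub>M \<rho>' x. norm (case z of (m, m') => ?f m m') \<le> norm (3 * W * B * c0)"
  proof (rule AE_I2)
   fix z
   have "\<bar>gain_loss w p x (fst z) (snd z)\<bar> * \<bar>k (fst z) (snd z)\<bar> \<le> 3 * W * B * c0"
    using W(1) admD(4)[OF p] by (intro mult_mono gain_loss_bound[OF p W(2,1)] abs_k) auto
   thus "norm (case z of (m, m') => ?f m m') \<le> norm (3 * W * B * c0)"
    using W(1) admD(4)[OF p] c0_le by (simp add: case_prod_beta' abs_mult)
  qed
 qed
 have "(\<integral>m. inner_collision w k \<rho>' p (x, m) \<partial>\<rho> x) = (\<integral>m. (\<integral>m'. ?f m m' \<partial>\<rho>' x) \<partial>\<rho> x)"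
  by (simp add: inner_collision_def)
 also have "... = (\<integral>m'. (\<integral>m. ?f m m' \<partial>\<rho> x) \<partial>\<rho>' x)"
  by (rule P.Fubini_integral[OF int, symmetric])
 also have "... = (\<integral>m'. (\<integral>m. ?f m' m \<partial>\<rho> x) \<partial>\<rho>' x)"
  by (subst sym) (rule refl)
 finally show "(\<integral>m. inner_collision w k \<rho>' p (x, m) \<partial>\<rho> x) = (\<integral>m. inner_collision w k \<rho> p (x, m) \<partial>\<rho>' x)"
  by (simp add: inner_collision_def)
qed

text \<open>The difference of the collision terms of two kernels is the difference of their pairings with
  the sum of the functions \<open>inner_collision\<close> of both. On the slab the loss of the
  particle \<open>m\<close> itself is absorbed in the damping rate \<open>2 c0 W\<close>. Off the
  slab that loss is zero because \<open>p\<close> vanishes there, but a gain may remain, and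
  subadditivity bounds it by the weight \<open>w m\<close> and the moment of \<open>w\<close>.\<close>

lemma linearised_bound:
 assumes \<rho>: "subkernel \<rho>" and \<rho>': "subkernel \<rho>'" and r: "1 \<le> r"
  and W: "0 \<le> W" "!!m. m \<in> slab r ==> w m \<le> W"
  and p: "adm RR (strip r) 1 p"
  and mom: "(\<integral>\<^sup>+m. ennreal (w m) \<partial>\<rho> x) \<le> ennreal C" "(\<integral>\<^sup>+m. ennreal (w m) \<partial>\<rho>' x) \<le> ennreal C" "0 \<le> C"
  and null: "emeasure (\<rho> x) {..0} = 0" "emeasure (\<rho>' x) {..0} = 0"
 shows "\<bar>2 * c0 * W * p (x, m) + (inner_collision w k \<rho> p (x, m) + inner_collision w k \<rho>' p (x, m))\<bar>
  \<le> (if m \<in> slab r then 2 * c0 * W + 4 * c0 * C else if 0 < m then 4 * c0 * C + 2 * c0 * w m else 0)"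
proof (cases "0 < m")
 case False
 hence "k m m' = 0" for m' using k_pos by blast
 moreover have "m \<notin> slab r" using False slab_pos[OF _ r] by auto
 ultimately show ?thesis using False admD(3)[OF p, of "(x, m)"] by (auto simp: inner_collision_def)
next
 case m: True
 have absW: "!!m. m \<in> slab r ==> \<bar>w m\<bar> \<le> W" using W(2) w_pos slab_pos[OF _ r] by (force simp: abs_le_iff)
 have W_nn: "\<bar>p (x, m)\<bar> \<le> 1" for m by (rule admD(2)[OF p])
 let ?on = "indicator (slab r) m :: real"
 let ?q = "2 * c0 * W * p (x, m)"
 have c0: "0 \<le> c0" by (rule c0_le)
 have part: "\<bar>c0 * W * p (x, m) + inner_collision w k \<mu> p (x, m)\<bar> \<le> (if m \<in> slab r then c0 * W + 2 * c0 * C else 2 * c0 * C + c0 * w m)"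
  if \<mu>: "subkernel \<mu>" and mom: "(\<integral>\<^sup>+m. ennreal (w m) \<partial>\<mu> x) \<le> ennreal C" and null: "emeasure (\<mu> x) {..0} = 0" for \<mu>
 proof -
  interpret M: subprob_space "\<mu> x" by (rule subkernel_subprob[OF \<mu>])
  have pos: "AE m' in \<mu> x. 0 < m'"
   by (rule AE_I[of _ _ "{..0}"]) (use null subkernel_sets[OF \<mu>] in auto)
  have wm: "w \<in> bmeas (\<mu> x)" by (rule subkernel_measurable[OF \<mu> w_meas])
  have w_int: "integrable (\<mu> x) w"
  proof (rule integrableI_nonneg[OF wm])
   show "AE m' in \<mu> x. 0 \<le> w m'" using pos by (rule eventually_mono) (use w_pos in \<open>auto intro: less_imp_le\<close>)
   show "(\<integral>\<^sup>+m. ennreal (w m) \<partial>\<mu> x) < \<infinity>" using mom by (rule le_less_trans) simp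
  qed
  have w_le: "(\<integral>m. w m \<partial>\<mu> x) \<le> C"
  proof -
   have "ennreal (\<integral>m. w m \<partial>\<mu> x) \<le> ennreal C"
    using ennreal_integral_le_nn[OF w_int] mom by (rule order_trans)
   thus ?thesis using \<open>0 \<le> C\<close> ennreal_le_iff by blast
  qed
  have k_sec: "(%m'. k m m') \<in> bmeas borel"
   using measurable_compose[OF measurable_Pair1' k_meas, of m] by simp
  have k_int: "integrable (\<mu> x) (%m'. k m m')" by (rule subkernel_integrable[OF \<mu> k_sec abs_k])
  define K where "K = (\<integral>m'. k m m' \<partial>\<mu> x)"
  have K: "0 \<le> K" "K \<le> c0"
   using subkernel_integral_bound[OF \<mu> k_sec abs_k, of x] k_nonneg by (auto simp: K_def integral_nonneg_AE)
  have wk_int: "integrable (\<mu> x) (%m'. w m' * k m m')"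
  proof (rule Bochner_Integration.integrable_bound)
   show "integrable (\<mu> x) (%m'. c0 * w m')" using w_int by simp
   show "(%m'. w m' * k m m') \<in> bmeas (\<mu> x)"
    using wm subkernel_measurable[OF \<mu> k_sec] by (rule borel_measurable_times)
   show "AE m' in \<mu> x. norm (w m' * k m m') \<le> norm (c0 * w m')"
    using mult_right_mono[OF abs_k[of m] abs_ge_zero] c0 by (intro AE_I2) (simp add: abs_mult mult.commute)
  qed
  have wk_le: "(\<integral>m'. w m' * k m m' \<partial>\<mu> x) \<le> c0 * C"
  proof -
   have "(\<integral>m'. w m' * k m m' \<partial>\<mu> x) \<le> (\<integral>m'. w m' * c0 \<partial>\<mu> x)"
   proof (rule integral_mono_AE[OF wk_int])
    show "AE m' in \<mu> x. w m' * k m m' \<le> w m' * c0"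
     using pos
    proof (rule eventually_mono)
     show "w m' * k m m' \<le> w m' * c0" if "0 < m'" for m'
      using w_pos[OF that] by (intro mult_left_mono[OF k_le]) simp
    qed
   qed (use w_int in auto)
   also have "... = (\<integral>m'. w m' \<partial>\<mu> x) * c0" by simp
   also have "... \<le> C * c0" by (rule mult_right_mono[OF w_le c0])
   finally show ?thesis by (simp add: mult.commute)
  qed
  have gl_int: "integrable (\<mu> x) (%m'. gain_loss w p x m m' * k m m')"
   by (rule inner_collision_adm(2)[OF \<mu> r W(1) absW p])
  have split: "\<bar>(gain_loss w p x m m' + w m * p (x, m)) * k m m'\<bar> \<le> (w m + 2 * w m') * k m m'" if "0 < m'" for m'
  proof -
   have "\<bar>w (m + m') * p (x, m + m')\<bar> \<le> w (m + m')"
    using W_nn[of "m + m'"] w_pos[of "m + m'"] m that by (simp add: abs_mult mult_left_le)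
   also have "... \<le> w m + w m'" by (rule w_sub[OF m that])
   finally have 1: "\<bar>w (m + m') * p (x, m + m')\<bar> \<le> w m + w m'" .
   have 2: "\<bar>w m' * p (x, m')\<bar> \<le> w m'"
    using W_nn[of m'] w_pos[OF that] by (simp add: abs_mult mult_left_le)
   have "\<bar>gain_loss w p x m m' + w m * p (x, m)\<bar> \<le> w m + 2 * w m'"
    using 1 2 unfolding gain_loss_def by linarith
   thus ?thesis using k_nonneg[of m m'] by (simp add: abs_mult mult_right_mono)
  qed
  define J where "J = (\<integral>m'. (gain_loss w p x m m' + w m * p (x, m)) * k m m' \<partial>\<mu> x)"
  have J_int: "integrable (\<mu> x) (%m'. (gain_loss w p x m m' + w m * p (x, m)) * k m m')"
   using Bochner_Integration.integrable_add[OF gl_int integrable_mult_right[OF k_int, of "w m * p (x, m)"]]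
   by (simp add: distrib_right)
  have J: "\<bar>J\<bar> \<le> w m * K + 2 * (c0 * C)"
  proof -
   have "\<bar>J\<bar> \<le> (\<integral>m'. \<bar>(gain_loss w p x m m' + w m * p (x, m)) * k m m'\<bar> \<partial>\<mu> x)"
    unfolding J_def by (rule integral_abs_bound)
   also have "... \<le> (\<integral>m'. w m * k m m' + 2 * (w m' * k m m') \<partial>\<mu> x)"
   proof (rule integral_mono_AE)
    show "AE m' in \<mu> x. \<bar>(gain_loss w p x m m' + w m * p (x, m)) * k m m'\<bar> \<le> w m * k m m' + 2 * (w m' * k m m')"
     using pos by (rule eventually_mono) (use split in \<open>simp add: distrib_right mult.assoc\<close>)
   qed (use J_int k_int wk_int in auto)
   also have "... = w m * K + 2 * (\<integral>m'. w m' * k m m' \<partial>\<mu> x)"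
    using k_int wk_int by (simp add: K_def)
   finally show ?thesis using wk_le by linarith
  qed
  have inner: "inner_collision w k \<mu> p (x, m) = J - w m * p (x, m) * K"
  proof -
   have "J = (\<integral>m'. gain_loss w p x m m' * k m m' + (w m * p (x, m)) * k m m' \<partial>\<mu> x)"
    unfolding J_def by (simp add: distrib_right)
   also have "... = inner_collision w k \<mu> p (x, m) + (w m * p (x, m)) * K"
    using gl_int k_int by (simp add: inner_collision_def K_def)
   finally show ?thesis by simp
  qed
  have wm0: "0 < w m" by (rule w_pos[OF m])
  show ?thesis
  proof (cases "m \<in> slab r")
   case True
   have wK: "w m * K \<le> c0 * W"
    using W(2)[OF True] K wm0 W(1) mult_mono[of "w m" W K c0] by (simp add: mult.commute)
   have "\<bar>c0 * W * p (x, m) + inner_collision w k \<mu> p (x, m)\<bar> = \<bar>(c0 * W - w m * K) * p (x, m) + J\<bar>"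
    unfolding inner by (simp add: algebra_simps)
   also have "... \<le> \<bar>(c0 * W - w m * K) * p (x, m)\<bar> + \<bar>J\<bar>" by (rule abs_triangle_ineq)
   also have "... \<le> (c0 * W - w m * K) + (w m * K + 2 * (c0 * C))"
    using wK W_nn[of m] J by (intro add_mono) (auto simp: abs_mult mult_left_le)
   finally show ?thesis using True by simp
  next
   case False
   hence "p (x, m) = 0" using admD(3)[OF p, of "(x, m)"] by auto
   moreover have "w m * K \<le> c0 * w m" using K wm0 by (simp add: mult.commute)
   ultimately show ?thesis using J False inner by simp
  qed
 qed
 have "\<bar>2 * c0 * W * p (x, m) + (inner_collision w k \<rho> p (x, m) + inner_collision w k \<rho>' p (x, m))\<bar>
  \<le> \<bar>c0 * W * p (x, m) + inner_collision w k \<rho> p (x, m)\<bar> + \<bar>c0 * W * p (x, m) + inner_collision w k \<rho>' p (x, m)\<bar>"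
  by linarith
 with part[OF \<rho> mom(1) null(1)] part[OF \<rho>' mom(2) null(2)] m show ?thesis
  by (auto split: if_splits)
qed

end

section \<open>Comparison of two paths\<close>

context moment_path
begin

text \<open>The part of a path outside a slab, in the weight that dominates the linearised collision
  operator there.\<close>

definition tail :: "real => real => real => real"
 where "tail D r s = enn2real (nnpair (\<rho> s) (%(x, m). ennreal (D + 2 * c0 * w m) * indicator (- slab r) m))"

lemma tail_bounds:
 assumes s: "s \<in> {0..T}" and D: "0 \<le> D" and C: "0 \<le> C" "AE x in torus. (\<integral>\<^sup>+m. ennreal (w m) \<partial>\<rho> s x) \<le> ennreal C"
 shows "nnpair (\<rho> s) (%(x, m). ennreal (D + 2 * c0 * w m)) \<le> ennreal (D + 2 * c0 * C)"
  and "nnpair (\<rho> s) (%(x, m). ennreal (D + 2 * c0 * w m) * indicator (- slab r) m) = ennreal (tail D r s)"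
  and "0 \<le> tail D r s" "tail D r s \<le> D + 2 * c0 * C"
proof -
 note k = kernel[OF s]
 show all: "nnpair (\<rho> s) (%(x, m). ennreal (D + 2 * c0 * w m)) \<le> ennreal (D + 2 * c0 * C)"
 proof -
  have "nnpair (\<rho> s) (%(x, m). ennreal (D + 2 * c0 * w m)) \<le> (\<integral>\<^sup>+x. ennreal (D + 2 * c0 * C) \<partial>torus)"
   unfolding nnpair_def
  proof (rule nn_integral_mono_AE, rule eventually_mono[OF C(2)])
   fix x assume x: "(\<integral>\<^sup>+m. ennreal (w m) \<partial>\<rho> s x) \<le> ennreal C"
   interpret subprob_space "\<rho> s x" by (rule subkernel_subprob[OF k])
   have wm: "w \<in> bmeas (\<rho> s x)" by (rule subkernel_measurable[OF k w_meas])
   have "ennreal (D + 2 * c0 * w m) \<le> ennreal D + ennreal (2 * c0) * ennreal (w m)" for m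
   proof (cases "0 \<le> w m")
    case True
    thus ?thesis using D c0_nonneg by (simp add: ennreal_plus ennreal_mult)
   next
    case False
    hence "2 * c0 * w m \<le> 0" using c0_nonneg by (simp add: mult_nonneg_nonpos)
    hence "ennreal (D + 2 * c0 * w m) \<le> ennreal D" by (intro ennreal_leI) simp
    thus ?thesis by (rule order_trans) simp
   qed
   hence "(\<integral>\<^sup>+m. (case (x, m) of (x, m) => ennreal (D + 2 * c0 * w m)) \<partial>\<rho> s x)
    \<le> (\<integral>\<^sup>+m. ennreal D + ennreal (2 * c0) * ennreal (w m) \<partial>\<rho> s x)"
    by (intro nn_integral_mono) simp
   also have "... = (\<integral>\<^sup>+m. ennreal D \<partial>\<rho> s x) + ennreal (2 * c0) * (\<integral>\<^sup>+m. ennreal (w m) \<partial>\<rho> s x)"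
    using wm by (simp add: nn_integral_add nn_integral_cmult)
   also have "... \<le> ennreal D + ennreal (2 * c0) * ennreal C"
    by (intro add_mono mult_left_mono x nn_integral_le_const) auto
   also have "... = ennreal (D + 2 * c0 * C)"
    using D C(1) c0_nonneg by (simp add: ennreal_plus ennreal_mult)
   finally show "(\<integral>\<^sup>+m. (case (x, m) of (x, m) => ennreal (D + 2 * c0 * w m)) \<partial>\<rho> s x) \<le> ennreal (D + 2 * c0 * C)" .
  qed
  also have "... = ennreal (D + 2 * c0 * C)" using torus.emeasure_space_1 by simp
  finally show ?thesis .
 qed
 have le: "nnpair (\<rho> s) (%(x, m). ennreal (D + 2 * c0 * w m) * indicator (- slab r) m) \<le> ennreal (D + 2 * c0 * C)"
  by (rule order_trans[OF nnpair_mono all]) (auto simp: indicator_def)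
 thus eq: "nnpair (\<rho> s) (%(x, m). ennreal (D + 2 * c0 * w m) * indicator (- slab r) m) = ennreal (tail D r s)"
  unfolding tail_def using le_less_trans[OF le ennreal_less_top] by simp
 show "0 \<le> tail D r s" by (simp add: tail_def)
 show "tail D r s \<le> D + 2 * c0 * C"
  using le D C(1) c0_nonneg unfolding tail_def by (intro enn2real_leI) auto
qed

lemma tail_meas:
 assumes "0 \<le> D"
 shows "set_borel_measurable lborel {0..T} (tail D r)"
proof -
 have "(%m. ennreal (D + 2 * c0 * w m) * indicator (- slab r) m) \<in> bmeas borel"
  using w_meas by measurable
 from time_meas[OF this]
 have "(%s. enn2real (indicator {0..T} s * nnpair (\<rho> s) (%(x, m). ennreal (D + 2 * c0 * w m) * indicator (- slab r) m))) \<in> bmeas lborel"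
  by measurable
 also have "(%s. enn2real (indicator {0..T} s * nnpair (\<rho> s) (%(x, m). ennreal (D + 2 * c0 * w m) * indicator (- slab r) m)))
  = (%s. indicator {0..T} s *\<^sub>R tail D r s)"
  by (auto simp: fun_eq_iff tail_def indicator_def)
 finally show ?thesis by (simp add: set_borel_measurable_def)
qed

text \<open>The a priori moment bound supplies the dominating function.\<close>

lemma tail_limit:
 assumes D: "0 \<le> D" and C: "0 \<le> C" "!!s. s \<in> {0..T} ==> AE x in torus. (\<integral>\<^sup>+m. ennreal (w m) \<partial>\<rho> s x) \<le> ennreal C"
 shows "(%n. LINT s:{0..T}|lborel. tail D (real (Suc n)) s) \<longlonglongrightarrow> 0"
proof -
 let ?P = "%(x :: real, m). ennreal (D + 2 * c0 * w m)"
 let ?on = "%n (x :: real, m). ennreal (D + 2 * c0 * w m) * indicator (slab (real (Suc n))) m"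
 let ?off = "%n (x :: real, m). ennreal (D + 2 * c0 * w m) * indicator (- slab (real (Suc n))) m"
 have lim: "(%n. tail D (real (Suc n)) s) \<longlonglongrightarrow> 0" if s: "s \<in> {0..T}" for s
 proof -
  note k = kernel[OF s]
  note [measurable] = w_meas
  have Pm: "?P \<in> bmeas RR" by measurable
  have onm: "?on n \<in> bmeas RR" and offm: "?off n \<in> bmeas RR" for n by measurable
  have on_lim: "(%n. nnpair (\<rho> s) (?on n)) \<longlonglongrightarrow> nnpair (\<rho> s) ?P"
  proof (rule nnpair_LIMSEQ[OF k no_zero[OF s] onm])
   show "?on n (x, m) \<le> ?on (Suc n) (x, m)" for n x m
    using slab_mono[of "real (Suc n)" "real (Suc (Suc n))"] by (auto simp: indicator_def)
   show "(%n. ?on n (x, m)) \<longlonglongrightarrow> ?P (x, m)" if "0 < m" for x m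
    by (rule tendsto_eventually, rule eventually_mono[OF slab_exhaust[OF that]]) simp
  qed
  have sum: "nnpair (\<rho> s) ?P = nnpair (\<rho> s) (?on n) + nnpair (\<rho> s) (?off n)" for n
  proof -
   have "nnpair (\<rho> s) ?P = nnpair (\<rho> s) (%z. ?on n z + ?off n z)"
    unfolding nnpair_def by (intro nn_integral_cong) (auto simp: indicator_def)
   also have "... = (\<integral>\<^sup>+x. (\<integral>\<^sup>+m. ?on n (x, m) \<partial>\<rho> s x) + (\<integral>\<^sup>+m. ?off n (x, m) \<partial>\<rho> s x) \<partial>torus)"
    unfolding nnpair_def
    by (intro nn_integral_cong nn_integral_add subkernel_measurable[OF k]
      measurable_section_nn[OF onm] measurable_section_nn[OF offm])
   also have "... = nnpair (\<rho> s) (?on n) + nnpair (\<rho> s) (?off n)"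
    unfolding nnpair_def
    by (intro nn_integral_add measurable_torus nnpair_inner_measurable[OF k onm] nnpair_inner_measurable[OF k offm])
   finally show ?thesis .
  qed
  have P_fin: "nnpair (\<rho> s) ?P < top"
   using le_less_trans[OF tail_bounds(1)[OF s D C(1) C(2)[OF s]] ennreal_less_top] .
  define P where "P = enn2real (nnpair (\<rho> s) ?P)"
  have eq: "tail D (real (Suc n)) s = P - enn2real (nnpair (\<rho> s) (?on n))" for n
  proof -
   have "nnpair (\<rho> s) (?on n) < top" "nnpair (\<rho> s) (?off n) < top"
    using P_fin unfolding sum[of n] by (auto simp: less_top)
   hence "P = enn2real (nnpair (\<rho> s) (?on n)) + enn2real (nnpair (\<rho> s) (?off n))"
    unfolding P_def sum[of n] by (rule enn2real_plus)
   thus ?thesis by (simp add: tail_def)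
  qed
  have "nnpair (\<rho> s) ?P = ennreal P" using P_fin by (simp add: P_def)
  from tendsto_enn2real[OF on_lim[unfolded this]] have "(%n. P - enn2real (nnpair (\<rho> s) (?on n))) \<longlonglongrightarrow> P - P"
   by (intro tendsto_diff tendsto_const) (simp add: P_def)
  thus ?thesis unfolding eq by simp
 qed
 have "(%n. LINT s:{0..T}|lborel. tail D (real (Suc n)) s) \<longlonglongrightarrow> (LINT s:{0..T}|lborel. (0::real))"
  unfolding set_lebesgue_integral_def
 proof (rule integral_dominated_convergence)
  show "integrable lborel (%s. indicator {0..T} s *\<^sub>R (D + 2 * c0 * C))"
   by (intro integrable_scaleR_left integrable_real_indicator) (auto simp: emeasure_lborel_Icc_eq)
  show "AE s in lborel. (%n. indicator {0..T} s *\<^sub>R tail D (real (Suc n)) s) \<longlonglongrightarrow> indicator {0..T} s *\<^sub>R 0"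
   using lim by (auto simp: indicator_def)
  show "AE s in lborel. norm (indicator {0..T} s *\<^sub>R tail D (real (Suc n)) s) \<le> indicator {0..T} s *\<^sub>R (D + 2 * c0 * C)" for n
   using tail_bounds(3,4)[OF _ D C(1) C(2)] by (auto simp: indicator_def)
 qed (use tail_meas[OF D] in \<open>auto simp: set_borel_measurable_def\<close>)
 thus ?thesis by simp
qed

end

lemma (in coagulation) generator_difference:
 assumes \<rho>: "subkernel \<rho>" and \<rho>': "subkernel \<rho>'" and r: "1 \<le> r"
  and W: "0 \<le> W" "!!m. m \<in> slab r ==> w m \<le> W"
  and p: "adm RR (strip r) 1 p" and C: "0 \<le> C" and D: "D = 4 * c0 * C + 1"
  and mom: "AE x in torus. (\<integral>\<^sup>+m. ennreal (w m) \<partial>\<rho> x) \<le> ennreal C" "AE x in torus. (\<integral>\<^sup>+m. ennreal (w m) \<partial>\<rho>' x) \<le> ennreal C"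
  and null: "!!x. emeasure (\<rho> x) {..0} = 0" "!!x. emeasure (\<rho>' x) {..0} = 0"
  and b: "!!j. adm RR (strip r) 1 j ==> pairing \<rho> j - pairing \<rho>' j \<le> b"
  and tails: "nnpair \<rho> (%(x, m). ennreal (D + 2 * c0 * w m) * indicator (- slab r) m) \<le> ennreal e"
   "nnpair \<rho>' (%(x, m). ennreal (D + 2 * c0 * w m) * indicator (- slab r) m) \<le> ennreal e'" "0 \<le> e" "0 \<le> e'"
 shows "(2 * c0 * W * pairing \<rho> p + collision w k \<rho> p) - (2 * c0 * W * pairing \<rho>' p + collision w k \<rho>' p)
  \<le> (2 * c0 * W + D) * b + (e + e')"
proof -
 have absW: "!!m. m \<in> slab r ==> \<bar>w m\<bar> \<le> W" using W(2) w_pos slab_pos[OF _ r] by (force simp: abs_le_iff)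
 note ad = inner_collision_adm(1)[OF \<rho> r W(1) absW p] and ad' = inner_collision_adm(1)[OF \<rho>' r W(1) absW p]
 define c where "c = 2 * c0 * W"
 have c0: "0 \<le> c0" and c: "0 \<le> c" using c0_le W(1) by (auto simp: c_def)
 have D0: "0 < D" using c0 C by (simp add: D add_nonneg_pos)
 let ?I = "inner_collision w k \<rho> p" and ?I' = "inner_collision w k \<rho>' p"
 define B where "B = c * 1 + (3 * W * c0 * 1 + 3 * W * c0 * 1)"
 define \<Phi> where "\<Phi> z = c * p z + (?I z + ?I' z)" for z
 have p': "adm RR UNIV 1 p" using p by (auto simp: adm_def)
 have \<Phi>: "adm RR UNIV B \<Phi>"
  unfolding \<Phi>_def B_def using adm_add[OF adm_scale[OF p', of c] adm_add[OF ad ad']] c by simp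
 have pair_\<Phi>: "pairing \<mu> \<Phi> = c * pairing \<mu> p + (pairing \<mu> ?I + pairing \<mu> ?I')" if "subkernel \<mu>" for \<mu>
  using bp_add[OF bp_pairing[OF that] adm_scale[OF p', of c] adm_add[OF ad ad']] bp_add[OF bp_pairing[OF that] ad ad']
  by (simp add: \<Phi>_def[abs_def] pairing_scale)
 have lhs: "(c * pairing \<rho> p + collision w k \<rho> p) - (c * pairing \<rho>' p + collision w k \<rho>' p) = pairing \<rho> \<Phi> - pairing \<rho>' \<Phi>"
  using pairing_inner_swap[OF \<rho> \<rho>' r W(1) absW p] unfolding pair_\<Phi>[OF \<rho>] pair_\<Phi>[OF \<rho>'] collision_inner by simp
 define good where "good = {x. (\<integral>\<^sup>+m. ennreal (w m) \<partial>\<rho> x) \<le> ennreal C \<and> (\<integral>\<^sup>+m. ennreal (w m) \<partial>\<rho>' x) \<le> ennreal C}"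
 have wm: "(%m. ennreal (w m)) \<in> bmeas borel" using w_meas by measurable
 have mm: "(%x. \<integral>\<^sup>+m. ennreal (w m) \<partial>\<mu> x) \<in> bmeas borel" if "subkernel \<mu>" for \<mu>
  by (rule subkernel_nn_integral_measurable[OF that]) (use wm in \<open>auto simp: case_prod_beta' intro: measurable_compose[OF measurable_snd]\<close>)
 have [measurable]: "good \<in> sets borel"
  unfolding good_def using mm[OF \<rho>] mm[OF \<rho>'] by measurable
 have good_AE: "AE x in torus. x \<in> good" using mom by eventually_elim (simp add: good_def)
 define on where "on z = indicator (good \<times> slab r) z * \<Phi> z" for z
 define off where "off z = indicator (good \<times> (- slab r)) z * \<Phi> z" for z
 note [measurable] = admD(1)[OF \<Phi>]
 have on_m: "on \<in> bmeas RR" and off_m: "off \<in> bmeas RR" unfolding on_def off_def by measurable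
 have on_B: "\<bar>on z\<bar> \<le> B" "\<bar>off z\<bar> \<le> B" for z
  using admD(2)[OF \<Phi>, of z] admD(4)[OF \<Phi>] by (auto simp: on_def off_def indicator_def)
 have split: "pairing \<mu> \<Phi> = pairing \<mu> on + pairing \<mu> off" if "subkernel \<mu>" for \<mu>
 proof -
  have "pairing \<mu> \<Phi> = pairing \<mu> (%z. on z + off z)"
   unfolding pairing_def
  proof (rule integral_cong_AE)
   show "(%x. \<integral>m. \<Phi> (x, m) \<partial>\<mu> x) \<in> bmeas torus"
    by (rule measurable_torus[OF pairing_inner_measurable[OF that admD(1,2)[OF \<Phi>]]])
   have "\<bar>on z + off z\<bar> \<le> B + B" for z using on_B[of z] by linarith
   thus "(%x. \<integral>m. on (x, m) + off (x, m) \<partial>\<mu> x) \<in> bmeas torus"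
    using on_m off_m by (intro measurable_torus pairing_inner_measurable[OF that, of "%z. on z + off z" "B + B"]) auto
   show "AE x in torus. (\<integral>m. \<Phi> (x, m) \<partial>\<mu> x) = (\<integral>m. on (x, m) + off (x, m) \<partial>\<mu> x)"
    using good_AE
   proof (rule eventually_mono)
    fix x assume "x \<in> good"
    hence "\<Phi> (x, m) = on (x, m) + off (x, m)" for m by (auto simp: on_def off_def indicator_def)
    thus "(\<integral>m. \<Phi> (x, m) \<partial>\<mu> x) = (\<integral>m. on (x, m) + off (x, m) \<partial>\<mu> x)" by simp
   qed
  qed
  also have "... = pairing \<mu> on + pairing \<mu> off"
   by (rule pairing_add[OF that on_m on_B(1) off_m on_B(2)])
  finally show ?thesis .
 qed
 have \<Phi>_bound: "\<bar>\<Phi> (x, m)\<bar> \<le> (if m \<in> slab r then c + 4 * c0 * C else if 0 < m then 4 * c0 * C + 2 * c0 * w m else 0)" if "x \<in> good" for x m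
  unfolding \<Phi>_def c_def by (rule linearised_bound[OF \<rho> \<rho>' r W p _ _ C null]) (use that in \<open>auto simp: good_def\<close>)
 have "pairing \<rho> on - pairing \<rho>' on \<le> (c + D) * b"
 proof -
  have cD: "0 < c + D" using c D0 by simp
  have "adm RR (strip r) 1 (%z. 1 / (c + D) * on z)"
  proof (rule admI)
   show "\<bar>1 / (c + D) * on z\<bar> \<le> 1" for z
   proof -
    have "\<bar>on z\<bar> \<le> c + D" using \<Phi>_bound[of "fst z" "snd z"] cD by (cases z) (auto simp: on_def indicator_def D)
    thus ?thesis using cD by (simp add: abs_mult)
   qed
  qed (use on_m in \<open>auto simp: on_def indicator_def\<close>)
  from b[OF this] have "1 / (c + D) * (pairing \<rho> on - pairing \<rho>' on) \<le> b"
   by (simp only: pairing_scale right_diff_distrib)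
  thus ?thesis using cD by (simp add: field_simps)
 qed
 moreover have off_le: "\<bar>pairing \<mu> off\<bar> \<le> e''"
  if \<mu>: "subkernel \<mu>" and t: "nnpair \<mu> (%(x, m). ennreal (D + 2 * c0 * w m) * indicator (- slab r) m) \<le> ennreal e''" "0 \<le> e''" for \<mu> e''
 proof -
  have le: "\<bar>off z\<bar> \<le> (if snd z \<in> slab r \<or> snd z \<le> 0 then 0 else D + 2 * c0 * w (snd z))" for z
  proof (cases "z \<in> good \<times> (- slab r)")
   case True
   thus ?thesis using \<Phi>_bound[of "fst z" "snd z"] by (cases z) (auto simp: off_def D split: if_splits)
  next
   case False
   hence "off z = 0" by (simp add: off_def)
   moreover have "0 \<le> D + 2 * c0 * w (snd z)" if "0 < snd z"
    using D0 c0 w_pos[OF that] by simp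
   ultimately show ?thesis by auto
  qed
  have nn: "nnpair \<mu> (%z. ennreal (\<sigma> * off z)) \<le> ennreal e''" if "\<sigma> = 1 \<or> \<sigma> = -1" for \<sigma> :: real
  proof -
   have "ennreal (\<sigma> * off z) \<le> ennreal (D + 2 * c0 * w (snd z)) * indicator (- slab r) (snd z)" for z
   proof (cases "snd z \<in> slab r \<or> snd z \<le> 0")
    case True
    hence "off z = 0" using le[of z] by simp
    thus ?thesis by simp
   next
    case False
    hence "\<sigma> * off z \<le> D + 2 * c0 * w (snd z)" using le[of z] that by auto
    thus ?thesis using False by (auto simp: intro: ennreal_leI)
   qed
   thus ?thesis by (intro order_trans[OF nnpair_mono t(1)]) (auto simp: case_prod_beta')
  qed
  have "pairing \<mu> (%z. \<sigma> * off z) \<le> e''" if "\<sigma> = 1 \<or> \<sigma> = -1" for \<sigma> :: real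
  proof (rule pairing_le_nnpair[OF \<mu> _ _ nn[OF that] t(2)])
   show "\<bar>\<sigma> * off z\<bar> \<le> B" for z using on_B(2)[of z] that by auto
  qed (use off_m in measurable)
  from this[of 1] this[of "-1"] show ?thesis unfolding pairing_scale by simp
 qed
 ultimately have "pairing \<rho> \<Phi> - pairing \<rho>' \<Phi> \<le> (c + D) * b + (e + e')"
  using off_le[OF \<rho> tails(1,3)] off_le[OF \<rho>' tails(2,4)] unfolding split[OF \<rho>] split[OF \<rho>'] by linarith
 thus ?thesis using lhs by (simp add: c_def)
qed

text \<open>Gronwall's argument for the largest difference of the pairings over all test functions bounded
  by one on a slab. The damping rate needed depends on the slab and is unbounded, but
  \<open>comparison\<close> removes it; what remains is a rate \<open>D\<close>, independent of
  the slab, and the tails, which vanish with the slab.\<close>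

theorem paths_agree:
 assumes 1: "moment_path a w q k c0 Q0 T E0 \<rho> \<eta>" and 2: "moment_path a w q k c0 Q0 T E0 \<rho>' \<eta>'"
  and t: "t \<in> {0..T}" and r: "1 \<le> r" and p: "adm RR (strip r) 1 p"
 shows "pairing (\<rho> t) p \<le> pairing (\<rho>' t) p"
proof -
 interpret A: moment_path a w q k c0 Q0 T E0 \<rho> \<eta> by (rule 1)
 interpret B: moment_path a w q k c0 Q0 T E0 \<rho>' \<eta>' by (rule 2)
 obtain CA where CA: "0 \<le> CA" "!!t. t \<in> {0..T} ==> AE x in torus. (\<integral>\<^sup>+m. ennreal (w m) \<partial>\<rho> t x) \<le> ennreal CA"
  using A.moment_bound by blast
 obtain CB where CB: "0 \<le> CB" "!!t. t \<in> {0..T} ==> AE x in torus. (\<integral>\<^sup>+m. ennreal (w m) \<partial>\<rho>' t x) \<le> ennreal CB"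
  using B.moment_bound by blast
 define C where "C = max CA CB"
 have C: "0 \<le> C" using CA(1) by (simp add: C_def)
 have mom: "AE x in torus. (\<integral>\<^sup>+m. ennreal (w m) \<partial>\<rho> t x) \<le> ennreal C"
  "AE x in torus. (\<integral>\<^sup>+m. ennreal (w m) \<partial>\<rho>' t x) \<le> ennreal C" if "t \<in> {0..T}" for t
 proof -
  have le: "ennreal CA \<le> ennreal C" "ennreal CB \<le> ennreal C" by (auto simp: C_def intro: ennreal_leI)
  show "AE x in torus. (\<integral>\<^sup>+m. ennreal (w m) \<partial>\<rho> t x) \<le> ennreal C"
   by (rule eventually_mono[OF CA(2)[OF that]]) (erule order_trans[OF _ le(1)])
  show "AE x in torus. (\<integral>\<^sup>+m. ennreal (w m) \<partial>\<rho>' t x) \<le> ennreal C"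
   by (rule eventually_mono[OF CB(2)[OF that]]) (erule order_trans[OF _ le(2)])
 qed
 define D where "D = 4 * c0 * C + 1"
 have c0: "0 \<le> c0" by (rule A.c0_nonneg)
 have D: "0 < D" using c0 C by (simp add: D_def add_nonneg_pos)
 define l where "l = 2 * D"
 have T: "0 \<le> T" using t by auto
 define rem where "rem n s = A.tail D (real (Suc n)) s + B.tail D (real (Suc n)) s" for n s
 define R where "R n = (LINT s:{0..T}|lborel. rem n s)" for n
 note tA = A.tail_bounds[OF _ less_imp_le[OF D] C mom(1)]
 note tB = B.tail_bounds[OF _ less_imp_le[OF D] C mom(2)]
 have int_tail: "set_integrable lborel {0..T} (A.tail D r)" "set_integrable lborel {0..T} (B.tail D r)" for r
  using tA(3,4) tB(3,4)
  by (auto intro!: set_integrable_bounded[OF A.tail_meas, of _ _ "D + 2 * c0 * C"] set_integrable_bounded[OF B.tail_meas, of _ _ "D + 2 * c0 * C"] less_imp_le[OF D])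
 have R: "R \<longlonglongrightarrow> 0"
 proof -
  have "(%n. (LINT s:{0..T}|lborel. A.tail D (real (Suc n)) s) + (LINT s:{0..T}|lborel. B.tail D (real (Suc n)) s)) \<longlonglongrightarrow> 0 + 0"
   by (intro tendsto_add A.tail_limit[OF less_imp_le[OF D] C mom(1)] B.tail_limit[OF less_imp_le[OF D] C mom(2)])
  thus ?thesis unfolding R_def rem_def by (simp add: set_integral_add(2)[OF int_tail])
 qed
 have rem_int: "set_integrable lborel {0..T} (rem n)" for n
  unfolding rem_def by (rule set_integral_add(1)[OF int_tail])
 have rem_nn: "0 \<le> rem n s" "rem n s \<le> 2 * (D + 2 * c0 * C)" if "s \<in> {0..T}" for n s
 proof -
  show "0 \<le> rem n s" unfolding rem_def by (rule add_nonneg_nonneg[OF tA(3)[OF that that] tB(3)[OF that that]])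
  show "rem n s \<le> 2 * (D + 2 * c0 * C)"
   unfolding rem_def mult_2[of "D + 2 * c0 * C"] by (rule add_mono[OF tA(4)[OF that that] tB(4)[OF that that]])
 qed
 have main: "pairing (\<rho> t) p - pairing (\<rho>' t) p \<le> 2 * R n * exp (l * t)"
  if p: "adm RR (strip (real (Suc n))) 1 p" and t: "t \<in> {0..T}" for n p t
 proof -
  let ?r = "real (Suc n)"
  have r: "1 \<le> ?r" by simp
  obtain W where W: "0 \<le> W" "!!m. m \<in> slab ?r ==> 0 < w m" "!!m. m \<in> slab ?r ==> w m \<le> W"
   using A.w_slab_bound[OF r] by blast
  define c where "c = 2 * c0 * W"
  have c: "0 \<le> c" using c0 W(1) by (simp add: c_def)
  define I where "I = {p. adm RR (strip ?r) 1 p}"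
  define v where "v p s = pairing (\<rho> s) p - pairing (\<rho>' s) p" for p s
  have v_le: "v p s \<le> 2" if "p \<in> I" "s \<in> {0..T}" for p s
   using bp_bound[OF bp_pairing[OF A.kernel[OF that(2)]]] bp_bound[OF bp_pairing[OF B.kernel[OF that(2)]]] that(1)
   unfolding v_def I_def by (fastforce simp: abs_le_iff)
  have zero: "(%_. 0) \<in> I" by (simp add: I_def adm_zero)
  define S where "S = (%(p, s). v p s * exp (- l * s)) ` (I \<times> {0..T})"
  have S_bdd: "bdd_above S"
  proof (rule bdd_aboveI)
   fix y assume "y \<in> S"
   then obtain p s where y: "y = v p s * exp (- l * s)" "p \<in> I" "s \<in> {0..T}" by (auto simp: S_def)
   have "v p s * exp (- l * s) \<le> 2 * exp (- l * s)" using v_le[OF y(2,3)] by (intro mult_right_mono) auto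
   also have "... \<le> 2 * 1" using D y(3) by (intro mult_left_mono) (auto simp: l_def)
   finally show "y \<le> 2" using y(1) by simp
  qed
  define \<alpha> where "\<alpha> = Sup S"
  have S0: "0 \<in> S" unfolding S_def using zero T by (auto simp: v_def pairing_def intro!: image_eqI[of _ _ "(%_. 0, 0)"])
  have \<alpha>0: "0 \<le> \<alpha>" unfolding \<alpha>_def by (rule cSup_upper[OF S0 S_bdd])
  have le: "v p s \<le> \<alpha> * exp (l * s)" if "p \<in> I" "s \<in> {0..T}" for p s
  proof -
   have "v p s * exp (- l * s) \<le> \<alpha>"
    unfolding \<alpha>_def using that by (intro cSup_upper[OF _ S_bdd]) (auto simp: S_def)
   thus ?thesis by (simp add: exp_minus field_simps)
  qed
  define h where "h s = D * \<alpha> * exp (l * s) + rem n s" for s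
  have h_int: "set_integrable lborel {0..T} (%s. D * \<alpha> * exp (l * s))"
   by (rule set_integrable_bounded[where C="D * \<alpha> * exp (l * T)"])
    (use D \<alpha>0 in \<open>auto simp: set_borel_measurable_def l_def abs_mult intro!: mult_left_mono\<close>)
  have h_meas: "set_borel_measurable lborel {0..T} h"
   using set_integral_add(1)[OF h_int rem_int[of n]] unfolding h_def set_integrable_def set_borel_measurable_def by auto
  have h_bound: "\<bar>h s\<bar> \<le> D * \<alpha> * exp (l * T) + 2 * (D + 2 * c0 * C)" if "s \<in> {0..T}" for s
  proof -
   have "0 \<le> D * \<alpha> * exp (l * s)" "D * \<alpha> * exp (l * s) \<le> D * \<alpha> * exp (l * T)"
    using that D \<alpha>0 by (auto simp: l_def intro!: mult_left_mono)
   thus ?thesis using rem_nn[OF that, of n] by (simp add: h_def)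
  qed
  have step: "v p s \<le> 0 + (LINT s':{0..s}|lborel. h s')" if "p \<in> I" "s \<in> {0..T}" for p s
  proof (rule comparison[OF h_meas h_bound c, where I=I and V=2 and v=v and i=p and t=s and ?u0.0=0])
   fix p t assume pt: "p \<in> I" "t \<in> {0..T}"
   hence p: "adm RR (strip ?r) 1 p" by (simp add: I_def)
   define gA where "gA s = c * pairing (\<rho> s) (semigroup_at a (t - s) p) + collision w k (\<rho> s) (semigroup_at a (t - s) p)" for s
   define gB where "gB s = c * pairing (\<rho>' s) (semigroup_at a (t - s) p) + collision w k (\<rho>' s) (semigroup_at a (t - s) p)" for s
   have balA: "set_borel_measurable lborel {0..t} (%s. exp (- c * (t - s)) * gA s)"
    "pairing (\<rho> t) p = exp (- c * t) * E0 (semigroup_at a t p) + (LINT s:{0..t}|lborel. exp (- c * (t - s)) * gA s)"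
    using A.mild[OF r c pt(2) p] unfolding balanced_def gA_def by auto
   have balB: "set_borel_measurable lborel {0..t} (%s. exp (- c * (t - s)) * gB s)"
    "pairing (\<rho>' t) p = exp (- c * t) * E0 (semigroup_at a t p) + (LINT s:{0..t}|lborel. exp (- c * (t - s)) * gB s)"
    using B.mild[OF r c pt(2) p] unfolding balanced_def gB_def by auto
   obtain K where K: "!!s. s \<in> {0..T} ==> bpf RR (strip ?r) K (pairing (\<rho> s))"
    "bpf RR (strip ?r) K E0"
    "!!s. s \<in> {0..T} ==> bpf RR (strip ?r) K (%p. c * pairing (\<rho> s) p + collision w k (\<rho> s) p)"
    using A.path_bp[OF r c] by blast
   obtain K' where K': "!!s. s \<in> {0..T} ==> bpf RR (strip ?r) K' (pairing (\<rho>' s))"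
    "bpf RR (strip ?r) K' E0"
    "!!s. s \<in> {0..T} ==> bpf RR (strip ?r) K' (%p. c * pairing (\<rho>' s) p + collision w k (\<rho>' s) p)"
    using B.path_bp[OF r c] by blast
   have exp_bound: "\<bar>exp (- c * (t - s)) * g\<bar> \<le> L" if "\<bar>g\<bar> \<le> L" "s \<le> t" for g L s
   proof -
    have "exp (- c * (t - s)) * \<bar>g\<bar> \<le> 1 * L" using that c by (intro mult_mono) auto
    thus ?thesis by (simp add: abs_mult)
   qed
   have intA: "set_integrable lborel {0..t} (%s. exp (- c * (t - s)) * gA s)"
   proof (rule set_integrable_bounded[OF balA(1)])
    fix s assume s: "0 \<le> s" "s \<le> t"
    hence "\<bar>gA s\<bar> \<le> K * 1" unfolding gA_def using pt(2) by (intro bp_bound[OF K(3)] adm_semigroup[OF A.a_meas p]) auto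
    thus "\<bar>exp (- c * (t - s)) * gA s\<bar> \<le> K * 1" by (rule exp_bound[OF _ s(2)])
   qed
   have intB: "set_integrable lborel {0..t} (%s. exp (- c * (t - s)) * gB s)"
   proof (rule set_integrable_bounded[OF balB(1)])
    fix s assume s: "0 \<le> s" "s \<le> t"
    hence "\<bar>gB s\<bar> \<le> K' * 1" unfolding gB_def using pt(2) by (intro bp_bound[OF K'(3)] adm_semigroup[OF A.a_meas p]) auto
    thus "\<bar>exp (- c * (t - s)) * gB s\<bar> \<le> K' * 1" by (rule exp_bound[OF _ s(2)])
   qed
   define g where "g s = gA s - gB s" for s
   have "set_integrable lborel {0..t} (%s. exp (- c * (t - s)) * g s)"
    using set_integral_diff(1)[OF intA intB] by (simp add: g_def right_diff_distrib)
   moreover have "v p t \<le> exp (- c * t) * 0 + (LINT s:{0..t}|lborel. exp (- c * (t - s)) * g s)"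
    using set_integral_diff(2)[OF intA intB] unfolding v_def balA(2) balB(2) by (simp add: g_def right_diff_distrib)
   moreover have "g s \<le> c * b + h s" if s: "s \<in> {0..t}" and b: "!!j. j \<in> I ==> v j s \<le> b" for s b
   proof -
    have sT: "s \<in> {0..T}" using s pt(2) by auto
    define b' where "b' = min b (\<alpha> * exp (l * s))"
    have "g s \<le> (2 * c0 * W + D) * b' + (A.tail D ?r s + B.tail D ?r s)"
     unfolding g_def gA_def gB_def c_def
    proof (rule A.generator_difference[OF A.kernel[OF sT] B.kernel[OF sT] r W(1,3) adm_semigroup[OF A.a_meas p] C D_def mom[OF sT] A.no_zero[OF sT] B.no_zero[OF sT]])
     show "pairing (\<rho> s) j - pairing (\<rho>' s) j \<le> b'" if "adm RR (strip ?r) 1 j" for j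
      using b[of j] le[OF _ sT, of j] that by (simp add: I_def v_def b'_def)
    qed (use tA(2,3)[OF sT sT] tB(2,3)[OF sT sT] in auto)
    also have "(2 * c0 * W + D) * b' = c * b' + D * b'" by (simp add: c_def distrib_right)
    also have "c * b' + D * b' \<le> c * b + D * (\<alpha> * exp (l * s))"
     using c D by (intro add_mono mult_left_mono) (auto simp: b'_def)
    finally show ?thesis by (simp add: h_def rem_def)
   qed
   ultimately show "\<exists>g. set_integrable lborel {0..t} (%s. exp (- c * (t - s)) * g s)
    \<and> v p t \<le> exp (- c * t) * 0 + (LINT s:{0..t}|lborel. exp (- c * (t - s)) * g s)
    \<and> (\<forall>s\<in>{0..t}. \<forall>b. (\<forall>j\<in>I. v j s \<le> b) --> g s \<le> c * b + h s)"
    by blast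
  qed (use v_le that in auto)
  have step2: "v p s \<le> \<alpha> / 2 * exp (l * s) + R n" if ps: "p \<in> I" "s \<in> {0..T}" for p s
  proof -
   have i1: "set_integrable lborel {0..s} (%s. D * \<alpha> * exp (l * s))" and i2: "set_integrable lborel {0..s} (rem n)"
    by (rule set_integrable_subset[OF h_int] set_integrable_subset[OF rem_int]; use ps(2) in auto)+
   have "(LINT s':{0..s}|lborel. h s') = D * \<alpha> * (LINT s':{0..s}|lborel. exp (l * s')) + (LINT s':{0..s}|lborel. rem n s')"
    unfolding h_def by (simp add: set_integral_add(2)[OF i1 i2])
   also have "D * \<alpha> * (LINT s':{0..s}|lborel. exp (l * s')) = \<alpha> / 2 * (exp (l * s) - 1)"
    using set_integral_exp[of l s] D ps(2) by (simp add: l_def)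
   also have "(LINT s':{0..s}|lborel. rem n s') \<le> R n"
    unfolding R_def set_lebesgue_integral_def
    using i2 rem_int[of n] rem_nn(1)[of _ n] ps(2)
    by (intro integral_mono) (auto simp: set_integrable_def indicator_def)
   finally have "(LINT s':{0..s}|lborel. h s') \<le> \<alpha> / 2 * exp (l * s) + R n"
    using \<alpha>0 by (simp add: algebra_simps)
   thus ?thesis using step[OF ps] by simp
  qed
  have Rn: "0 \<le> R n"
   unfolding R_def set_lebesgue_integral_def using rem_nn(1) by (intro integral_nonneg_AE AE_I2) (auto simp: indicator_def)
  \<comment> \<open>The constant \<open>l = 2 D\<close> in the discount makes the linear term contribute half of the supremum \<open>\<alpha>\<close>.\<close>
  have "\<alpha> \<le> \<alpha> / 2 + R n"
   unfolding \<alpha>_def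
  proof (rule cSup_least, fold \<alpha>_def)
   show "S \<noteq> {}" using S0 by auto
   fix y assume "y \<in> S"
   then obtain p s where y: "y = v p s * exp (- l * s)" "p \<in> I" "s \<in> {0..T}" by (auto simp: S_def)
   have "y \<le> (\<alpha> / 2 * exp (l * s) + R n) * exp (- l * s)"
    unfolding y(1) using step2[OF y(2,3)] by (intro mult_right_mono) auto
   also have "... = \<alpha> / 2 + R n * exp (- l * s)" by (simp add: exp_minus distrib_right)
   also have "... \<le> \<alpha> / 2 + R n" using Rn D y(3) by (simp add: mult_left_le l_def)
   finally show "y \<le> \<alpha> / 2 + R n" .
  qed
  hence "\<alpha> \<le> 2 * R n" by simp
  hence "\<alpha> * exp (l * t) \<le> 2 * R n * exp (l * t)" by (intro mult_right_mono) auto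
  moreover have "v p t \<le> \<alpha> * exp (l * t)"
   by (rule le) (use p t in \<open>simp_all add: I_def\<close>)
  ultimately show ?thesis unfolding v_def by linarith
 qed
 obtain N where N: "r \<le> real N" using real_arch_simple by blast
 have "pairing (\<rho> t) p - pairing (\<rho>' t) p \<le> 0"
 proof (rule LIMSEQ_le_const)
  have "(%n. 2 * R n * exp (l * t)) \<longlonglongrightarrow> 2 * 0 * exp (l * t)" by (intro tendsto_intros R)
  thus "(%n. 2 * R n * exp (l * t)) \<longlonglongrightarrow> 0" by simp
  have "pairing (\<rho> t) p - pairing (\<rho>' t) p \<le> 2 * R n * exp (l * t)" if "N \<le> n" for n
  proof (rule main[OF _ t])
   have "slab r \<subseteq> slab (real (Suc n))" using N that by (intro slab_mono[OF r]) auto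
   hence "strip r \<subseteq> strip (real (Suc n))" by (rule Sigma_mono[OF subset_refl])
   thus "adm RR (strip (real (Suc n))) 1 p" using p unfolding adm_def by blast
  qed
  thus "\<exists>N. \<forall>n\<ge>N. pairing (\<rho> t) p - pairing (\<rho>' t) p \<le> 2 * R n * exp (l * t)" by blast
 qed
 thus ?thesis by simp
qed

section \<open>Measures on phase space with a spatial density\<close>

lemma space_masses [simp]: "space masses = {0..}"
 by (simp add: masses_def)

lemma max_masses: "max 0 \<in> borel \<rightarrow>\<^sub>M masses"
 unfolding masses_def by (rule measurable_restrict_space2) auto

lemma frac_torus: "frac \<in> borel \<rightarrow>\<^sub>M torus"
 unfolding measurable_cong_sets[OF refl sets_torus]
 by (rule measurable_restrict_space2) (auto simp: frac_lt_1)

lemma masses_borel: "f \<in> borel \<rightarrow>\<^sub>M N ==> f \<in> masses \<rightarrow>\<^sub>M N"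
 unfolding masses_def by (rule measurable_restrict_space1)

lemma torus_borel: "f \<in> borel \<rightarrow>\<^sub>M N ==> f \<in> torus \<rightarrow>\<^sub>M N"
 unfolding measurable_cong_sets[OF sets_torus refl] by (rule measurable_restrict_space1)

text \<open>Retractions of the line onto the torus and onto the half-line, which turn functions on phase
  space into functions on all pairs of reals.\<close>

lemma to_phase: "(%z. (frac (fst z), max 0 (snd z))) \<in> RR \<rightarrow>\<^sub>M torus \<Otimes>\<^sub>M masses"
 by (rule measurable_Pair[OF measurable_compose[OF measurable_fst frac_torus] measurable_compose[OF measurable_snd max_masses]])

lemma from_phase: "(%z. z) \<in> torus \<Otimes>\<^sub>M masses \<rightarrow>\<^sub>M RR"
proof -
 have "(%z. (fst z, snd z)) \<in> torus \<Otimes>\<^sub>M masses \<rightarrow>\<^sub>M RR"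
 proof (rule measurable_Pair)
  show "fst \<in> torus \<Otimes>\<^sub>M masses \<rightarrow>\<^sub>M borel"
   using measurable_compose[OF measurable_fst torus_borel[OF measurable_ident]] by (simp only: id_apply)
  show "snd \<in> torus \<Otimes>\<^sub>M masses \<rightarrow>\<^sub>M borel"
   using measurable_compose[OF measurable_snd masses_borel[OF measurable_ident]] by (simp only: id_apply)
 qed
 thus ?thesis by (simp only: prod.collapse)
qed

lemma phase_borel: "f \<in> RR \<rightarrow>\<^sub>M N ==> f \<in> torus \<Otimes>\<^sub>M masses \<rightarrow>\<^sub>M N"
 by (rule measurable_compose[OF from_phase])

lemma space_phase: "space (torus \<Otimes>\<^sub>M masses) = {0..<1} \<times> {0..}"
 by (simp add: space_pair_measure)

text \<open>Finite kernels are multiples of sub-probability kernels, for which the measurability of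
  parameter integrals is known.\<close>

lemma spatial_density_factor:
 assumes d: "spatial_density \<mu> \<upsilon>"
 obtains c K where "c \<in> bmeas torus" "!!x. 0 < c x" "K \<in> torus \<rightarrow>\<^sub>M subprob_algebra masses"
  "!!x. x \<in> space torus ==> \<upsilon> x = scale_measure (ennreal (c x)) (K x)"
proof -
 have fin: "finite_measure (\<upsilon> x)" "sets (\<upsilon> x) = sets masses" if "x \<in> space torus" for x
  using d that unfolding spatial_density_def finite_measures_def by auto
 have meas: "(%x. emeasure (\<upsilon> x) A) \<in> bmeas torus" if "A \<in> sets masses" for A
  using d that unfolding spatial_density_def by auto
 have top: "{0..} \<in> sets masses" using sets.top[of masses] by simp
 define c where "c x = 1 + enn2real (emeasure (\<upsilon> x) {0..})" for x
 define K where "K x = scale_measure (ennreal (1 / c x)) (\<upsilon> x)" for x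
 have c: "0 < c x" for x by (simp add: c_def add_pos_nonneg)
 have cm: "c \<in> bmeas torus"
  unfolding c_def by (intro borel_measurable_add borel_measurable_const borel_measurable_enn2real meas top)
 have cc: "ennreal (c x) * ennreal (1 / c x) = 1" for x
  using c[of x] by (simp add: ennreal_mult[symmetric] less_imp_le)
 have "K \<in> torus \<rightarrow>\<^sub>M subprob_algebra masses"
 proof (rule measurable_subprob_algebra)
  fix x assume x: "x \<in> space torus"
  have sp: "space (\<upsilon> x) = {0..}" using sets_eq_imp_space_eq[OF fin(2)[OF x]] by simp
  have "emeasure (\<upsilon> x) {0..} = ennreal (enn2real (emeasure (\<upsilon> x) {0..}))"
   using finite_measure.emeasure_finite[OF fin(1)[OF x]] by (simp add: less_top)
  also have "... \<le> ennreal (c x)" by (rule ennreal_leI) (simp add: c_def)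
  finally have "ennreal (1 / c x) * emeasure (\<upsilon> x) {0..} \<le> ennreal (1 / c x) * ennreal (c x)"
   by (rule mult_left_mono) simp
  hence "ennreal (1 / c x) * emeasure (\<upsilon> x) {0..} \<le> 1" using cc[of x] by (simp add: mult.commute)
  thus "subprob_space (K x)" by (intro subprob_spaceI) (simp_all add: K_def space_scale_measure sp)
  show "sets (K x) = sets masses" using fin(2)[OF x] by (simp add: K_def)
 next
  fix A assume A: "A \<in> sets masses"
  have "(%x. ennreal (1 / c x) * emeasure (\<upsilon> x) A) \<in> bmeas torus"
   by (intro borel_measurable_times_ennreal meas A measurable_compose[OF _ measurable_ennreal]
    borel_measurable_divide borel_measurable_const cm)
  thus "(%x. emeasure (K x) A) \<in> bmeas torus" by (simp add: K_def)
 qed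
 moreover have "\<upsilon> x = scale_measure (ennreal (c x)) (K x)" if "x \<in> space torus" for x
 proof (rule measure_eqI)
  show "emeasure (\<upsilon> x) A = emeasure (scale_measure (ennreal (c x)) (K x)) A" for A
   using cc[of x] by (simp add: K_def mult.assoc[symmetric])
 qed (simp add: K_def)
 ultimately show ?thesis using that[OF cm c] by blast
qed

lemma spatial_density_kernel:
 assumes d: "spatial_density \<mu> \<upsilon>" and f: "(%(x, m). f x m) \<in> bmeas (torus \<Otimes>\<^sub>M masses)"
 shows "(%x. \<integral>\<^sup>+m. f x m \<partial>\<upsilon> x) \<in> bmeas torus"
proof (rule spatial_density_factor[OF d])
 fix c K
 assume c: "c \<in> bmeas torus" "!!x. 0 < (c x :: real)" and K: "K \<in> torus \<rightarrow>\<^sub>M subprob_algebra masses"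
  and \<upsilon>: "!!x. x \<in> space torus ==> \<upsilon> x = scale_measure (ennreal (c x)) (K x)"
 have "(%x. ennreal (c x) * (\<integral>\<^sup>+m. f x m \<partial>K x)) \<in> bmeas torus"
  by (intro borel_measurable_times_ennreal measurable_compose[OF c(1) measurable_ennreal]
   nn_integral_measurable_subprob_algebra2[OF f K])
 also have "?this \<longleftrightarrow> ?thesis"
 proof (rule measurable_cong)
  fix x assume x: "x \<in> space torus"
  have "f x \<in> bmeas masses" using measurable_compose[OF measurable_Pair1'[OF x] f] by simp
  hence "f x \<in> bmeas (K x)"
   using measurable_cong_sets[OF sets_kernel[OF K x] refl] by blast
  thus "ennreal (c x) * (\<integral>\<^sup>+m. f x m \<partial>K x) = (\<integral>\<^sup>+m. f x m \<partial>\<upsilon> x)"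
   unfolding \<upsilon>[OF x] by (simp add: nn_integral_scale_measure)
 qed
 finally show ?thesis .
qed

lemma spatial_density_pair_kernel:
 assumes d: "spatial_density \<mu> \<upsilon>" and f: "(%(x, z). f x z) \<in> bmeas (torus \<Otimes>\<^sub>M (masses \<Otimes>\<^sub>M masses))"
 shows "(%x. \<integral>\<^sup>+z. f x z \<partial>(\<upsilon> x \<Otimes>\<^sub>M \<upsilon> x)) \<in> bmeas torus"
proof (rule spatial_density_factor[OF d])
 fix c K
 assume c: "c \<in> bmeas torus" "!!x. 0 < (c x :: real)" and K: "K \<in> torus \<rightarrow>\<^sub>M subprob_algebra masses"
  and \<upsilon>: "!!x. x \<in> space torus ==> \<upsilon> x = scale_measure (ennreal (c x)) (K x)"
 have KK: "(%x. K x \<Otimes>\<^sub>M K x) \<in> torus \<rightarrow>\<^sub>M subprob_algebra (masses \<Otimes>\<^sub>M masses)"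
  by (rule measurable_pair_measure[OF K K])
 have "(%x. (ennreal (c x) * ennreal (c x)) * (\<integral>\<^sup>+z. f x z \<partial>(K x \<Otimes>\<^sub>M K x))) \<in> bmeas torus"
  by (intro borel_measurable_times_ennreal measurable_compose[OF c(1) measurable_ennreal]
   nn_integral_measurable_subprob_algebra2[OF f KK])
 also have "?this \<longleftrightarrow> ?thesis"
 proof (rule measurable_cong)
  fix x assume x: "x \<in> space torus"
  interpret K: subprob_space "K x" by (rule subprob_space_kernel[OF K x])
  have fin: "finite_measure (\<upsilon> x)"
   using d x unfolding spatial_density_def finite_measures_def by auto
  hence sf: "sigma_finite_measure (\<upsilon> x)" by (rule finite_measure.axioms(1))
  have "\<upsilon> x \<Otimes>\<^sub>M \<upsilon> x = scale_measure (ennreal (c x) * ennreal (c x)) (K x \<Otimes>\<^sub>M K x)"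
  proof (rule pair_measure_eqI[OF sf sf])
   have s: "sets (\<upsilon> x) = sets (K x)" by (simp add: \<upsilon>[OF x])
   show "sets (\<upsilon> x \<Otimes>\<^sub>M \<upsilon> x) = sets (scale_measure (ennreal (c x) * ennreal (c x)) (K x \<Otimes>\<^sub>M K x))"
    unfolding sets_scale_measure by (rule sets_pair_measure_cong[OF s s])
   fix A B assume "A \<in> sets (\<upsilon> x)" "B \<in> sets (\<upsilon> x)"
   thus "emeasure (\<upsilon> x) A * emeasure (\<upsilon> x) B = emeasure (scale_measure (ennreal (c x) * ennreal (c x)) (K x \<Otimes>\<^sub>M K x)) (A \<times> B)"
    unfolding s unfolding \<upsilon>[OF x] by (simp add: K.emeasure_pair_measure_Times mult_ac)
  qed
  moreover have "f x \<in> bmeas (masses \<Otimes>\<^sub>M masses)" using measurable_compose[OF measurable_Pair1'[OF x] f] by simp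
  hence "f x \<in> bmeas (K x \<Otimes>\<^sub>M K x)"
   using measurable_cong_sets[OF sets_kernel[OF KK x] refl] by blast
  ultimately show "(ennreal (c x) * ennreal (c x)) * (\<integral>\<^sup>+z. f x z \<partial>(K x \<Otimes>\<^sub>M K x)) = (\<integral>\<^sup>+z. f x z \<partial>(\<upsilon> x \<Otimes>\<^sub>M \<upsilon> x))"
   by (simp add: nn_integral_scale_measure)
 qed
 finally show ?thesis .
qed

text \<open>The definition of a spatial density gives this for indicators; the rest is the standard
  induction over nonnegative functions.\<close>

lemma spatial_density_nn:
 assumes d: "spatial_density \<mu> \<upsilon>" and \<mu>: "sets \<mu> = sets (torus \<Otimes>\<^sub>M masses)"
  and f: "f \<in> bmeas (torus \<Otimes>\<^sub>M masses)"
 shows "(\<integral>\<^sup>+z. f z \<partial>\<mu>) = (\<integral>\<^sup>+x. (\<integral>\<^sup>+m. f (x, m) \<partial>\<upsilon> x) \<partial>torus)"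
proof -
 have sets: "sets (\<upsilon> x) = sets masses" if "x \<in> space torus" for x
  using d that unfolding spatial_density_def finite_measures_def by auto
 have sp: "space \<mu> = space (torus \<Otimes>\<^sub>M masses)" by (rule sets_eq_imp_space_eq[OF \<mu>])
 have sec: "(%m. g (x, m)) \<in> bmeas (\<upsilon> x)"
  if "x \<in> space torus" "g \<in> bmeas (torus \<Otimes>\<^sub>M masses)" for x and g :: "real \<times> real => ennreal"
  using measurable_compose[OF measurable_Pair1'[OF that(1)] that(2)]
  unfolding measurable_cong_sets[OF sets[OF that(1)] refl] .
 have tm: "(%x. \<integral>\<^sup>+m. g (x, m) \<partial>\<upsilon> x) \<in> bmeas torus"
  if "g \<in> bmeas (torus \<Otimes>\<^sub>M masses)" for g
  by (rule spatial_density_kernel[OF d]) (use that in auto)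
 have m\<mu>: "g \<in> bmeas \<mu> \<longleftrightarrow> g \<in> bmeas (torus \<Otimes>\<^sub>M masses)" for g :: "real \<times> real => ennreal"
  using measurable_cong_sets[OF \<mu> refl] by blast
 show ?thesis
  using f
 proof (induction rule: borel_measurable_induct)
  case (cong f g)
  have "(\<integral>\<^sup>+z. f z \<partial>\<mu>) = (\<integral>\<^sup>+z. g z \<partial>\<mu>)" using cong(3) sp by (intro nn_integral_cong) auto
  moreover have "(\<integral>\<^sup>+x. (\<integral>\<^sup>+m. f (x, m) \<partial>\<upsilon> x) \<partial>torus) = (\<integral>\<^sup>+x. (\<integral>\<^sup>+m. g (x, m) \<partial>\<upsilon> x) \<partial>torus)"
  proof (intro nn_integral_cong)
   fix x m assume "x \<in> space torus" "m \<in> space (\<upsilon> x)"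
   thus "f (x, m) = g (x, m)"
    using cong(3) sets_eq_imp_space_eq[OF sets] by (auto simp: space_pair_measure)
  qed
  ultimately show ?case using cong(4) by simp
 next
  case (set A)
  have "(\<integral>\<^sup>+x. (\<integral>\<^sup>+m. indicator A (x, m) \<partial>\<upsilon> x) \<partial>torus) = (\<integral>\<^sup>+x. emeasure (\<upsilon> x) (Pair x -` A) \<partial>torus)"
  proof (rule nn_integral_cong)
   fix x assume x: "x \<in> space torus"
   have "Pair x -` A \<in> sets (\<upsilon> x)" using sets_Pair1[OF set] sets[OF x] by simp
   moreover have "(\<integral>\<^sup>+m. indicator A (x, m) \<partial>\<upsilon> x) = (\<integral>\<^sup>+m. indicator (Pair x -` A) m \<partial>\<upsilon> x)"
    by (intro nn_integral_cong) (auto simp: indicator_def)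
   ultimately show "(\<integral>\<^sup>+m. indicator A (x, m) \<partial>\<upsilon> x) = emeasure (\<upsilon> x) (Pair x -` A)" by simp
  qed
  moreover have "emeasure \<mu> A = (\<integral>\<^sup>+x. emeasure (\<upsilon> x) (Pair x -` A) \<partial>torus)"
   using d set unfolding spatial_density_def by blast
  ultimately show ?case using set \<mu> by simp
 next
  case (mult u c)
  have "(\<integral>\<^sup>+x. (\<integral>\<^sup>+m. c * u (x, m) \<partial>\<upsilon> x) \<partial>torus) = (\<integral>\<^sup>+x. c * (\<integral>\<^sup>+m. u (x, m) \<partial>\<upsilon> x) \<partial>torus)"
   by (intro nn_integral_cong nn_integral_cmult sec mult(2))
  also have "... = c * (\<integral>\<^sup>+x. (\<integral>\<^sup>+m. u (x, m) \<partial>\<upsilon> x) \<partial>torus)" by (rule nn_integral_cmult[OF tm[OF mult(2)]])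
  finally show ?case using mult m\<mu>[of u] by (simp add: nn_integral_cmult)
 next
  case (add u v)
  have "(\<integral>\<^sup>+x. (\<integral>\<^sup>+m. v (x, m) + u (x, m) \<partial>\<upsilon> x) \<partial>torus) = (\<integral>\<^sup>+x. (\<integral>\<^sup>+m. v (x, m) \<partial>\<upsilon> x) + (\<integral>\<^sup>+m. u (x, m) \<partial>\<upsilon> x) \<partial>torus)"
   by (intro nn_integral_cong nn_integral_add sec add.hyps)
  also have "... = (\<integral>\<^sup>+x. (\<integral>\<^sup>+m. v (x, m) \<partial>\<upsilon> x) \<partial>torus) + (\<integral>\<^sup>+x. (\<integral>\<^sup>+m. u (x, m) \<partial>\<upsilon> x) \<partial>torus)"
   by (intro nn_integral_add tm add.hyps)
  finally show ?case using add m\<mu>[of u] m\<mu>[of v] by (simp add: nn_integral_add)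
 next
  case (seq U)
  have "(\<integral>\<^sup>+x. (\<integral>\<^sup>+m. (SUP i. U i) (x, m) \<partial>\<upsilon> x) \<partial>torus) = (\<integral>\<^sup>+x. (SUP i. \<integral>\<^sup>+m. U i (x, m) \<partial>\<upsilon> x) \<partial>torus)"
  proof (rule nn_integral_cong)
   fix x assume x: "x \<in> space torus"
   have "(\<integral>\<^sup>+m. (SUP i. U i) (x, m) \<partial>\<upsilon> x) = (\<integral>\<^sup>+m. (SUP i. U i (x, m)) \<partial>\<upsilon> x)"
    by (simp add: SUP_apply image_comp)
   also have "... = (SUP i. \<integral>\<^sup>+m. U i (x, m) \<partial>\<upsilon> x)"
    using \<open>incseq U\<close> by (intro nn_integral_monotone_convergence_SUP sec[OF x seq(1)]) (auto simp: incseq_def le_fun_def)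
   finally show "(\<integral>\<^sup>+m. (SUP i. U i) (x, m) \<partial>\<upsilon> x) = (SUP i. \<integral>\<^sup>+m. U i (x, m) \<partial>\<upsilon> x)" .
  qed
  also have "... = (SUP i. \<integral>\<^sup>+x. (\<integral>\<^sup>+m. U i (x, m) \<partial>\<upsilon> x) \<partial>torus)"
   using \<open>incseq U\<close> by (intro nn_integral_monotone_convergence_SUP tm seq(1)) (auto simp: incseq_def le_fun_def intro!: nn_integral_mono)
  also have "... = (SUP i. \<integral>\<^sup>+z. U i z \<partial>\<mu>)" using seq by simp
  also have "... = (\<integral>\<^sup>+z. (SUP i. U i z) \<partial>\<mu>)"
   using seq m\<mu> by (intro nn_integral_monotone_convergence_SUP[symmetric]) auto
  finally show ?case by (simp add: SUP_apply image_comp)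
 qed
qed

section \<open>Normalised rates and weighted kernels\<close>

lemma torus_ext:
 fixes f :: "real => ennreal"
 assumes "f \<in> bmeas torus"
 shows "(%x. f x * indicator {0..<1} x) \<in> bmeas borel"
proof -
 have "f \<in> bmeas (restrict_space borel {0..<1})"
  using assms measurable_cong_sets[OF sets_torus refl] by blast
 thus ?thesis by (subst (asm) borel_measurable_restrict_space_iff_ennreal) auto
qed

lemma mass_fun: "f \<in> masses \<rightarrow>\<^sub>M N ==> (%m. f (max 0 m)) \<in> borel \<rightarrow>\<^sub>M N"
 by (rule measurable_compose[OF max_masses])

lemma mass_id: "(%m. m) \<in> bmeas masses"
 by (rule masses_borel) simp

lemma per_mass_meas: "g \<in> bmeas masses ==> per_mass g \<in> bmeas masses"
proof -
 assume [measurable]: "g \<in> bmeas masses"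
 note [measurable] = mass_id
 show ?thesis unfolding per_mass_def by measurable
qed

text \<open>The data of the equation together with the constant \<open>C\<close> that normalises the
  weighted kernels to sub-probabilities.\<close>

locale rates =
 fixes a \<omega> \<pi> :: "real => real" and \<kappa> :: "real => real => real" and C :: real
 assumes a_pos: "m > 0 ==> a m > 0"
  and a_nonincreasing: "antimono_on {0<..} a"
  and \<kappa>_measurable: "(%(m, m'). \<kappa> m m') \<in> bmeas (masses \<Otimes>\<^sub>M masses)"
  and \<kappa>_nonneg: "m > 0 ==> m' > 0 ==> \<kappa> m m' \<ge> 0"
  and \<kappa>_sym: "m > 0 ==> m' > 0 ==> \<kappa> m m' = \<kappa> m' m"
  and \<omega>_measurable: "\<omega> \<in> bmeas masses"
  and \<pi>_measurable: "\<pi> \<in> bmeas masses"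
  and \<omega>_pos: "m > 0 ==> \<omega> m > 0" and \<pi>_pos: "m > 0 ==> \<pi> m > 0"
  and \<omega>_loc_bounded: "compact S ==> S \<subseteq> {0<..} ==> bounded (\<omega> ` S)"
  and \<pi>_over_\<omega>_bounded: "bounded ((%m. \<pi> m * inverse (\<omega> m)) ` {0<..})"
  and subadd_\<omega>: "subadditive_mass \<omega>"
  and subadd_a\<omega>: "subadditive_mass (%m. a m powr (-1/2) * \<omega> m)"
  and subadd_a\<omega>\<pi>: "subadditive_mass (%m. a m powr (-1/2) * \<omega> m * \<pi> m)"
  and \<kappa>_le1: "m > 0 ==> m' > 0 ==> \<kappa> m m' \<le> \<omega> m * \<omega> m'"
  and \<kappa>_le2: "m > 0 ==> m' > 0 ==> \<kappa> m m' \<le> \<omega> m * \<pi> m' + \<pi> m * \<omega> m'"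
  and C_pos: "0 < C"
begin

text \<open>Outside the positive masses the values are arbitrary, subject to the requirements on the
  normalised rates.\<close>

definition w where "w m = (if 0 < m then \<omega> m else 1)"
definition q where "q m = (if 0 < m then \<pi> m / \<omega> m else 0)"
definition a' where "a' m = (if 0 < m then a m else 1)"
definition k where "k m m' = (if 0 < m \<and> 0 < m' then C / 2 * (\<kappa> m m' / (\<omega> m * \<omega> m')) else 0)"
text \<open>The factor between the density of a solution and its normalised kernel.\<close>

definition wt where "wt m = (if 0 < m then \<omega> m / (C * m) else 0)"

lemma \<omega>_borel [measurable]: "(%m. \<omega> (max 0 m)) \<in> bmeas borel"
 and \<pi>_borel [measurable]: "(%m. \<pi> (max 0 m)) \<in> bmeas borel"
 by (rule mass_fun[OF \<omega>_measurable] mass_fun[OF \<pi>_measurable])+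

lemma w_meas [measurable]: "w \<in> bmeas borel"
proof -
 have "w = (%m. if 0 < m then \<omega> (max 0 m) else 1)" by (auto simp: w_def fun_eq_iff)
 also have "... \<in> bmeas borel" by measurable
 finally show ?thesis .
qed

lemma q_meas [measurable]: "q \<in> bmeas borel"
proof -
 have "q = (%m. if 0 < m then \<pi> (max 0 m) / \<omega> (max 0 m) else 0)" by (auto simp: q_def fun_eq_iff)
 also have "... \<in> bmeas borel" by measurable
 finally show ?thesis .
qed

lemma wt_meas [measurable]: "wt \<in> bmeas borel"
proof -
 have "wt = (%m. if 0 < m then \<omega> (max 0 m) / (C * m) else 0)" by (auto simp: wt_def fun_eq_iff)
 also have "... \<in> bmeas borel" by measurable
 finally show ?thesis .
qed

lemma a'_meas: "a' \<in> bmeas borel"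
proof -
 have "mono_on {0<..} (%m. - a m)"
  using a_nonincreasing by (auto simp: monotone_on_def)
 hence "(%m. - (- a m)) \<in> bmeas (restrict_space borel {0<..})"
  by (intro borel_measurable_uminus borel_measurable_mono_on_fnc)
 hence "a \<in> bmeas (restrict_space borel {0<..})" by simp
 hence "(%m. if m \<in> {0<..} then a m else 1) \<in> bmeas borel"
  by (subst (asm) measurable_restrict_space_iff[where c=1]) auto
 thus ?thesis by (simp add: a'_def[abs_def])
qed

lemma k_meas: "(%(m, m'). k m m') \<in> bmeas RR"
proof -
 have [measurable]: "(%z. \<kappa> (max 0 (fst z)) (max 0 (snd z))) \<in> bmeas RR"
  using measurable_compose[OF _ \<kappa>_measurable, of "%z. (max 0 (fst z), max 0 (snd z))" RR]
   measurable_Pair[OF measurable_compose[OF measurable_fst max_masses] measurable_compose[OF measurable_snd max_masses]]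
  by simp
 have "(%(m, m'). k m m') = (%z. if 0 < fst z \<and> 0 < snd z
   then C / 2 * (\<kappa> (max 0 (fst z)) (max 0 (snd z)) / (\<omega> (max 0 (fst z)) * \<omega> (max 0 (snd z)))) else 0)"
  by (auto simp: k_def fun_eq_iff)
 also have "... \<in> bmeas RR" by measurable
 finally show ?thesis .
qed

lemma powr_sqrt: "0 < m ==> a m powr (-1/2) = 1 / sqrt (a m)"
proof -
 assume m: "0 < m"
 have "a m powr (-1/2) = a m powr (- (1/2))" by simp
 also have "... = 1 / sqrt (a m)"
  using a_pos[OF m] by (simp only: powr_minus_divide powr_half_sqrt[OF less_imp_le])
 finally show ?thesis .
qed

lemma slab_compact: "1 \<le> r ==> compact (slab r) \<and> slab r \<subseteq> {0<..}"
 using slab_pos[of _ r] by (auto simp: slab_def[of r])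

lemma w_slab: "1 \<le> r ==> \<exists>W. \<forall>m\<in>slab r. w m \<le> W"
proof -
 assume r: "1 \<le> r"
 obtain W where "\<forall>y\<in>\<omega> ` slab r. norm y \<le> W"
  using \<omega>_loc_bounded[of "slab r"] slab_compact[OF r] unfolding bounded_iff by blast
 hence "\<forall>m\<in>slab r. w m \<le> W" using slab_pos[OF _ r] by (force simp: w_def)
 thus ?thesis by blast
qed

lemma wt_slab: "1 \<le> r ==> \<exists>V\<ge>0. \<forall>m\<in>slab r. \<bar>wt m\<bar> \<le> V"
proof -
 assume r: "1 \<le> r"
 obtain W where W: "\<forall>m\<in>slab r. w m \<le> W" using w_slab[OF r] by blast
 have "\<bar>wt m\<bar> \<le> \<bar>W\<bar> * r / C" if m: "m \<in> slab r" for m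
 proof -
  have m0: "0 < m" "inverse r \<le> m" using slab_pos[OF m r] m by (auto simp: slab_def)
  have "1 / m \<le> r" using m0 r by (simp add: field_simps)
  hence "\<omega> m * (1 / m) \<le> \<bar>W\<bar> * r"
   using W m m0 \<omega>_pos[OF m0(1)] by (intro mult_mono) (auto simp: w_def)
  hence "\<omega> m * (1 / m) / C \<le> \<bar>W\<bar> * r / C" by (rule divide_right_mono) (use C_pos in simp)
  thus ?thesis using m0 \<omega>_pos[OF m0(1)] C_pos by (simp add: wt_def abs_mult mult.commute)
 qed
 moreover have "0 \<le> \<bar>W\<bar> * r / C" using r C_pos by simp
 ultimately show ?thesis by blast
qed

lemma wt_nonneg: "0 \<le> wt m"
 using \<omega>_pos C_pos by (auto simp: wt_def less_imp_le)

lemma wt_pos: "0 < m ==> 0 < wt m"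
 using \<omega>_pos C_pos by (auto simp: wt_def)

definition Q0 where "Q0 = (SUP m\<in>{0<..}. \<pi> m * inverse (\<omega> m))"

sublocale R: coagulation a' w q k "C / 2" Q0
proof
 show "0 < a' m" if "0 < m" for m using that a_pos by (simp add: a'_def)
 show "a' m' \<le> a' m" if "0 < m" "m \<le> m'" for m m'
  using that a_nonincreasing by (auto simp: a'_def monotone_on_def)
 show "0 < w m" if "0 < m" for m using that \<omega>_pos by (simp add: w_def)
 show "0 \<le> q m" if "0 < m" for m using that \<omega>_pos \<pi>_pos by (simp add: q_def less_imp_le)
 show "q m \<le> Q0" if "0 < m" for m
 proof -
  have "\<pi> m * inverse (\<omega> m) \<le> Q0"
   unfolding Q0_def by (rule cSUP_upper) (use that bounded_imp_bdd_above[OF \<pi>_over_\<omega>_bounded] in auto)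
  thus ?thesis using that by (simp add: q_def divide_inverse)
 qed
 show "0 \<le> k m m'" for m m'
  using \<kappa>_nonneg \<omega>_pos C_pos by (simp add: k_def less_imp_le)
 show "k m m' \<le> C / 2" for m m'
  using \<kappa>_le1[of m m'] \<omega>_pos[of m] \<omega>_pos[of m'] C_pos by (auto simp: k_def mult_left_le divide_le_eq)
 show "k m m' = k m' m" for m m' using \<kappa>_sym by (simp add: k_def mult.commute)
 show "0 < m \<and> 0 < m'" if "k m m' \<noteq> 0" for m m' using that by (auto simp: k_def split: if_splits)
 show "k m m' \<le> C / 2 * (q m + q m')" if m: "0 < m" "0 < m'" for m m'
 proof -
  have "\<kappa> m m' / (\<omega> m * \<omega> m') \<le> (\<omega> m * \<pi> m' + \<pi> m * \<omega> m') / (\<omega> m * \<omega> m')"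
   using \<kappa>_le2[OF m] \<omega>_pos m by (intro divide_right_mono) (auto simp: less_imp_le)
  also have "... = q m + q m'" using \<omega>_pos[OF m(1)] \<omega>_pos[OF m(2)] m by (simp add: q_def field_simps)
  finally have "C / 2 * (\<kappa> m m' / (\<omega> m * \<omega> m')) \<le> C / 2 * (q m + q m')"
   by (rule mult_left_mono) (use C_pos in simp)
  thus ?thesis using m by (simp only: k_def simp_thms if_True)
 qed
 show "w (m + m') \<le> w m + w m'" if "0 < m" "0 < m'" for m m'
  using subadd_\<omega> that by (simp add: w_def subadditive_mass_def)
 show "w (m + m') / sqrt (a' (m + m')) \<le> w m / sqrt (a' m) + w m' / sqrt (a' m')" if m: "0 < m" "0 < m'" for m m'
  using subadd_a\<omega>[unfolded subadditive_mass_def, rule_format, OF m] powr_sqrt m by (simp add: w_def a'_def)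
 show "(w (m + m'))\<^sup>2 * q (m + m') / sqrt (a' (m + m')) \<le> (w m)\<^sup>2 * q m / sqrt (a' m) + (w m')\<^sup>2 * q m' / sqrt (a' m')"
  if m: "0 < m" "0 < m'" for m m'
 proof -
  have "(w m)\<^sup>2 * q m / sqrt (a' m) = a m powr (-1/2) * \<omega> m * \<pi> m" if "0 < m" for m
   using that \<omega>_pos[OF that] powr_sqrt[OF that] by (simp add: w_def q_def a'_def power2_eq_square)
  thus ?thesis using subadd_a\<omega>\<pi>[unfolded subadditive_mass_def, rule_format, OF m] m by simp
 qed
qed (use w_slab w_meas q_meas a'_meas k_meas in auto)

lemma wt_per_mass: "0 \<le> m ==> ennreal (wt m) \<le> ennreal (1 / C) * per_mass \<omega> m"
proof (cases "m = 0")
 case False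
 assume "0 \<le> m"
 hence m: "0 < m" using False by simp
 thus ?thesis using C_pos \<omega>_pos[OF m] by (simp add: wt_def per_mass_def ennreal_mult[symmetric])
qed (simp add: wt_def)

definition weigh :: "real measure => real measure"
 where "weigh U = distr (density U (%m. ennreal (wt m))) borel (%m. m)"

lemma weigh_meas:
 assumes "sets U = sets masses"
 shows "f \<in> borel \<rightarrow>\<^sub>M N ==> f \<in> U \<rightarrow>\<^sub>M N"
 using masses_borel measurable_cong_sets[OF assms refl] by blast

lemma nn_weigh:
 assumes U: "sets U = sets masses" and f: "f \<in> bmeas borel"
 shows "(\<integral>\<^sup>+m. f m \<partial>weigh U) = (\<integral>\<^sup>+m. ennreal (wt m) * f m \<partial>U)"
proof -
 have "(%m. m) \<in> density U (%m. ennreal (wt m)) \<rightarrow>\<^sub>M borel"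
  using weigh_meas[OF U, of "%m. m" borel] by simp
 thus ?thesis
  unfolding weigh_def using f weigh_meas[OF U f] weigh_meas[OF U wt_meas]
  by (simp add: nn_integral_distr nn_integral_density)
qed

lemma int_weigh:
 fixes f :: "real => real"
 assumes U: "sets U = sets masses" and f: "f \<in> bmeas borel"
 shows "(\<integral>m. f m \<partial>weigh U) = (\<integral>m. wt m * f m \<partial>U)"
proof -
 have "(%m. m) \<in> density U (%m. ennreal (wt m)) \<rightarrow>\<^sub>M borel"
  using weigh_meas[OF U, of "%m. m" borel] by simp
 hence "(\<integral>m. f m \<partial>weigh U) = (\<integral>m. f m \<partial>density U (%m. ennreal (wt m)))"
  unfolding weigh_def by (rule integral_distr[OF _ f])
 also have "... = (\<integral>m. wt m *\<^sub>R f m \<partial>U)"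
  by (rule integral_density[OF weigh_meas[OF U f] weigh_meas[OF U wt_meas]]) (simp add: wt_nonneg)
 finally show ?thesis by simp
qed

lemma emeasure_weigh:
 assumes U: "sets U = sets masses" and A: "A \<in> sets borel"
 shows "emeasure (weigh U) A = (\<integral>\<^sup>+m. ennreal (wt m) * indicator A m \<partial>U)"
proof -
 have "A \<in> sets (weigh U)" using A by (simp add: weigh_def)
 hence "emeasure (weigh U) A = (\<integral>\<^sup>+m. indicator A m \<partial>weigh U)" by simp
 also have "... = (\<integral>\<^sup>+m. ennreal (wt m) * indicator A m \<partial>U)" by (rule nn_weigh[OF U]) (use A in simp)
 finally show ?thesis .
qed

text \<open>The total mass is the integral of \<open>\<omega>(m) / m\<close>, divided by \<open>C\<close>.\<close>

lemma weigh_subprob: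
 assumes U: "sets U = sets masses" and b: "(\<integral>\<^sup>+m. per_mass \<omega> m \<partial>U) \<le> ennreal C"
 shows "subprob_space (weigh U)"
proof (rule subprob_spaceI)
 have sp: "space U = {0..}" using sets_eq_imp_space_eq[OF U] by simp
 have pm: "per_mass \<omega> \<in> bmeas U"
  using per_mass_meas[OF \<omega>_measurable] measurable_cong_sets[OF U refl] by blast
 have "emeasure (weigh U) UNIV = (\<integral>\<^sup>+m. ennreal (wt m) \<partial>U)" by (simp add: emeasure_weigh[OF U])
 also have "... \<le> (\<integral>\<^sup>+m. ennreal (1 / C) * per_mass \<omega> m \<partial>U)"
  by (intro nn_integral_mono wt_per_mass) (simp add: sp)
 also have "... = ennreal (1 / C) * (\<integral>\<^sup>+m. per_mass \<omega> m \<partial>U)" by (rule nn_integral_cmult[OF pm])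
 also have "... \<le> ennreal (1 / C) * ennreal C" by (rule mult_left_mono[OF b]) simp
 also have "... = 1" using C_pos by (simp add: ennreal_mult[symmetric])
 finally show "emeasure (weigh U) (space (weigh U)) \<le> 1" by (simp add: weigh_def)
 show "space (weigh U) \<noteq> {}" by (simp add: weigh_def)
qed

text \<open>Symmetrisation of the collision term. Exchanging the two particles and averaging replaces
  \<open>1/m'\<close> by \<open>(1/m + 1/m')/2 = (m + m')/(2 m m')\<close> in the gain, which is
  why the natural test function is \<open>m f(m)\<close>. The exchange is legitimate because the
  integrand vanishes unless \<open>m \<le> r\<close>, so that it is dominated by a product of
  \<open>\<omega>(m)/m\<close> and \<open>\<omega>(m')/m'\<close>.\<close>

lemma coag_weigh:
 assumes U: "sets U = sets masses" "finite_measure U" and b: "(\<integral>\<^sup>+m. per_mass \<omega> m \<partial>U) \<le> ennreal C"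
  and r: "1 \<le> r" and F: "adm RR (strip r) B F"
 shows "coag \<kappa> U (%m. F (x, m))
  = (\<integral>m. (\<integral>m'. gain_loss (%_. 1) (%z. C * snd z * F z) x m m' * k m m' \<partial>weigh U) \<partial>weigh U)"
proof -
 interpret U: finite_measure U by (rule U(2))
 interpret UU: pair_sigma_finite U U ..
 have sp: "space U = {0..}" using sets_eq_imp_space_eq[OF U(1)] by simp
 have UU: "sets (U \<Otimes>\<^sub>M U) = sets (masses \<Otimes>\<^sub>M masses)" by (rule sets_pair_measure_cong[OF U(1) U(1)])
 have mU: "f \<in> U \<rightarrow>\<^sub>M N" if "f \<in> borel \<rightarrow>\<^sub>M N" for f :: "real => real" and N by (rule weigh_meas[OF U(1) that])
 have mid: "(%m. m) \<in> bmeas U" by (rule weigh_meas[OF U(1)]) simp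
 have pm[measurable]: "per_mass \<omega> \<in> bmeas U"
  using per_mass_meas[OF \<omega>_measurable] measurable_cong_sets[OF U(1) refl] by blast
 have [measurable]: "fst \<in> bmeas (U \<Otimes>\<^sub>M U)" "snd \<in> bmeas (U \<Otimes>\<^sub>M U)"
  by (rule measurable_compose[OF measurable_fst mid] measurable_compose[OF measurable_snd mid])+
 have [measurable]: "(%z. \<kappa> (fst z) (snd z)) \<in> bmeas (U \<Otimes>\<^sub>M U)"
  using \<kappa>_measurable measurable_cong_sets[OF UU refl] by (auto simp: case_prod_beta')
 have [measurable]: "F \<in> bmeas RR" by (rule admD(1)[OF F])
 have [measurable]: "(%z. k (fst z) (snd z)) \<in> bmeas (U \<Otimes>\<^sub>M U)"
 proof -
  have "(%z. (fst z, snd z)) \<in> U \<Otimes>\<^sub>M U \<rightarrow>\<^sub>M RR" by (rule measurable_Pair) fact+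
  from measurable_compose[OF this k_meas] show ?thesis by (simp only: prod.case)
 qed
 note [measurable] = measurable_compose[OF measurable_fst mU[OF wt_meas]] measurable_compose[OF measurable_snd mU[OF wt_meas]]
 have pos: "AE m in U. 0 < m"
 proof -
  have "(\<integral>\<^sup>+m. per_mass \<omega> m \<partial>U) \<noteq> \<infinity>" using b by (auto simp: top_unique)
  hence "AE m in U. per_mass \<omega> m \<noteq> \<infinity>" by (intro nn_integral_PInf_AE pm) auto
  with AE_space show ?thesis by eventually_elim (auto simp: sp per_mass_def split: if_splits)
 qed
 have pos2: "AE z in U \<Otimes>\<^sub>M U. 0 < fst z \<and> 0 < snd z"
 proof (rule UU.AE_pair_measure)
  show "{z \<in> space (U \<Otimes>\<^sub>M U). 0 < fst z \<and> 0 < snd z} \<in> sets (U \<Otimes>\<^sub>M U)" by measurable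
  show "AE x in U. AE y in U. 0 < fst (x, y) \<and> 0 < snd (x, y)" using pos by eventually_elim (use pos in auto)
 qed
 define H where "H z = (F (x, fst z + snd z) - F (x, fst z)) * (\<kappa> (fst z) (snd z) / snd z)" for z
 define P where "P z = C * snd z * F z" for z
 define L where "L z = wt (fst z) * (wt (snd z) * (gain_loss (%_. 1) P x (fst z) (snd z) * k (fst z) (snd z)))" for z
 have [measurable]: "P \<in> bmeas RR" unfolding P_def by measurable
 have H_meas: "H \<in> bmeas (U \<Otimes>\<^sub>M U)" unfolding H_def by measurable
 have L_meas: "L \<in> bmeas (U \<Otimes>\<^sub>M U)" unfolding L_def gain_loss_def by measurable
 have B: "0 \<le> B" by (rule admD(4)[OF F])
 have H_bound: "ennreal \<bar>H z\<bar> \<le> ennreal (2 * B * r) * (per_mass \<omega> (fst z) * per_mass \<omega> (snd z))"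
  if z: "0 < fst z" "0 < snd z" for z
 proof (cases "fst z \<le> r")
  case True
  let ?m = "fst z" and ?m' = "snd z"
  have "\<bar>H z\<bar> = \<bar>F (x, ?m + ?m') - F (x, ?m)\<bar> * (\<kappa> ?m ?m' / ?m')"
   using \<kappa>_nonneg[OF z] z by (simp add: H_def abs_mult)
  also have "... \<le> (2 * B) * (\<omega> ?m * \<omega> ?m' / ?m')"
   using admD(2)[OF F, of "(x, ?m + ?m')"] admD(2)[OF F, of "(x, ?m)"] B \<kappa>_le1[OF z] \<kappa>_nonneg[OF z] z
   by (intro mult_mono divide_right_mono) auto
  also have "... \<le> (2 * B) * (r * (\<omega> ?m / ?m) * (\<omega> ?m' / ?m'))"
  proof -
   have "\<omega> ?m \<le> r * (\<omega> ?m / ?m)" using True z(1) \<omega>_pos[OF z(1)] by (simp add: field_simps)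
   hence "\<omega> ?m * (\<omega> ?m' / ?m') \<le> r * (\<omega> ?m / ?m) * (\<omega> ?m' / ?m')"
    using z \<omega>_pos[OF z(2)] by (intro mult_right_mono) auto
   thus ?thesis using B by (intro mult_left_mono) auto
  qed
  finally have "\<bar>H z\<bar> \<le> (2 * B * r) * ((\<omega> ?m / ?m) * (\<omega> ?m' / ?m'))" by (simp only: mult.assoc)
  hence "ennreal \<bar>H z\<bar> \<le> ennreal ((2 * B * r) * ((\<omega> ?m / ?m) * (\<omega> ?m' / ?m')))" by (rule ennreal_leI)
  also have "... = ennreal (2 * B * r) * ennreal ((\<omega> ?m / ?m) * (\<omega> ?m' / ?m'))"
   by (rule ennreal_mult) (use z \<omega>_pos[OF z(1)] \<omega>_pos[OF z(2)] B r in auto)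
  also have "ennreal ((\<omega> ?m / ?m) * (\<omega> ?m' / ?m')) = ennreal (\<omega> ?m / ?m) * ennreal (\<omega> ?m' / ?m')"
   by (rule ennreal_mult) (use z \<omega>_pos[OF z(1)] \<omega>_pos[OF z(2)] in auto)
  finally show ?thesis using z by (simp only: per_mass_def if_False less_imp_neq[THEN not_sym])
 next
  case False
  hence "F (x, fst z + snd z) = 0" "F (x, fst z) = 0"
   using z admD(3)[OF F] by (auto simp: slab_def)
  thus ?thesis by (simp add: H_def)
 qed
 have H_int: "integrable (U \<Otimes>\<^sub>M U) H"
 proof (rule integrableI_bounded[OF H_meas])
  let ?I = "\<integral>\<^sup>+m. per_mass \<omega> m \<partial>U"
  have "(\<integral>\<^sup>+z. ennreal (norm (H z)) \<partial>(U \<Otimes>\<^sub>M U)) \<le> (\<integral>\<^sup>+z. ennreal (2 * B * r) * (per_mass \<omega> (fst z) * per_mass \<omega> (snd z)) \<partial>(U \<Otimes>\<^sub>M U))"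
   by (intro nn_integral_mono_AE, rule eventually_mono[OF pos2], unfold real_norm_def, rule H_bound) blast+
  also have "... = (\<integral>\<^sup>+m. (\<integral>\<^sup>+m'. ennreal (2 * B * r) * (per_mass \<omega> m * per_mass \<omega> m') \<partial>U) \<partial>U)"
   by (subst U.nn_integral_fst[symmetric]) simp_all
  also have "... = ennreal (2 * B * r) * (?I * ?I)"
   by (simp add: nn_integral_cmult nn_integral_multc)
  also have "... < \<infinity>" using le_less_trans[OF b ennreal_less_top] by (simp add: ennreal_mult_less_top)
  finally show "(\<integral>\<^sup>+z. ennreal (norm (H z)) \<partial>(U \<Otimes>\<^sub>M U)) < \<infinity>" .
 qed
 have swap_int: "integrable (U \<Otimes>\<^sub>M U) (%z. H (snd z, fst z))"
  using UU.integrable_product_swap[OF H_int] by (simp add: case_prod_beta')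
 have swap: "(\<integral>z. H (snd z, fst z) \<partial>(U \<Otimes>\<^sub>M U)) = (\<integral>z. H z \<partial>(U \<Otimes>\<^sub>M U))"
  using UU.integral_product_swap[OF H_meas] by (simp add: case_prod_beta')
 \<comment> \<open>Adding the two orders of the pair turns \<open>1/m'\<close> and \<open>1/m\<close> into \<open>(m + m')/(m m')\<close>.\<close>
 have sym: "H z + H (snd z, fst z) = 2 * L z" if z: "0 < fst z" "0 < snd z" for z
 proof -
  have "C \<noteq> 0" "\<omega> (fst z) \<noteq> 0" "\<omega> (snd z) \<noteq> 0" "fst z \<noteq> 0" "snd z \<noteq> 0"
   using z \<omega>_pos[OF z(1)] \<omega>_pos[OF z(2)] C_pos by auto
  thus ?thesis
   using z \<kappa>_sym[OF z] unfolding H_def L_def P_def gain_loss_def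
   by (simp add: k_def wt_def field_simps)
 qed
 have LH: "AE z in U \<Otimes>\<^sub>M U. (H z + H (snd z, fst z)) / 2 = L z"
  using pos2 by eventually_elim (use sym in auto)
 have hm: "(%z. (H z + H (snd z, fst z)) / 2) \<in> bmeas (U \<Otimes>\<^sub>M U)"
  using H_int swap_int by (intro borel_measurable_divide borel_measurable_add) auto
 have L_int: "integrable (U \<Otimes>\<^sub>M U) L"
 proof -
  have "integrable (U \<Otimes>\<^sub>M U) (%z. (H z + H (snd z, fst z)) / 2)" using H_int swap_int by simp
  thus ?thesis using integrable_cong_AE[OF hm L_meas LH] by simp
 qed
 have "coag \<kappa> U (%m. F (x, m)) = (\<integral>z. H z \<partial>(U \<Otimes>\<^sub>M U))"
  unfolding coag_def H_def by (simp add: case_prod_beta')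
 also have "... = (\<integral>z. (H z + H (snd z, fst z)) / 2 \<partial>(U \<Otimes>\<^sub>M U))"
  using H_int swap_int swap by simp
 also have "... = (\<integral>z. L z \<partial>(U \<Otimes>\<^sub>M U))" by (rule integral_cong_AE[OF hm L_meas LH])
 also have "... = (\<integral>m. (\<integral>m'. L (m, m') \<partial>U) \<partial>U)"
  by (rule UU.integral_fst'[OF L_int, symmetric])
 also have "... = (\<integral>m. wt m * (\<integral>m'. gain_loss (%_. 1) P x m m' * k m m' \<partial>weigh U) \<partial>U)"
 proof (rule Bochner_Integration.integral_cong[OF refl])
  fix m
  have [measurable]: "(%m'. k m m') \<in> bmeas borel"
   using measurable_section[OF k_meas, of m] by simp
  have "(%m'. gain_loss (%_. 1) P x m m' * k m m') \<in> bmeas borel"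
   unfolding gain_loss_def by measurable
  thus "(\<integral>m'. L (m, m') \<partial>U) = wt m * (\<integral>m'. gain_loss (%_. 1) P x m m' * k m m' \<partial>weigh U)"
   by (simp add: L_def int_weigh[OF U(1)])
 qed
 also have "... = (\<integral>m. (\<integral>m'. gain_loss (%_. 1) P x m m' * k m m' \<partial>weigh U) \<partial>weigh U)"
 proof (rule int_weigh[OF U(1), symmetric])
  interpret W: subprob_space "weigh U" by (rule weigh_subprob[OF U(1) b])
  have sw: "sets (weigh U) = sets borel" by (simp add: weigh_def)
  have km: "(%z. k (fst z) (snd z)) \<in> bmeas RR" using k_meas by (simp add: case_prod_beta')
  have "(%z. gain_loss (%_. 1) P x (fst z) (snd z) * k (fst z) (snd z)) \<in> bmeas RR"
   unfolding gain_loss_def using km by measurable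
  hence "(%(m, m'). gain_loss (%_. 1) P x m m' * k m m') \<in> bmeas (borel \<Otimes>\<^sub>M weigh U)"
   unfolding measurable_cong_sets[OF sets_pair_measure_cong[OF refl sw] refl] by (simp only: case_prod_beta')
  thus "(%m. \<integral>m'. gain_loss (%_. 1) P x m m' * k m m' \<partial>weigh U) \<in> bmeas borel"
   by (rule W.borel_measurable_lebesgue_integral)
 qed
 finally show ?thesis by (simp add: P_def[abs_def])
qed

end

section \<open>Solutions as kernel paths: the collision term\<close>

lemma bp_phase:
 assumes M: "sets M = sets (torus \<Otimes>\<^sub>M masses)" "finite_measure M"
 shows "bpf RR Z (measure M (space M)) (%p. integral\<^sup>L M p)"
proof -
 interpret finite_measure M by (rule M(2))
 have meas: "f \<in> bmeas M" if "adm RR Z B f" for f B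
  using phase_borel[OF admD(1)[OF that]] measurable_cong_sets[OF M(1) refl] by blast
 have int: "integrable M f" if "adm RR Z B f" for f B
  by (rule integrable_const_bound[where B=B]) (use meas[OF that] admD(2)[OF that] in auto)
 show ?thesis
 proof (rule bp_functionalI)
  show "\<bar>integral\<^sup>L M f\<bar> \<le> measure M (space M) * B" if f: "adm RR Z B f" for f B
  proof -
   have "\<bar>integral\<^sup>L M f\<bar> \<le> (\<integral>z. \<bar>f z\<bar> \<partial>M)" by (rule integral_abs_bound)
   also have "... \<le> (\<integral>z. B \<partial>M)"
    by (rule integral_mono) (use int[OF f] admD(2)[OF f] in auto)
   finally show ?thesis by simp
  qed
  show "(\<integral>z. f z + g z \<partial>M) = integral\<^sup>L M f + integral\<^sup>L M g" if "adm RR Z B f" "adm RR Z D g" for f g B D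
   by (rule Bochner_Integration.integral_add[OF int[OF that(1)] int[OF that(2)]])
  show "(%n. integral\<^sup>L M (F n)) \<longlonglongrightarrow> integral\<^sup>L M f"
   if F: "!!n. adm RR Z B (F n)" "!!z. (%n. F n z) \<longlonglongrightarrow> f z" for F f B
  proof (rule integral_dominated_convergence[where w="%_. B"])
   have "f \<in> bmeas RR" by (rule borel_measurable_LIMSEQ_real[OF F(2) admD(1)[OF F(1)]])
   thus "f \<in> bmeas M" using phase_borel measurable_cong_sets[OF M(1) refl] by blast
   show "AE z in M. norm (F n z) \<le> B" for n using admD(2)[OF F(1)] by auto
  qed (use meas[OF F(1)] F(2) in auto)
 qed simp_all
qed

lemma trig_test_Cb:
 assumes "continuous_on UNIV \<phi>" "!!m. \<bar>\<phi> m\<bar> \<le> B"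
 shows "trig_test n \<theta> \<phi> \<in> Cb"
 unfolding Cb_def
proof (intro CollectI conjI allI impI)
 fix x m :: real
 have "cos (2 * pi * real n * (x + 1) + \<theta>) = cos ((2 * pi * real n * x + \<theta>) + 2 * pi * real n)"
  by (simp add: algebra_simps)
 also have "... = cos (2 * pi * real n * x + \<theta>)"
  using sin_2npi[of n] cos_2npi[of n] by (simp add: cos_add mult_ac)
 finally show "trig_test n \<theta> \<phi> (x + 1, m) = trig_test n \<theta> \<phi> (x, m)" by (simp add: trig_test_def)
next
 have "continuous_on (UNIV \<times> {0..}) (%z :: real \<times> real. \<phi> (snd z))"
  by (rule continuous_on_compose2[OF assms(1)]) (auto intro!: continuous_intros)
 thus "continuous_on (UNIV \<times> {0..}) (trig_test n \<theta> \<phi>)"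
  unfolding trig_test_def case_prod_beta' by (intro continuous_intros)
 show "bounded (trig_test n \<theta> \<phi> ` (UNIV \<times> {0..}))"
  unfolding bounded_iff
 proof (intro exI ballI)
  fix y assume "y \<in> trig_test n \<theta> \<phi> ` (UNIV \<times> {0..})"
  then obtain x m where y: "y = cos (2 * pi * real n * x + \<theta>) * \<phi> m" by (auto simp: trig_test_def)
  have "\<bar>cos (2 * pi * real n * x + \<theta>)\<bar> * \<bar>\<phi> m\<bar> \<le> 1 * B" by (intro mult_mono assms(2)) auto
  thus "norm y \<le> B" by (simp add: y abs_mult)
 qed
qed

lemma trig_test_deriv:
 "((%y. trig_test n \<theta> \<phi> (y, m)) has_real_derivative trig_test n (\<theta> + pi / 2) (%m. 2 * pi * real n * \<phi> m) (x, m)) (at x)"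
proof -
 have "((%y. cos (2 * pi * real n * y + \<theta>) * \<phi> m) has_real_derivative - sin (2 * pi * real n * x + \<theta>) * (2 * pi * real n) * \<phi> m) (at x)"
  by (auto intro!: derivative_eq_intros)
 moreover have "cos (2 * pi * real n * x + (\<theta> + pi / 2)) = - sin (2 * pi * real n * x + \<theta>)"
  using cos_add[of "2 * pi * real n * x + \<theta>" "pi / 2"] by (simp add: add.assoc)
 ultimately show ?thesis by (simp add: trig_test_def mult_ac)
qed

lemma dx_trig_test: "dx (trig_test n \<theta> \<phi>) = trig_test n (\<theta> + pi / 2) (%m. 2 * pi * real n * \<phi> m)"
 unfolding dx_def using DERIV_imp_deriv[OF trig_test_deriv[of n \<theta> \<phi>]] by (auto simp: fun_eq_iff)

lemma dxdx_trig_test: "dx (dx (trig_test n \<theta> \<phi>)) (x, m) = - 4 * pi\<^sup>2 * (real n)\<^sup>2 * trig_test n \<theta> \<phi> (x, m)"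
proof -
 have "cos (2 * pi * real n * x + (\<theta> + pi / 2 + pi / 2)) = cos ((2 * pi * real n * x + \<theta>) + pi)"
  by (simp add: algebra_simps)
 thus ?thesis unfolding dx_trig_test by (simp add: trig_test_def power2_eq_square)
qed

lemma trig_test_Cb2:
 assumes "continuous_on UNIV \<phi>" "!!m. \<bar>\<phi> m\<bar> \<le> B"
 shows "trig_test n \<theta> \<phi> \<in> Cb2"
proof -
 have Cb': "trig_test n \<theta>' (%m. c * \<phi> m) \<in> Cb" for \<theta>' c
 proof (rule trig_test_Cb)
  show "continuous_on UNIV (%m. c * \<phi> m)" by (intro continuous_intros assms(1))
  show "\<bar>c * \<phi> m\<bar> \<le> \<bar>c\<bar> * B" for m using assms(2) by (simp add: abs_mult mult_left_mono)
 qed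
 have "(%y. trig_test n \<theta>' \<phi>' (y, m)) differentiable at x" for \<theta>' \<phi>' x m
  using trig_test_deriv[of n \<theta>' \<phi>' m x] by (auto simp: real_differentiable_def)
 thus ?thesis
  using Cb'[of \<theta> 1] Cb' by (simp add: Cb2_def dx_trig_test mult.assoc[symmetric])
qed

text \<open>A continuous bump between two slabs. The test functions of the equation are continuous, so a
  function on a slab is reached from continuous functions on a larger one.\<close>

definition cutoff :: "real => real => real"
 where "cutoff r m = max 0 (min 1 (min (2 * r * m - 1) (2 - m / r)))"

lemma cutoff:
 assumes r: "1 \<le> r"
 shows "continuous_on UNIV (cutoff r)" "m \<in> slab r ==> cutoff r m = 1" "adm borel (slab (2 * r)) 1 (cutoff r)"
proof -
 show cont: "continuous_on UNIV (cutoff r)"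
  unfolding cutoff_def by (intro continuous_intros) (use r in auto)
 show "cutoff r m = 1" if "m \<in> slab r"
 proof -
  have "1 \<le> r * m" "m / r \<le> 1" using that r by (auto simp: slab_def field_simps)
  thus ?thesis by (auto simp: cutoff_def min_def max_def)
 qed
 show "adm borel (slab (2 * r)) 1 (cutoff r)"
 proof (rule admI)
  show "cutoff r \<in> bmeas borel" by (rule borel_measurable_continuous_onI[OF cont])
  show "cutoff r m = 0" if "m \<notin> slab (2 * r)" for m
  proof -
   have "m < inverse (2 * r) \<or> 2 * r < m" using that by (auto simp: slab_def)
   hence "2 * r * m - 1 \<le> 0 \<or> 2 - m / r \<le> 0" using r by (auto simp: field_simps)
   thus ?thesis by (auto simp: cutoff_def min_def max_def)
  qed
 qed (auto simp: cutoff_def)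
qed

text \<open>Bochner integrals of functions that are not integrable are zero, so measurability in the
  parameter is read off from the positive and the negative part.\<close>

lemma coag_measurable:
 assumes d: "spatial_density \<mu> \<upsilon>" and \<kappa>: "(%(m, m'). \<kappa> m m') \<in> bmeas (masses \<Otimes>\<^sub>M masses)"
  and f[measurable]: "f \<in> bmeas RR"
 shows "(%x. coag \<kappa> (\<upsilon> x) (%m. f (x, m))) \<in> bmeas torus"
proof -
 let ?M = "torus \<Otimes>\<^sub>M (masses \<Otimes>\<^sub>M masses)"
 define H where "H x z = (f (x, fst z + snd z) - f (x, fst z)) * (\<kappa> (fst z) (snd z) / snd z)" for x z
 have [measurable]: "(%u. \<kappa> (fst (snd u)) (snd (snd u))) \<in> borel_measurable ?M"
  using measurable_compose[OF measurable_snd \<kappa>, of torus] by (simp add: case_prod_beta')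
 have [measurable]: "(%u. fst u) \<in> borel_measurable ?M"
  using measurable_compose[OF measurable_fst torus_borel[OF measurable_ident]] by (simp only: id_apply)
 have [measurable]: "(%u. fst (snd u)) \<in> borel_measurable ?M" "(%u. snd (snd u)) \<in> borel_measurable ?M"
  by (rule measurable_compose[OF measurable_snd measurable_compose[OF measurable_fst mass_id]]
   measurable_compose[OF measurable_snd measurable_compose[OF measurable_snd mass_id]])+
 have H: "(%u. H (fst u) (snd u)) \<in> borel_measurable ?M"
  unfolding H_def by measurable
 have nn: "(%x. \<integral>\<^sup>+z. ennreal (c * H x z) \<partial>(\<upsilon> x \<Otimes>\<^sub>M \<upsilon> x)) \<in> bmeas torus" for c
  by (rule spatial_density_pair_kernel[OF d]) (use H in \<open>simp add: case_prod_beta'\<close>)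
 let ?P = "%x. \<integral>\<^sup>+z. ennreal (H x z) \<partial>(\<upsilon> x \<Otimes>\<^sub>M \<upsilon> x)" and ?N = "%x. \<integral>\<^sup>+z. ennreal (- H x z) \<partial>(\<upsilon> x \<Otimes>\<^sub>M \<upsilon> x)"
 have [measurable]: "?P \<in> bmeas torus" "?N \<in> bmeas torus" using nn[of 1] nn[of "-1"] by simp_all
 have "(%x. coag \<kappa> (\<upsilon> x) (%m. f (x, m))) \<in> bmeas torus
  \<longleftrightarrow> (%x. if ?P x \<noteq> \<infinity> \<and> ?N x \<noteq> \<infinity> then enn2real (?P x) - enn2real (?N x) else 0) \<in> bmeas torus"
 proof (rule measurable_cong)
  fix x assume x: "x \<in> space torus"
  have s: "sets (\<upsilon> x) = sets masses" using d x unfolding spatial_density_def finite_measures_def by auto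
  have "H x \<in> bmeas (masses \<Otimes>\<^sub>M masses)" using measurable_compose[OF measurable_Pair1'[OF x] H] by simp
  hence m: "H x \<in> bmeas (\<upsilon> x \<Otimes>\<^sub>M \<upsilon> x)"
   using measurable_cong_sets[OF sets_pair_measure_cong[OF s s] refl] by blast
  have "coag \<kappa> (\<upsilon> x) (%m. f (x, m)) = (\<integral>z. H x z \<partial>(\<upsilon> x \<Otimes>\<^sub>M \<upsilon> x))"
   by (simp add: coag_def H_def case_prod_beta')
  also have "... = (if ?P x \<noteq> \<infinity> \<and> ?N x \<noteq> \<infinity> then enn2real (?P x) - enn2real (?N x) else 0)"
   using m by (cases "integrable (\<upsilon> x \<Otimes>\<^sub>M \<upsilon> x) (H x)")
    (auto simp: real_lebesgue_integral_def real_integrable_def not_integrable_integral_eq)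
  finally show "coag \<kappa> (\<upsilon> x) (%m. f (x, m)) = (if ?P x \<noteq> \<infinity> \<and> ?N x \<noteq> \<infinity> then enn2real (?P x) - enn2real (?N x) else 0)" .
 qed
 also have "..." by measurable
 finally show ?thesis .
qed

text \<open>A weak solution with a chosen density whose moment of \<open>\<omega>(m)/m\<close> is at most
  \<open>C\<close> almost everywhere.\<close>

locale rate_solution = rates +
 fixes \<nu> :: "(real \<times> real) measure" and \<nu>s :: "real measure" and T :: real
  and \<mu> :: "real => (real \<times> real) measure" and \<upsilon> :: "real => real => real measure"
 assumes \<nu>: "\<nu> \<in> phase_measures"
  and \<nu>s: "sets \<nu>s = sets masses"
  and \<nu>_le: "A \<in> sets \<nu> ==> emeasure \<nu> A \<le> emeasure (torus \<Otimes>\<^sub>M \<nu>s) A"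
  and \<nu>s_moment: "(\<integral>\<^sup>+m. per_mass (%m. \<omega> m ^ 2) m \<partial>\<nu>s) < \<infinity>"
  and T_pos: "0 < T"
  and phase: "t \<in> {0..T} ==> \<mu> t \<in> phase_measures"
  and weakly_continuous: "weakly_continuous_on {0..T} \<mu>"
  and density: "t \<in> {0..T} ==> spatial_density (\<mu> t) (\<upsilon> t)"
  and per_mass_bound: "t \<in> {0..T} ==> AE x in torus. (\<integral>\<^sup>+m. per_mass \<omega> m \<partial>\<upsilon> t x) \<le> ennreal C"
  and weak: "f \<in> Cb2 ==>
   set_integrable lborel {0..T} (%s. \<integral>z. (case z of (x, m) => 1/2 * a m * dx (dx f) (x, m)) \<partial>\<mu> s)
   \<and> set_integrable lborel {0..T} (%s. \<integral>x. coag \<kappa> (\<upsilon> s x) (%m. f (x, m)) \<partial>torus)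
   \<and> (\<forall>t\<in>{0..T}. integral\<^sup>L (\<mu> t) f - integral\<^sup>L \<nu> f
    = (LINT s:{0..t}|lborel. \<integral>z. (case z of (x, m) => 1/2 * a m * dx (dx f) (x, m)) \<partial>\<mu> s)
     + (LINT s:{0..t}|lborel. \<integral>x. coag \<kappa> (\<upsilon> s x) (%m. f (x, m)) \<partial>torus))"
begin

definition good where "good s x \<longleftrightarrow> x \<in> {0..<1} \<and> (\<integral>\<^sup>+m. per_mass \<omega> m \<partial>\<upsilon> s x) \<le> ennreal C"
text \<open>At the exceptional positions, where the moment bound fails, the kernel is zero; it has to be a
  sub-probability at every point.\<close>

definition \<rho> where "\<rho> s x = (if good s x then weigh (\<upsilon> s x) else null_measure borel)"
definition E0 where "E0 p = (\<integral>z. wt (snd z) * p z \<partial>\<nu>)"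
definition \<eta> where "\<eta> = distr (Nonnegative_Lebesgue_Integration.density \<nu>s (%m. ennreal (wt m * w m))) borel (%m. m)"

lemma phase_sets: "t \<in> {0..T} ==> sets (\<mu> t) = sets (torus \<Otimes>\<^sub>M masses)"
 and phase_finite: "t \<in> {0..T} ==> finite_measure (\<mu> t)"
 using phase by (auto simp: finite_measures_def)

lemma \<nu>_sets: "sets \<nu> = sets (torus \<Otimes>\<^sub>M masses)" and \<nu>_finite: "finite_measure \<nu>"
 using \<nu> by (auto simp: finite_measures_def)

lemma \<upsilon>_sets: "t \<in> {0..T} ==> x \<in> {0..<1} ==> sets (\<upsilon> t x) = sets masses"
 and \<upsilon>_finite: "t \<in> {0..T} ==> x \<in> {0..<1} ==> finite_measure (\<upsilon> t x)"
 using density[of t] unfolding spatial_density_def finite_measures_def by auto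

lemma good_AE: assumes "s \<in> {0..T}" shows "AE x in torus. good s x"
 using per_mass_bound[OF assms] AE_space[of torus] by eventually_elim (auto simp: good_def)

lemma subkernel_\<rho>: assumes s: "s \<in> {0..T}" shows "subkernel (\<rho> s)"
 unfolding subkernel_def
proof (rule measurable_subprob_algebra)
 fix x
 have "subprob_space (null_measure borel :: real measure)" by (rule subprob_spaceI) auto
 thus "subprob_space (\<rho> s x)"
  using weigh_subprob[OF \<upsilon>_sets[OF s]] by (auto simp: \<rho>_def good_def)
 show "sets (\<rho> s x) = sets borel" by (simp add: \<rho>_def weigh_def)
next
 fix A :: "real set" assume A[measurable]: "A \<in> sets borel"
 define G where "G x = (\<integral>\<^sup>+m. ennreal (wt m) * indicator A m \<partial>\<upsilon> s x) * indicator {0..<1} x" for x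
 define I where "I x = (\<integral>\<^sup>+m. per_mass \<omega> m \<partial>\<upsilon> s x) * indicator {0..<1} x" for x
 have [measurable]: "G \<in> bmeas borel"
  unfolding G_def
 proof (intro torus_ext spatial_density_kernel[OF density[OF s]])
  have "(%z. ennreal (wt (snd z)) * indicator A (snd z)) \<in> bmeas RR" by measurable
  from phase_borel[OF this] show "(%(x, m). ennreal (wt m) * indicator A m) \<in> bmeas (torus \<Otimes>\<^sub>M masses)"
   by (simp only: case_prod_beta')
 qed
 have [measurable]: "I \<in> bmeas borel"
  unfolding I_def
  by (intro torus_ext spatial_density_kernel[OF density[OF s]])
   (use measurable_compose[OF measurable_snd per_mass_meas[OF \<omega>_measurable]] in \<open>simp add: case_prod_beta'\<close>)
 have "(%x. emeasure (\<rho> s x) A) = (%x. if x \<in> {0..<1} \<and> I x \<le> ennreal C then G x else 0)"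
  using emeasure_weigh[OF \<upsilon>_sets[OF s] A] by (auto simp: fun_eq_iff \<rho>_def good_def I_def G_def)
 also have "... \<in> bmeas borel" by measurable
 finally show "(%x. emeasure (\<rho> s x) A) \<in> bmeas borel" .
qed

lemma nnpair_\<mu>:
 assumes s: "s \<in> {0..T}" and P: "P \<in> bmeas RR"
 shows "nnpair (\<rho> s) P = (\<integral>\<^sup>+z. ennreal (wt (snd z)) * P z \<partial>\<mu> s)"
proof -
 note [measurable] = P
 have "(%z. ennreal (wt (snd z)) * P z) \<in> bmeas RR" by measurable
 hence "(\<integral>\<^sup>+z. ennreal (wt (snd z)) * P z \<partial>\<mu> s) = (\<integral>\<^sup>+x. (\<integral>\<^sup>+m. ennreal (wt m) * P (x, m) \<partial>\<upsilon> s x) \<partial>torus)"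
  using spatial_density_nn[OF density[OF s] phase_sets[OF s] phase_borel] by simp
 also have "... = nnpair (\<rho> s) P"
  unfolding nnpair_def
 proof (rule nn_integral_cong_AE)
  show "AE x in torus. (\<integral>\<^sup>+m. ennreal (wt m) * P (x, m) \<partial>\<upsilon> s x) = (\<integral>\<^sup>+m. P (x, m) \<partial>\<rho> s x)"
   using good_AE[OF s]
  proof eventually_elim
   case (elim x)
   hence "sets (\<upsilon> s x) = sets masses" using \<upsilon>_sets[OF s] by (auto simp: good_def)
   from nn_weigh[OF this measurable_section_nn[OF P]] show ?case using elim by (simp add: \<rho>_def)
  qed
 qed
 finally show ?thesis by simp
qed

lemma bp_wt:
 assumes M: "sets M = sets (torus \<Otimes>\<^sub>M masses)" "finite_measure M" and r: "1 \<le> r"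
 shows "\<exists>K. bpf RR (strip r) K (%p. \<integral>z. wt (snd z) * p z \<partial>M)"
proof -
 obtain V where V: "0 \<le> V" "\<forall>m\<in>slab r. \<bar>wt m\<bar> \<le> V" using wt_slab[OF r] by blast
 have "bpf RR (strip r) (measure M (space M) * V) (%p. \<integral>z. wt (snd z) * p z \<partial>M)"
  by (rule bp_functional_mult[OF bp_phase[OF M]]) (use V in auto)
 thus ?thesis by blast
qed

text \<open>The weight \<open>wt\<close> need not be bounded below on a slab, so the correspondence is used
  in the direction from \<open>p\<close> to the test function \<open>wt p\<close> only.\<close>

lemma integral_eq_pairing:
 assumes s: "s \<in> {0..T}" and r: "1 \<le> r" and p: "adm RR (strip r) B p"
 shows "pairing (\<rho> s) p = (\<integral>z. wt (snd z) * p z \<partial>\<mu> s)"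
proof -
 obtain K where K: "bpf RR (strip r) K (%p. \<integral>z. wt (snd z) * p z \<partial>\<mu> s)"
  using bp_wt[OF phase_sets[OF s] phase_finite[OF s] r] by blast
 obtain V where V: "0 \<le> V" "\<forall>m\<in>slab r. \<bar>wt m\<bar> \<le> V" using wt_slab[OF r] by blast
 note sk = subkernel_\<rho>[OF s]
 have nn: "pairing (\<rho> s) p = (\<integral>z. wt (snd z) * p z \<partial>\<mu> s)"
  if p: "adm RR (strip r) B p" and p0: "!!z. 0 \<le> p z" for p
 proof -
  note [measurable] = admD(1)[OF p]
  have wp0: "0 \<le> wt (snd z) * p z" for z using wt_nonneg p0 by simp
  have wp: "(%z. wt (snd z) * p z) \<in> bmeas (\<mu> s)"
  proof -
   have "(%z. wt (snd z) * p z) \<in> bmeas RR" by measurable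
   thus ?thesis using phase_borel measurable_cong_sets[OF phase_sets[OF s] refl] by blast
  qed
  have adm: "adm RR (strip r) (V * B) (%z. wt (snd z) * p z)"
   by (rule adm_mult[OF p]) (use V in auto)
  interpret finite_measure "\<mu> s" by (rule phase_finite[OF s])
  have int: "integrable (\<mu> s) (%z. wt (snd z) * p z)"
   by (rule integrable_const_bound[where B="V * B"]) (use wp admD(2)[OF adm] in auto)
  have "ennreal (pairing (\<rho> s) p) = nnpair (\<rho> s) (%z. ennreal (p z))"
   by (rule nnpair_eq_pairing[OF sk admD(1)[OF p] p0, symmetric]) (use admD(2)[OF p] abs_le_D1 in blast)
  also have "... = (\<integral>\<^sup>+z. ennreal (wt (snd z) * p z) \<partial>\<mu> s)"
   by (subst nnpair_\<mu>[OF s]) (simp_all add: ennreal_mult wt_nonneg p0)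
  also have "... = ennreal (\<integral>z. wt (snd z) * p z \<partial>\<mu> s)"
   by (rule nn_integral_eq_integral[OF int]) (use wp0 in auto)
  finally have e: "ennreal (pairing (\<rho> s) p) = ennreal (\<integral>z. wt (snd z) * p z \<partial>\<mu> s)" .
  have "0 \<le> pairing (\<rho> s) p" unfolding pairing_def by (intro integral_nonneg_AE AE_I2) (auto intro!: integral_nonneg_AE simp: p0)
  moreover have "0 \<le> (\<integral>z. wt (snd z) * p z \<partial>\<mu> s)" by (intro integral_nonneg_AE AE_I2 wp0)
  ultimately show ?thesis using e by simp
 qed
 have adm: "adm RR (strip r) B (%z. max 0 (p z))" "adm RR (strip r) B (%z. max 0 (- p z))"
  using admD(1,4)[OF p] admD(2,3)[OF p] by (auto simp: adm_def max_def abs_le_iff)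
 have e: "max 0 (p z) - max 0 (- p z) = p z" for z by (simp add: max_def)
 have "pairing (\<rho> s) p = pairing (\<rho> s) (%z. max 0 (p z)) - pairing (\<rho> s) (%z. max 0 (- p z))"
  using bp_diff[OF bp_pairing[OF sk] adm] by (simp only: e)
 moreover have "(\<integral>z. wt (snd z) * p z \<partial>\<mu> s) = (\<integral>z. wt (snd z) * max 0 (p z) \<partial>\<mu> s) - (\<integral>z. wt (snd z) * max 0 (- p z) \<partial>\<mu> s)"
  using bp_diff[OF K adm] by (simp only: e)
 moreover have "pairing (\<rho> s) (%z. max 0 (p z)) = (\<integral>z. wt (snd z) * max 0 (p z) \<partial>\<mu> s)"
  by (rule nn[OF adm(1)]) simp
 moreover have "pairing (\<rho> s) (%z. max 0 (- p z)) = (\<integral>z. wt (snd z) * max 0 (- p z) \<partial>\<mu> s)"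
  by (rule nn[OF adm(2)]) simp
 ultimately show ?thesis by linarith
qed

lemma no_zero: "s \<in> {0..T} ==> emeasure (\<rho> s x) {..0} = 0"
proof (cases "good s x")
 case True
 assume s: "s \<in> {0..T}"
 have "emeasure (weigh (\<upsilon> s x)) {..0} = (\<integral>\<^sup>+m. ennreal (wt m) * indicator {..0} m \<partial>\<upsilon> s x)"
  by (rule emeasure_weigh) (use \<upsilon>_sets[OF s] True in \<open>auto simp: good_def\<close>)
 also have "... = (\<integral>\<^sup>+m. 0 \<partial>\<upsilon> s x)" by (intro nn_integral_cong) (auto simp: wt_def indicator_def)
 finally show ?thesis using True by (simp add: \<rho>_def)
qed (simp add: \<rho>_def)

text \<open>The symmetrised form holds at every good position; measurability of both sides lets it be
  integrated over the torus.\<close>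

lemma coag_collision:
 assumes s: "s \<in> {0..T}" and r: "1 \<le> r" and F: "adm RR (strip r) B F"
 shows "(\<integral>x. coag \<kappa> (\<upsilon> s x) (%m. F (x, m)) \<partial>torus) = collision (%_. 1) k (\<rho> s) (%z. C * snd z * F z)"
proof -
 have P: "adm RR (strip r) (C * r * B) (%z. C * snd z * F z)"
 proof (rule adm_mult[OF F])
  show "\<bar>C * snd z\<bar> \<le> C * r" if "z \<in> strip r" for z
  proof -
   have "snd z \<in> slab r" using that by auto
   thus ?thesis using slab_pos[OF _ r, of "snd z"] C_pos by (simp add: abs_mult slab_def)
  qed
 qed (use C_pos r in auto)
 have inner: "adm RR UNIV (3 * 1 * (C / 2) * (C * r * B)) (%(x, m). \<integral>m'. gain_loss (%_. 1) (%z. C * snd z * F z) x m m' * k m m' \<partial>\<rho> s x)"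
  by (rule adm_collision_inner(1)[OF subkernel_\<rho>[OF s] _ _ _ k_meas _ P])
   (use R.k_nonneg R.k_le in \<open>auto simp: abs_le_iff intro: order_trans[of _ 0]\<close>)
 show ?thesis
  unfolding collision_def pairing_def
 proof (rule integral_cong_AE)
  show "(%x. coag \<kappa> (\<upsilon> s x) (%m. F (x, m))) \<in> bmeas torus"
   by (rule coag_measurable[OF density[OF s] \<kappa>_measurable admD(1)[OF F]])
  show "(%x. \<integral>m. (case (x, m) of (x, m) => \<integral>m'. gain_loss (%_. 1) (%z. C * snd z * F z) x m m' * k m m' \<partial>\<rho> s x) \<partial>\<rho> s x) \<in> bmeas torus"
   by (rule measurable_torus[OF pairing_inner_measurable[OF subkernel_\<rho>[OF s] admD(1,2)[OF inner]]])
  show "AE x in torus. coag \<kappa> (\<upsilon> s x) (%m. F (x, m)) = (\<integral>m. (case (x, m) of (x, m) => \<integral>m'. gain_loss (%_. 1) (%z. C * snd z * F z) x m m' * k m m' \<partial>\<rho> s x) \<partial>\<rho> s x)"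
   using good_AE[OF s]
  proof eventually_elim
   case (elim x)
   hence x: "x \<in> {0..<1}" "(\<integral>\<^sup>+m. per_mass \<omega> m \<partial>\<upsilon> s x) \<le> ennreal C" by (auto simp: good_def)
   show ?case
    using coag_weigh[OF \<upsilon>_sets[OF s x(1)] \<upsilon>_finite[OF s x(1)] x(2) r F, of x] elim by (simp add: \<rho>_def)
  qed
 qed
qed

end

section \<open>Solutions as kernel paths: the evolution equation\<close>

lemma bp_trig_phase:
 assumes M: "sets M = sets (torus \<Otimes>\<^sub>M masses)" "finite_measure M" and L: "measure M (space M) \<le> L"
 shows "bpf borel Z L (%h. integral\<^sup>L M (trig_test n \<theta> h))"
 by (rule bp_trig_test[OF bp_functional_mono[OF bp_phase[OF M] L]])

lemma inf_of_nat_limit: "(%n. inf a (of_nat n)) \<longlonglongrightarrow> (a :: ennreal)"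
 and SUP_inf_of_nat: "(SUP n. inf a (of_nat n)) = (a :: ennreal)"
proof -
 show s: "(SUP n. inf a (of_nat n)) = a"
  using inf_SUP[of a "of_nat :: nat => ennreal" UNIV] by (simp add: ennreal_SUP_of_nat_eq_top)
 have "incseq (%n. inf a (of_nat n))" by (auto simp: incseq_def intro: le_infI2 inf_mono)
 from LIMSEQ_SUP[OF this] show "(%n. inf a (of_nat n)) \<longlonglongrightarrow> a" by (simp add: s)
qed

text \<open>The sets where \<open>f\<close> is at least \<open>1/(n + 1)\<close> have finite measure by
  Markov's inequality.\<close>

lemma sigma_finite_of_moment:
 assumes f: "f \<in> bmeas M" "(\<integral>\<^sup>+x. f x \<partial>M) < \<infinity>" and pos: "!!x. x \<in> space M ==> 0 < f x"
 shows "sigma_finite_measure M"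
proof
 define A where "A n = {x \<in> space M. 1 \<le> ennreal (real (Suc n)) * f x}" for n
 have A: "A n \<in> sets M" for n unfolding A_def using f(1) by measurable
 have "emeasure M (A n) \<noteq> \<infinity>" for n
 proof -
  have "emeasure M (A n) = (\<integral>\<^sup>+x. indicator (A n) x \<partial>M)" using A by simp
  also have "... \<le> (\<integral>\<^sup>+x. ennreal (real (Suc n)) * f x \<partial>M)"
   by (intro nn_integral_mono) (auto simp: A_def indicator_def)
  also have "... = ennreal (real (Suc n)) * (\<integral>\<^sup>+x. f x \<partial>M)" by (rule nn_integral_cmult[OF f(1)])
  also have "... < \<infinity>" using f(2) by (simp add: ennreal_mult_less_top del: of_nat_Suc)
  finally show ?thesis by simp
 qed
 moreover have "(\<Union>n. A n) = space M"
 proof -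
  have "\<exists>n. x \<in> A n" if x: "x \<in> space M" for x
  proof (cases "f x = \<infinity>")
   case True
   hence "x \<in> A 0" using x by (simp add: A_def)
   thus ?thesis by blast
  next
   case False
   then obtain y where y: "f x = ennreal y" "0 \<le> y" by (cases "f x") auto
   hence "0 < y" using pos[OF x] by simp
   obtain n where "1 / y < real n" using reals_Archimedean2 by blast
   hence "1 / y \<le> real (Suc n)" by simp
   hence "1 \<le> real (Suc n) * y" using \<open>0 < y\<close> by (simp add: field_simps)
   hence "x \<in> A n" using x y by (simp add: A_def ennreal_mult[symmetric] del: of_nat_Suc)
   thus ?thesis by blast
  qed
  thus ?thesis by (auto simp: A_def)
 qed
 ultimately show "\<exists>A. countable A \<and> A \<subseteq> sets M \<and> \<Union> A = space M \<and> (\<forall>a\<in>A. emeasure M a \<noteq> \<infinity>)"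
  using A by (intro exI[of _ "range A"]) auto
qed

context rate_solution
begin

lemma mass_bounded: "\<exists>L. \<forall>s\<in>{0..T}. measure (\<mu> s) (space (\<mu> s)) \<le> L"
proof -
 have "trig_test 0 0 (%_. 1) \<in> Cb" by (rule trig_test_Cb[where B=1]) auto
 hence "continuous_on {0..T} (%s. integral\<^sup>L (\<mu> s) (trig_test 0 0 (%_. 1)))"
  using weakly_continuous unfolding weakly_continuous_on_def by blast
 hence "compact ((%s. integral\<^sup>L (\<mu> s) (trig_test 0 0 (%_. 1))) ` {0..T})"
  by (rule compact_continuous_image) simp
 from compact_imp_bounded[OF this] obtain L
  where L: "\<forall>y\<in>(%s. integral\<^sup>L (\<mu> s) (trig_test 0 0 (%_. 1))) ` {0..T}. norm y \<le> L"
  unfolding bounded_iff by (elim exE)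
 have "trig_test 0 0 (%_. 1) = (%_. 1)" by (simp add: trig_test_def fun_eq_iff)
 hence "measure (\<mu> s) (space (\<mu> s)) \<le> L" if "s \<in> {0..T}" for s using L that by force
 thus ?thesis by blast
qed

text \<open>Weak continuity gives measurability in time for continuous functions of the mass, and a monotone
  class argument extends it to measurable ones.\<close>

lemma trig_time_meas:
 assumes h: "h \<in> bmeas borel" "!!m. \<bar>h m\<bar> \<le> B"
 shows "(%s. indicator {0..T} s * integral\<^sup>L (\<mu> s) (trig_test n \<theta> h)) \<in> bmeas borel"
proof -
 obtain L where L: "\<forall>s\<in>{0..T}. measure (\<mu> s) (space (\<mu> s)) \<le> L" using mass_bounded by blast
 define \<Phi> where "\<Phi> s h = indicator {0..T} s * integral\<^sup>L (\<mu> s) (trig_test n \<theta> h)" for s h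
 have bp: "bpf borel UNIV L (%h. integral\<^sup>L (\<mu> s) (trig_test n \<theta> h))" if "s \<in> {0..T}" for s
  by (rule bp_trig_phase[OF phase_sets[OF that] phase_finite[OF that]]) (use L that in blast)
 have L0: "0 \<le> L" by (rule bp_nonneg[OF bp[of 0]]) (use T_pos in simp)
 have \<Phi>: "bpf borel UNIV L (\<Phi> s)" for s
 proof (cases "s \<in> {0..T}")
  case True
  hence "\<Phi> s = (%h. integral\<^sup>L (\<mu> s) (trig_test n \<theta> h))" by (simp add: \<Phi>_def fun_eq_iff)
  thus ?thesis using bp[OF True] by simp
 next
  case False
  hence "\<Phi> s = (%h. 0)" by (simp add: \<Phi>_def fun_eq_iff)
  thus ?thesis using L0 by (auto intro!: bp_functionalI dest: admD(4))
 qed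
 define H where "H = {h. (\<exists>B. adm borel UNIV B h) \<and> (%s. \<Phi> s h) \<in> bmeas borel}"
 have lim: "f \<in> H" if F: "!!j. F j \<in> H" "!!j m. \<bar>F j m\<bar> \<le> B" "!!m. (%j. F j m) \<longlonglongrightarrow> f m" for F f B
 proof -
  have a: "adm borel UNIV B (F j)" for j
   using F(1)[of j] F(2)[of j] by (auto simp: H_def adm_def)
  have "(%s. \<Phi> s f) \<in> bmeas borel"
   by (rule borel_measurable_LIMSEQ_real[OF bp_lim[OF \<Phi> a F(3)]]) (use F(1) in \<open>auto simp: H_def\<close>)
  thus ?thesis using adm_lim[OF a F(3)] by (auto simp: H_def)
 qed
 have cont: "f \<in> H" if f: "continuous_on UNIV f" "!!m. \<bar>f m\<bar> \<le> B" for f B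
 proof -
  have "continuous_on {0..T} (%s. integral\<^sup>L (\<mu> s) (trig_test n \<theta> f))"
   using weakly_continuous trig_test_Cb[OF f] unfolding weakly_continuous_on_def by blast
  from borel_measurable_continuous_on_indicator[OF _ this]
  have "(%s. \<Phi> s f) \<in> bmeas borel" by (simp add: \<Phi>_def)
  moreover have "adm borel UNIV B f"
   using f borel_measurable_continuous_onI[OF f(1)] by (auto simp: adm_def)
  ultimately show ?thesis by (auto simp: H_def)
 qed
 have "h \<in> H"
 proof (rule monotone_class_real[where G="{U. open U}" and B=B])
  show "sets borel = sigma_sets UNIV {U :: real set. open U}" by (simp add: borel_def)
  show "Int_stable {U :: real set. open U}" by (auto simp: Int_stable_def)
  show "indicator U \<in> H" if "U \<in> {U. open U}" for U
  proof -
   have U: "open U" using that by simp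
   obtain F :: "nat => real => real" where F: "!!j. continuous_on UNIV (F j)" "!!j z. 0 \<le> F j z" "!!j z. F j z \<le> 1"
    "!!z. (%j. F j z) \<longlonglongrightarrow> indicator U z"
    by (rule open_indicator_limit[OF U]) (rule that)
   have F1: "\<bar>F j z\<bar> \<le> 1" for j z using F(2,3)[of j z] by simp
   show ?thesis by (rule lim[OF cont[OF F(1) F1] F1 F(4)])
  qed
  show "(%_. 1) \<in> H" by (rule cont[where B=1]) auto
  show "(%x. f x + g x) \<in> H" if "f \<in> H" "g \<in> H" for f g
  proof -
   obtain B D where BD: "adm borel UNIV B f" "adm borel UNIV D g" using \<open>f \<in> H\<close> \<open>g \<in> H\<close> by (auto simp: H_def)
   have "(%s. \<Phi> s f + \<Phi> s g) \<in> bmeas borel"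
    by (rule borel_measurable_add) (use \<open>f \<in> H\<close> \<open>g \<in> H\<close> in \<open>auto simp: H_def\<close>)
   thus ?thesis using bp_add[OF \<Phi> BD] adm_add[OF BD] by (auto simp: H_def)
  qed
  show "(%x. c * f x) \<in> H" if "f \<in> H" for c f
  proof -
   obtain B where B: "adm borel UNIV B f" using \<open>f \<in> H\<close> by (auto simp: H_def)
   have "(%s. c * \<Phi> s f) \<in> bmeas borel"
    by (rule borel_measurable_times[OF borel_measurable_const]) (use that in \<open>auto simp: H_def\<close>)
   thus ?thesis using bp_scale[OF \<Phi> B] adm_scale[OF B, of c] by (auto simp: H_def)
  qed
  show "f \<in> H" if "!!j. F j \<in> H" "!!j m. \<bar>F j m\<bar> \<le> B" "!!m. (%j. F j m) \<longlonglongrightarrow> f m" for F f B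
   by (rule lim[OF that])
 qed (rule h)+
 thus ?thesis by (simp add: H_def \<Phi>_def)
qed

text \<open>The rate of change of the pairing with a trigonometric test function whose mass profile is
  \<open>\<phi>\<close>.\<close>

definition J where "J n \<theta> s \<phi> = - 2 * pi\<^sup>2 * (real n)\<^sup>2 * integral\<^sup>L (\<mu> s) (trig_test n \<theta> (%m. a' m * \<phi> m))
 + collision (%_. 1) k (\<rho> s) (%z. C * snd z * trig_test n \<theta> \<phi> z)"

text \<open>The weak equation, with diffusion evaluated on the Fourier mode and the collision term in its
  symmetrised form.\<close>

lemma weak_continuous:
 assumes \<phi>: "continuous_on UNIV \<phi>" "adm borel (slab r) B \<phi>" and r: "1 \<le> r" and t: "t \<in> {0..T}"
 shows "balanced t (%\<phi>. integral\<^sup>L (\<mu> t) (trig_test n \<theta> \<phi>)) (%\<phi>. integral\<^sup>L \<nu> (trig_test n \<theta> \<phi>)) (J n \<theta>) \<phi>"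
proof -
 let ?f = "trig_test n \<theta> \<phi>"
 let ?D = "%s. \<integral>z. (case z of (x, m) => 1/2 * a m * dx (dx ?f) (x, m)) \<partial>\<mu> s"
 let ?C = "%s. \<integral>x. coag \<kappa> (\<upsilon> s x) (%m. ?f (x, m)) \<partial>torus"
 note w = weak[OF trig_test_Cb2[OF \<phi>(1) admD(2)[OF \<phi>(2)]], of n \<theta>]
 have D: "?D s = - 2 * pi\<^sup>2 * (real n)\<^sup>2 * integral\<^sup>L (\<mu> s) (trig_test n \<theta> (%m. a' m * \<phi> m))" for s
 proof -
  have "(case z of (x, m) => 1/2 * a m * dx (dx ?f) (x, m)) = - 2 * pi\<^sup>2 * (real n)\<^sup>2 * trig_test n \<theta> (%m. a' m * \<phi> m) z" for z
  proof (cases z)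
   case (Pair x m)
   have "a m * \<phi> m = a' m * \<phi> m"
    using admD(3)[OF \<phi>(2), of m] slab_pos[OF _ r, of m] by (cases "m \<in> slab r") (auto simp: a'_def)
   hence "a m * ?f (x, m) = trig_test n \<theta> (%m. a' m * \<phi> m) (x, m)"
    by (simp add: trig_test_def mult.left_commute)
   thus ?thesis unfolding Pair prod.case dxdx_trig_test by (simp add: mult_ac)
  qed
  thus ?thesis by simp
 qed
 have Cs: "?C s = collision (%_. 1) k (\<rho> s) (%z. C * snd z * ?f z)" if "s \<in> {0..T}" for s
  by (rule coag_collision[OF that r adm_trig_test[OF \<phi>(2)]])
 have sub: "{0..t} \<subseteq> {0..T}" using t by auto
 have i1: "set_integrable lborel {0..t} ?D" and i2: "set_integrable lborel {0..t} ?C"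
  using w by (auto intro: set_integrable_subset[OF _ _ sub])
 have DC: "?D s + ?C s = J n \<theta> s \<phi>" if "s \<in> {0..t}" for s
  unfolding D J_def Cs[OF subsetD[OF sub that]] by (rule refl)
 have "set_borel_measurable lborel {0..t} (%s. ?D s + ?C s)"
  using set_integral_add(1)[OF i1 i2] unfolding set_borel_measurable_def set_integrable_def by auto
 hence "set_borel_measurable lborel {0..t} (%s. J n \<theta> s \<phi>)"
  by (rule set_borel_measurable_cong) (rule DC)
 moreover have "(LINT s:{0..t}|lborel. J n \<theta> s \<phi>) = (LINT s:{0..t}|lborel. ?D s + ?C s)"
  by (rule set_lebesgue_integral_cong, simp, intro allI impI, rule DC[symmetric])
 moreover have "integral\<^sup>L (\<mu> t) ?f - integral\<^sup>L \<nu> ?f = (LINT s:{0..t}|lborel. ?D s) + (LINT s:{0..t}|lborel. ?C s)"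
  using w t by blast
 ultimately show ?thesis
  using set_integral_add(2)[OF i1 i2] unfolding balanced_def by linarith
qed

lemma a'_slab: "1 \<le> r ==> m \<in> slab r ==> \<bar>a' m\<bar> \<le> a' (inverse r)"
 using R.a_anti[of "inverse r" m] R.a_pos[OF slab_pos[of m r]] by (auto simp: slab_def)

text \<open>Both sides are continuous under bounded pointwise convergence of mass profiles on the slab of
  radius \<open>2 r\<close>; the cutoff is one on the slab of radius \<open>r\<close>.\<close>

lemma weak_slab:
 assumes h: "adm borel (slab r) B h" and r: "1 \<le> r" and t: "t \<in> {0..T}"
 shows "balanced t (%\<phi>. integral\<^sup>L (\<mu> t) (trig_test n \<theta> \<phi>)) (%\<phi>. integral\<^sup>L \<nu> (trig_test n \<theta> \<phi>)) (J n \<theta>) h"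
proof -
 let ?r = "2 * r"
 let ?A = "%\<phi>. integral\<^sup>L (\<mu> t) (trig_test n \<theta> \<phi>)" and ?N = "%\<phi>. integral\<^sup>L \<nu> (trig_test n \<theta> \<phi>)"
 have r2: "1 \<le> ?r" using r by simp
 obtain L where L: "\<forall>s\<in>{0..T}. measure (\<mu> s) (space (\<mu> s)) \<le> L" using mass_bounded by blast
 define Lm where "Lm = max L (measure \<nu> (space \<nu>))"
 have bp: "bpf borel Z Lm (%\<phi>. integral\<^sup>L (\<mu> s) (trig_test n \<theta> \<phi>))" if "s \<in> {0..T}" for s and Z :: "real set"
  by (rule bp_trig_phase[OF phase_sets[OF that] phase_finite[OF that]]) (use L that in \<open>auto simp: Lm_def le_max_iff_disj\<close>)
 have bp0: "bpf borel Z Lm ?N" for Z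
  by (rule bp_trig_phase[OF \<nu>_sets \<nu>_finite]) (simp add: Lm_def)
 define c where "c = - 2 * pi\<^sup>2 * (real n)\<^sup>2"
 define KJ where "KJ = \<bar>c\<bar> * (Lm * a' (inverse ?r)) + 3 * 1 * (C / 2) * (C * ?r)"
 have bpJ: "bpf borel (slab ?r) KJ (J n \<theta> s)" if s: "s \<in> {0..T}" for s
 proof -
  have 1: "bpf borel (slab ?r) (\<bar>c\<bar> * (Lm * a' (inverse ?r))) (%\<phi>. c * integral\<^sup>L (\<mu> s) (trig_test n \<theta> (%m. a' m * \<phi> m)))"
  proof (rule bp_functional_cmult[OF bp_functional_mult[OF bp[OF s]]])
   show "\<bar>a' m\<bar> \<le> a' (inverse ?r)" if "m \<in> slab ?r" for m by (rule a'_slab[OF r2 that])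
   show "0 \<le> a' (inverse ?r)" using R.a_pos[of "inverse ?r"] r by simp
  qed (rule a'_meas)
  have bc: "bpf RR (strip ?r) (3 * 1 * (C / 2)) (collision (%_. 1) k (\<rho> s))"
   by (rule bp_collision[OF subkernel_\<rho>[OF s] _ _ _ k_meas])
    (use R.k_nonneg R.k_le in auto)
  have "bpf RR (strip ?r) (3 * 1 * (C / 2) * (C * ?r)) (%p. collision (%_. 1) k (\<rho> s) (%z. C * snd z * p z))"
  proof (rule bp_functional_mult[OF bc])
   show "\<bar>C * snd z\<bar> \<le> C * ?r" if "z \<in> strip ?r" for z
   proof -
    have "snd z \<in> slab ?r" using that by auto
    thus ?thesis using slab_pos[OF _ r2, of "snd z"] C_pos by (simp add: abs_mult slab_def)
   qed
  qed (use C_pos r in auto)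
  from bp_functional_add[OF 1 bp_trig_test[OF this]]
  have "bpf borel (slab ?r) KJ (%\<phi>. c * integral\<^sup>L (\<mu> s) (trig_test n \<theta> (%m. a' m * \<phi> m)) + collision (%_. 1) k (\<rho> s) (%z. C * snd z * trig_test n \<theta> \<phi> z))"
   by (simp add: KJ_def)
  moreover have "J n \<theta> s = (%\<phi>. c * integral\<^sup>L (\<mu> s) (trig_test n \<theta> (%m. a' m * \<phi> m)) + collision (%_. 1) k (\<rho> s) (%z. C * snd z * trig_test n \<theta> \<phi> z))"
   by (simp add: fun_eq_iff J_def c_def)
  ultimately show ?thesis by simp
 qed
 define K where "K = max Lm KJ"
 have A: "bpf borel (slab ?r) K ?A" and A0: "bpf borel (slab ?r) K ?N"
  and AJ: "!!s. s \<in> {0..t} ==> bpf borel (slab ?r) K (J n \<theta> s)"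
 proof -
  have K: "Lm \<le> K" "KJ \<le> K" by (simp_all add: K_def)
  show "bpf borel (slab ?r) K ?A" by (rule bp_functional_mono[OF bp[OF t] K(1)])
  show "bpf borel (slab ?r) K ?N" by (rule bp_functional_mono[OF bp0 K(1)])
  show "bpf borel (slab ?r) K (J n \<theta> s)" if "s \<in> {0..t}" for s
   by (rule bp_functional_mono[OF bpJ K(2)]) (use that t in simp)
 qed
 have cut: "balanced t ?A ?N (J n \<theta>) (%m. cutoff r m * f m)"
  if f: "continuous_on UNIV f" "!!m. \<bar>f m\<bar> \<le> 1" for f
 proof (rule weak_continuous[OF _ _ r2 t])
  show "continuous_on UNIV (%m. cutoff r m * f m)" by (intro continuous_intros cutoff(1)[OF r] f(1))
  have "adm borel (slab ?r) (1 * 1) (%m. f m * cutoff r m)"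
   by (rule adm_mult[OF cutoff(3)[OF r]]) (use f borel_measurable_continuous_onI in auto)
  thus "adm borel (slab ?r) 1 (%m. cutoff r m * f m)" by (simp add: mult.commute)
 qed
 have "balanced t ?A ?N (J n \<theta>) (%m. cutoff r m * h m)"
 proof (rule balanced_monotone_class[OF A A0 AJ, where G="{U. open U}" and B=B])
  show "sets borel = sigma_sets UNIV {U :: real set. open U}" by (simp add: borel_def)
  show "Int_stable {U :: real set. open U}" by (auto simp: Int_stable_def)
  show "adm borel (slab ?r) 1 (cutoff r)" by (rule cutoff(3)[OF r])
  show "balanced t ?A ?N (J n \<theta>) (cutoff r)" using cut[of "%_. 1"] by simp
  show "balanced t ?A ?N (J n \<theta>) (%m. cutoff r m * indicator U m)" if "U \<in> {U. open U}" for U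
  proof -
   have U: "open U" using that by simp
   obtain F :: "nat => real => real" where F: "!!j. continuous_on UNIV (F j)" "!!j z. 0 \<le> F j z" "!!j z. F j z \<le> 1"
    "!!z. (%j. F j z) \<longlonglongrightarrow> indicator U z"
    by (rule open_indicator_limit[OF U]) (rule that)
   have F1: "\<bar>F j z\<bar> \<le> 1" for j z using F(2,3)[of j z] by simp
   show ?thesis
   proof (rule balanced_lim[OF A A0 AJ, where B=1 and F="%j m. cutoff r m * F j m"])
    show "balanced t ?A ?N (J n \<theta>) (%m. cutoff r m * F j m)" for j by (rule cut[OF F(1) F1])
    show "(%j. cutoff r m * F j m) \<longlonglongrightarrow> cutoff r m * indicator U m" for m
     by (intro tendsto_mult tendsto_const F(4))
    show "adm borel (slab ?r) 1 (%m. cutoff r m * F j m)" for j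
    proof -
     have "adm borel (slab ?r) (1 * 1) (%m. F j m * cutoff r m)"
      by (rule adm_mult[OF cutoff(3)[OF r]]) (use F1 borel_measurable_continuous_onI[OF F(1)] in auto)
     thus ?thesis by (simp add: mult.commute)
    qed
   qed
  qed
 qed (use admD(1,2)[OF h] in auto)
 moreover have "(%m. cutoff r m * h m) = h"
  using cutoff(2)[OF r] admD(3)[OF h] by (fastforce simp: fun_eq_iff)
 ultimately show ?thesis by simp
qed

lemma pairing_trig:
 assumes s: "s \<in> {0..T}" and r: "1 \<le> r" and g: "adm borel (slab r) B g"
 shows "pairing (\<rho> s) (trig_test n \<theta> g) = integral\<^sup>L (\<mu> s) (trig_test n \<theta> (%m. wt m * g m))"
 unfolding trig_test_mult' by (rule integral_eq_pairing[OF s r adm_trig_test[OF g]])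

lemma J_wt:
 assumes s: "s \<in> {0..T}" and r: "1 \<le> r" and g: "adm borel (slab r) B g"
 shows "J n \<theta> s (%m. wt m * g m) = collision w k (\<rho> s) (trig_test n \<theta> g)
  - 2 * pi\<^sup>2 * (real n)\<^sup>2 * pairing (\<rho> s) (trig_test n \<theta> (%m. a' m * g m))"
proof -
 have ag: "adm borel (slab r) (a' (inverse r) * B) (%m. a' m * g m)"
  by (rule adm_mult[OF g]) (use a'_slab[OF r] a'_meas R.a_pos[of "inverse r"] r in auto)
 have e: "C * m * (wt m * g m) = w m * g m" for m
 proof (cases "0 < m")
  case True
  thus ?thesis using C_pos by (simp add: wt_def w_def)
 next
  case False
  hence "m \<notin> slab r" using slab_pos[OF _ r] by blast
  thus ?thesis using admD(3)[OF g] by simp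
 qed
 have "C * m * trig_test n \<theta> (%m. wt m * g m) (x, m) = w m * trig_test n \<theta> g (x, m)" for x m
 proof -
  have "C * m * trig_test n \<theta> (%m. wt m * g m) (x, m) = cos (2 * pi * real n * x + \<theta>) * (C * m * (wt m * g m))"
   by (simp add: trig_test_def mult_ac)
  also have "... = w m * trig_test n \<theta> g (x, m)" unfolding e by (simp add: trig_test_def mult_ac)
  finally show ?thesis .
 qed
 hence "collision (%_. 1) k (\<rho> s) (%z. C * snd z * trig_test n \<theta> (%m. wt m * g m) z) = collision w k (\<rho> s) (trig_test n \<theta> g)"
  unfolding collision_def gain_loss_def by simp
 moreover have "(%m. a' m * (wt m * g m)) = (%m. wt m * (a' m * g m))" by (simp add: mult.left_commute)
 ultimately show ?thesis unfolding J_def pairing_trig[OF s r ag] by simp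
qed

lemma adm_wt: "1 \<le> r ==> adm borel (slab r) B g ==> \<exists>B'. adm borel (slab r) B' (%m. wt m * g m)"
proof -
 assume r: "1 \<le> r" and g: "adm borel (slab r) B g"
 obtain V where V: "0 \<le> V" "\<forall>m\<in>slab r. \<bar>wt m\<bar> \<le> V" using wt_slab[OF r] by blast
 have "adm borel (slab r) (V * B) (%m. wt m * g m)" by (rule adm_mult[OF g]) (use V in auto)
 thus ?thesis by blast
qed

lemma space_\<mu>: "t \<in> {0..T} ==> space (\<mu> t) = {0..<1} \<times> {0..}"
 by (drule phase_sets, drule sets_eq_imp_space_eq) (simp only: space_phase)

lemma AE_mass_pos: assumes t: "t \<in> {0..T}" shows "AE z in \<mu> t. 0 < snd z"
proof -
 have pm: "(%z. per_mass \<omega> (snd z)) \<in> bmeas (torus \<Otimes>\<^sub>M masses)"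
  by (rule measurable_compose[OF measurable_snd per_mass_meas[OF \<omega>_measurable]])
 have "(\<integral>\<^sup>+z. per_mass \<omega> (snd z) \<partial>\<mu> t) = (\<integral>\<^sup>+x. (\<integral>\<^sup>+m. per_mass \<omega> m \<partial>\<upsilon> t x) \<partial>torus)"
  using spatial_density_nn[OF density[OF t] phase_sets[OF t] pm] by simp
 also have "... \<le> (\<integral>\<^sup>+x. ennreal C \<partial>torus)" by (rule nn_integral_mono_AE[OF per_mass_bound[OF t]])
 also have "... < \<infinity>" by (simp add: torus.emeasure_space_1[unfolded space_torus])
 finally have "(\<integral>\<^sup>+z. per_mass \<omega> (snd z) \<partial>\<mu> t) \<noteq> \<infinity>" by simp
 hence "AE z in \<mu> t. per_mass \<omega> (snd z) \<noteq> \<infinity>"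
  by (rule nn_integral_PInf_AE[rotated]) (use pm measurable_cong_sets[OF phase_sets[OF t] refl] in blast)
 with AE_space show ?thesis
 proof eventually_elim
  case (elim z)
  have "0 \<le> snd z" using elim(1) unfolding space_\<mu>[OF t] by (simp only: mem_Times_iff atLeast_iff)
  moreover have "snd z \<noteq> 0" using elim(2) by (auto simp: per_mass_def)
  ultimately show ?case by simp
 qed
qed

text \<open>The measure that dominates the initial value is not assumed to be sigma-finite, but its moment
  makes it so, and then the product measure is computed by iterated integrals.\<close>

lemma \<nu>_initial: assumes P: "P \<in> bmeas RR"
 shows "(\<integral>\<^sup>+z. P z \<partial>\<nu>) \<le> (\<integral>\<^sup>+x. (\<integral>\<^sup>+m. P (x, m) \<partial>\<nu>s) \<partial>torus)"
proof -
 have w2: "(%m. (\<omega> m)\<^sup>2) \<in> bmeas masses" using \<omega>_measurable by simp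
 have sp: "space \<nu>s = {0..}" using sets_eq_imp_space_eq[OF \<nu>s] by simp
 have "sigma_finite_measure \<nu>s"
 proof (rule sigma_finite_of_moment[OF _ \<nu>s_moment])
  show "per_mass (%m. (\<omega> m)\<^sup>2) \<in> bmeas \<nu>s"
   using per_mass_meas[OF w2] measurable_cong_sets[OF \<nu>s refl] by blast
  show "0 < per_mass (%m. (\<omega> m)\<^sup>2) m" if "m \<in> space \<nu>s" for m
  proof (cases "m = 0")
   case False
   hence "0 < m" using that sp by simp
   hence "0 < (\<omega> m)\<^sup>2 / m" using \<omega>_pos[of m] by simp
   thus ?thesis using False by (simp add: per_mass_def)
  qed (simp add: per_mass_def)
 qed
 then interpret S: sigma_finite_measure \<nu>s .
 have sets: "sets (torus \<Otimes>\<^sub>M \<nu>s) = sets (torus \<Otimes>\<^sub>M masses)" by (rule sets_pair_measure_cong[OF refl \<nu>s])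
 have "(\<integral>\<^sup>+z. P z \<partial>\<nu>) \<le> (\<integral>\<^sup>+z. P z \<partial>(torus \<Otimes>\<^sub>M \<nu>s))"
 proof (rule nn_integral_mono_measure)
  show s: "sets \<nu> = sets (torus \<Otimes>\<^sub>M \<nu>s)" using \<nu>_sets sets by simp
  have "emeasure \<nu> A \<le> emeasure (torus \<Otimes>\<^sub>M \<nu>s) A" for A
   by (cases "A \<in> sets \<nu>") (simp_all add: \<nu>_le emeasure_notin_sets)
  thus "\<nu> \<le> torus \<Otimes>\<^sub>M \<nu>s"
   unfolding less_eq_measure.simps using s sets_eq_imp_space_eq[OF s] by (auto simp: le_fun_def)
 qed
 also have "... = (\<integral>\<^sup>+x. (\<integral>\<^sup>+m. P (x, m) \<partial>\<nu>s) \<partial>torus)"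
  by (rule S.nn_integral_fst[symmetric]) (use phase_borel[OF P] measurable_cong_sets[OF sets refl] in blast)
 finally show ?thesis .
qed

theorem moment_path: "moment_path a' w q k (C / 2) Q0 T E0 \<rho> \<eta>"
proof (intro moment_path.intro coagulation_path.intro coagulation_path_axioms.intro moment_path_axioms.intro)
 show "coagulation a' w q k (C / 2) Q0" by (rule R.coagulation_axioms)
 show "subkernel (\<rho> s)" if "s \<in> {0..T}" for s by (rule subkernel_\<rho>[OF that])
 show "\<exists>K. bpf RR (strip r) K E0" if "1 \<le> r" for r
  unfolding E0_def[abs_def] by (rule bp_wt[OF \<nu>_sets \<nu>_finite that])
 show "E0 p = E0 p'" if "!!x m. 0 \<le> x ==> x < 1 ==> p (x, m) = p' (x, m)" for p p'
  unfolding E0_def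
  by (rule Bochner_Integration.integral_cong[OF refl])
   (use that sets_eq_imp_space_eq[OF \<nu>_sets] in \<open>auto simp: space_phase\<close>)
 have pm: "set_borel_measurable lborel {0..T} (%s. pairing (\<rho> s) (trig_test n \<theta> g))"
  if r: "1 \<le> r" and g: "adm borel (slab r) B g" for r B g n \<theta>
 proof -
  obtain B' where "adm borel (slab r) B' (%m. wt m * g m)" using adm_wt[OF r g] by blast
  from trig_time_meas[OF admD(1,2)[OF this]]
  have "set_borel_measurable lborel {0..T} (%s. integral\<^sup>L (\<mu> s) (trig_test n \<theta> (%m. wt m * g m)))"
   by (simp add: set_borel_measurable_def)
  thus ?thesis by (rule set_borel_measurable_cong) (simp add: pairing_trig[OF _ r g])
 qed
 thus "set_borel_measurable lborel {0..T} (%s. pairing (\<rho> s) (trig_test n \<theta> g))"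
  if "1 \<le> r" "adm borel (slab r) B g" for r B g n \<theta> using that by blast
 have ag: "adm borel (slab r) (a' (inverse r) * B) (%m. a' m * g m)"
  if r: "1 \<le> r" and g: "adm borel (slab r) B g" for r B g
  by (rule adm_mult[OF g]) (use a'_slab[OF r] a'_meas R.a_pos[of "inverse r"] r in auto)
 have bal: "balanced t (%\<phi>. integral\<^sup>L (\<mu> t) (trig_test n \<theta> \<phi>)) (%\<phi>. integral\<^sup>L \<nu> (trig_test n \<theta> \<phi>)) (J n \<theta>) (%m. wt m * g m)"
  if r: "1 \<le> r" and g: "adm borel (slab r) B g" and t: "t \<in> {0..T}" for r B g t n \<theta>
 proof -
  obtain B' where "adm borel (slab r) B' (%m. wt m * g m)" using adm_wt[OF r g] by blast
  thus ?thesis by (rule weak_slab[OF _ r t])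
 qed
 show "set_borel_measurable lborel {0..T} (%s. collision w k (\<rho> s) (trig_test n \<theta> g))"
  if r: "1 \<le> r" and g: "adm borel (slab r) B g" for r B g n \<theta>
 proof -
  let ?c = "2 * pi\<^sup>2 * (real n)\<^sup>2"
  have "set_borel_measurable lborel {0..T} (%s. J n \<theta> s (%m. wt m * g m))"
   using bal[OF r g, of T] T_pos unfolding balanced_def by simp
  hence m1: "(%s. indicator {0..T} s *\<^sub>R J n \<theta> s (%m. wt m * g m)) \<in> bmeas lborel"
   unfolding set_borel_measurable_def .
  have m2: "(%s. indicator {0..T} s *\<^sub>R pairing (\<rho> s) (trig_test n \<theta> (%m. a' m * g m))) \<in> bmeas lborel"
   using pm[OF r ag[OF r g]] unfolding set_borel_measurable_def .
  have "(%s. indicator {0..T} s *\<^sub>R J n \<theta> s (%m. wt m * g m) + ?c * (indicator {0..T} s *\<^sub>R pairing (\<rho> s) (trig_test n \<theta> (%m. a' m * g m)))) \<in> bmeas lborel"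
   by (intro borel_measurable_add borel_measurable_times borel_measurable_const m1 m2)
  also have "(%s. indicator {0..T} s *\<^sub>R J n \<theta> s (%m. wt m * g m) + ?c * (indicator {0..T} s *\<^sub>R pairing (\<rho> s) (trig_test n \<theta> (%m. a' m * g m))))
   = (%s. indicator {0..T} s *\<^sub>R collision w k (\<rho> s) (trig_test n \<theta> g))"
  proof (rule ext)
   fix s
   show "indicator {0..T} s *\<^sub>R J n \<theta> s (%m. wt m * g m) + ?c * (indicator {0..T} s *\<^sub>R pairing (\<rho> s) (trig_test n \<theta> (%m. a' m * g m)))
    = indicator {0..T} s *\<^sub>R collision w k (\<rho> s) (trig_test n \<theta> g)"
    using J_wt[OF _ r g, of s n \<theta>] by (cases "s \<in> {0..T}") simp_all
  qed
  finally show ?thesis unfolding set_borel_measurable_def .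
 qed
 show "pairing (\<rho> t) (trig_test n \<theta> g) = E0 (trig_test n \<theta> g)
   + (LINT s:{0..t}|lborel. collision w k (\<rho> s) (trig_test n \<theta> g)
     - 2 * pi\<^sup>2 * (real n)\<^sup>2 * pairing (\<rho> s) (trig_test n \<theta> (%m. a' m * g m)))"
  if r: "1 \<le> r" and g: "adm borel (slab r) B g" and t: "t \<in> {0..T}" for r B g t n \<theta>
 proof -
  have "integral\<^sup>L (\<mu> t) (trig_test n \<theta> (%m. wt m * g m)) = integral\<^sup>L \<nu> (trig_test n \<theta> (%m. wt m * g m))
   + (LINT s:{0..t}|lborel. J n \<theta> s (%m. wt m * g m))"
   using bal[OF r g t] unfolding balanced_def by blast
  also have "integral\<^sup>L \<nu> (trig_test n \<theta> (%m. wt m * g m)) = E0 (trig_test n \<theta> g)"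
   unfolding E0_def trig_test_mult' by (rule refl)
  also have "(LINT s:{0..t}|lborel. J n \<theta> s (%m. wt m * g m)) = (LINT s:{0..t}|lborel. collision w k (\<rho> s) (trig_test n \<theta> g)
     - 2 * pi\<^sup>2 * (real n)\<^sup>2 * pairing (\<rho> s) (trig_test n \<theta> (%m. a' m * g m)))"
   by (rule set_lebesgue_integral_cong) (use t J_wt[OF _ r g] in auto)
  finally show ?thesis by (simp add: pairing_trig[OF t r g])
 qed
 have idm: "(%m. m) \<in> Nonnegative_Lebesgue_Integration.density \<nu>s (%m. ennreal (wt m * w m)) \<rightarrow>\<^sub>M borel"
  using weigh_meas[OF \<nu>s, of "%m. m" borel] by simp
 have nn\<eta>: "(\<integral>\<^sup>+m. f m \<partial>\<eta>) = (\<integral>\<^sup>+m. ennreal (wt m * w m) * f m \<partial>\<nu>s)" if f: "f \<in> bmeas borel" for f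
 proof -
  have "(%m. ennreal (wt m * w m)) \<in> bmeas \<nu>s" by (rule weigh_meas[OF \<nu>s]) measurable
  thus ?thesis unfolding \<eta>_def using idm f weigh_meas[OF \<nu>s f] by (simp add: nn_integral_distr nn_integral_density)
 qed
 have sp\<nu>s: "space \<nu>s = {0..}" using sets_eq_imp_space_eq[OF \<nu>s] by simp
 show "sets \<eta> = sets borel" by (simp add: \<eta>_def)
 show "finite_measure \<eta>"
 proof
  have w2: "(%m. (\<omega> m)\<^sup>2) \<in> bmeas masses" using \<omega>_measurable by simp
  have "emeasure \<eta> UNIV = (\<integral>\<^sup>+m. indicator UNIV m \<partial>\<eta>)" by (subst nn_integral_indicator) (simp_all add: \<eta>_def)
  also have "... = (\<integral>\<^sup>+m. ennreal (wt m * w m) \<partial>\<nu>s)" by (subst nn\<eta>) simp_all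
  also have "... \<le> (\<integral>\<^sup>+m. ennreal (1 / C) * per_mass (%m. (\<omega> m)\<^sup>2) m \<partial>\<nu>s)"
  proof (rule nn_integral_mono)
   fix m assume "m \<in> space \<nu>s"
   hence "m = 0 \<or> 0 < m" using sp\<nu>s by auto
   thus "ennreal (wt m * w m) \<le> ennreal (1 / C) * per_mass (%m. (\<omega> m)\<^sup>2) m"
    using C_pos by (auto simp: wt_def w_def per_mass_def power2_eq_square ennreal_mult[symmetric] mult_ac)
  qed
  also have "... = ennreal (1 / C) * (\<integral>\<^sup>+m. per_mass (%m. (\<omega> m)\<^sup>2) m \<partial>\<nu>s)"
   by (rule nn_integral_cmult) (use per_mass_meas[OF w2] measurable_cong_sets[OF \<nu>s refl] in blast)
  also have "... < \<infinity>" using \<nu>s_moment by (simp add: ennreal_mult_less_top)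
  finally show "emeasure \<eta> (space \<eta>) \<noteq> \<infinity>" by (simp add: \<eta>_def)
 qed
 show "ennreal (E0 p) \<le> (\<integral>\<^sup>+x. (\<integral>\<^sup>+m. ennreal (p (x, m) / w m) \<partial>\<eta>) \<partial>torus)"
  if r: "1 \<le> r" and p: "adm RR (strip r) B p" and p0: "!!z. 0 \<le> p z" for r B p
 proof -
  obtain V where V: "0 \<le> V" "\<forall>m\<in>slab r. \<bar>wt m\<bar> \<le> V" using wt_slab[OF r] by blast
  have wp: "adm RR (strip r) (V * B) (%z. wt (snd z) * p z)"
   by (rule adm_mult[OF p]) (use V in auto)
  have wp0: "0 \<le> wt (snd z) * p z" for z using wt_nonneg p0 by simp
  interpret N: finite_measure \<nu> by (rule \<nu>_finite)
  have m\<nu>: "(%z. wt (snd z) * p z) \<in> bmeas \<nu>"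
   using phase_borel[OF admD(1)[OF wp]] measurable_cong_sets[OF \<nu>_sets refl] by blast
  have int: "integrable \<nu> (%z. wt (snd z) * p z)"
   by (rule N.integrable_const_bound[where B="V * B"]) (use m\<nu> admD(2)[OF wp] in auto)
  have "ennreal (E0 p) = (\<integral>\<^sup>+z. ennreal (wt (snd z) * p z) \<partial>\<nu>)"
   unfolding E0_def by (rule nn_integral_eq_integral[OF int, symmetric]) (use wp0 in auto)
  also have "... \<le> (\<integral>\<^sup>+x. (\<integral>\<^sup>+m. ennreal (wt m * p (x, m)) \<partial>\<nu>s) \<partial>torus)"
   using \<nu>_initial[OF measurable_compose[OF admD(1)[OF wp] measurable_ennreal]] by simp
  also have "... = (\<integral>\<^sup>+x. (\<integral>\<^sup>+m. ennreal (p (x, m) / w m) \<partial>\<eta>) \<partial>torus)"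
  proof (rule nn_integral_cong)
   fix x
   note [measurable] = measurable_section[OF admD(1)[OF p], of x]
   have "(%m. ennreal (p (x, m) / w m)) \<in> bmeas borel" by measurable
   hence "(\<integral>\<^sup>+m. ennreal (p (x, m) / w m) \<partial>\<eta>) = (\<integral>\<^sup>+m. ennreal (wt m * w m) * ennreal (p (x, m) / w m) \<partial>\<nu>s)"
    by (rule nn\<eta>)
   also have "... = (\<integral>\<^sup>+m. ennreal (wt m * p (x, m)) \<partial>\<nu>s)"
   proof (rule nn_integral_cong)
    fix m
    have "0 < w m" using \<omega>_pos by (simp add: w_def)
    thus "ennreal (wt m * w m) * ennreal (p (x, m) / w m) = ennreal (wt m * p (x, m))"
     using wt_nonneg[of m] p0[of "(x, m)"] by (simp add: ennreal_mult[symmetric])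
   qed
   finally show "(\<integral>\<^sup>+m. ennreal (wt m * p (x, m)) \<partial>\<nu>s) = (\<integral>\<^sup>+m. ennreal (p (x, m) / w m) \<partial>\<eta>)" by simp
  qed
  finally show ?thesis .
 qed
 show "emeasure (\<rho> s x) {..0} = 0" if "s \<in> {0..T}" for s x by (rule no_zero[OF that])
 show "(%s. indicator {0..T} s * nnpair (\<rho> s) (%(x, m). h m)) \<in> bmeas borel"
  if h[measurable]: "h \<in> bmeas borel" for h
 proof -
  define u where "u n m = enn2real (inf (ennreal (wt m) * h m) (of_nat n))" for n m
  have u_meas[measurable]: "u n \<in> bmeas borel" for n unfolding u_def inf_min by measurable
  have u_eq: "ennreal (u n m) = inf (ennreal (wt m) * h m) (of_nat n)" for n m
   unfolding u_def by (rule ennreal_enn2real) (simp add: inf_min min_less_iff_disj of_nat_less_top)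
  have u0: "0 \<le> u n m" for n m by (simp add: u_def)
  have un: "u n m \<le> real n" for n m
  proof -
   have "ennreal (u n m) \<le> ennreal (real n)" unfolding u_eq ennreal_of_nat_eq_real_of_nat by simp
   thus ?thesis by (simp add: ennreal_le_iff)
  qed
  have eq: "indicator {0..T} s * nnpair (\<rho> s) (%(x, m). h m)
   = (SUP n. ennreal (indicator {0..T} s * integral\<^sup>L (\<mu> s) (trig_test 0 0 (u n))))" for s
  proof (cases "s \<in> {0..T}")
   case s: True
   interpret finite_measure "\<mu> s" by (rule phase_finite[OF s])
   have m\<mu>: "(%z. f (snd z)) \<in> bmeas (\<mu> s)" if "f \<in> bmeas borel" for f :: "real => ennreal"
    using phase_borel[OF measurable_compose[OF measurable_snd that]] measurable_cong_sets[OF phase_sets[OF s] refl] by blast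
   have m\<mu>r: "(%z. f (snd z)) \<in> bmeas (\<mu> s)" if "f \<in> bmeas borel" for f :: "real => real"
    using phase_borel[OF measurable_compose[OF measurable_snd that]] measurable_cong_sets[OF phase_sets[OF s] refl] by blast
   have "nnpair (\<rho> s) (%(x, m). h m) = (\<integral>\<^sup>+z. ennreal (wt (snd z)) * h (snd z) \<partial>\<mu> s)"
    by (subst nnpair_\<mu>[OF s]) (simp_all add: case_prod_beta')
   also have "... = (\<integral>\<^sup>+z. (SUP n. ennreal (u n (snd z))) \<partial>\<mu> s)" by (simp only: u_eq SUP_inf_of_nat)
   also have "... = (SUP n. \<integral>\<^sup>+z. ennreal (u n (snd z)) \<partial>\<mu> s)"
   proof (rule nn_integral_monotone_convergence_SUP)
    show "incseq (%n z. ennreal (u n (snd z)))"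
     by (auto simp: incseq_def le_fun_def u_eq intro: le_infI2 inf_mono)
    show "(%z. ennreal (u n (snd z))) \<in> bmeas (\<mu> s)" for n by (rule m\<mu>) measurable
   qed
   also have "(%n. \<integral>\<^sup>+z. ennreal (u n (snd z)) \<partial>\<mu> s) = (%n. ennreal (\<integral>z. u n (snd z) \<partial>\<mu> s))"
   proof
    fix n
    have "integrable (\<mu> s) (%z. u n (snd z))"
     by (rule integrable_const_bound[where B="real n"]) (use m\<mu>r[OF u_meas] u0 un in auto)
    thus "(\<integral>\<^sup>+z. ennreal (u n (snd z)) \<partial>\<mu> s) = ennreal (\<integral>z. u n (snd z) \<partial>\<mu> s)"
     by (rule nn_integral_eq_integral) (use u0 in auto)
   qed
   also have "(%n. ennreal (\<integral>z. u n (snd z) \<partial>\<mu> s)) = (%n. ennreal (indicator {0..T} s * integral\<^sup>L (\<mu> s) (trig_test 0 0 (u n))))"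
    using s by (simp add: trig_test_def case_prod_beta')
   finally show ?thesis using s by simp
  qed simp
  have "(%s. SUP n. ennreal (indicator {0..T} s * integral\<^sup>L (\<mu> s) (trig_test 0 0 (u n)))) \<in> bmeas borel"
  proof (rule borel_measurable_SUP)
   show "(%s. ennreal (indicator {0..T} s * integral\<^sup>L (\<mu> s) (trig_test 0 0 (u n)))) \<in> bmeas borel" for n
    by (rule measurable_compose[OF trig_time_meas measurable_ennreal]) (use u_meas u0 un in auto)
  qed simp
  thus ?thesis by (simp only: eq)
 qed
qed

text \<open>The solution is recovered from its kernel by dividing by the weight, since it does not charge
  the mass zero.\<close>

lemma emeasure_\<mu>:
 assumes t: "t \<in> {0..T}" and A: "A \<in> sets (torus \<Otimes>\<^sub>M masses)"
 defines "P \<equiv> %z. indicator A (frac (fst z), max 0 (snd z)) * ennreal (1 / wt (snd z))"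
 shows "P \<in> bmeas RR" "emeasure (\<mu> t) A = nnpair (\<rho> t) P"
proof -
 have [measurable]: "(%z. indicator A (frac (fst z), max 0 (snd z)) :: ennreal) \<in> bmeas RR"
  by (rule measurable_compose[OF to_phase]) (use A in simp)
 show P: "P \<in> bmeas RR" unfolding P_def by measurable
 have "emeasure (\<mu> t) A = (\<integral>\<^sup>+z. indicator A z \<partial>\<mu> t)" using A phase_sets[OF t] by simp
 also have "... = (\<integral>\<^sup>+z. ennreal (wt (snd z)) * P z \<partial>\<mu> t)"
 proof (rule nn_integral_cong_AE)
  show "AE z in \<mu> t. indicator A z = ennreal (wt (snd z)) * P z"
   using AE_mass_pos[OF t] AE_space
  proof eventually_elim
   case (elim z)
   have "fst z \<in> {0..<1}" using elim(2) unfolding space_\<mu>[OF t] by (simp only: mem_Times_iff)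
   hence "(frac (fst z), max 0 (snd z)) = z" using elim(1) by (simp add: frac_eq prod_eq_iff)
   moreover have "ennreal (wt (snd z)) * ennreal (1 / wt (snd z)) = 1"
    using wt_pos[OF elim(1)] by (simp add: ennreal_mult[symmetric])
   ultimately show ?case by (simp add: P_def indicator_def)
  qed
 qed
 also have "... = nnpair (\<rho> t) P" by (rule nnpair_\<mu>[OF t P, symmetric])
 finally show "emeasure (\<mu> t) A = nnpair (\<rho> t) P" .
qed

end

text \<open>Every nonnegative function is the increasing limit of bounded functions on slabs at the masses
  that the kernels charge.\<close>

lemma nnpair_eqI:
 assumes \<rho>: "subkernel \<rho>" "!!x. emeasure (\<rho> x) {..0} = 0" and \<rho>': "subkernel \<rho>'" "!!x. emeasure (\<rho>' x) {..0} = 0"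
  and eq: "!!r p. 1 \<le> r ==> adm RR (strip r) 1 p ==> pairing \<rho> p = pairing \<rho>' p"
  and P[measurable]: "P \<in> bmeas RR"
 shows "nnpair \<rho> P = nnpair \<rho>' P"
proof -
 define p where "p n z = enn2real (if snd z \<in> slab (real (Suc n)) then inf (P z) (of_nat n) else 0)" for n z
 have top: "(if snd z \<in> slab (real (Suc n)) then inf (P z) (of_nat n) else 0) < \<top>" for n z
  by (simp add: inf_min min_less_iff_disj of_nat_less_top)
 have pe: "ennreal (p n z) = (if snd z \<in> slab (real (Suc n)) then inf (P z) (of_nat n) else 0)" for n z
  unfolding p_def by (rule ennreal_enn2real[OF top])
 have p0: "0 \<le> p n z" for n z by (simp add: p_def)
 have pn: "p n z \<le> real n" for n z
 proof -
  have "ennreal (p n z) \<le> ennreal (real n)" unfolding pe ennreal_of_nat_eq_real_of_nat by simp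
  thus ?thesis by (simp add: ennreal_le_iff)
 qed
 have pm[measurable]: "p n \<in> bmeas RR" for n unfolding p_def inf_min by measurable
 have "pairing \<rho> (p n) = pairing \<rho>' (p n)" for n
 proof -
  have "adm RR (strip (real (Suc n))) 1 (%z. (1 / real (Suc n)) * p n z)"
  proof (rule admI)
   show "(%z. (1 / real (Suc n)) * p n z) \<in> bmeas RR" by measurable
   show "\<bar>(1 / real (Suc n)) * p n z\<bar> \<le> 1" for z using p0[of n z] pn[of n z] by (simp add: abs_mult)
   show "(1 / real (Suc n)) * p n z = 0" if "z \<notin> strip (real (Suc n))" for z
   proof -
    have "snd z \<notin> slab (real (Suc n))" using that by (cases z) simp
    thus ?thesis by (simp only: p_def if_False enn2real_0 mult_zero_right)
   qed
  qed simp
  hence "pairing \<rho> (%z. (1 / real (Suc n)) * p n z) = pairing \<rho>' (%z. (1 / real (Suc n)) * p n z)"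
   by (rule eq[rotated]) simp
  thus ?thesis unfolding pairing_scale by simp
 qed
 hence n: "nnpair \<rho> (%z. ennreal (p n z)) = nnpair \<rho>' (%z. ennreal (p n z))" for n
  using nnpair_eq_pairing[OF \<rho>(1) pm p0 pn] nnpair_eq_pairing[OF \<rho>'(1) pm p0 pn] by simp
 have "(%n. nnpair \<rho>0 (%z. ennreal (p n z))) \<longlonglongrightarrow> nnpair \<rho>0 P"
  if \<rho>0: "subkernel \<rho>0" "!!x. emeasure (\<rho>0 x) {..0} = 0" for \<rho>0
 proof (rule nnpair_LIMSEQ[OF \<rho>0])
  show "(%z. ennreal (p n z)) \<in> bmeas RR" for n by measurable
  show "ennreal (p n (x, m)) \<le> ennreal (p (Suc n) (x, m))" if "0 < m" for n x m
  proof (cases "m \<in> slab (real (Suc n))")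
   case True
   have "slab (real (Suc n)) \<subseteq> slab (real (Suc (Suc n)))" by (rule slab_mono) auto
   hence "m \<in> slab (real (Suc (Suc n)))" using True by blast
   thus ?thesis using True unfolding pe snd_conv by (simp only: if_True) (rule inf_mono, simp, simp)
  next
   case False
   thus ?thesis unfolding pe snd_conv by (simp only: if_False zero_le)
  qed
  show "(%n. ennreal (p n (x, m))) \<longlonglongrightarrow> P (x, m)" if m: "0 < m" for x m
  proof (rule Lim_transform_eventually[OF inf_of_nat_limit])
   show "\<forall>\<^sub>F n in sequentially. inf (P (x, m)) (of_nat n) = ennreal (p n (x, m))"
    using slab_exhaust[OF m] by eventually_elim (simp only: pe snd_conv if_True)
  qed
 qed
 from this[OF \<rho>] this[OF \<rho>'] show ?thesis unfolding n by (rule LIMSEQ_unique)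
qed

text \<open>Membership in the class and the equation may refer to different densities of the same measure;
  averages over sets of positions do not see the difference.\<close>

lemma class_B_bound:
 assumes \<mu>: "\<mu> \<in> class_B \<omega> T" and \<omega>: "\<omega> \<in> bmeas masses"
  and d: "!!t. t \<in> {0..T} ==> spatial_density (\<mu> t) (\<upsilon> t)"
 shows "\<exists>c\<ge>0. \<forall>t\<in>{0..T}. AE x in torus. (\<integral>\<^sup>+m. per_mass \<omega> m \<partial>\<upsilon> t x) \<le> ennreal c"
proof -
 obtain \<upsilon>' where d': "!!t. t \<in> {0..T} ==> spatial_density (\<mu> t) (\<upsilon>' t)"
  and sup: "(SUP t\<in>{0..T}. esssup torus (%x. \<integral>\<^sup>+m. per_mass \<omega> m \<partial>\<upsilon>' t x)) < \<infinity>"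
  using \<mu> unfolding class_B_def by blast
 then obtain c where c: "0 \<le> c" "(SUP t\<in>{0..T}. esssup torus (%x. \<integral>\<^sup>+m. per_mass \<omega> m \<partial>\<upsilon>' t x)) = ennreal c"
  by (cases "SUP t\<in>{0..T}. esssup torus (%x. \<integral>\<^sup>+m. per_mass \<omega> m \<partial>\<upsilon>' t x)") auto
 have pm: "(%(x :: real, m). per_mass \<omega> m) \<in> bmeas (torus \<Otimes>\<^sub>M masses)"
  using measurable_compose[OF measurable_snd per_mass_meas] \<omega> by (simp add: case_prod_beta')
 have "AE x in torus. (\<integral>\<^sup>+m. per_mass \<omega> m \<partial>\<upsilon> t x) \<le> ennreal c" if t: "t \<in> {0..T}" for t
 proof -
  have s: "sets (\<mu> t) = sets (torus \<Otimes>\<^sub>M masses)" using \<mu> t by (auto simp: class_B_def finite_measures_def)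
  define I where "I \<upsilon> x = (\<integral>\<^sup>+m. per_mass \<omega> m \<partial>\<upsilon> t x) * indicator {0..<1} x" for \<upsilon> :: "real => real => real measure" and x
  have I: "I \<upsilon> \<in> bmeas borel" unfolding I_def by (intro torus_ext spatial_density_kernel[OF d[OF t] pm])
  have avg: "(\<integral>\<^sup>+x. I \<upsilon>0 x * indicator A x \<partial>torus) = (\<integral>\<^sup>+z. per_mass \<omega> (snd z) * indicator A (fst z) \<partial>\<mu> t)"
   if A[measurable]: "A \<in> sets borel" and d0: "spatial_density (\<mu> t) (\<upsilon>0 t)" for A and \<upsilon>0 :: "real => real => real measure"
  proof -
   have iA: "(%z. indicator A (fst z) :: ennreal) \<in> bmeas (torus \<Otimes>\<^sub>M masses)"
    by (rule phase_borel) measurable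
   have "(%z. per_mass \<omega> (snd z) * indicator A (fst z)) \<in> bmeas (torus \<Otimes>\<^sub>M masses)"
    using pm iA by (intro borel_measurable_times_ennreal) (auto simp: case_prod_beta')
   hence "(\<integral>\<^sup>+z. per_mass \<omega> (snd z) * indicator A (fst z) \<partial>\<mu> t) = (\<integral>\<^sup>+x. (\<integral>\<^sup>+m. per_mass \<omega> m * indicator A x \<partial>\<upsilon>0 t x) \<partial>torus)"
    using spatial_density_nn[OF d0 s] by simp
   also have "... = (\<integral>\<^sup>+x. I \<upsilon>0 x * indicator A x \<partial>torus)"
   proof (rule nn_integral_cong)
    fix x assume x: "x \<in> space torus"
    have "sets (\<upsilon>0 t x) = sets masses" using d0 x unfolding spatial_density_def finite_measures_def by auto
    hence "per_mass \<omega> \<in> bmeas (\<upsilon>0 t x)"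
     using per_mass_meas[OF \<omega>] measurable_cong_sets by blast
    thus "(\<integral>\<^sup>+m. per_mass \<omega> m * indicator A x \<partial>\<upsilon>0 t x) = I \<upsilon>0 x * indicator A x"
     using x by (simp add: I_def nn_integral_multc)
   qed
   finally show ?thesis by simp
  qed
  have "AE x in torus. I \<upsilon> x \<le> ennreal c"
  proof (rule AE_le_of_averages[OF I c(1)])
   fix A :: "real set" assume A: "A \<in> sets borel"
   have "AE x in torus. (\<integral>\<^sup>+m. per_mass \<omega> m \<partial>\<upsilon>' t x) \<le> ennreal c"
    using esssup_AE[of "%x. \<integral>\<^sup>+m. per_mass \<omega> m \<partial>\<upsilon>' t x" torus]
   proof eventually_elim
    case (elim x)
    also have "esssup torus (%x. \<integral>\<^sup>+m. per_mass \<omega> m \<partial>\<upsilon>' t x) \<le> ennreal c"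
     unfolding c(2)[symmetric] by (rule SUP_upper[OF t])
    finally show ?case .
   qed
   hence b: "AE x in torus. I \<upsilon>' x * indicator A x \<le> ennreal c * indicator A x"
    by eventually_elim (auto simp: I_def indicator_def)
   have "(\<integral>\<^sup>+x. I \<upsilon> x * indicator A x \<partial>torus) = (\<integral>\<^sup>+x. I \<upsilon>' x * indicator A x \<partial>torus)"
    using avg[where ?\<upsilon>0.0=\<upsilon>, OF A d[OF t]] avg[where ?\<upsilon>0.0=\<upsilon>', OF A d'[OF t]] by simp
   also have "... \<le> (\<integral>\<^sup>+x. ennreal c * indicator A x \<partial>torus)" by (rule nn_integral_mono_AE[OF b])
   also have "... = ennreal c * (\<integral>\<^sup>+x. indicator A x \<partial>torus)"
    by (rule nn_integral_cmult) (use A in \<open>simp add: measurable_torus torus_borel\<close>)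
   finally show "(\<integral>\<^sup>+x. I \<upsilon> x * indicator A x \<partial>torus) \<le> ennreal c * (\<integral>\<^sup>+x. indicator A x \<partial>torus)" .
  qed
  thus ?thesis using AE_space by eventually_elim (simp add: I_def)
 qed
 thus ?thesis using c(1) by blast
qed

lemma rate_solutionI:
 assumes rates: "rates a \<omega> \<pi> \<kappa> C" and \<nu>: "\<nu> \<in> phase_measures" and \<nu>s: "sets \<nu>s = sets masses"
  and \<nu>_le: "!!A. A \<in> sets \<nu> ==> emeasure \<nu> A \<le> emeasure (torus \<Otimes>\<^sub>M \<nu>s) A"
  and \<nu>s_moment: "(\<integral>\<^sup>+m. per_mass (%m. \<omega> m ^ 2) m \<partial>\<nu>s) < \<infinity>" and T: "0 < T"
  and \<mu>: "\<mu> \<in> class_B \<omega> T"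
  and d: "\<forall>t\<in>{0..T}. spatial_density (\<mu> t) (\<upsilon> t)"
  and weak: "\<forall>f\<in>Cb2.
     let D = (%(x, m). 1/2 * a m * dx (dx f) (x, m));
       C = (%s x. coag \<kappa> (\<upsilon> s x) (%m. f (x, m)))
     in (AE s in lborel. s \<in> {0..T} --> integrable (\<mu> s) D \<and> integrable torus (C s))
       \<and> set_integrable lborel {0..T} (%s. integral\<^sup>L (\<mu> s) D)
       \<and> set_integrable lborel {0..T} (%s. integral\<^sup>L torus (C s))
       \<and> (\<forall>t\<in>{0..T}. integral\<^sup>L (\<mu> t) f - integral\<^sup>L \<nu> f =
         (LINT s:{0..t}|lborel. integral\<^sup>L (\<mu> s) D)
         + (LINT s:{0..t}|lborel. integral\<^sup>L torus (C s)))"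
  and c: "\<forall>t\<in>{0..T}. AE x in torus. (\<integral>\<^sup>+m. per_mass \<omega> m \<partial>\<upsilon> t x) \<le> ennreal c" "c \<le> C"
 shows "rate_solution a \<omega> \<pi> \<kappa> C \<nu> \<nu>s T \<mu> \<upsilon>"
proof (intro rate_solution.intro rates rate_solution_axioms.intro)
 show "\<mu> t \<in> phase_measures" if "t \<in> {0..T}" for t using \<mu> that by (auto simp: class_B_def)
 show "weakly_continuous_on {0..T} \<mu>" using \<mu> by (auto simp: class_B_def)
 show "AE x in torus. (\<integral>\<^sup>+m. per_mass \<omega> m \<partial>\<upsilon> t x) \<le> ennreal C" if "t \<in> {0..T}" for t
  using bspec[OF c(1) that] by eventually_elim (use c(2) in \<open>auto intro: order_trans ennreal_leI\<close>)
 fix f assume "f \<in> Cb2"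
 from bspec[OF weak this] show "set_integrable lborel {0..T} (%s. \<integral>z. (case z of (x, m) => 1/2 * a m * dx (dx f) (x, m)) \<partial>\<mu> s)
   \<and> set_integrable lborel {0..T} (%s. \<integral>x. coag \<kappa> (\<upsilon> s x) (%m. f (x, m)) \<partial>torus)
   \<and> (\<forall>t\<in>{0..T}. integral\<^sup>L (\<mu> t) f - integral\<^sup>L \<nu> f
    = (LINT s:{0..t}|lborel. \<integral>z. (case z of (x, m) => 1/2 * a m * dx (dx f) (x, m)) \<partial>\<mu> s)
     + (LINT s:{0..t}|lborel. \<integral>x. coag \<kappa> (\<upsilon> s x) (%m. f (x, m)) \<partial>torus))"
  unfolding Let_def by blast
qed (use \<nu> \<nu>s \<nu>_le \<nu>s_moment T d in auto)

theorem theorem3: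
  fixes a \<omega> \<pi> :: "real \<Rightarrow> real"
    and \<kappa> :: "real \<Rightarrow> real \<Rightarrow> real"
    and \<nu> :: "(real \<times> real) measure"
    and \<mu> \<mu>' :: "real \<Rightarrow> (real \<times> real) measure"
    and \<nu>s :: "real measure"
    and T :: real
  assumes a_pos: "\<And>m. m > 0 \<Longrightarrow> a m > 0"
    and a_nonincreasing: "antimono_on {0<..} a"
    and \<kappa>_measurable: "(\<lambda>(m, m'). \<kappa> m m') \<in> borel_measurable (masses \<Otimes>\<^sub>M masses)"
    and \<kappa>_nonneg: "\<And>m m'. m > 0 \<Longrightarrow> m' > 0 \<Longrightarrow> \<kappa> m m' \<ge> 0"
    and \<kappa>_sym: "\<And>m m'. m > 0 \<Longrightarrow> m' > 0 \<Longrightarrow> \<kappa> m m' = \<kappa> m' m"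
    and \<nu>: "\<nu> \<in> phase_measures"
    and \<omega>\<pi>_measurable: "\<omega> \<in> borel_measurable masses" "\<pi> \<in> borel_measurable masses"
    and \<omega>\<pi>_pos: "\<And>m. m > 0 \<Longrightarrow> \<omega> m > 0" "\<And>m. m > 0 \<Longrightarrow> \<pi> m > 0"
    and \<omega>_loc_bounded: "\<And>S. compact S \<Longrightarrow> S \<subseteq> {0<..} \<Longrightarrow> bounded (\<omega> ` S)"
    and \<pi>_loc_bounded: "\<And>S. compact S \<Longrightarrow> S \<subseteq> {0<..} \<Longrightarrow> bounded (\<pi> ` S)"
    and \<pi>_over_\<omega>_bounded: "bounded ((\<lambda>m. \<pi> m * inverse (\<omega> m)) ` {0<..})"
    and subadd_\<omega>: "subadditive_mass \<omega>"
    and subadd_a\<omega>: "subadditive_mass (\<lambda>m. a m powr (-1/2) * \<omega> m)"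
    and subadd_a\<omega>\<pi>: "subadditive_mass (\<lambda>m. a m powr (-1/2) * \<omega> m * \<pi> m)"
    and \<kappa>_le1: "\<And>m m'. m > 0 \<Longrightarrow> m' > 0 \<Longrightarrow> \<kappa> m m' \<le> \<omega> m * \<omega> m'"
    and \<kappa>_le2: "\<And>m m'. m > 0 \<Longrightarrow> m' > 0 \<Longrightarrow> \<kappa> m m' \<le> \<omega> m * \<pi> m' + \<pi> m * \<omega> m'"
    and \<nu>s: "sets \<nu>s = sets masses"
    and \<nu>_le: "\<And>A. A \<in> sets \<nu> \<Longrightarrow> emeasure \<nu> A \<le> emeasure (torus \<Otimes>\<^sub>M \<nu>s) A"
    and \<nu>s_moment: "(\<integral>\<^sup>+m. per_mass (\<lambda>m. \<omega> m ^ 2) m \<partial>\<nu>s) < \<infinity>"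
    and T_pos: "T > 0"
    and sol: "\<mu> \<in> class_B \<omega> T" "weak_solution a \<kappa> \<nu> T \<mu>"
    and sol': "\<mu>' \<in> class_B \<omega> T" "weak_solution a \<kappa> \<nu> T \<mu>'"
  shows "\<forall>t\<in>{0..T}. \<mu> t = \<mu>' t"
proof
 fix t assume t: "t \<in> {0..T}"
 note ws = sol(2)[unfolded weak_solution_def] and ws' = sol'(2)[unfolded weak_solution_def]
 obtain \<upsilon> where \<upsilon>: "\<forall>t\<in>{0..T}. spatial_density (\<mu> t) (\<upsilon> t)"
  and weak: "\<forall>f\<in>Cb2.
     let D = (%(x, m). 1/2 * a m * dx (dx f) (x, m));
       C = (%s x. coag \<kappa> (\<upsilon> s x) (%m. f (x, m)))
     in (AE s in lborel. s \<in> {0..T} --> integrable (\<mu> s) D \<and> integrable torus (C s))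
       \<and> set_integrable lborel {0..T} (%s. integral\<^sup>L (\<mu> s) D)
       \<and> set_integrable lborel {0..T} (%s. integral\<^sup>L torus (C s))
       \<and> (\<forall>t\<in>{0..T}. integral\<^sup>L (\<mu> t) f - integral\<^sup>L \<nu> f =
         (LINT s:{0..t}|lborel. integral\<^sup>L (\<mu> s) D)
         + (LINT s:{0..t}|lborel. integral\<^sup>L torus (C s)))"
  using ws by (elim exE conjE) (rule that)
 obtain \<upsilon>' where \<upsilon>': "\<forall>t\<in>{0..T}. spatial_density (\<mu>' t) (\<upsilon>' t)"
  and weak': "\<forall>f\<in>Cb2.
     let D = (%(x, m). 1/2 * a m * dx (dx f) (x, m));
       C = (%s x. coag \<kappa> (\<upsilon>' s x) (%m. f (x, m)))
     in (AE s in lborel. s \<in> {0..T} --> integrable (\<mu>' s) D \<and> integrable torus (C s))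
       \<and> set_integrable lborel {0..T} (%s. integral\<^sup>L (\<mu>' s) D)
       \<and> set_integrable lborel {0..T} (%s. integral\<^sup>L torus (C s))
       \<and> (\<forall>t\<in>{0..T}. integral\<^sup>L (\<mu>' t) f - integral\<^sup>L \<nu> f =
         (LINT s:{0..t}|lborel. integral\<^sup>L (\<mu>' s) D)
         + (LINT s:{0..t}|lborel. integral\<^sup>L torus (C s)))"
  using ws' by (elim exE conjE) (rule that)
 obtain c where c: "0 \<le> c" "\<forall>t\<in>{0..T}. AE x in torus. (\<integral>\<^sup>+m. per_mass \<omega> m \<partial>\<upsilon> t x) \<le> ennreal c"
  using class_B_bound[OF sol(1) \<omega>\<pi>_measurable(1) bspec[OF \<upsilon>]] by blast
 obtain c' where c': "0 \<le> c'" "\<forall>t\<in>{0..T}. AE x in torus. (\<integral>\<^sup>+m. per_mass \<omega> m \<partial>\<upsilon>' t x) \<le> ennreal c'"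
  using class_B_bound[OF sol'(1) \<omega>\<pi>_measurable(1) bspec[OF \<upsilon>']] by blast
 \<comment> \<open>Both solutions are normalised by one constant, so that their kernels solve the same equation.\<close>
 define C where "C = 1 + c + c'"
 have C: "0 < C" "c \<le> C" "c' \<le> C" using c(1) c'(1) by (auto simp: C_def)
 have rates: "rates a \<omega> \<pi> \<kappa> C"
  by (rule rates.intro) (fact | rule C(1))+
 interpret S: rate_solution a \<omega> \<pi> \<kappa> C \<nu> \<nu>s T \<mu> \<upsilon>
  by (rule rate_solutionI[OF rates \<nu> \<nu>s \<nu>_le \<nu>s_moment T_pos sol(1) \<upsilon> weak c(2) C(2)])
 interpret S': rate_solution a \<omega> \<pi> \<kappa> C \<nu> \<nu>s T \<mu>' \<upsilon>'
  by (rule rate_solutionI[OF rates \<nu> \<nu>s \<nu>_le \<nu>s_moment T_pos sol'(1) \<upsilon>' weak' c'(2) C(3)])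
 note path = S.moment_path and path' = S'.moment_path
 show "\<mu> t = \<mu>' t"
 proof (rule measure_eqI)
  show "sets (\<mu> t) = sets (\<mu>' t)" by (simp add: S.phase_sets[OF t] S'.phase_sets[OF t])
  fix A assume "A \<in> sets (\<mu> t)"
  hence A: "A \<in> sets (torus \<Otimes>\<^sub>M masses)" using S.phase_sets[OF t] by simp
  have "nnpair (S.\<rho> t) P = nnpair (S'.\<rho> t) P" if "P \<in> bmeas RR" for P
  proof (rule nnpair_eqI[OF S.subkernel_\<rho>[OF t] S.no_zero[OF t] S'.subkernel_\<rho>[OF t] S'.no_zero[OF t] _ that])
   show "pairing (S.\<rho> t) p = pairing (S'.\<rho> t) p" if "1 \<le> r" "adm RR (strip r) 1 p" for r p
    using paths_agree[OF path path' t that] paths_agree[OF path' path t that] by (rule antisym)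
  qed
  thus "emeasure (\<mu> t) A = emeasure (\<mu>' t) A"
   using S.emeasure_\<mu>[OF t A] S'.emeasure_\<mu>[OF t A] by simp
 qed
qed

end
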